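(* Let $w_1,w_2$ be two smooth weight functions on $\mathbb{R}^2\times S^1$, let $g=(g_1,g_2)\in\mathcal{E}'(\mathbb{R}^2)$, and let $s\in\mathbb{R}$. Then $$\mathcal{I}g:=I_{w_1}g_1+I_{w_2}g_2\in H^s(Z)$$ if and only if $$\begin{pmatrix}\bar w_1^*(x,D^\perp/|D|)&\bar w_2^*(x,D^\perp/|D|)\\ \bar w_1^*(x,-D^\perp/|D|)&\bar w_2^*(x,-D^\perp/|D|)\end{pmatrix}g\in H^{s-1/2}(\mathbb{R}^2).$$
   Context: Notation: $v^\perp=(-v_2,v_1)$. $Z=\{(z,\theta):\theta\in S^1,\ z\cdot\theta=0\}$, parameterized by $(p,\theta)\in\mathbb{R}\times S^1$ via $z=p\theta^\perp$, with measure $dp\,d\theta$. $I_wh(z,\theta)=\int_{\mathbb{R}}w(z+t\theta,\theta)h(z+t\theta)\,dt$, extended to compactly supported distributions by duality with its transpose $I_w'\psi(x)=\int_{S^1}w(x,\theta)\psi(x-(x\cdot\theta)\theta,\theta)\,d\theta$. The operator $\bar w^*(x,\pm D^\perp/|D|)$ is the pseudo-differential operator with amplitude $w(y,\pm\xi^\perp/|\xi|)$, that is, $\bar w^*(x,\pm D^\perp/|D|)h(x)=(2\pi)^{-2}\iint e^{i(x-y)\cdot\xi}w(y,\pm\xi^\perp/|\xi|)h(y)\,dy\,d\xi$ (equivalently, its Fourier transform is $\xi\mapsto\int e^{-iy\cdot\xi}w(y,\pm\xi^\perp/|\xi|)h(y)\,dy$). By rescaling, the supports of $g_1,g_2$ are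 assumed contained in $(-\pi,\pi)^2$ and such that all lines meeting them have $|p|<\pi$. $\|h\|_{H^s(Z)}=\|(1-\partial_p^2)^{s/2}h\|_{L^2(Z)}$, with $p$ on the circle $[-\pi,\pi]$ with endpoints identified (no $\theta$-derivatives). *)

theory Defs
  imports "HOL-Analysis.Analysis"
begin

subsection \<open>Smooth functions\<close>

fun iter_deriv :: "'a::euclidean_space list \<Rightarrow> ('a \<Rightarrow> 'b::real_normed_vector) \<Rightarrow> 'a \<Rightarrow> 'b" where
  "iter_deriv [] f = f"
| "iter_deriv (v # vs) f = (\<lambda>x. frechet_derivative (iter_deriv vs f) (at x) v)"

definition smooth :: "('a::euclidean_space \<Rightarrow> 'b::real_normed_vector) \<Rightarrow> bool" where
  "smooth f \<longleftrightarrow> (\<forall>vs. set vs \<subseteq> Basis \<longrightarrow> (\<forall>x. iter_deriv vs f differentiable (at x)))"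

definition schwartz :: "('a::euclidean_space \<Rightarrow> complex) \<Rightarrow> bool" where
  "schwartz \<phi> \<longleftrightarrow> smooth \<phi> \<and>
     (\<forall>vs N. set vs \<subseteq> Basis \<longrightarrow>
        (\<exists>C. \<forall>x. (1 + norm x) ^ N * norm (iter_deriv vs \<phi> x) \<le> C))"

subsection \<open>Compactly supported distributions\<close>

text \<open>Compactly supported distributions are the continuous linear functionals on the Frechet space
  of all smooth functions. A functional is represented by a total function; its values
  at non-smooth arguments carry no meaning.\<close>

definition compact_distribution :: "(('a::euclidean_space \<Rightarrow> complex) \<Rightarrow> complex) \<Rightarrow> bool" where
  "compact_distribution u \<longleftrightarrow>
     (\<forall>\<phi> \<psi>. smooth \<phi> \<longrightarrow> smooth \<psi> \<longrightarrow> u (\<lambda>x. \<phi> x + \<psi> x) = u \<phi> + u \<psi>) \<and>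
     (\<forall>c \<phi>. smooth \<phi> \<longrightarrow> u (\<lambda>x. c * \<phi> x) = c * u \<phi>) \<and>
     (\<exists>K N C. compact K \<and>
        (\<forall>\<phi> B. smooth \<phi> \<longrightarrow> 0 \<le> B \<longrightarrow>
           (\<forall>vs. set vs \<subseteq> Basis \<longrightarrow> length vs \<le> N \<longrightarrow> (\<forall>x\<in>K. norm (iter_deriv vs \<phi> x) \<le> B)) \<longrightarrow>
           norm (u \<phi>) \<le> C * B))"

definition dist_support :: "(('a::euclidean_space \<Rightarrow> complex) \<Rightarrow> complex) \<Rightarrow> 'a set" where
  "dist_support u =
     - \<Union>{U. open U \<and> (\<forall>\<phi>. smooth \<phi> \<longrightarrow> compact (closure {x. \<phi> x \<noteq> 0}) \<longrightarrow>
                          closure {x. \<phi> x \<noteq> 0} \<subseteq> U \<longrightarrow> u \<phi> = 0)}"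

subsection \<open>The circle, the weights and the manifold of lines\<close>

definition perp :: "real^2 \<Rightarrow> real^2" where
  "perp v = vector [- (v $ 2), v $ 1]"

definition circ :: "real \<Rightarrow> real^2" where
  "circ t = vector [cos t, sin t]"

text \<open>A function on the product of the plane with the unit circle is a function of two vectors, of
  which only the values at unit vectors \<open>\<theta>\<close> matter. As \<open>circ\<close> is a local
  diffeomorphism onto the circle, smoothness may be tested in the angle.\<close>

definition smooth_weight :: "(real^2 \<Rightarrow> real^2 \<Rightarrow> complex) \<Rightarrow> bool" where
  "smooth_weight w \<longleftrightarrow> smooth (\<lambda>(x :: real^2, t :: real). w x (circ t))"

definition line_pt :: "real \<Rightarrow> real^2 \<Rightarrow> (real^2) \<times> (real^2)" where
  "line_pt p \<theta> = (p *\<^sub>R perp \<theta>, \<theta>)"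

definition the_line :: "real \<Rightarrow> real^2 \<Rightarrow> (real^2) set" where
  "the_line p \<theta> = {p *\<^sub>R perp \<theta> + t *\<^sub>R \<theta> | t. True}"

text \<open>Functions on the manifold \<open>Z\<close> of pairs \<open>(z, \<theta>)\<close> with \<open>norm \<theta> = 1\<close> and
  \<open>z \<bullet> \<theta> = 0\<close> are treated likewise; \<open>Z\<close> is the set of all \<open>line_pt p (circ t)\<close>.\<close>

definition smooth_Z :: "((real^2) \<times> (real^2) \<Rightarrow> complex) \<Rightarrow> bool" where
  "smooth_Z \<psi> \<longleftrightarrow> smooth (\<lambda>(p :: real, t :: real). \<psi> (line_pt p (circ t)))"

subsection \<open>The weighted X-ray transform of a distribution\<close>

definition xray_transpose ::
    "(real^2 \<Rightarrow> real^2 \<Rightarrow> complex) \<Rightarrow> ((real^2) \<times> (real^2) \<Rightarrow> complex) \<Rightarrow> real^2 \<Rightarrow> complex" where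
  "xray_transpose w \<psi> x =
     (LINT t:{0..2*pi}|lborel. w x (circ t) * \<psi> (x - (x \<bullet> circ t) *\<^sub>R circ t, circ t))"

text \<open>The transform of a compactly supported distribution \<open>h\<close> is a functional on the smooth
  functions on \<open>Z\<close>. The pairing is bilinear, without complex conjugation.\<close>

definition xray ::
    "(real^2 \<Rightarrow> real^2 \<Rightarrow> complex) \<Rightarrow> ((real^2 \<Rightarrow> complex) \<Rightarrow> complex)
       \<Rightarrow> ((real^2) \<times> (real^2) \<Rightarrow> complex) \<Rightarrow> complex" where
  "xray w h \<psi> = h (xray_transpose w \<psi>)"

subsection \<open>The Sobolev space on \<open>Z\<close>\<close>

definition periodic_Z :: "((real^2) \<times> (real^2) \<Rightarrow> complex) \<Rightarrow> bool" where
  "periodic_Z \<psi> \<longleftrightarrow>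
     (\<forall>p \<theta>. norm \<theta> = 1 \<longrightarrow> \<psi> (line_pt (p + 2 * pi) \<theta>) = \<psi> (line_pt p \<theta>))"

text \<open>The measure \<open>dp d\<theta>\<close> on \<open>Z\<close>, with \<open>p\<close> on the circle of length \<open>2 * pi\<close>.\<close>

definition Z_measure :: "((real^2) \<times> (real^2)) measure" where
  "Z_measure =
     distr (restrict_space lborel ({-pi<..pi} \<times> {0..<2*pi})) borel
       (\<lambda>(p, t). line_pt p (circ t))"

text \<open>The Fourier multiplier \<open>(1 - \<partial>\<^sub>p\<^sup>2)\<close> to the power \<open>s/2\<close> on
  functions that are \<open>2 * pi\<close>-periodic in \<open>p\<close>, through their Fourier series in \<open>p\<close>.
  On \<open>Z\<close> one has \<open>p = z \<bullet> perp \<theta>\<close>.\<close>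

definition fourier_coeff_Z ::
    "((real^2) \<times> (real^2) \<Rightarrow> complex) \<Rightarrow> int \<Rightarrow> real^2 \<Rightarrow> complex" where
  "fourier_coeff_Z \<psi> k \<theta> =
     (1 / (2 * complex_of_real pi)) *
     (LINT q:{-pi..pi}|lborel. exp (- \<i> * of_int k * of_real q) * \<psi> (line_pt q \<theta>))"

definition bessel_Z ::
    "real \<Rightarrow> ((real^2) \<times> (real^2) \<Rightarrow> complex) \<Rightarrow> (real^2) \<times> (real^2) \<Rightarrow> complex" where
  "bessel_Z s \<psi> = (\<lambda>(z, \<theta>).
     \<Sum>\<^sub>\<infinity>k::int. of_real ((1 + (of_int k)\<^sup>2) powr (s / 2)) * fourier_coeff_Z \<psi> k \<theta>
                   * exp (\<i> * of_int k * of_real (z \<bullet> perp \<theta>)))"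

text \<open>Membership of \<open>v\<close> means that the multiplier applied to \<open>v\<close> in the sense of
  distributions is a square integrable function; the multiplier is its own transpose, its symbol
  being even. A distribution on \<open>Z\<close> supported in \<open>\<bar>p\<bar> < pi\<close> becomes one on the
  product of two circles by restricting it to the test functions that are periodic in \<open>p\<close>.\<close>

definition sobolev_Z :: "real \<Rightarrow> (((real^2) \<times> (real^2) \<Rightarrow> complex) \<Rightarrow> complex) \<Rightarrow> bool" where
  "sobolev_Z s v \<longleftrightarrow>
     (\<exists>F. F \<in> borel_measurable Z_measure \<and>
          integrable Z_measure (\<lambda>\<zeta>. (cmod (F \<zeta>))\<^sup>2) \<and>
          (\<forall>\<psi>. smooth_Z \<psi> \<longrightarrow> periodic_Z \<psi> \<longrightarrow>
             v (bessel_Z s \<psi>) = (LINT \<zeta>|Z_measure. F \<zeta> * \<psi> \<zeta>)))"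

subsection \<open>The Sobolev space on the plane and the pseudo-differential operators\<close>

text \<open>The tempered distribution whose Fourier transform is the function \<open>G\<close>, as a functional
  on Schwartz functions \<open>\<phi>\<close>.\<close>

definition inv_fourier :: "(real^2 \<Rightarrow> complex) \<Rightarrow> (real^2 \<Rightarrow> complex) \<Rightarrow> complex" where
  "inv_fourier G \<phi> =
     (1 / (2 * complex_of_real pi)\<^sup>2) *
     (LINT \<xi>|lborel. G \<xi> * (LINT x|lborel. exp (\<i> * of_real (x \<bullet> \<xi>)) * \<phi> x))"

definition sobolev :: "real \<Rightarrow> ((real^2 \<Rightarrow> complex) \<Rightarrow> complex) \<Rightarrow> bool" where
  "sobolev r u \<longleftrightarrow>
     (\<exists>G. G \<in> borel_measurable lborel \<and>
          integrable lborel (\<lambda>\<xi>. (1 + (norm \<xi>)\<^sup>2) powr r * (cmod (G \<xi>))\<^sup>2) \<and>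
          (\<forall>\<phi>. schwartz \<phi> \<longrightarrow> u \<phi> = inv_fourier G \<phi>))"

text \<open>The operator with amplitude \<open>w(y, \<epsilon> \<xi>\<^sup>\<bottom>/|\<xi>|)\<close>, where \<open>\<epsilon>\<close> is \<open>1\<close> or \<open>-1\<close>,
  applied to \<open>h\<close>. The inner functional is \<open>h\<close> acting in the variable \<open>y\<close>. At
  \<open>\<xi> = 0\<close> the direction is undefined (here it is \<open>0\<close>), which affects only a null set.\<close>

definition psdo ::
    "real \<Rightarrow> (real^2 \<Rightarrow> real^2 \<Rightarrow> complex) \<Rightarrow> ((real^2 \<Rightarrow> complex) \<Rightarrow> complex)
       \<Rightarrow> (real^2 \<Rightarrow> complex) \<Rightarrow> complex" where
  "psdo \<epsilon> w h =
     inv_fourier (\<lambda>\<xi>. h (\<lambda>y. exp (- \<i> * of_real (y \<bullet> \<xi>)) * w y (\<epsilon> *\<^sub>R (perp \<xi> /\<^sub>R norm \<xi>))))"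

end

theory Submission
  imports Defs "HOL-Probability.Probability"
begin

text \<open>
  Put \<open>A(\<sigma>, \<theta>) = \<langle>g\<^sub>1, e\<^bsup>-i\<sigma> y\<bullet>\<theta>\<^sup>\<bottom>\<^esup> w\<^sub>1(y, \<theta>)\<rangle> + \<langle>g\<^sub>2, e\<^bsup>-i\<sigma> y\<bullet>\<theta>\<^sup>\<bottom>\<^esup> w\<^sub>2(y, \<theta>)\<rangle>\<close>. Formally \<open>A(\<cdot>, \<theta>)\<close> is
  the Fourier transform in \<open>p\<close> of the weighted transform along the lines of direction
  \<open>\<theta>\<close>, because \<open>p = y \<bullet> \<theta>\<^sup>\<bottom>\<close> on such a line. It is continuous and of polynomial growth in
  \<open>\<sigma>\<close>. Both sides of the equivalence are weighted \<open>L\<^sup>2\<close> conditions on this one function.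

  On the manifold of lines, \<open>p\<close> lives on a circle of length \<open>2\<pi>\<close>, so only the integer
  frequencies occur: by Parseval in \<open>p\<close> and in the angle, together with the completeness of
  \<open>L\<^sup>2\<close>, the left side says that \<open>\<Sum>\<^sub>k (1 + k\<^sup>2)\<^sup>s \<integral> |A(k, \<theta>)|\<^sup>2 d\<theta>\<close> is finite
  (\<open>sobolev_Z_imp_summable\<close>, \<open>summable_imp_sobolev_Z\<close>).

  On the plane, \<open>\<xi> = -\<epsilon>|\<xi>| \<theta>\<^sup>\<bottom>\<close> for \<open>\<theta> = \<epsilon>\<xi>\<^sup>\<bottom>/|\<xi>|\<close>, so the Fourier transform of the row with sign
  \<open>\<epsilon>\<close> is \<open>A(-\<epsilon>|\<xi>|, \<epsilon>\<xi>\<^sup>\<bottom>/|\<xi>|)\<close> (\<open>psdo_symbol\<close>): one row sees the negative and the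
  other one the positive frequencies. A function of polynomial growth is determined almost everywhere
  by its pairings with Schwartz functions, so membership in the Sobolev space is the integrability of
  \<open>(1 + |\<xi>|\<^sup>2)\<^bsup>s-1/2\<^esup> |A|\<^sup>2\<close> (\<open>sobolev_inv_fourier_iff\<close>). In polar coordinates the
  measure is \<open>|\<sigma>| d\<sigma> d\<theta>\<close>, and the factor \<open>|\<sigma>|\<close> makes up for the half derivative. As \<open>A\<close>
  is bounded for small \<open>\<sigma>\<close>, the two rows together say that
  \<open>\<integral>\<integral> (1 + \<sigma>\<^sup>2)\<^sup>s |A(\<sigma>, \<theta>)|\<^sup>2 d\<sigma> d\<theta>\<close> is finite.

  What remains is to compare a sum over the integers with an integral over the line, and this is where
  the supports enter. If they lie in the disc of radius \<open>R < \<pi>\<close>, then \<open>A(\<cdot>, \<theta>)\<close> is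
  band limited below the Nyquist rate of the integer lattice, and oversampling gives
  \<open>A(a, \<theta>) = \<Sum>\<^sub>n C\<^sub>n A(b - n, \<theta>)\<close> with coefficients that depend on \<open>a - b\<close> only and decay
  rapidly, uniformly for \<open>|a - b| \<le> 1\<close> (\<open>sampling_formula\<close>). With Peetre's inequality for the weights and
  Young's inequality for the convolution, the weighted \<open>\<ell>\<^sup>2\<close> norms of \<open>A\<close> on any two translates of the
  lattice by numbers in the unit interval are comparable (\<open>lattice_energy_comparable\<close>). Averaging over the
  translates turns the sum into the integral.
\<close>

section \<open>Smooth families of functions\<close>

text \<open>Functions of a space variable and a parameter are needed that are smooth in the first and,
  with all derivatives in the first, only continuous in the pair. This regularity survives integration
  over the parameter, and the pairing of such a family with a distribution is continuous in the parameter. The derivatives are not computed by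
  \<^const>\<open>iter_deriv\<close> but asserted to exist, so that closure properties become inductions on the
  order.\<close>

primrec Ck :: "nat \<Rightarrow> ('a::euclidean_space \<Rightarrow> 't::topological_space \<Rightarrow> 'b::real_normed_vector) \<Rightarrow> bool"
  where
  "Ck 0 f \<longleftrightarrow> continuous_on UNIV (\<lambda>z. f (fst z) (snd z))"
| "Ck (Suc n) f \<longleftrightarrow> continuous_on UNIV (\<lambda>z. f (fst z) (snd z)) \<and>
     (\<exists>f'. (\<forall>x t. ((\<lambda>x. f x t) has_derivative (\<lambda>v. f' v x t)) (at x)) \<and> (\<forall>b\<in>Basis. Ck n (f' b)))"

definition smooth_family ::
    "('a::euclidean_space \<Rightarrow> 't::topological_space \<Rightarrow> 'b::real_normed_vector) \<Rightarrow> bool" where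
  "smooth_family f \<longleftrightarrow> (\<forall>n. Ck n f)"

lemma Ck_continuous: "Ck n f \<Longrightarrow> continuous_on UNIV (\<lambda>z. f (fst z) (snd z))"
  by (cases n) auto

lemma Ck_SucD: "Ck (Suc n) f \<Longrightarrow> Ck n f"
proof (induction n arbitrary: f)
  case (Suc n)
  from Suc.prems obtain f' where "continuous_on UNIV (\<lambda>z. f (fst z) (snd z))"
    and "\<forall>x t. ((\<lambda>x. f x t) has_derivative (\<lambda>v. f' v x t)) (at x)" "\<forall>b\<in>Basis. Ck (Suc n) (f' b)"
    by (subst (asm) Ck.simps(2)) blast
  moreover from this have "\<forall>b\<in>Basis. Ck n (f' b)" using Suc.IH by blast
  ultimately show ?case by (subst Ck.simps(2)) blast
qed auto

lemma continuous_on_compose_pair: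
  assumes "continuous_on UNIV (\<lambda>z. f (fst z) (snd z))" "continuous_on S a" "continuous_on S b"
  shows "continuous_on S (\<lambda>z. f (a z) (b z))"
  using continuous_on_compose2[OF assms(1) continuous_on_Pair[OF assms(2,3)]] by simp

lemma Ck_SucI:
  assumes "continuous_on UNIV (\<lambda>z. f (fst z) (snd z))"
    and "\<And>x t. ((\<lambda>x. f x t) has_derivative (\<lambda>v. f' v x t)) (at x)"
    and "\<And>b. b \<in> Basis \<Longrightarrow> Ck n (f' b)"
  shows "Ck (Suc n) f"
  using assms by (auto intro!: exI[of _ f'])

lemma Ck_SucE:
  assumes "Ck (Suc n) f"
  obtains f' where "\<And>x t. ((\<lambda>x. f x t) has_derivative (\<lambda>v. f' v x t)) (at x)"
    "\<And>b. b \<in> Basis \<Longrightarrow> Ck n (f' b)"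
  using assms by auto

text \<open>Smoothness is a greatest fixed point: a class of families that is closed under taking partial
  derivatives consists of smooth families. The exponentials and the superpositions of plane waves are treated
  in this way.\<close>

lemma smooth_family_coinduct:
  assumes "X f"
    and "\<And>f. X f \<Longrightarrow> continuous_on UNIV (\<lambda>z. f (fst z) (snd z))"
    and "\<And>f. X f \<Longrightarrow> \<exists>f'. (\<forall>x t. ((\<lambda>x. f x t) has_derivative (\<lambda>v. f' v x t)) (at x)) \<and> (\<forall>b\<in>Basis. X (f' b))"
  shows "smooth_family f"
proof -
  have "Ck n f" for n
    using assms(1)
  proof (induction n arbitrary: f)
    case (Suc n)
    then show ?case using assms(2,3)[of f] by fastforce
  qed (use assms(2) in auto)
  then show ?thesis by (simp add: smooth_family_def)
qed

lemma smooth_family_continuous: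
  "smooth_family f \<Longrightarrow> continuous_on UNIV (\<lambda>z. f (fst z) (snd z))"
  using Ck_continuous smooth_family_def by blast

lemma smooth_family_derivE:
  assumes "smooth_family f"
  obtains f' where "\<And>x t. ((\<lambda>x. f x t) has_derivative (\<lambda>v. f' v x t)) (at x)"
    "\<And>b. b \<in> Basis \<Longrightarrow> smooth_family (f' b)"
proof -
  from assms have "Ck (Suc n) f" for n by (simp add: smooth_family_def del: Ck.simps)
  then have "\<forall>n. \<exists>f'. (\<forall>x t. ((\<lambda>x. f x t) has_derivative (\<lambda>v. f' v x t)) (at x)) \<and> (\<forall>b\<in>Basis. Ck n (f' b))"
    by simp
  then obtain F where F: "\<And>n x t. ((\<lambda>x. f x t) has_derivative (\<lambda>v. F n v x t)) (at x)"
    "\<And>n b. b \<in> Basis \<Longrightarrow> Ck n (F n b)" by metis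
  have "(\<lambda>v. F n v x t) = (\<lambda>v. F 0 v x t)" for n x t
    using has_derivative_unique[OF F(1) F(1)] .
  then have "F n = F 0" for n by (auto simp: fun_eq_iff)
  with F that[of "F 0"] show ?thesis by (metis smooth_family_def)
qed

lemma smooth_family_deriv:
  assumes "smooth_family f" "b \<in> Basis"
  shows "smooth_family (\<lambda>x t. frechet_derivative (\<lambda>x. f x t) (at x) b)"
proof -
  obtain f' where f': "\<And>x t. ((\<lambda>x. f x t) has_derivative (\<lambda>v. f' v x t)) (at x)"
    "\<And>b. b \<in> Basis \<Longrightarrow> smooth_family (f' b)" using smooth_family_derivE[OF assms(1)] by blast
  have "frechet_derivative (\<lambda>x. f x t) (at x) = (\<lambda>v. f' v x t)" for x t
    using frechet_derivative_at[OF f'(1)] by simp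
  then show ?thesis using f'(2)[OF assms(2)] by simp
qed

lemma smooth_family_differentiable: "smooth_family f \<Longrightarrow> (\<lambda>x. f x t) differentiable (at x)"
  using smooth_family_derivE[of f] differentiable_def by metis

lemma smooth_family_iter_deriv:
  assumes "smooth_family f" "set vs \<subseteq> Basis"
  shows "smooth_family (\<lambda>x t. iter_deriv vs (\<lambda>x. f x t) x)"
  using assms(2)
proof (induction vs)
  case (Cons v vs)
  then show ?case using smooth_family_deriv[of "\<lambda>x t. iter_deriv vs (\<lambda>x. f x t) x" v] by simp
qed (use assms(1) in simp)

lemma smooth_family_smooth: "smooth_family f \<Longrightarrow> smooth (\<lambda>x. f x t)"
  unfolding smooth_def using smooth_family_differentiable[OF smooth_family_iter_deriv] by fastforce

lemma iter_deriv_append: "iter_deriv (vs @ ws) f = iter_deriv vs (iter_deriv ws f)"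
  by (induction vs) auto

lemma smooth_iter_deriv:
  assumes "smooth f" "set vs \<subseteq> Basis" shows "smooth (iter_deriv vs f)"
  using assms unfolding smooth_def by (auto simp: iter_deriv_append[symmetric])

lemma smooth_has_derivative:
  assumes "smooth f" shows "(f has_derivative frechet_derivative f (at x)) (at x)"
proof -
  have "iter_deriv [] f differentiable at x" using assms unfolding smooth_def
    by (metis empty_set empty_subsetI)
  then show ?thesis using frechet_derivative_works by auto
qed

lemma smooth_continuous: "smooth f \<Longrightarrow> continuous_on UNIV f"
  by (meson differentiable_at_imp_differentiable_on differentiable_def differentiable_imp_continuous_on
      smooth_has_derivative)

lemma smooth_partial: "smooth f \<Longrightarrow> b \<in> Basis \<Longrightarrow> smooth (\<lambda>x. frechet_derivative f (at x) b)"
  using smooth_iter_deriv[of f "[b]"] by simp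

lemma smooth_smooth_family:
  assumes "smooth f" shows "smooth_family (\<lambda>x (t::'t::topological_space). f x)"
proof (rule smooth_family_coinduct[where X="\<lambda>g. \<exists>f. smooth f \<and> g = (\<lambda>x t. f x)"], goal_cases)
  case (2 g)
  then obtain f where f: "smooth f" "g = (\<lambda>x t. f x)" by auto
  show ?case unfolding f by (intro continuous_on_compose2[OF smooth_continuous[OF f(1)]] continuous_intros) auto
next
  case (3 g)
  then obtain f where f: "smooth f" "g = (\<lambda>x t. f x)" by auto
  show ?case using smooth_has_derivative[OF f(1)] smooth_partial[OF f(1)]
    by (intro exI[of _ "\<lambda>v x t. frechet_derivative f (at x) v"]) (auto simp: f)
qed (use assms in auto)

lemma smooth_prod_smooth_family:
  fixes f :: "'a::euclidean_space \<times> 'c::euclidean_space \<Rightarrow> 'b::real_normed_vector"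
  assumes "smooth f" shows "smooth_family (\<lambda>x t. f (x, t))"
proof (rule smooth_family_coinduct[where X="\<lambda>g. \<exists>f. smooth f \<and> g = (\<lambda>x t. f (x, t))"], goal_cases)
  case (2 g)
  then obtain f where f: "smooth f" "g = (\<lambda>x t. f (x, t))" by auto
  show ?case unfolding f by (intro continuous_on_compose2[OF smooth_continuous[OF f(1)]] continuous_intros) auto
next
  case (3 g)
  then obtain f where f: "smooth f" "g = (\<lambda>x t. f (x, t))" by auto
  have "((\<lambda>x. f (x, t)) has_derivative (\<lambda>v. frechet_derivative f (at (x, t)) (v, 0))) (at x)" for x t
    by (rule has_derivative_compose[where f="\<lambda>x. (x, t)" and g=f, OF _ smooth_has_derivative[OF f(1)]])
       (auto intro!: derivative_eq_intros)
  moreover have "smooth (\<lambda>z. frechet_derivative f (at z) (b, 0))" if "b \<in> Basis" for b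
    using smooth_partial[OF f(1), of "(b, 0)"] that by (simp add: Basis_prod_def)
  ultimately show ?case
    by (intro exI[of _ "\<lambda>v x t. frechet_derivative f (at (x, t)) (v, 0)"])
       (auto simp: f intro!: exI[of _ "\<lambda>z. frechet_derivative f (at z) (b, 0)" for b])
qed (use assms in auto)

lemma continuous_fst_snd:
  assumes "continuous_on UNIV f" shows "continuous_on UNIV (\<lambda>z. f (fst z))" "continuous_on UNIV (\<lambda>z. f (snd z))"
  using assms by (auto intro!: continuous_on_compose2[OF assms] continuous_intros)

lemma smooth_family_param:
  assumes "continuous_on UNIV c" shows "smooth_family (\<lambda>x t. c t)"
proof (rule smooth_family_coinduct[where X="\<lambda>g. \<exists>c. continuous_on UNIV c \<and> g = (\<lambda>x t. c t)"], goal_cases)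
  case (3 g)
  then obtain c where "g = (\<lambda>x t. c t)" by auto
  then show ?case by (auto intro!: exI[of _ "\<lambda>v x t. 0"] exI[of _ "\<lambda>t. 0"])
qed (use assms in \<open>auto simp: continuous_fst_snd\<close>)

lemmas smooth_family_const = smooth_family_param[OF continuous_on_const]

lemma smooth_family_inner:
  assumes "continuous_on UNIV e" shows "smooth_family (\<lambda>x t. x \<bullet> e t)"
proof -
  have "Ck n (\<lambda>x t. x \<bullet> e t)" for n
  proof (cases n)
    case (Suc m)
    have "continuous_on UNIV (\<lambda>t. b \<bullet> e t)" for b using assms by (intro continuous_intros)
    then have "Ck m (\<lambda>x t. b \<bullet> e t)" for b using smooth_family_param smooth_family_def by blast
    then show ?thesis unfolding Suc
      by (intro Ck_SucI[where f'="\<lambda>v x t. v \<bullet> e t"]) (auto intro!: derivative_eq_intros continuous_intros continuous_fst_snd assms)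
  qed (auto intro!: continuous_intros continuous_fst_snd assms)
  then show ?thesis by (simp add: smooth_family_def)
qed

lemma Ck_add: "Ck n f \<Longrightarrow> Ck n g \<Longrightarrow> Ck n (\<lambda>x t. f x t + g x t)"
proof (induction n arbitrary: f g)
  case (Suc n)
  obtain f' where f': "\<And>x t. ((\<lambda>x. f x t) has_derivative (\<lambda>v. f' v x t)) (at x)"
    "\<And>b. b \<in> Basis \<Longrightarrow> Ck n (f' b)" using Ck_SucE[OF Suc.prems(1)] by blast
  obtain g' where g': "\<And>x t. ((\<lambda>x. g x t) has_derivative (\<lambda>v. g' v x t)) (at x)"
    "\<And>b. b \<in> Basis \<Longrightarrow> Ck n (g' b)" using Ck_SucE[OF Suc.prems(2)] by blast
  show ?case
    by (rule Ck_SucI[where f'="\<lambda>v x t. f' v x t + g' v x t"])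
       (use Suc.prems in \<open>auto intro!: continuous_intros Suc.IH f' g' has_derivative_add Ck_continuous[OF Suc.prems(1)] Ck_continuous[OF Suc.prems(2)]\<close>)
qed (auto intro!: continuous_intros)

lemma Ck_mult:
  fixes f g :: "'a::euclidean_space \<Rightarrow> 't::topological_space \<Rightarrow> 'b::real_normed_algebra"
  shows "Ck n f \<Longrightarrow> Ck n g \<Longrightarrow> Ck n (\<lambda>x t. f x t * g x t)"
proof (induction n arbitrary: f g)
  case (Suc n)
  obtain f' where f': "\<And>x t. ((\<lambda>x. f x t) has_derivative (\<lambda>v. f' v x t)) (at x)"
    "\<And>b. b \<in> Basis \<Longrightarrow> Ck n (f' b)" using Ck_SucE[OF Suc.prems(1)] by blast
  obtain g' where g': "\<And>x t. ((\<lambda>x. g x t) has_derivative (\<lambda>v. g' v x t)) (at x)"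
    "\<And>b. b \<in> Basis \<Longrightarrow> Ck n (g' b)" using Ck_SucE[OF Suc.prems(2)] by blast
  note c = Ck_SucD[OF Suc.prems(1)] Ck_SucD[OF Suc.prems(2)]
  show ?case
    by (rule Ck_SucI[where f'="\<lambda>v x t. f x t * g' v x t + f' v x t * g x t"])
       (use c Suc.prems in \<open>auto intro!: continuous_intros Ck_add Suc.IH f' g' has_derivative_mult Ck_continuous[OF Suc.prems(1)] Ck_continuous[OF Suc.prems(2)]\<close>)
qed (auto intro!: continuous_intros)

lemma Ck_of_real:
  "Ck n f \<Longrightarrow> Ck n (\<lambda>x t. of_real (f x t) :: 'b::{real_normed_algebra_1})"
proof (induction n arbitrary: f)
  case (Suc n)
  obtain f' where f': "\<And>x t. ((\<lambda>x. f x t) has_derivative (\<lambda>v. f' v x t)) (at x)"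
    "\<And>b. b \<in> Basis \<Longrightarrow> Ck n (f' b)" using Ck_SucE[OF Suc.prems(1)] by blast
  show ?case
    by (rule Ck_SucI[where f'="\<lambda>v x t. of_real (f' v x t)"])
       (use Suc.prems in \<open>auto intro!: continuous_intros Suc.IH f' has_derivative_of_real Ck_continuous[OF Suc.prems(1)]\<close>)
qed (auto intro!: continuous_intros)

lemma Ck_compose:
  fixes f :: "real \<Rightarrow> 't::topological_space \<Rightarrow> 'b::real_normed_algebra_1"
  shows "Ck n f \<Longrightarrow> Ck n q \<Longrightarrow> Ck n (\<lambda>x t. f (q x t) t)"
proof (induction n arbitrary: f q)
  case 0
  then show ?case
    by (auto intro!: continuous_intros continuous_on_compose_pair[where f=f])
next
  case (Suc n)
  obtain f' where f': "\<And>x t. ((\<lambda>x. f x t) has_derivative (\<lambda>v. f' v x t)) (at x)"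
    "\<And>b. b \<in> Basis \<Longrightarrow> Ck n (f' b)" using Ck_SucE[OF Suc.prems(1)] by blast
  obtain q' where q': "\<And>x t. ((\<lambda>x. q x t) has_derivative (\<lambda>v. q' v x t)) (at x)"
    "\<And>b. b \<in> Basis \<Longrightarrow> Ck n (q' b)" using Ck_SucE[OF Suc.prems(2)] by blast
  have lin: "f' v x t = of_real v * f' 1 x t" for v x t
    using linear_scale[OF has_derivative_linear[OF f'(1)], of v 1 x t] by (simp add: scaleR_conv_of_real)
  have "((\<lambda>x. f (q x t) t) has_derivative (\<lambda>v. of_real (q' v x t) * f' 1 (q x t) t)) (at x)" for x t
    using has_derivative_compose[OF q'(1)[where x=x and t=t] f'(1)[where t=t]] by (simp add: lin[symmetric])
  moreover have "Ck n (\<lambda>x t. of_real (q' b x t) * f' 1 (q x t) t)" if "b \<in> Basis" for b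
    by (intro Ck_mult Ck_of_real q' that Suc.IH f' Ck_SucD[OF Suc.prems(2)]) auto
  moreover have "continuous_on UNIV (\<lambda>z. f (q (fst z) (snd z)) (snd z))"
    using Ck_continuous[OF Suc.prems(1)] Ck_continuous[OF Suc.prems(2)]
    by (auto intro!: continuous_intros continuous_on_compose_pair[where f=f])
  ultimately show ?case
    by (intro Ck_SucI[where f'="\<lambda>v x t. of_real (q' v x t) * f' 1 (q x t) t"]) auto
qed

lemma Ck_inverse:
  fixes f :: "'a::euclidean_space \<Rightarrow> 't::topological_space \<Rightarrow> 'b::real_normed_field"
  shows "Ck n f \<Longrightarrow> (\<And>x t. f x t \<noteq> 0) \<Longrightarrow> Ck n (\<lambda>x t. inverse (f x t))"
proof (induction n arbitrary: f)
  case (Suc n)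
  obtain f' where f': "\<And>x t. ((\<lambda>x. f x t) has_derivative (\<lambda>v. f' v x t)) (at x)"
    "\<And>b. b \<in> Basis \<Longrightarrow> Ck n (f' b)" using Ck_SucE[OF Suc.prems(1)] by blast
  have "((\<lambda>x. inverse (f x t)) has_derivative (\<lambda>v. (- 1) * (inverse (f x t) * f' v x t * inverse (f x t)))) (at x)" for x t
    using has_derivative_compose[OF f'(1)[where x=x and t=t] has_derivative_inverse'[OF Suc.prems(2)]] by simp
  moreover have "Ck n (\<lambda>x t. (- 1) * (inverse (f x t) * f' b x t * inverse (f x t)))" if "b \<in> Basis" for b
    using smooth_family_const[of "-1::'b"] Ck_SucD[OF Suc.prems(1)] Suc.prems(2)
    by (intro Ck_mult Suc.IH f' that) (auto simp: smooth_family_def)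
  ultimately show ?case
    using Suc.prems Ck_continuous[OF Suc.prems(1)]
    by (intro Ck_SucI[where f'="\<lambda>v x t. (- 1) * (inverse (f x t) * f' v x t * inverse (f x t))"])
       (auto intro!: continuous_intros)
qed (auto intro!: continuous_intros)

lemma Ck_reparam:
  "Ck n f \<Longrightarrow> continuous_on UNIV h \<Longrightarrow> Ck n (\<lambda>x s. f x (h s))"
proof (induction n arbitrary: f)
  case 0
  then show ?case
    by (auto intro!: continuous_intros continuous_on_compose_pair[where f=f] continuous_fst_snd)
next
  case (Suc n)
  obtain f' where f': "\<And>x t. ((\<lambda>x. f x t) has_derivative (\<lambda>v. f' v x t)) (at x)"
    "\<And>b. b \<in> Basis \<Longrightarrow> Ck n (f' b)" using Ck_SucE[OF Suc.prems(1)] by blast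
  show ?case
    using Suc Ck_continuous[OF Suc.prems(1)] f'
    by (intro Ck_SucI[where f'="\<lambda>v x s. f' v x (h s)"])
       (auto intro!: continuous_intros continuous_on_compose_pair[where f=f] continuous_fst_snd)
qed

lemma smooth_family_intros:
  fixes f g :: "'a::euclidean_space \<Rightarrow> 't::topological_space \<Rightarrow> 'b::real_normed_field"
    and q :: "'a \<Rightarrow> 't \<Rightarrow> real"
  shows "smooth_family f \<Longrightarrow> smooth_family g \<Longrightarrow> smooth_family (\<lambda>x t. f x t + g x t)"
    and "smooth_family f \<Longrightarrow> smooth_family g \<Longrightarrow> smooth_family (\<lambda>x t. f x t * g x t)"
    and "smooth_family f \<Longrightarrow> smooth_family g \<Longrightarrow> smooth_family (\<lambda>x t. f x t - g x t)"
    and "smooth_family f \<Longrightarrow> smooth_family (\<lambda>x t. - f x t)"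
    and "smooth_family f \<Longrightarrow> (\<And>x t. f x t \<noteq> 0) \<Longrightarrow> smooth_family (\<lambda>x t. inverse (f x t))"
    and "smooth_family q \<Longrightarrow> smooth_family (\<lambda>x t. of_real (q x t) :: 'b)"
proof -
  show mult: "smooth_family f \<Longrightarrow> smooth_family g \<Longrightarrow> smooth_family (\<lambda>x t. f x t * g x t)" for f g :: "'a \<Rightarrow> 't \<Rightarrow> 'b"
    by (simp add: smooth_family_def Ck_mult)
  show add: "smooth_family f \<Longrightarrow> smooth_family g \<Longrightarrow> smooth_family (\<lambda>x t. f x t + g x t)" for f g :: "'a \<Rightarrow> 't \<Rightarrow> 'b"
    by (simp add: smooth_family_def Ck_add)
  show minus: "smooth_family f \<Longrightarrow> smooth_family (\<lambda>x t. - f x t)" for f :: "'a \<Rightarrow> 't \<Rightarrow> 'b"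
    using mult[OF smooth_family_const[of "-1"]] by auto
  show "smooth_family f \<Longrightarrow> smooth_family g \<Longrightarrow> smooth_family (\<lambda>x t. f x t - g x t)"
    using add[OF _ minus, of f g] by auto
qed (simp_all add: smooth_family_def Ck_inverse Ck_of_real)

lemma smooth_family_compose:
  fixes f :: "real \<Rightarrow> 't::topological_space \<Rightarrow> 'b::real_normed_algebra_1"
  shows "smooth_family f \<Longrightarrow> smooth_family q \<Longrightarrow> smooth_family (\<lambda>x t. f (q x t) t)"
  by (simp add: smooth_family_def Ck_compose)

lemma smooth_family_reparam:
  "smooth_family f \<Longrightarrow> continuous_on UNIV h \<Longrightarrow> smooth_family (\<lambda>x s. f x (h s))"
  by (simp add: smooth_family_def Ck_reparam)

lemma smooth_iff_smooth_family: "smooth f \<longleftrightarrow> smooth_family (\<lambda>x (t::real). f x)"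
  using smooth_smooth_family smooth_family_smooth by blast

lemma smooth_intros:
  fixes f g :: "'a::euclidean_space \<Rightarrow> 'b::real_normed_field"
  shows "smooth f \<Longrightarrow> smooth g \<Longrightarrow> smooth (\<lambda>x. f x + g x)"
    and "smooth f \<Longrightarrow> smooth g \<Longrightarrow> smooth (\<lambda>x. f x * g x)"
    and "smooth f \<Longrightarrow> smooth g \<Longrightarrow> smooth (\<lambda>x. f x - g x)"
    and "smooth (\<lambda>x::'a. c::'b)"
  unfolding smooth_iff_smooth_family by (intro smooth_family_intros smooth_family_const; assumption)+

subsection \<open>Integration over the parameter\<close>

text \<open>The Leibniz rule. It requires continuity of the derivative as an operator, which in finite dimension
  follows from the continuity of its values on the basis.\<close>

lemma has_derivative_family_integral:
  fixes f :: "'a::euclidean_space \<Rightarrow> real \<Rightarrow> complex"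
  assumes f': "\<And>x t. ((\<lambda>x. f x t) has_derivative (\<lambda>v. f' v x t)) (at x)"
    and cf: "continuous_on UNIV (\<lambda>z. f (fst z) (snd z))"
    and c: "\<And>b. b \<in> Basis \<Longrightarrow> continuous_on UNIV (\<lambda>z. f' b (fst z) (snd z))"
  shows "((\<lambda>x. integral {a..b} (f x)) has_derivative (\<lambda>v. integral {a..b} (f' v x))) (at x)"
proof -
  define fx where "fx x t = Blinfun (\<lambda>v. f' v x t)" for x t
  have app: "blinfun_apply (fx x t) = (\<lambda>v. f' v x t)" for x t
    unfolding fx_def by (rule bounded_linear_Blinfun_apply) (use f' has_derivative_bounded_linear in blast)
  have contf: "continuous_on {a..b} (f x)" for x
    by (rule continuous_on_compose_pair[OF cf]) (auto intro!: continuous_intros)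
  have cfx: "continuous_on UNIV (\<lambda>z. fx (fst z) (snd z))"
    by (rule continuous_on_blinfun_componentwise) (simp add: app c)
  have "((\<lambda>x. integral (cbox a b) (f x)) has_derivative blinfun_apply (integral (cbox a b) (fx x))) (at x within UNIV)"
  proof (rule leibniz_rule)
    show "continuous_on (UNIV \<times> cbox a b) (\<lambda>(x, t). fx x t)"
      using continuous_on_subset[OF cfx, of "UNIV \<times> cbox a b"] by (simp add: case_prod_unfold)
  qed (use f' contf in \<open>auto simp: app intro!: integrable_continuous_real\<close>)
  moreover have "fx x integrable_on cbox a b"
    using continuous_on_compose_pair[OF cfx, of "cbox a b" "\<lambda>t. x" "\<lambda>t. t"]
    by (auto intro!: integrable_continuous_real continuous_intros)
  then have "blinfun_apply (integral (cbox a b) (fx x)) = (\<lambda>v. integral (cbox a b) (f' v x))"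
    by (auto simp: fun_eq_iff blinfun_apply_integral app)
  ultimately show ?thesis by simp
qed

lemma continuous_on_family_integral:
  fixes f :: "'a::topological_space \<Rightarrow> real \<Rightarrow> complex"
  assumes "continuous_on UNIV (\<lambda>z. f (fst z) (snd z))"
  shows "continuous_on UNIV (\<lambda>x. integral {a..b} (f x))"
proof -
  have "continuous_on (UNIV \<times> cbox a b) (\<lambda>(x, t). f x t)"
    using continuous_on_subset[OF assms, of "UNIV \<times> cbox a b"] by (simp add: case_prod_unfold)
  then show ?thesis using integral_continuous_on_param[of UNIV a b f] by simp
qed

lemma smooth_family_section:
  fixes f :: "'a::euclidean_space \<Rightarrow> 't::topological_space \<Rightarrow> 'b::real_normed_vector"
  assumes "smooth_family f"
  shows "continuous_on S (f x)"
  by (rule continuous_on_compose_pair[OF smooth_family_continuous[OF assms]]) (auto intro!: continuous_intros)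

lemma smooth_family_integral:
  fixes f :: "'a::euclidean_space \<Rightarrow> real \<Rightarrow> complex"
  assumes "smooth_family f"
  shows "smooth_family (\<lambda>x (u::'u::topological_space). integral {a..b} (f x))"
proof (rule smooth_family_coinduct[where X="\<lambda>g. \<exists>f. smooth_family f \<and> g = (\<lambda>x u. integral {a..b} (f x))"], goal_cases)
  case (2 g)
  then obtain f where f: "smooth_family f" "g = (\<lambda>x u. integral {a..b} (f x))" by auto
  show ?case unfolding f
    by (intro continuous_fst_snd continuous_on_family_integral smooth_family_continuous f)
next
  case (3 g)
  then obtain f where f: "smooth_family f" "g = (\<lambda>x u. integral {a..b} (f x))" by auto
  obtain f' where f': "\<And>x t. ((\<lambda>x. f x t) has_derivative (\<lambda>v. f' v x t)) (at x)"
    "\<And>b. b \<in> Basis \<Longrightarrow> smooth_family (f' b)" using smooth_family_derivE[OF f(1)] by blast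
  show ?case unfolding f
    using has_derivative_family_integral[OF f'(1) smooth_family_continuous[OF f(1)] smooth_family_continuous[OF f'(2)]] f'(2)
    by (intro exI[of _ "\<lambda>v x u. integral {a..b} (f' v x)"]) blast
qed (use assms in auto)

lemma iter_deriv_integral:
  fixes f :: "'a::euclidean_space \<Rightarrow> real \<Rightarrow> complex"
  assumes "smooth_family f" "set vs \<subseteq> Basis"
  shows "iter_deriv vs (\<lambda>x. integral {a..b} (f x)) = (\<lambda>x. integral {a..b} (\<lambda>t. iter_deriv vs (\<lambda>x. f x t) x))"
  using assms(2)
proof (induction vs)
  case (Cons v vs)
  then have sm: "smooth_family (\<lambda>x t. iter_deriv vs (\<lambda>x. f x t) x)" (is "smooth_family ?F")
    by (intro smooth_family_iter_deriv assms) auto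
  obtain f' where f': "\<And>x t. ((\<lambda>x. ?F x t) has_derivative (\<lambda>v. f' v x t)) (at x)"
    "\<And>b. b \<in> Basis \<Longrightarrow> smooth_family (f' b)" using smooth_family_derivE[OF sm] by blast
  have "((\<lambda>x. integral {a..b} (?F x)) has_derivative (\<lambda>v. integral {a..b} (f' v x))) (at x)" for x
    using has_derivative_family_integral[OF f'(1) smooth_family_continuous[OF sm] smooth_family_continuous[OF f'(2)]] .
  from frechet_derivative_at[OF this, symmetric]
  show ?case using Cons frechet_derivative_at[OF f'(1), symmetric] by simp
qed auto

section \<open>Compactly supported distributions\<close>

text \<open>The seminorms that enter the continuity of a compactly supported distribution.\<close>

definition deriv_bound :: "nat \<Rightarrow> 'a::euclidean_space set \<Rightarrow> real \<Rightarrow> ('a \<Rightarrow> 'b::real_normed_vector) \<Rightarrow> bool" where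
  "deriv_bound N K B f \<longleftrightarrow>
     (\<forall>vs. set vs \<subseteq> Basis \<longrightarrow> length vs \<le> N \<longrightarrow> (\<forall>x\<in>K. norm (iter_deriv vs f x) \<le> B))"

lemma deriv_bound_mono: "deriv_bound N K B f \<Longrightarrow> M \<le> N \<Longrightarrow> B \<le> B' \<Longrightarrow> deriv_bound M K B' f"
  unfolding deriv_bound_def by (meson order_trans)

lemma iter_deriv_has_derivative:
  assumes "smooth f" "set vs \<subseteq> Basis"
  shows "(iter_deriv vs f has_derivative frechet_derivative (iter_deriv vs f) (at x)) (at x)"
  using smooth_has_derivative[OF smooth_iter_deriv[OF assms]] .

lemma iter_deriv_add:
  assumes "smooth f" "smooth g" "set vs \<subseteq> Basis"
  shows "iter_deriv vs (\<lambda>x. f x + g x) = (\<lambda>x. iter_deriv vs f x + iter_deriv vs g x)"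
  using assms(3)
proof (induction vs)
  case (Cons v vs)
  then show ?case
    using frechet_derivative_at[OF has_derivative_add[OF iter_deriv_has_derivative[OF assms(1)] iter_deriv_has_derivative[OF assms(2)]], symmetric]
    by auto
qed auto

lemma iter_deriv_cmult:
  fixes f :: "'a::euclidean_space \<Rightarrow> 'b::real_normed_algebra"
  assumes "smooth f" "set vs \<subseteq> Basis"
  shows "iter_deriv vs (\<lambda>x. c * f x) = (\<lambda>x. c * iter_deriv vs f x)"
  using assms(2)
proof (induction vs)
  case (Cons v vs)
  then show ?case
    using frechet_derivative_at[OF has_derivative_mult_right[OF iter_deriv_has_derivative[OF assms(1)]], symmetric]
    by auto
qed auto

lemma iter_deriv_diff:
  fixes f :: "'a::euclidean_space \<Rightarrow> complex"
  assumes "smooth f" "smooth g" "set vs \<subseteq> Basis"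
  shows "iter_deriv vs (\<lambda>x. f x - g x) = (\<lambda>x. iter_deriv vs f x - iter_deriv vs g x)"
  using iter_deriv_add[OF assms(1) smooth_intros(2)[OF smooth_intros(4)[of "-1"] assms(2)] assms(3)]
    iter_deriv_cmult[OF assms(2,3), of "-1"] by simp

lemma iter_deriv_zero_open:
  assumes "open U" "\<And>x. x \<in> U \<Longrightarrow> f x = 0" "x \<in> U"
  shows "iter_deriv vs f x = 0"
  using assms(3)
proof (induction vs arbitrary: x)
  case (Cons v vs)
  have "(iter_deriv vs f has_derivative (\<lambda>v. 0)) (at x)"
    by (rule has_derivative_transform_within_open[OF has_derivative_const[of 0] assms(1) Cons.prems])
       (use Cons.IH in auto)
  from frechet_derivative_at[OF this, symmetric] show ?case by simp
qed (use assms in auto)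

text \<open>By the product rule, a derivative of order \<open>n\<close> of a product is a sum of \<open>2\<^sup>n\<close> products of derivatives.\<close>

lemma deriv_bound_mult:
  fixes f g :: "'a::euclidean_space \<Rightarrow> 'b::real_normed_field"
  assumes "smooth f" "smooth g" "deriv_bound N K A f" "deriv_bound N K B g"
  shows "deriv_bound N K (2 ^ N * A * B) (\<lambda>x. f x * g x)"
  using assms
proof (induction N arbitrary: f g)
  case 0
  then show ?case by (auto simp: deriv_bound_def norm_mult intro!: mult_mono order_trans[OF norm_ge_zero])
next
  case (Suc N)
  show ?case unfolding deriv_bound_def
  proof (intro allI impI ballI)
    fix vs :: "'a list" and x assume vs: "set vs \<subseteq> Basis" "length vs \<le> Suc N" and x: "x \<in> K"
    have ab: "0 \<le> A" "0 \<le> B" using Suc.prems(3,4)[unfolded deriv_bound_def, rule_format, of "[]" x] x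
      by (auto intro: order_trans[OF norm_ge_zero])
    show "norm (iter_deriv vs (\<lambda>x. f x * g x) x) \<le> 2 ^ Suc N * A * B"
    proof (cases vs rule: rev_cases)
      case Nil
      have "norm (f x * g x) \<le> A * B" using Suc.prems(3,4)[unfolded deriv_bound_def, rule_format, of "[]" x] x
        by (auto simp: norm_mult intro!: mult_mono order_trans[OF norm_ge_zero])
      also have "A * B \<le> 2 ^ Suc N * (A * B)"
        using mult_right_mono[of 1 "2 ^ Suc N" "A * B"] ab one_le_power[of "2::real" "Suc N"] by simp
      finally show ?thesis using Nil by (simp add: mult.assoc)
    next
      case (snoc ws v)
      define fv where "fv = (\<lambda>x. frechet_derivative f (at x) v)"
      define gv where "gv = (\<lambda>x. frechet_derivative g (at x) v)"
      have v: "v \<in> Basis" "set ws \<subseteq> Basis" "length ws \<le> N" using vs snoc by auto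
      have sm: "smooth fv" "smooth gv" unfolding fv_def gv_def using smooth_partial Suc.prems v by auto
      have "deriv_bound N K A fv" "deriv_bound N K B gv"
        unfolding deriv_bound_def
      proof safe
        fix us :: "'a list" and y assume us: "set us \<subseteq> Basis" "length us \<le> N" "y \<in> K"
        show "norm (iter_deriv us fv y) \<le> A"
          using Suc.prems(3)[unfolded deriv_bound_def, rule_format, of "us @ [v]" y] us v
          by (simp add: iter_deriv_append fv_def)
        show "norm (iter_deriv us gv y) \<le> B"
          using Suc.prems(4)[unfolded deriv_bound_def, rule_format, of "us @ [v]" y] us v
          by (simp add: iter_deriv_append gv_def)
      qed
      then have "deriv_bound N K (2 ^ N * A * B) (\<lambda>x. f x * gv x)" "deriv_bound N K (2 ^ N * A * B) (\<lambda>x. fv x * g x)"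
        using Suc.IH[OF Suc.prems(1) sm(2)] Suc.IH[OF sm(1) Suc.prems(2)]
          deriv_bound_mono[OF Suc.prems(3), of N A] deriv_bound_mono[OF Suc.prems(4), of N B] by auto
      then have le: "norm (iter_deriv ws (\<lambda>x. f x * gv x) x) \<le> 2 ^ N * A * B"
        "norm (iter_deriv ws (\<lambda>x. fv x * g x) x) \<le> 2 ^ N * A * B"
        using v x by (auto simp: deriv_bound_def)
      have "frechet_derivative (\<lambda>x. f x * g x) (at y) v = f y * gv y + fv y * g y" for y
        using frechet_derivative_at[OF has_derivative_mult[OF smooth_has_derivative[OF Suc.prems(1)] smooth_has_derivative[OF Suc.prems(2)]], symmetric]
        by (simp add: fv_def gv_def)
      then have "iter_deriv vs (\<lambda>x. f x * g x) = iter_deriv ws (\<lambda>x. f x * gv x + fv x * g x)"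
        using snoc by (simp add: iter_deriv_append)
      also have "\<dots> = (\<lambda>x. iter_deriv ws (\<lambda>x. f x * gv x) x + iter_deriv ws (\<lambda>x. fv x * g x) x)"
        using sm Suc.prems v by (intro iter_deriv_add smooth_intros) auto
      finally show ?thesis using norm_triangle_mono[OF le] by (simp add: algebra_simps)
    qed
  qed
qed

lemma deriv_bound_zero_open:
  assumes "open U" "K \<subseteq> U" "\<And>x. x \<in> U \<Longrightarrow> f x = 0"
  shows "deriv_bound N K 0 f"
  using iter_deriv_zero_open[OF assms(1,3)] assms(2) by (auto simp: deriv_bound_def)

text \<open>Derivatives up to a given order depend continuously on the parameter, uniformly on compact sets.\<close>

lemma smooth_family_deriv_bound:
  fixes f :: "'a::euclidean_space \<Rightarrow> 't::topological_space \<Rightarrow> complex"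
  assumes "smooth_family f" "compact K" "e > 0"
  obtains U where "open U" "t0 \<in> U" "\<And>t. t \<in> U \<Longrightarrow> deriv_bound N K e (\<lambda>x. f x t - f x t0)"
proof -
  let ?V = "{vs :: 'a list. set vs \<subseteq> Basis \<and> length vs \<le> N}"
  have fin: "finite ?V" using finite_lists_length_le[of "Basis :: 'a set" N] by simp
  have "\<exists>U. open U \<and> t0 \<in> U \<and> (\<forall>t\<in>U. \<forall>x\<in>K. dist (iter_deriv vs (\<lambda>x. f x t) x) (iter_deriv vs (\<lambda>x. f x t0) x) \<le> e)"
    if "vs \<in> ?V" for vs
  proof -
    have sm: "smooth_family (\<lambda>x t. iter_deriv vs (\<lambda>x. f x t) x)"
      using smooth_family_iter_deriv[OF assms(1)] that by auto
    define h where "h z = iter_deriv vs (\<lambda>x. f x (fst z)) (snd z)" for z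
    have "continuous_on (UNIV \<times> K) h"
      unfolding h_def
      by (rule continuous_on_compose_pair[OF smooth_family_continuous[OF sm]] continuous_on_fst continuous_on_snd continuous_on_id)+
    from continuous_on_prod_compactE[OF this assms(2) UNIV_I assms(3), of t0]
    obtain X where "t0 \<in> X" "open X" "\<forall>t\<in>X \<inter> UNIV. \<forall>x\<in>K. dist (h (t, x)) (h (t0, x)) \<le> e" by metis
    then show ?thesis by (intro exI[of _ X]) (simp add: h_def)
  qed
  then have "\<forall>vs\<in>?V. \<exists>U. open U \<and> t0 \<in> U \<and> (\<forall>t\<in>U. \<forall>x\<in>K. dist (iter_deriv vs (\<lambda>x. f x t) x) (iter_deriv vs (\<lambda>x. f x t0) x) \<le> e)"
    by simp
  from bchoice[OF this] obtain U where U: "\<forall>vs\<in>?V. open (U vs) \<and> t0 \<in> U vs \<and>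
     (\<forall>t\<in>U vs. \<forall>x\<in>K. dist (iter_deriv vs (\<lambda>x. f x t) x) (iter_deriv vs (\<lambda>x. f x t0) x) \<le> e)" ..
  show ?thesis
  proof (rule that[of "\<Inter>vs\<in>?V. U vs"])
    show "open (\<Inter>vs\<in>?V. U vs)" using U fin by (intro open_INT) auto
    fix t assume t: "t \<in> (\<Inter>vs\<in>?V. U vs)"
    show "deriv_bound N K e (\<lambda>x. f x t - f x t0)"
      unfolding deriv_bound_def
      using U t iter_deriv_diff[OF smooth_family_smooth[OF assms(1)] smooth_family_smooth[OF assms(1)]]
      by (auto simp: dist_norm)
  qed (use U in auto)
qed

context
  fixes u :: "('a::euclidean_space \<Rightarrow> complex) \<Rightarrow> complex"
  assumes u: "compact_distribution u"
begin

lemma distribution_add: "smooth \<phi> \<Longrightarrow> smooth \<psi> \<Longrightarrow> u (\<lambda>x. \<phi> x + \<psi> x) = u \<phi> + u \<psi>"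
  using u by (simp add: compact_distribution_def)

lemma distribution_cmult: "smooth \<phi> \<Longrightarrow> u (\<lambda>x. c * \<phi> x) = c * u \<phi>"
  using u by (simp add: compact_distribution_def)

lemma distribution_zero: "u (\<lambda>x. 0) = 0"
  using distribution_cmult[of "\<lambda>x. 0" 0] by (simp add: smooth_intros)

lemma distribution_diff:
  assumes "smooth \<phi>" "smooth \<psi>" shows "u (\<lambda>x. \<phi> x - \<psi> x) = u \<phi> - u \<psi>"
  using distribution_add[OF assms(1) smooth_intros(2)[OF smooth_intros(4)[of "-1"] assms(2)]]
    distribution_cmult[OF assms(2), of "-1"] by simp

lemma distribution_sum:
  "finite I \<Longrightarrow> (\<And>i. i \<in> I \<Longrightarrow> smooth (f i)) \<Longrightarrow> smooth (\<lambda>x. \<Sum>i\<in>I. f i x) \<and> u (\<lambda>x. \<Sum>i\<in>I. f i x) = (\<Sum>i\<in>I. u (f i))"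
  by (induction I rule: finite_induct) (auto simp: distribution_zero distribution_add smooth_intros)

lemma distribution_boundE:
  obtains K N C where "compact K" "C \<ge> 0"
    "\<And>\<phi> B. smooth \<phi> \<Longrightarrow> 0 \<le> B \<Longrightarrow> deriv_bound N K B \<phi> \<Longrightarrow> norm (u \<phi>) \<le> C * B"
proof -
  from u obtain K N C where *: "compact K" "\<And>\<phi> B. smooth \<phi> \<Longrightarrow> 0 \<le> B \<Longrightarrow> deriv_bound N K B \<phi> \<Longrightarrow> norm (u \<phi>) \<le> C * B"
    unfolding compact_distribution_def deriv_bound_def[symmetric] by metis
  show ?thesis
  proof (rule that[of K "\<bar>C\<bar>" N])
    fix \<phi> :: "'a \<Rightarrow> complex" and B :: real assume a: "smooth \<phi>" "0 \<le> B" "deriv_bound N K B \<phi>"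
    have "C * B \<le> \<bar>C\<bar> * B" using a by (intro mult_right_mono) auto
    with *(2)[OF a] show "norm (u \<phi>) \<le> \<bar>C\<bar> * B" by linarith
  qed (use * in auto)
qed

lemma distribution_family_continuous:
  assumes f: "smooth_family f" shows "continuous_on UNIV (\<lambda>t. u (\<lambda>x. f x t))"
proof -
  obtain K N C where K: "compact K" "C \<ge> 0"
    "\<And>\<phi> B. smooth \<phi> \<Longrightarrow> 0 \<le> B \<Longrightarrow> deriv_bound N K B \<phi> \<Longrightarrow> norm (u \<phi>) \<le> C * B" by (rule distribution_boundE) blast
  have "(\<lambda>t. u (\<lambda>x. f x t)) \<midarrow>t0\<rightarrow> u (\<lambda>x. f x t0)" for t0
  proof (rule tendstoI)
    fix e :: real assume e: "e > 0"
    obtain U where U: "open U" "t0 \<in> U" "\<And>t. t \<in> U \<Longrightarrow> deriv_bound N K (e / (C + 1)) (\<lambda>x. f x t - f x t0)"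
      using smooth_family_deriv_bound[OF f K(1)] e K(2) by (metis add_nonneg_pos zero_less_divide_iff zero_less_one)
    have "dist (u (\<lambda>x. f x t)) (u (\<lambda>x. f x t0)) < e" if "t \<in> U" for t
    proof -
      have "norm (u (\<lambda>x. f x t - f x t0)) \<le> C * (e / (C + 1))"
        using e K(2) by (intro K(3) U that smooth_intros smooth_family_smooth[OF f]) auto
      also have "\<dots> < e" using e K(2) by (simp add: field_simps)
      finally show ?thesis by (simp add: dist_norm distribution_diff smooth_family_smooth[OF f])
    qed
    then show "\<forall>\<^sub>F t in at t0. dist (u (\<lambda>x. f x t)) (u (\<lambda>x. f x t0)) < e"
      using U eventually_at_topological by blast
  qed
  then show ?thesis by (simp add: continuous_on_def)
qed

text \<open>A distribution may be moved under an integral over a parameter. Riemann sums are avoided: both sides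
  are functions of the upper limit with the same derivative, which is computed from the continuity
  of the family in the seminorms of \<^const>\<open>deriv_bound\<close>.\<close>

lemma distribution_integral:
  fixes f :: "'a \<Rightarrow> real \<Rightarrow> complex"
  assumes f: "smooth_family f" and ab: "a \<le> b"
  shows "u (\<lambda>x. integral {a..b} (f x)) = integral {a..b} (\<lambda>t. u (\<lambda>x. f x t))"
proof -
  obtain K N C where K: "compact K" "C \<ge> 0"
    "\<And>\<phi> B. smooth \<phi> \<Longrightarrow> 0 \<le> B \<Longrightarrow> deriv_bound N K B \<phi> \<Longrightarrow> norm (u \<phi>) \<le> C * B" by (rule distribution_boundE) blast
  define H where "H d = u (\<lambda>x. integral {a..d} (f x))" for d
  have smi: "smooth (\<lambda>x. integral {c..d} (g x))" if "smooth_family g" for g :: "'a \<Rightarrow> real \<Rightarrow> complex" and c d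
    using smooth_family_integral[OF that, where 'u=real] smooth_iff_smooth_family by blast
  have smf: "smooth (\<lambda>x. f x t)" for t by (rule smooth_family_smooth[OF f])
  have int: "f x integrable_on {c..d}" for x c d
    by (rule integrable_continuous_real smooth_family_section[OF f])+
  \<comment> \<open>The increment of \<open>H\<close> is the value on an integral over a short interval, whose derivatives are small.\<close>
  have incr: "norm (H d - H c - (d - c) *\<^sub>R u (\<lambda>x. f x \<tau>)) \<le> C * (e * (d - c))"
    if "a \<le> c" "c \<le> d" "0 \<le> e" "\<And>t. t \<in> {c..d} \<Longrightarrow> deriv_bound N K e (\<lambda>x. f x t - f x \<tau>)" for c d \<tau> e
  proof -
    have smg: "smooth_family (\<lambda>x t. f x t - f x \<tau>)"
      by (intro smooth_family_intros f smooth_family_reparam[OF f, of "\<lambda>t. \<tau>"] continuous_intros)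
    have "integral {a..d} (f x) - integral {a..c} (f x) - (of_real (d - c)) * f x \<tau> = integral {c..d} (\<lambda>t. f x t - f x \<tau>)" for x
    proof -
      have "integral {a..d} (f x) = integral {a..c} (f x) + integral {c..d} (f x)"
        using Henstock_Kurzweil_Integration.integral_combine[OF that(1,2) int] by simp
      moreover have "integral {c..d} (\<lambda>t. f x t - f x \<tau>) = integral {c..d} (f x) - of_real (d - c) * f x \<tau>"
        using that(2) int by (subst integral_diff) (auto simp: scaleR_conv_of_real)
      ultimately show ?thesis by simp
    qed
    then have "H d - H c - (d - c) *\<^sub>R u (\<lambda>x. f x \<tau>) = u (\<lambda>x. integral {c..d} (\<lambda>t. f x t - f x \<tau>))"
      using distribution_diff[OF smooth_intros(3)[OF smi[OF f] smi[OF f]] smooth_intros(2)[OF smooth_intros(4) smf],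
          of a d a c "of_real (d - c)" \<tau>]
        distribution_diff[OF smi[OF f] smi[OF f], of a d a c] distribution_cmult[OF smf, of "of_real (d - c)" \<tau>]
      by (simp add: H_def scaleR_conv_of_real)
    also have "norm \<dots> \<le> C * (e * (d - c))"
    proof (rule K(3)[OF smi[OF smg]])
      show "deriv_bound N K (e * (d - c)) (\<lambda>x. integral {c..d} (\<lambda>t. f x t - f x \<tau>))"
        unfolding deriv_bound_def
      proof (intro allI impI ballI)
        fix vs :: "'a list" and x assume vs: "set vs \<subseteq> Basis" "length vs \<le> N" "x \<in> K"
        have "continuous_on {c..d} (\<lambda>t. iter_deriv vs (\<lambda>x. f x t - f x \<tau>) x)"
          using smooth_family_section[OF smooth_family_iter_deriv[OF smg vs(1)]] .
        then have "norm (integral {c..d} (\<lambda>t. iter_deriv vs (\<lambda>x. f x t - f x \<tau>) x)) \<le> e * (d - c)"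
          using that vs by (intro integral_bound) (auto simp: deriv_bound_def)
        then show "norm (iter_deriv vs (\<lambda>x. integral {c..d} (\<lambda>t. f x t - f x \<tau>)) x) \<le> e * (d - c)"
          by (simp add: iter_deriv_integral[OF smg vs(1)])
      qed
    qed (use that in auto)
    finally show ?thesis .
  qed
  have "(H has_vector_derivative u (\<lambda>x. f x \<tau>)) (at \<tau> within {a..b})" if \<tau>: "\<tau> \<in> {a..b}" for \<tau>
    unfolding has_vector_derivative_def has_derivative_within_alt2
  proof (intro conjI allI impI)
    fix e :: real assume e: "e > 0"
    define e' where "e' = e / (C + 1)"
    have e': "e' > 0" "C * e' \<le> e" using e K(2) by (auto simp: e'_def field_simps)
    obtain U where U: "open U" "\<tau> \<in> U" "\<And>t. t \<in> U \<Longrightarrow> deriv_bound N K e' (\<lambda>x. f x t - f x \<tau>)"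
      using smooth_family_deriv_bound[OF f K(1) e'(1)] by metis
    obtain r where r: "r > 0" "ball \<tau> r \<subseteq> U" using U openE by blast
    have "norm (H y - H \<tau> - (y - \<tau>) *\<^sub>R u (\<lambda>x. f x \<tau>)) \<le> e * norm (y - \<tau>)"
      if y: "y \<in> {a..b}" "dist y \<tau> < r" for y
    proof -
      have sub: "t \<in> U" if "min y \<tau> \<le> t" "t \<le> max y \<tau>" for t
      proof -
        have "dist \<tau> t < r" using that y(2) by (auto simp: dist_real_def abs_if split: if_splits)
        then show ?thesis using r by auto
      qed
      have "norm (H y - H \<tau> - (y - \<tau>) *\<^sub>R u (\<lambda>x. f x \<tau>)) \<le> C * (e' * \<bar>y - \<tau>\<bar>)"
      proof (cases "\<tau> \<le> y")
        case True
        then show ?thesis using incr[of \<tau> y e' \<tau>] \<tau> e' U(3) sub by auto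
      next
        case False
        have "H y - H \<tau> - (y - \<tau>) *\<^sub>R u (\<lambda>x. f x \<tau>) = - (H \<tau> - H y - (\<tau> - y) *\<^sub>R u (\<lambda>x. f x \<tau>))"
          by (simp add: algebra_simps)
        then have "norm (H y - H \<tau> - (y - \<tau>) *\<^sub>R u (\<lambda>x. f x \<tau>)) = norm (H \<tau> - H y - (\<tau> - y) *\<^sub>R u (\<lambda>x. f x \<tau>))"
          by (metis norm_minus_cancel)
        moreover have "\<bar>y - \<tau>\<bar> = \<tau> - y" using False by simp
        ultimately show ?thesis using incr[of y \<tau> e' \<tau>] y e' U(3) sub False by (metis atLeastAtMost_iff less_imp_le max.commute max.order_iff min.absorb_iff1 not_le)
      qed
      also have "\<dots> = (C * e') * \<bar>y - \<tau>\<bar>" by simp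
      also have "\<dots> \<le> e * \<bar>y - \<tau>\<bar>" using e' by (intro mult_right_mono) auto
      finally show ?thesis by simp
    qed
    then show "\<forall>\<^sub>F y in at \<tau> within {a..b}. norm (H y - H \<tau> - (y - \<tau>) *\<^sub>R u (\<lambda>x. f x \<tau>)) \<le> e * norm (y - \<tau>)"
      using r(1) by (auto simp: eventually_at)
  qed (auto intro: bounded_linear_scaleR_left)
  then have "((\<lambda>t. u (\<lambda>x. f x t)) has_integral (H b - H a)) {a..b}"
    using ab by (intro fundamental_theorem_of_calculus) auto
  moreover have "H a = 0" by (simp add: H_def distribution_zero)
  ultimately show ?thesis by (simp add: H_def integral_unique)
qed

end

section \<open>Cutoff functions and supports\<close>

lemma tendsto_poly_exp_zero: "((\<lambda>y. y ^ k * poly P y * exp (- y)) \<longlongrightarrow> (0::real)) at_top"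
proof (induction P arbitrary: k)
  case (pCons a P)
  have "((\<lambda>y. a * (y ^ k / exp y) + y ^ Suc k * poly P y * exp (- y)) \<longlongrightarrow> a * 0 + 0) at_top"
    by (intro tendsto_intros tendsto_power_div_exp_0 pCons.IH)
  then show ?case by (simp add: algebra_simps exp_minus divide_inverse)
qed simp

text \<open>The functions \<open>P(1/x) e\<^bsup>-1/x\<^esup>\<close>, extended by zero. This class is closed under differentiation.\<close>

definition flat_exp :: "real poly \<Rightarrow> real \<Rightarrow> real" where
  "flat_exp P x = (if x > 0 then poly P (inverse x) * exp (- inverse x) else 0)"

lemma flat_exp_has_derivative:
  "(flat_exp P has_field_derivative flat_exp (monom 1 2 * (P - pderiv P)) x) (at x)"
proof -
  consider "x > 0" | "x < 0" | "x = 0" by linarith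
  then show ?thesis
  proof cases
    case 1
    have "((\<lambda>x. poly P (inverse x) * exp (- inverse x)) has_field_derivative flat_exp (monom 1 2 * (P - pderiv P)) x) (at x)"
      using 1 by (auto intro!: derivative_eq_intros DERIV_chain2[OF poly_DERIV]
          simp: flat_exp_def poly_monom field_simps power2_eq_square)
    then show ?thesis
      by (rule has_field_derivative_transform_within_open[where S="{0<..}"]) (use 1 in \<open>auto simp: flat_exp_def\<close>)
  next
    case 2
    have "((\<lambda>x. 0) has_field_derivative flat_exp (monom 1 2 * (P - pderiv P)) x) (at x)" using 2 by (simp add: flat_exp_def)
    then show ?thesis
      by (rule has_field_derivative_transform_within_open[where S="{..<0}"]) (use 2 in \<open>auto simp: flat_exp_def\<close>)
  next
    case 3
    have "((\<lambda>h. flat_exp P h / h) \<longlongrightarrow> 0) (at_right 0)"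
    proof -
      have "((\<lambda>h. inverse h ^ 1 * poly P (inverse h) * exp (- inverse h)) \<longlongrightarrow> 0) (at_right (0::real))"
        using filterlim_compose[OF tendsto_poly_exp_zero filterlim_inverse_at_top_right] .
      then show ?thesis
        by (rule Lim_transform_eventually) (auto simp: eventually_at flat_exp_def divide_inverse intro!: exI[of _ 1])
    qed
    moreover have "((\<lambda>h. flat_exp P h / h) \<longlongrightarrow> 0) (at_left 0)"
      by (rule Lim_transform_eventually[OF tendsto_const]) (auto simp: eventually_at flat_exp_def intro!: exI[of _ 1])
    ultimately show ?thesis using 3 by (auto simp: DERIV_def flat_exp_def filterlim_split_at)
  qed
qed

lemma smooth_flat_exp: "smooth_family (\<lambda>x (t::'t::topological_space). flat_exp P x)"
proof (rule smooth_family_coinduct[where X="\<lambda>f. \<exists>P. f = (\<lambda>x t. flat_exp P x)"], goal_cases)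
  case (2 f)
  have "continuous_on UNIV (flat_exp P)" for P
    by (meson DERIV_isCont continuous_at_imp_continuous_on flat_exp_has_derivative)
  with 2 show ?case by (auto intro: continuous_fst_snd)
next
  case (3 f)
  then obtain P where P: "f = (\<lambda>x t. flat_exp P x)" by auto
  have "((\<lambda>x. f x t) has_derivative (\<lambda>v. flat_exp (monom 1 2 * (P - pderiv P)) x * v)) (at x)" for x t
    using flat_exp_has_derivative[of P x] by (simp add: P has_field_derivative_def)
  then show ?case
    by (intro exI[of _ "\<lambda>v x t. flat_exp (monom 1 2 * (P - pderiv P)) x * v"]) auto
qed auto

definition smooth_step :: "real \<Rightarrow> real" where
  "smooth_step x = flat_exp 1 (1 - x) * inverse (flat_exp 1 x + flat_exp 1 (1 - x))"

lemma smooth_step_simps: "x \<le> 0 \<Longrightarrow> smooth_step x = 1" "x \<ge> 1 \<Longrightarrow> smooth_step x = 0"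
  by (auto simp: smooth_step_def flat_exp_def)

text \<open>A cutoff that is \<open>1\<close> on the ball of radius \<open>r\<close> and \<open>0\<close> off the ball of radius \<open>R\<close>. Using the
  square of the distance keeps it smooth at the centre.\<close>

definition bump :: "'a::euclidean_space \<Rightarrow> real \<Rightarrow> real \<Rightarrow> 'a \<Rightarrow> complex" where
  "bump a r R x = of_real (smooth_step (((x - a) \<bullet> (x - a) - r\<^sup>2) / (R\<^sup>2 - r\<^sup>2)))"

lemma smooth_family_bump: "smooth_family (\<lambda>x (t::'t::topological_space). bump a r R x)"
proof -
  have pos: "flat_exp 1 x + flat_exp 1 (1 - x) \<noteq> 0" for x
  proof -
    have "flat_exp 1 x + flat_exp 1 (1 - x) > 0"
      by (cases "x > 0"; cases "x < 1") (auto simp: flat_exp_def add_pos_pos)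
    then show ?thesis by simp
  qed
  have id: "smooth_family (\<lambda>x (t::'t). x :: real)"
    using smooth_family_inner[of "\<lambda>t. 1::real"] by (simp add: continuous_on_const)
  have "smooth_family (\<lambda>x (t::'t). 1 - x :: real)"
    by (intro smooth_family_intros smooth_family_const id)
  then have fl: "smooth_family (\<lambda>x (t::'t). flat_exp 1 (1 - x))"
    using smooth_family_compose[OF smooth_flat_exp[of 1, where 't='t]] by fastforce
  have st: "smooth_family (\<lambda>x (t::'t). smooth_step x)"
    unfolding smooth_step_def by (intro smooth_family_intros fl smooth_flat_exp pos)
  have "smooth_family (\<lambda>x (t::'t). (\<Sum>b\<in>S. (x \<bullet> b - a \<bullet> b) * (x \<bullet> b - a \<bullet> b)))" if "finite S" for S :: "'a set"
    using that
    by (induction S rule: finite_induct)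
       (auto intro!: smooth_family_intros smooth_family_const smooth_family_inner continuous_intros)
  then have "smooth_family (\<lambda>x (t::'t). (x - a) \<bullet> (x - a))"
    by (subst euclidean_inner) (simp add: inner_diff_left)
  then have "smooth_family (\<lambda>x (t::'t). ((x - a) \<bullet> (x - a) - r\<^sup>2) * inverse (R\<^sup>2 - r\<^sup>2))"
    by (intro smooth_family_intros smooth_family_const)
  from smooth_family_intros(6)[OF smooth_family_compose[OF st this]]
  show ?thesis by (simp add: bump_def divide_inverse)
qed

lemma smooth_bump: "smooth (bump a r R)"
  using smooth_family_bump smooth_iff_smooth_family by blast

lemma bump_eq_1:
  assumes "0 \<le> r" "r < R" "norm (x - a) \<le> r" shows "bump a r R x = 1"
proof -
  have "(x - a) \<bullet> (x - a) \<le> r\<^sup>2" using assms by (simp add: power2_norm_eq_inner[symmetric] power_mono)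
  moreover have "r\<^sup>2 < R\<^sup>2" using assms by (intro power_strict_mono) auto
  ultimately show ?thesis unfolding bump_def by (subst smooth_step_simps) (auto intro!: divide_nonpos_pos)
qed

lemma bump_eq_0:
  assumes "0 \<le> r" "r < R" "norm (x - a) \<ge> R" shows "bump a r R x = 0"
proof -
  have "R\<^sup>2 \<le> (x - a) \<bullet> (x - a)" using assms by (simp add: power2_norm_eq_inner[symmetric] power_mono)
  moreover have "r\<^sup>2 < R\<^sup>2" using assms by (intro power_strict_mono) auto
  ultimately show ?thesis unfolding bump_def by (subst smooth_step_simps(2)) (auto simp: field_simps)
qed

text \<open>The support is defined by test functions with compact support, each inside one open set on which the
  distribution vanishes. The general case follows by cutting off outside the compact set that carries the
  distribution and then by peeling off one ball of a finite cover after the other, which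
  replaces a partition of unity.\<close>

lemma distribution_zero_off_support:
  fixes u :: "('a::euclidean_space \<Rightarrow> complex) \<Rightarrow> complex"
  assumes u: "compact_distribution u" and \<phi>: "smooth \<phi>" and U: "open U" "dist_support u \<subseteq> U"
    and z: "\<And>x. x \<in> U \<Longrightarrow> \<phi> x = 0"
  shows "u \<phi> = 0"
proof -
  define null where "null = {W. open W \<and> (\<forall>\<phi>. smooth \<phi> \<longrightarrow> compact (closure {x. \<phi> x \<noteq> 0}) \<longrightarrow>
                          closure {x. \<phi> x \<noteq> 0} \<subseteq> W \<longrightarrow> u \<phi> = 0)}"
  have supp: "- U \<subseteq> \<Union>null" using U(2) unfolding dist_support_def null_def by auto
  \<comment> \<open>The doubled balls leave room for a cutoff that is \<open>1\<close> on the ball itself.\<close>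
  have cover: "u \<phi> = 0" if "finite T" "\<And>a r. (a, r) \<in> T \<Longrightarrow> r > 0 \<and> (\<exists>W\<in>null. ball a (2 * r) \<subseteq> W)"
    "smooth \<phi>" "compact (closure {x. \<phi> x \<noteq> 0})" "closure {x. \<phi> x \<noteq> 0} \<subseteq> (\<Union>(a, r)\<in>T. ball a r)" for T \<phi>
    using that
  proof (induction T arbitrary: \<phi> rule: finite_induct)
    case empty
    then have "\<phi> = (\<lambda>x. 0)" using closure_subset by fastforce
    then show ?case using distribution_zero[OF u] by simp
  next
    case (insert p T)
    obtain a r where p: "p = (a, r)" by (cases p)
    from insert.prems(1)[of a r] p obtain W where r: "r > 0" and W: "W \<in> null" "ball a (2 * r) \<subseteq> W" by auto
    \<comment> \<open>Split the function into the part near the ball \<open>p\<close> and the part covered by the other balls.\<close>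
    define \<rho> where "\<rho> = bump a r (3 / 2 * r)"
    have sm: "smooth \<rho>" by (simp add: \<rho>_def smooth_bump)
    have sub: "closure {x. \<phi> x * \<rho> x \<noteq> 0} \<subseteq> cball a (3 / 2 * r)"
    proof (rule closure_minimal)
      show "{x. \<phi> x * \<rho> x \<noteq> 0} \<subseteq> cball a (3 / 2 * r)"
        using bump_eq_0[of r "3 / 2 * r" _ a] r by (force simp: \<rho>_def dist_norm norm_minus_commute not_le)
    qed auto
    have "u (\<lambda>x. \<phi> x * \<rho> x) = 0"
    proof -
      have "compact (closure {x. \<phi> x * \<rho> x \<noteq> 0})"
        using sub by (meson bounded_cball bounded_subset closed_closure compact_eq_bounded_closed)
      moreover have "closure {x. \<phi> x * \<rho> x \<noteq> 0} \<subseteq> W"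
        using sub W(2) r by (force simp: subset_eq)
      ultimately show ?thesis using W(1) smooth_intros(2)[OF insert.prems(2) sm] by (simp add: null_def)
    qed
    moreover have "u (\<lambda>x. \<phi> x * (1 - \<rho> x)) = 0"
    proof (rule insert.IH)
      have s: "closure {x. \<phi> x * (1 - \<rho> x) \<noteq> 0} \<subseteq> closure {x. \<phi> x \<noteq> 0} \<inter> - ball a r"
      proof (rule closure_minimal)
        have "\<rho> x = 1" if "x \<in> ball a r" for x
          using that r bump_eq_1[of r "3 / 2 * r" x a] by (simp add: \<rho>_def dist_norm norm_minus_commute)
        then show "{x. \<phi> x * (1 - \<rho> x) \<noteq> 0} \<subseteq> closure {x. \<phi> x \<noteq> 0} \<inter> - ball a r"
          using closure_subset[of "{x. \<phi> x \<noteq> 0}"] by auto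
      qed (auto intro!: closed_Int closed_Compl)
      then have "bounded (closure {x. \<phi> x * (1 - \<rho> x) \<noteq> 0})"
        using bounded_subset[OF compact_imp_bounded[OF insert.prems(3)]] by blast
      then show "compact (closure {x. \<phi> x * (1 - \<rho> x) \<noteq> 0})"
        by (simp add: compact_eq_bounded_closed)
      show "closure {x. \<phi> x * (1 - \<rho> x) \<noteq> 0} \<subseteq> (\<Union>(a, r)\<in>T. ball a r)"
        using s insert.prems(4) p by auto
    qed (use insert.prems sm in \<open>auto intro!: smooth_intros\<close>)
    moreover have "u (\<lambda>x. \<phi> x * \<rho> x + \<phi> x * (1 - \<rho> x)) = u (\<lambda>x. \<phi> x * \<rho> x) + u (\<lambda>x. \<phi> x * (1 - \<rho> x))"
      using insert.prems(2) sm by (intro distribution_add[OF u] smooth_intros)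
    moreover have "(\<lambda>x. \<phi> x * \<rho> x + \<phi> x * (1 - \<rho> x)) = \<phi>" by (auto simp: algebra_simps)
    ultimately show ?case by simp
  qed
  obtain K N C where K: "compact K" "C \<ge> 0"
    "\<And>\<phi> B. smooth \<phi> \<Longrightarrow> 0 \<le> B \<Longrightarrow> deriv_bound N K B \<phi> \<Longrightarrow> norm (u \<phi>) \<le> C * B" by (rule distribution_boundE[OF u]) blast
  obtain r where r: "r > 0" "K \<subseteq> ball 0 r"
    using bounded_subset_ballD[OF compact_imp_bounded[OF K(1)], of 0] by blast
  define \<rho> where "\<rho> = (bump 0 r (r + 1) :: 'a \<Rightarrow> complex)"
  have sm: "smooth \<rho>" by (simp add: \<rho>_def smooth_bump)
  have "norm (u (\<lambda>x. \<phi> x - \<phi> x * \<rho> x)) \<le> C * 0"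
  proof (rule K(3))
    have "\<rho> x = 1" if "x \<in> ball 0 r" for x
      using that r bump_eq_1[of r "r + 1" x 0] by (simp add: \<rho>_def)
    then show "deriv_bound N K 0 (\<lambda>x. \<phi> x - \<phi> x * \<rho> x)"
      using r by (intro deriv_bound_zero_open[of "ball 0 r"]) auto
  qed (use \<phi> sm in \<open>auto intro!: smooth_intros\<close>)
  then have "u \<phi> = u (\<lambda>x. \<phi> x * \<rho> x)"
    using distribution_diff[OF u \<phi>, of "\<lambda>x. \<phi> x * \<rho> x"] \<phi> sm by (simp add: smooth_intros)
  also have "\<dots> = 0"
  proof -
    have cl: "closure {x. \<phi> x * \<rho> x \<noteq> 0} \<subseteq> - U \<inter> cball 0 (r + 1)"
    proof (rule closure_minimal)
      have "norm x \<le> r + 1" if "\<rho> x \<noteq> 0" for x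
        using that bump_eq_0[of r "r + 1" x 0] r by (force simp: \<rho>_def)
      then show "{x. \<phi> x * \<rho> x \<noteq> 0} \<subseteq> - U \<inter> cball 0 (r + 1)" using z by auto
    qed (use U in \<open>auto intro!: closed_Int\<close>)
    then have "bounded (closure {x. \<phi> x * \<rho> x \<noteq> 0})"
      using bounded_subset[OF bounded_cball, of "closure {x. \<phi> x * \<rho> x \<noteq> 0}"] by blast
    then have co: "compact (closure {x. \<phi> x * \<rho> x \<noteq> 0})"
      by (simp add: compact_eq_bounded_closed)
    have "\<exists>r>0. \<exists>W\<in>null. ball a (2 * r) \<subseteq> W" if a: "a \<in> closure {x. \<phi> x * \<rho> x \<noteq> 0}" for a
    proof -
      obtain W where W: "W \<in> null" "a \<in> W" using a cl supp by blast
      then obtain e where "e > 0" "ball a e \<subseteq> W" unfolding null_def using openE by blast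
      then show ?thesis using W(1) by (intro exI[of _ "e / 2"]) auto
    qed
    then have "\<forall>a\<in>closure {x. \<phi> x * \<rho> x \<noteq> 0}. \<exists>r. r > 0 \<and> (\<exists>W\<in>null. ball a (2 * r) \<subseteq> W)" by blast
    from bchoice[OF this] obtain R where
      R: "\<forall>a\<in>closure {x. \<phi> x * \<rho> x \<noteq> 0}. R a > 0 \<and> (\<exists>W\<in>null. ball a (2 * R a) \<subseteq> W)" ..
    obtain T where T: "T \<subseteq> closure {x. \<phi> x * \<rho> x \<noteq> 0}" "finite T" "closure {x. \<phi> x * \<rho> x \<noteq> 0} \<subseteq> (\<Union>a\<in>T. ball a (R a))"
    proof (rule compactE_image[OF co, of "closure {x. \<phi> x * \<rho> x \<noteq> 0}" "\<lambda>a. ball a (R a)"])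
      show "closure {x. \<phi> x * \<rho> x \<noteq> 0} \<subseteq> (\<Union>a\<in>closure {x. \<phi> x * \<rho> x \<noteq> 0}. ball a (R a))"
        using R by force
    qed auto
    show ?thesis
      by (rule cover[of "(\<lambda>a. (a, R a)) ` T"]) (use T R co \<phi> sm in \<open>auto intro!: smooth_intros\<close>)
  qed
  finally show ?thesis .
qed

section \<open>Orthogonal expansions\<close>

lemma borel_measurable_cnj [measurable (raw)]:
  "f \<in> borel_measurable M \<Longrightarrow> (\<lambda>x. cnj (f x)) \<in> borel_measurable M"
  by (rule measurable_compose[of f]) (auto intro!: borel_measurable_continuous_onI continuous_intros)

text \<open>The expansion of the squared distance from \<open>f\<close> to a linear combination of orthogonal functions of
  squared norm \<open>V\<close>; the last term is its squared distance to the best approximation. Dropping that term gives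
  the estimate behind Parseval's identity; the best approximation itself gives Bessel's inequality.\<close>

lemma (in finite_measure) orthogonal_expansion:
  fixes f :: "'a \<Rightarrow> complex" and e :: "'i \<Rightarrow> 'a \<Rightarrow> complex" and a :: "'i \<Rightarrow> complex"
  assumes f [measurable]: "f \<in> borel_measurable M" and f2: "integrable M (\<lambda>x. (cmod (f x))\<^sup>2)"
    and I: "finite I" and e [measurable]: "\<And>i. e i \<in> borel_measurable M"
    and e1: "\<And>i x. cmod (e i x) \<le> 1"
    and orth: "\<And>i j. i \<in> I \<Longrightarrow> j \<in> I \<Longrightarrow> (LINT x|M. e i x * cnj (e j x)) = (if i = j then complex_of_real V else 0)"
    and V: "V > 0"
  defines "c \<equiv> \<lambda>i. LINT x|M. f x * cnj (e i x)"
  shows "(LINT x|M. (cmod (f x - (\<Sum>i\<in>I. a i * e i x)))\<^sup>2) =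
     (LINT x|M. (cmod (f x))\<^sup>2) - (\<Sum>i\<in>I. (cmod (c i))\<^sup>2) / V + V * (\<Sum>i\<in>I. (cmod (a i - c i / V))\<^sup>2)"
    and "integrable M (\<lambda>x. (cmod (f x - (\<Sum>i\<in>I. a i * e i x)))\<^sup>2)"
proof -
  have fi: "integrable M f"
  proof (rule Bochner_Integration.integrable_bound[of M "\<lambda>x. 1 + (cmod (f x))\<^sup>2"])
    have "cmod z \<le> 1 + (cmod z)\<^sup>2" for z
    proof -
      have "(cmod z - 1 / 2)\<^sup>2 = (cmod z)\<^sup>2 - cmod z + 1 / 4" by (simp add: power2_eq_square field_simps)
      then show ?thesis using zero_le_power2[of "cmod z - 1 / 2"] by linarith
    qed
    then show "AE x in M. norm (f x) \<le> norm (1 + (cmod (f x))\<^sup>2)" by (simp add: abs_of_nonneg)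
  qed (use f2 in auto)
  have b: "has_bochner_integral M (\<lambda>x. f x * cnj (e i x)) (c i)" for i
  proof -
    have "integrable M (\<lambda>x. f x * cnj (e i x))"
      by (rule Bochner_Integration.integrable_bound[OF fi])
         (auto simp: norm_mult intro!: mult_left_le e1)
    then show ?thesis by (simp add: c_def has_bochner_integral_integrable)
  qed
  have bc: "has_bochner_integral M (\<lambda>x. cnj (f x * cnj (e i x))) (cnj (c i))" for i
    by (rule has_bochner_integral_bounded_linear[OF bounded_linear_cnj b])
  have be: "has_bochner_integral M (\<lambda>x. e i x * cnj (e j x)) (if i = j then complex_of_real V else 0)"
    if "i \<in> I" "j \<in> I" for i j
  proof -
    have "cmod (e i x * cnj (e j x)) \<le> 1" for x
      using mult_mono[OF e1[of i x] e1[of j x]] by (simp add: norm_mult)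
    then have "integrable M (\<lambda>x. e i x * cnj (e j x))"
      by (intro integrable_const_bound[where B=1]) auto
    then show ?thesis using orth[OF that] by (simp add: has_bochner_integral_iff)
  qed
  define F where "F = (LINT x|M. (cmod (f x))\<^sup>2)"
  have bf: "has_bochner_integral M (\<lambda>x. complex_of_real ((cmod (f x))\<^sup>2)) (of_real F)"
    using f2 by (intro has_bochner_integral_of_real) (simp add: F_def has_bochner_integral_integrable)
  have "has_bochner_integral M (\<lambda>x. of_real ((cmod (f x))\<^sup>2) - (\<Sum>i\<in>I. cnj (a i) * (f x * cnj (e i x)))
       - (\<Sum>i\<in>I. a i * cnj (f x * cnj (e i x))) + (\<Sum>i\<in>I. \<Sum>j\<in>I. a i * cnj (a j) * (e i x * cnj (e j x))))
     (of_real F - (\<Sum>i\<in>I. cnj (a i) * c i) - (\<Sum>i\<in>I. a i * cnj (c i))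
       + (\<Sum>i\<in>I. \<Sum>j\<in>I. a i * cnj (a j) * (if i = j then complex_of_real V else 0)))"
    by (intro has_bochner_integral_add has_bochner_integral_diff has_bochner_integral_sum
        has_bochner_integral_mult_right b bc be bf) auto
  moreover have "of_real ((cmod (f x))\<^sup>2) - (\<Sum>i\<in>I. cnj (a i) * (f x * cnj (e i x)))
       - (\<Sum>i\<in>I. a i * cnj (f x * cnj (e i x))) + (\<Sum>i\<in>I. \<Sum>j\<in>I. a i * cnj (a j) * (e i x * cnj (e j x)))
       = complex_of_real ((cmod (f x - (\<Sum>i\<in>I. a i * e i x)))\<^sup>2)" for x
  proof -
    define S where "S = (\<Sum>i\<in>I. a i * e i x)"
    have 1: "(\<Sum>i\<in>I. cnj (a i) * (f x * cnj (e i x))) = f x * cnj S"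
      by (simp add: S_def cnj_sum sum_distrib_left algebra_simps)
    have 2: "(\<Sum>i\<in>I. a i * cnj (f x * cnj (e i x))) = cnj (f x) * S"
      by (simp add: S_def sum_distrib_left algebra_simps)
    have 3: "(\<Sum>i\<in>I. \<Sum>j\<in>I. a i * cnj (a j) * (e i x * cnj (e j x))) = S * cnj S"
      by (simp add: S_def cnj_sum sum_product algebra_simps)
    show ?thesis unfolding 1 2 3 S_def[symmetric]
      by (simp only: complex_norm_square) (simp add: algebra_simps)
  qed
  moreover have "of_real F - (\<Sum>i\<in>I. cnj (a i) * c i) - (\<Sum>i\<in>I. a i * cnj (c i))
       + (\<Sum>i\<in>I. \<Sum>j\<in>I. a i * cnj (a j) * (if i = j then complex_of_real V else 0))
     = complex_of_real (F - (\<Sum>i\<in>I. (cmod (c i))\<^sup>2) / V + V * (\<Sum>i\<in>I. (cmod (a i - c i / V))\<^sup>2))"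
  proof -
    have "(\<Sum>i\<in>I. \<Sum>j\<in>I. a i * cnj (a j) * (if i = j then complex_of_real V else 0)) = (\<Sum>i\<in>I. a i * cnj (a i) * V)"
      using I by (intro sum.cong) (auto simp: if_distrib cong: if_cong)
    moreover have "V * (a i - c i / V) * cnj (a i - c i / V) =
        a i * cnj (a i) * V - cnj (a i) * c i - a i * cnj (c i) + c i * cnj (c i) / V" for i
      using V by (simp add: field_simps)
    then have "complex_of_real (V * (\<Sum>i\<in>I. (cmod (a i - c i / V))\<^sup>2)) =
       (\<Sum>i\<in>I. a i * cnj (a i) * V - cnj (a i) * c i - a i * cnj (c i) + c i * cnj (c i) / V)"
      by (simp only: of_real_mult of_real_sum complex_norm_square sum_distrib_left mult.assoc)
    moreover have "complex_of_real ((\<Sum>i\<in>I. (cmod (c i))\<^sup>2) / V) = (\<Sum>i\<in>I. c i * cnj (c i) / V)"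
      by (simp only: of_real_divide of_real_sum complex_norm_square sum_divide_distrib)
    ultimately show ?thesis
      by (simp only: of_real_add of_real_diff) (simp add: sum.distrib sum_subtractf)
  qed
  ultimately have "has_bochner_integral M (\<lambda>x. complex_of_real ((cmod (f x - (\<Sum>i\<in>I. a i * e i x)))\<^sup>2))
     (complex_of_real (F - (\<Sum>i\<in>I. (cmod (c i))\<^sup>2) / V + V * (\<Sum>i\<in>I. (cmod (a i - c i / V))\<^sup>2)))" by simp
  from has_bochner_integral_bounded_linear[OF bounded_linear_Re this]
  have "has_bochner_integral M (\<lambda>x. (cmod (f x - (\<Sum>i\<in>I. a i * e i x)))\<^sup>2)
     (F - (\<Sum>i\<in>I. (cmod (c i))\<^sup>2) / V + V * (\<Sum>i\<in>I. (cmod (a i - c i / V))\<^sup>2))" by (simp only: Re_complex_of_real)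
  then show "(LINT x|M. (cmod (f x - (\<Sum>i\<in>I. a i * e i x)))\<^sup>2) =
     (LINT x|M. (cmod (f x))\<^sup>2) - (\<Sum>i\<in>I. (cmod (c i))\<^sup>2) / V + V * (\<Sum>i\<in>I. (cmod (a i - c i / V))\<^sup>2)"
    and "integrable M (\<lambda>x. (cmod (f x - (\<Sum>i\<in>I. a i * e i x)))\<^sup>2)"
    by (auto simp: F_def has_bochner_integral_iff)
qed

lemma (in finite_measure) bessel_inequality:
  fixes f :: "'a \<Rightarrow> complex" and e :: "'i \<Rightarrow> 'a \<Rightarrow> complex"
  assumes f: "f \<in> borel_measurable M" "integrable M (\<lambda>x. (cmod (f x))\<^sup>2)"
    and I: "finite I" and e: "\<And>i. e i \<in> borel_measurable M" "\<And>i x. cmod (e i x) \<le> 1"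
    and orth: "\<And>i j. i \<in> I \<Longrightarrow> j \<in> I \<Longrightarrow> (LINT x|M. e i x * cnj (e j x)) = (if i = j then complex_of_real V else 0)"
    and V: "V > 0"
  shows "(\<Sum>i\<in>I. (cmod (LINT x|M. f x * cnj (e i x)))\<^sup>2) \<le> V * (LINT x|M. (cmod (f x))\<^sup>2)"
proof -
  have "0 \<le> (LINT x|M. (cmod (f x - (\<Sum>i\<in>I. ((LINT x|M. f x * cnj (e i x)) / V) * e i x)))\<^sup>2)"
    by simp
  also have "\<dots> = (LINT x|M. (cmod (f x))\<^sup>2) - (\<Sum>i\<in>I. (cmod (LINT x|M. f x * cnj (e i x)))\<^sup>2) / V"
    by (subst orthogonal_expansion(1)[OF f I e orth V]) auto
  finally show ?thesis using V by (simp add: field_simps)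
qed

section \<open>Fourier series on an interval of length \<open>2 * pi\<close>\<close>

text \<open>The frequency is a real number: integer frequencies are used on circles, real ones on the line.\<close>

definition char_exp :: "real \<Rightarrow> real \<Rightarrow> complex" where
  "char_exp \<sigma> p = exp (\<i> * of_real \<sigma> * of_real p)"

lemma norm_char_exp [simp]: "cmod (char_exp \<sigma> p) = 1"
  by (simp add: char_exp_def)

lemma cnj_char_exp [simp]: "cnj (char_exp \<sigma> p) = char_exp (-\<sigma>) p"
  by (simp add: char_exp_def exp_cnj)

lemma char_exp_mult: "char_exp \<sigma> p * char_exp \<tau> p = char_exp (\<sigma> + \<tau>) p"
  by (simp add: char_exp_def exp_add[symmetric] algebra_simps)

lemma char_exp_cis: "char_exp \<sigma> t = cis (\<sigma> * t)"
  by (simp add: char_exp_def cis_conv_exp mult_ac)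

lemma char_exp_zero [simp]: "char_exp 0 t = 1"
  by (simp add: char_exp_def)

lemma char_exp_periodic: "char_exp (of_int m) (t + 2 * pi) = char_exp (of_int m) t"
proof -
  have "cis (of_int m * (2 * pi)) = 1"
    using cis_power_int[of "2 * pi" m] by (simp add: cis_2pi)
  then show ?thesis by (simp add: char_exp_cis distrib_left cis_mult[symmetric])
qed

lemma char_exp_has_vector_derivative:
  "((\<lambda>q. char_exp \<sigma> q) has_vector_derivative (\<i> * of_real \<sigma> * char_exp \<sigma> q)) (at q within S)"
  unfolding char_exp_def
  by (rule has_vector_derivative_real_field) (auto intro!: derivative_eq_intros)

lemma continuous_on_char_exp [continuous_intros]:
  "continuous_on S f \<Longrightarrow> continuous_on S g \<Longrightarrow> continuous_on S (\<lambda>x. char_exp (f x) (g x))"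
  unfolding char_exp_def by (intro continuous_intros)

lemma measurable_char_exp [measurable]: "char_exp \<sigma> \<in> borel_measurable borel"
  by (intro borel_measurable_continuous_onI continuous_intros)

lemma set_integrable_continuous_interval:
  fixes f :: "real \<Rightarrow> complex"
  assumes "continuous_on {a..b} f"
  shows "set_integrable lborel {a..b} f"
  using borel_integrable_compact[OF compact_Icc assms] by (simp add: set_integrable_def)

lemma char_exp_integral:
  "(LINT t:{a..a + 2 * pi}|lborel. char_exp (of_int m) t) = (if m = 0 then 2 * complex_of_real pi else 0)"
proof -
  have "(LINT t:{a..a + 2 * pi}|lborel. char_exp (of_int m) t) = integral {a..a + 2 * pi} (char_exp (of_int m))"
    by (intro set_borel_integral_eq_integral set_integrable_continuous_interval continuous_intros)
  also have "\<dots> = (if m = 0 then 2 * complex_of_real pi else 0)"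
  proof (cases "m = 0")
    case False
    define F where "F t = char_exp (of_int m) t / (\<i> * of_int m)" for t
    have "(F has_vector_derivative char_exp (of_int m) t) (at t within {a..a + 2 * pi})" for t
      using bounded_linear.has_vector_derivative[OF bounded_linear_divide char_exp_has_vector_derivative[of "of_int m" t],
          of "\<i> * of_int m" "{a..a + 2 * pi}"] False
      unfolding F_def[abs_def] by simp
    then have "((char_exp (of_int m)) has_integral (F (a + 2 * pi) - F a)) {a..a + 2 * pi}"
      by (intro fundamental_theorem_of_calculus) auto
    moreover have "F (a + 2 * pi) = F a" by (simp only: F_def char_exp_periodic)
    ultimately show ?thesis using False by (simp add: integral_unique)
  next
    case True
    then have "char_exp (of_int m) = (\<lambda>_. 1)" by auto
    then show ?thesis using True by (simp add: scaleR_conv_of_real)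
  qed
  finally show ?thesis .
qed

text \<open>Trigonometric polynomials, as the closure that is convenient for showing that they form an algebra.\<close>

inductive trig :: "(real \<Rightarrow> complex) \<Rightarrow> bool" where
  trig_exp: "trig (\<lambda>t. c * char_exp (of_int m) t)"
| trig_add: "trig f \<Longrightarrow> trig g \<Longrightarrow> trig (\<lambda>t. f t + g t)"

lemma trig_mult:
  assumes "trig f" "trig g" shows "trig (\<lambda>t. f t * g t)"
  using assms(1)
proof induction
  case (trig_exp c m)
  from assms(2) show ?case
  proof induction
    case (trig_exp d n)
    have eq: "(\<lambda>t. c * char_exp (of_int m) t * (d * char_exp (of_int n) t)) = (\<lambda>t. (c * d) * char_exp (of_int (m + n)) t)"
      by (simp add: char_exp_mult[symmetric] algebra_simps)
    show ?case unfolding eq by (rule trig.trig_exp)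
  next
    case (trig_add f g)
    then show ?case using trig.trig_add by (simp add: algebra_simps)
  qed
next
  case (trig_add f h)
  then show ?case using trig.trig_add by (simp add: algebra_simps)
qed

lemma trig_finite_sum:
  assumes "trig f"
  obtains I c where "finite I" "\<And>t. f t = (\<Sum>m\<in>I. c m * char_exp (of_int m) t)"
proof -
  have "\<exists>I c. finite I \<and> (\<forall>m. m \<notin> I \<longrightarrow> c m = 0) \<and> (\<forall>t. f t = (\<Sum>m\<in>I. c m * char_exp (of_int m) t))"
    using assms
  proof induction
    case (trig_exp c m)
    show ?case by (intro exI[of _ "{m}"] exI[of _ "\<lambda>n. if n = m then c else 0"]) auto
  next
    case (trig_add f g)
    then obtain I c J d where *: "finite I" "\<And>m. m \<notin> I \<Longrightarrow> c m = 0" "\<And>t. f t = (\<Sum>m\<in>I. c m * char_exp (of_int m) t)"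
      "finite J" "\<And>m. m \<notin> J \<Longrightarrow> d m = 0" "\<And>t. g t = (\<Sum>m\<in>J. d m * char_exp (of_int m) t)" by blast
    have "f t = (\<Sum>m\<in>I \<union> J. c m * char_exp (of_int m) t)" for t
      unfolding * by (rule sum.mono_neutral_left) (use * in auto)
    moreover have "g t = (\<Sum>m\<in>I \<union> J. d m * char_exp (of_int m) t)" for t
      unfolding * by (rule sum.mono_neutral_left) (use * in auto)
    ultimately show ?case
      by (intro exI[of _ "I \<union> J"] exI[of _ "\<lambda>m. c m + d m"]) (use * in \<open>auto simp: sum.distrib algebra_simps\<close>)
  qed
  then show ?thesis using that by blast
qed

lemma trig_real_polynomial:
  fixes q :: "complex \<Rightarrow> real"
  assumes "real_polynomial_function q" shows "trig (\<lambda>t. of_real (q (cis t)))"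
  using assms
proof induction
  case (linear h)
  have "of_real (h (cis t)) = ((of_real (h 1) - \<i> * of_real (h \<i>)) / 2) * char_exp (of_int 1) t
          + ((of_real (h 1) + \<i> * of_real (h \<i>)) / 2) * char_exp (of_int (-1)) t" for t
  proof -
    have "cis t = cos t *\<^sub>R 1 + sin t *\<^sub>R \<i>" by (simp add: complex_eq_iff)
    then have "h (cis t) = cos t * h 1 + sin t * h \<i>"
      using linear by (simp add: bounded_linear.linear linear_add linear_scale)
    moreover have "char_exp (of_int 1) t = of_real (cos t) + \<i> * of_real (sin t)"
      "char_exp (of_int (-1)) t = of_real (cos t) - \<i> * of_real (sin t)"
      by (auto simp: complex_eq_iff char_exp_cis)
    ultimately show ?thesis by (simp add: complex_eq_iff field_simps)
  qed
  then show ?case by (simp only:) (intro trig.intros)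
next
  case (const c)
  then show ?case using trig_exp[of "of_real c" 0] by simp
qed (auto intro: trig.intros trig_mult)

text \<open>A periodic function factors through the circle, continuously since the circle is a compact
  quotient of the interval. There the Stone-Weierstrass theorem applies, and a polynomial in the coordinates
  \<open>cos t\<close> and \<open>sin t\<close> is a trigonometric polynomial.\<close>

lemma trig_approximation:
  fixes f :: "real \<Rightarrow> complex"
  assumes f: "continuous_on {a..a + 2 * pi} f" "f (a + 2 * pi) = f a" and e: "e > 0"
  obtains h where "trig h" "\<And>t. t \<in> {a..a + 2 * pi} \<Longrightarrow> cmod (f t - h t) < e"
proof -
  define I where "I = {a..a + 2 * pi}"
  have inj: "f s = f t" if st: "s \<in> I" "t \<in> I" "cis s = cis t" for s t
  proof -
    obtain n :: int where n: "s = t + 2 * pi * n"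
      using st(3) sin_cos_eq_iff[of s t] by (auto simp: complex_eq_iff)
    have "\<bar>2 * pi * n\<bar> \<le> 2 * pi" using n st(1,2) by (auto simp: I_def)
    then have "\<bar>real_of_int n\<bar> \<le> 1" by (simp add: abs_mult)
    then consider "n = 0" | "n = 1" | "n = -1" by linarith
    then show ?thesis
    proof cases
      case 2
      then have "t = a" "s = a + 2 * pi" using n st(1,2) by (auto simp: I_def)
      then show ?thesis using f(2) by simp
    next
      case 3
      then have "s = a" "t = a + 2 * pi" using n st(1,2) by (auto simp: I_def)
      then show ?thesis using f(2) by simp
    qed (use n in simp)
  qed
  define g where "g z = f (SOME t. t \<in> I \<and> cis t = z)" for z
  have g: "g (cis t) = f t" if "t \<in> I" for t
    unfolding g_def by (rule inj[OF _ that]; rule someI2[of _ t]) (use that in auto)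
  have surj: "sphere 0 1 = cis ` I"
  proof safe
    fix z :: complex assume "z \<in> sphere 0 1"
    then have z: "cis (Arg z) = z" using cis_Arg[of z] by (cases "z = 0") (auto simp: sgn_div_norm)
    define s where "s = Arg z - 2 * pi * of_int \<lfloor>(Arg z - a) / (2 * pi)\<rfloor>"
    have "s \<in> I"
    proof -
      define x where "x = (Arg z - a) / (2 * pi)"
      have "Arg z = a + 2 * pi * x" by (simp add: x_def)
      then have "s = a + 2 * pi * (x - of_int \<lfloor>x\<rfloor>)"
        unfolding s_def x_def[symmetric] by (simp add: algebra_simps)
      moreover have "0 \<le> 2 * pi * (x - of_int \<lfloor>x\<rfloor>)" by (intro mult_nonneg_nonneg) auto
      moreover have "2 * pi * (x - of_int \<lfloor>x\<rfloor>) \<le> 2 * pi * 1" using pi_ge_zero by (intro mult_left_mono) linarith+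
      ultimately show ?thesis by (simp add: I_def)
    qed
    moreover have "cis s = z"
    proof -
      have "s = Arg z + 2 * pi * of_int (- \<lfloor>(Arg z - a) / (2 * pi)\<rfloor>)" by (simp add: s_def)
      then have "sin s = sin (Arg z) \<and> cos s = cos (Arg z)" using sin_cos_eq_iff by blast
      then have "cis s = cis (Arg z)" by (simp add: complex_eq_iff)
      then show ?thesis using z by simp
    qed
    ultimately show "z \<in> cis ` I" by blast
  qed auto
  have "continuous_on (sphere 0 1) g"
  proof (subst continuous_on_closed_vimage[OF closed_sphere], intro allI impI)
    fix B :: "complex set" assume B: "closed B"
    have "g -` B \<inter> sphere 0 1 = cis ` (f -` B \<inter> I)" using g by (auto simp: surj)
    moreover have "compact (f -` B \<inter> I)"
    proof -
      have "closed (f -` B \<inter> I)" using f(1) B continuous_on_closed_vimage[of I f] by (simp add: I_def)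
      moreover have "bounded (f -` B \<inter> I)" by (rule bounded_subset[of I]) (auto simp: I_def)
      ultimately show ?thesis by (simp add: compact_eq_bounded_closed)
    qed
    then have "compact (cis ` (f -` B \<inter> I))"
      by (intro compact_continuous_image continuous_intros)
    ultimately show "closed (g -` B \<inter> sphere 0 1)" using compact_imp_closed by auto
  qed
  then obtain p where p: "polynomial_function p" "\<And>z. z \<in> sphere 0 1 \<Longrightarrow> norm (g z - p z) < e"
    using Stone_Weierstrass_polynomial_function[OF compact_sphere _ e] by metis
  have re: "real_polynomial_function (\<lambda>z. Re (p z))" "real_polynomial_function (\<lambda>z. Im (p z))"
    using p(1) bounded_linear_Re bounded_linear_Im by (auto simp: polynomial_function_def o_def)
  have "trig (\<lambda>t. of_real (Re (p (cis t))) + of_real (Im (p (cis t))) * (\<i> * char_exp (of_int 0) t))"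
    by (intro trig_add trig_mult trig_real_polynomial re trig_exp)
  moreover have "of_real (Re (p (cis t))) + of_real (Im (p (cis t))) * (\<i> * char_exp (of_int 0) t) = p (cis t)" for t
    by (simp add: complex_eq_iff)
  ultimately have "trig (\<lambda>t. p (cis t))" by simp
  then show ?thesis
    by (rule that) (use p(2) g surj in \<open>force simp: I_def\<close>)
qed

lemma set_lebesgue_integral_restrict:
  fixes f :: "real \<Rightarrow> 'b::{banach, second_countable_topology}"
  shows "(LINT t|restrict_space lborel {a..b}. f t) = (LINT t:{a..b}|lborel. f t)"
  by (subst integral_restrict_space) (auto simp: set_lebesgue_integral_def)

lemma finite_measure_interval: "finite_measure (restrict_space lborel {a..b::real})"
  by (rule finite_measureI) (auto simp: emeasure_restrict_space emeasure_lborel_Icc_eq)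

lemma trig_orthogonal:
  "(LINT t|restrict_space lborel {a..a + 2 * pi}. char_exp (of_int m) t * cnj (char_exp (of_int n) t)) =
    (if m = n then complex_of_real (2 * pi) else 0)"
  using char_exp_integral[of a "m - n"] unfolding set_lebesgue_integral_restrict cnj_char_exp char_exp_mult by simp

text \<open>The half of Parseval's identity that needs density of the trigonometric polynomials.\<close>

lemma parseval_approx:
  fixes f :: "real \<Rightarrow> complex"
  assumes f: "continuous_on {a..a + 2 * pi} f" "f (a + 2 * pi) = f a" and e: "e > 0"
  obtains I where "finite I"
    "(LINT t:{a..a + 2 * pi}|lborel. (cmod (f t))\<^sup>2) \<le>
       (\<Sum>m\<in>I. (cmod (LINT t:{a..a + 2 * pi}|lborel. f t * char_exp (- of_int m) t))\<^sup>2) / (2 * pi) + e"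
proof -
  define d where "d = sqrt (e / (2 * pi))"
  have d: "d > 0" "d\<^sup>2 * (2 * pi) = e" using e by (auto simp: d_def)
  obtain h where h: "trig h" "\<And>t. t \<in> {a..a + 2 * pi} \<Longrightarrow> cmod (f t - h t) < d"
    by (rule trig_approximation[OF f d(1)]) blast
  obtain I c where I: "finite I" "\<And>t. h t = (\<Sum>m\<in>I. c m * char_exp (of_int m) t)"
    using trig_finite_sum[OF h(1)] by metis
  let ?M = "restrict_space lborel {a..a + 2 * pi}"
  interpret finite_measure ?M by (rule finite_measure_interval)
  have fm: "f \<in> borel_measurable ?M"
    using borel_measurable_continuous_on_restrict[OF f(1)]
    by (simp add: measurable_cong_sets[OF sets_restrict_space_cong[OF sets_lborel] refl])
  have "continuous_on {a..a + 2 * pi} (\<lambda>t. (cmod (f t))\<^sup>2)" using f(1) by (intro continuous_intros)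
  from borel_integrable_compact[OF compact_Icc this]
  have f2: "integrable ?M (\<lambda>t. (cmod (f t))\<^sup>2)"
    by (subst integrable_restrict_space) auto
  have em: "char_exp (of_int m) \<in> borel_measurable ?M" for m
    using measurable_char_exp by (intro measurable_restrict_space1) auto
  note exp = orthogonal_expansion[OF fm f2 I(1), where e="\<lambda>m. char_exp (of_int m)" and V="2 * pi" and a=c]
  let ?c = "\<lambda>m. LINT t|?M. f t * cnj (char_exp (of_int m) t)"
  have "(LINT t|?M. (cmod (f t))\<^sup>2) - (\<Sum>m\<in>I. (cmod (?c m))\<^sup>2) / (2 * pi) \<le> (LINT t|?M. (cmod (f t - (\<Sum>m\<in>I. c m * char_exp (of_int m) t)))\<^sup>2)"
    by (subst exp(1)) (use em trig_orthogonal[of a] in \<open>auto simp del: of_real_mult intro!: sum_nonneg mult_nonneg_nonneg\<close>)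
  also have "\<dots> \<le> (LINT t|?M. d\<^sup>2)"
  proof (rule integral_mono)
    show "integrable ?M (\<lambda>t. (cmod (f t - (\<Sum>m\<in>I. c m * char_exp (of_int m) t)))\<^sup>2)"
      by (rule exp(2)) (use em trig_orthogonal[of a] in \<open>auto simp del: of_real_mult\<close>)
    show "(cmod (f t - (\<Sum>m\<in>I. c m * char_exp (of_int m) t)))\<^sup>2 \<le> d\<^sup>2" if "t \<in> space ?M" for t
      using h(2)[of t] that by (intro power_mono) (auto simp: I(2)[symmetric] space_restrict_space less_imp_le)
  qed simp
  also have "\<dots> = d\<^sup>2 * (2 * pi)"
    by (simp add: measure_restrict_space)
  finally show ?thesis
    using d(2) I(1) that[of I] unfolding set_lebesgue_integral_restrict cnj_char_exp by (simp add: algebra_simps)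
qed

text \<open>Sums over the integers are written as series along the enumeration \<^const>\<open>int_decode\<close>, so that the theory of
  series applies. By absolute convergence the order does not matter.\<close>

lemma int_decode_sums:
  fixes f :: "int \<Rightarrow> 'b::{banach}"
  assumes "summable (\<lambda>j. norm (f (int_decode j)))"
  shows "(\<lambda>j. f (int_decode j)) sums infsum f UNIV" "(f has_sum infsum f UNIV) UNIV"
proof -
  have "(\<lambda>j. f (int_decode j)) summable_on UNIV"
    using norm_summable_imp_summable_on[OF assms] .
  then have *: "((\<lambda>j. f (int_decode j)) has_sum infsum (\<lambda>j. f (int_decode j)) UNIV) UNIV" by simp
  have eq: "infsum (\<lambda>j. f (int_decode j)) UNIV = infsum f UNIV"
    using infsum_reindex_bij_betw[OF bij_int_decode, of f] by simp
  show "(\<lambda>j. f (int_decode j)) sums infsum f UNIV" using has_sum_imp_sums[OF *] eq by simp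
  show "(f has_sum infsum f UNIV) UNIV"
    using * has_sum_reindex_bij_betw[OF bij_int_decode, of f "infsum f UNIV"] eq by simp
qed

text \<open>The sum of the series is continuous and has the same Fourier coefficients as \<open>f\<close>; by Parseval a
  continuous function with vanishing coefficients is zero.\<close>

lemma fourier_inversion:
  fixes f :: "real \<Rightarrow> complex"
  assumes f: "continuous_on {a..a + 2 * pi} f" "f (a + 2 * pi) = f a"
  defines "c \<equiv> \<lambda>m. (LINT t:{a..a + 2 * pi}|lborel. f t * char_exp (- of_int m) t) / (2 * pi)"
  assumes sm: "summable (\<lambda>j. cmod (c (int_decode j)))"
    and t: "t \<in> {a..a + 2 * pi}"
  shows "(\<lambda>j. c (int_decode j) * char_exp (of_int (int_decode j)) t) sums f t"
proof -
  define S where "S t = (\<Sum>j. c (int_decode j) * char_exp (of_int (int_decode j)) t)" for t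
  have sums: "(\<lambda>j. c (int_decode j) * char_exp (of_int (int_decode j)) t) sums S t" for t
    unfolding S_def by (rule summable_sums, rule summable_norm_cancel) (use sm in \<open>simp add: norm_mult\<close>)
  have "continuous_on UNIV S"
  proof -
    have "uniform_limit UNIV (\<lambda>n t. \<Sum>j<n. c (int_decode j) * char_exp (of_int (int_decode j)) t) S sequentially"
      unfolding S_def by (rule Weierstrass_m_test[OF _ sm]) (simp add: norm_mult)
    then show ?thesis by (rule uniform_limit_theorem[rotated]) (auto intro!: continuous_intros always_eventually)
  qed
  then have cS: "continuous_on {a..b} S" for b using continuous_on_subset by blast
  define h where "h t = f t - S t" for t
  have ch: "continuous_on {a..a + 2 * pi} h" unfolding h_def by (intro continuous_intros f cS)
  have hp: "h (a + 2 * pi) = h a" unfolding h_def S_def f(2) char_exp_periodic ..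
  have int: "set_integrable lborel {a..a + 2 * pi} g" if "continuous_on {a..a + 2 * pi} g" for g :: "real \<Rightarrow> complex"
    using that by (rule set_integrable_continuous_interval)
  have zero: "(LINT t:{a..a + 2 * pi}|lborel. h t * char_exp (- of_int m) t) = 0" for m
  proof -
    let ?F = "\<lambda>j t. indicator {a..a + 2 * pi} t *\<^sub>R (c (int_decode j) * char_exp (of_int (int_decode j - m)) t)"
    have Fint: "integrable lborel (?F j)" for j
      using int[of "\<lambda>t. c (int_decode j) * char_exp (of_int (int_decode j - m)) t"]
      by (simp add: set_integrable_def continuous_intros)
    have "(LINT t|lborel. norm (?F j t)) = (2 * pi) * cmod (c (int_decode j))" for j
      by (simp add: norm_mult)
    then have "summable (\<lambda>j. LINT t|lborel. norm (?F j t))" using sm by (simp add: summable_mult)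
    moreover have "AE t in lborel. summable (\<lambda>j. norm (?F j t))"
      using sm by (auto simp: norm_mult summable_mult)
    ultimately have "(\<lambda>j. LINT t|lborel. ?F j t) sums (LINT t|lborel. (\<Sum>j. ?F j t))"
      using Fint by (intro sums_integral)
    moreover have "(\<Sum>j. ?F j t) = indicator {a..a + 2 * pi} t *\<^sub>R (S t * char_exp (- of_int m) t)" for t
    proof -
      have "(\<lambda>j. c (int_decode j) * char_exp (of_int (int_decode j)) t * char_exp (- of_int m) t) sums (S t * char_exp (- of_int m) t)"
        by (intro sums_mult2 sums)
      then have "(\<lambda>j. c (int_decode j) * char_exp (of_int (int_decode j - m)) t) sums (S t * char_exp (- of_int m) t)"
        by (simp add: mult.assoc char_exp_mult)
      from sums_scaleR_right[OF this, of "indicator {a..a + 2 * pi} t"] show ?thesis by (simp only: sums_iff)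
    qed
    moreover have "(LINT t|lborel. ?F j t) = (if int_decode j = m then 2 * pi * c m else 0)" for j
    proof -
      have "(LINT t|lborel. ?F j t) = c (int_decode j) * (LINT t:{a..a + 2 * pi}|lborel. char_exp (of_int (int_decode j - m)) t)"
        unfolding set_lebesgue_integral_def mult_scaleR_right[symmetric] by (rule integral_mult_right_zero)
      then show ?thesis unfolding char_exp_integral by auto
    qed
    ultimately have "(\<lambda>j. if int_decode j = m then 2 * pi * c m else 0) sums
       (LINT t:{a..a + 2 * pi}|lborel. S t * char_exp (- of_int m) t)"
      by (simp add: set_lebesgue_integral_def)
    moreover have "(\<lambda>j. if int_decode j = m then 2 * pi * c m else 0) = (\<lambda>j. if j = int_encode m then 2 * pi * c m else 0)"
      by (intro ext if_cong) auto
    ultimately have "(LINT t:{a..a + 2 * pi}|lborel. S t * char_exp (- of_int m) t) = 2 * pi * c m"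
      using sums_single[of "int_encode m" "\<lambda>j. 2 * pi * c m"] sums_unique2 by auto
    moreover have "(LINT t:{a..a + 2 * pi}|lborel. f t * char_exp (- of_int m) t) = 2 * pi * c m"
      by (simp add: c_def)
    moreover have "(LINT t:{a..a + 2 * pi}|lborel. h t * char_exp (- of_int m) t) =
        (LINT t:{a..a + 2 * pi}|lborel. f t * char_exp (- of_int m) t) - (LINT t:{a..a + 2 * pi}|lborel. S t * char_exp (- of_int m) t)"
      unfolding h_def left_diff_distrib
      by (intro set_integral_diff int continuous_intros f cS)
    ultimately show ?thesis by simp
  qed
  have "(LINT t:{a..a + 2 * pi}|lborel. (cmod (h t))\<^sup>2) \<le> 0"
  proof (rule field_le_epsilon)
    fix e :: real assume "e > 0"
    show "(LINT t:{a..a + 2 * pi}|lborel. (cmod (h t))\<^sup>2) \<le> 0 + e"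
      by (rule parseval_approx[OF ch hp \<open>e > 0\<close>]) (simp add: zero)
  qed
  moreover have ch2: "continuous_on {a..a + 2 * pi} (\<lambda>t. (cmod (h t))\<^sup>2)" by (intro continuous_intros ch)
  then have "(LINT t:{a..a + 2 * pi}|lborel. (cmod (h t))\<^sup>2) = integral {a..a + 2 * pi} (\<lambda>t. (cmod (h t))\<^sup>2)"
    using borel_integrable_compact[OF compact_Icc ch2]
    by (intro set_borel_integral_eq_integral) (simp add: set_integrable_def)
  moreover have "0 \<le> integral {a..a + 2 * pi} (\<lambda>t. (cmod (h t))\<^sup>2)"
    by (intro integral_nonneg integrable_continuous_real ch2) auto
  ultimately have "integral {a..a + 2 * pi} (\<lambda>t. (cmod (h t))\<^sup>2) = 0" by linarith
  then have "h t = 0" using integral_eq_0_iff[OF ch2] t by auto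
  then show ?thesis using sums[of t] by (simp add: h_def)
qed

subsection \<open>Decay of the coefficients of a smooth family\<close>

lemma smooth_family_real_derivE:
  fixes f :: "real \<Rightarrow> 't::topological_space \<Rightarrow> complex"
  assumes "smooth_family f"
  obtains f' where "\<And>x t. ((\<lambda>x. f x t) has_vector_derivative f' x t) (at x)" "smooth_family f'"
    "\<And>t. iter_deriv [1] (\<lambda>x. f x t) = (\<lambda>x. f' x t)"
proof -
  obtain f' where f': "\<And>x t. ((\<lambda>x. f x t) has_derivative (\<lambda>v. f' v x t)) (at x)"
    "\<And>b. b \<in> Basis \<Longrightarrow> smooth_family (f' b)" using smooth_family_derivE[OF assms] by blast
  have eq: "(\<lambda>v. f' v x t) = (\<lambda>v. v *\<^sub>R f' 1 x t)" for x t
  proof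
    show "f' v x t = v *\<^sub>R f' 1 x t" for v
      using linear_scale[OF has_derivative_linear[OF f'(1)], of v 1 x t] by simp
  qed
  have "((\<lambda>x. f x t) has_vector_derivative f' 1 x t) (at x)" for x t
    unfolding has_vector_derivative_def by (rule has_derivative_eq_rhs[OF f'(1) eq])
  then show ?thesis using that[of "f' 1"] f'(2)[of 1] frechet_derivative_at[OF f'(1), symmetric] by simp
qed

text \<open>Integrate by parts \<open>M\<close> times; the boundary terms cancel by periodicity of all derivatives.\<close>

lemma smooth_family_fourier_decay:
  fixes f :: "real \<Rightarrow> 't::topological_space \<Rightarrow> complex"
  assumes "smooth_family f" and "compact T"
    and "\<And>n t. t \<in> T \<Longrightarrow> iter_deriv (replicate n 1) (\<lambda>x. f x t) pi = iter_deriv (replicate n 1) (\<lambda>x. f x t) (-pi)"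
  shows "\<exists>B\<ge>0. \<forall>t\<in>T. \<forall>k::int. \<bar>of_int k\<bar> ^ M * cmod (LINT q:{-pi..pi}|lborel. f q t * char_exp (- of_int k) q) \<le> B"
  using assms(1,3)
proof (induction M arbitrary: f)
  case 0
  have "compact ((\<lambda>z. f (fst z) (snd z)) ` ({-pi..pi} \<times> T))"
    by (intro compact_continuous_image compact_Times continuous_on_subset[OF smooth_family_continuous[OF 0(1)]] assms) auto
  then obtain B where "\<forall>y\<in>(\<lambda>z. f (fst z) (snd z)) ` ({-pi..pi} \<times> T). cmod y \<le> B"
    unfolding compact_eq_bounded_closed bounded_iff by blast
  then have B: "cmod (f q t) \<le> B" if "q \<in> {-pi..pi}" "t \<in> T" for q t using that by force
  show ?case
  proof (intro exI[of _ "\<bar>B\<bar> * (2 * pi)"] conjI ballI allI)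
    fix t and k :: int assume t: "t \<in> T"
    have c: "continuous_on {-pi..pi} (\<lambda>q. f q t * char_exp (- of_int k) q)"
      by (intro continuous_intros continuous_on_compose_pair[OF smooth_family_continuous[OF 0(1)]])
    have "(LINT q:{-pi..pi}|lborel. f q t * char_exp (- of_int k) q) = integral {-pi..pi} (\<lambda>q. f q t * char_exp (- of_int k) q)"
      by (intro set_borel_integral_eq_integral set_integrable_continuous_interval c)
    also have "cmod \<dots> \<le> \<bar>B\<bar> * (pi - (-pi))"
      using B[OF _ t] by (intro integral_bound c) (auto simp: norm_mult intro: order_trans[OF _ abs_ge_self])
    finally show "\<bar>of_int k\<bar> ^ 0 * cmod (LINT q:{-pi..pi}|lborel. f q t * char_exp (- of_int k) q) \<le> \<bar>B\<bar> * (2 * pi)" by simp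
  qed auto
next
  case (Suc M)
  obtain f' where f': "\<And>x t. ((\<lambda>x. f x t) has_vector_derivative f' x t) (at x)" "smooth_family f'"
    "\<And>t. iter_deriv [1] (\<lambda>x. f x t) = (\<lambda>x. f' x t)" using smooth_family_real_derivE[OF Suc.prems(1)] by metis
  have "iter_deriv (replicate n 1) (\<lambda>x. f' x t) = iter_deriv (replicate (Suc n) 1) (\<lambda>x. f x t)" for n t
    by (simp only: f'(3)[symmetric] replicate_append_same[symmetric] iter_deriv_append replicate_Suc)
  then have "iter_deriv (replicate n 1) (\<lambda>x. f' x t) pi = iter_deriv (replicate n 1) (\<lambda>x. f' x t) (-pi)" if "t \<in> T" for n t
    using Suc.prems(2)[OF that, of "Suc n"] by metis
  from Suc.IH[OF f'(2) this] obtain B where B: "B \<ge> 0"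
    "\<And>t k. t \<in> T \<Longrightarrow> \<bar>of_int k\<bar> ^ M * cmod (LINT q:{-pi..pi}|lborel. f' q t * char_exp (- of_int k) q) \<le> B" by blast
  have "\<bar>of_int k\<bar> ^ Suc M * cmod (LINT q:{-pi..pi}|lborel. f q t * char_exp (- of_int k) q) \<le> B" if t: "t \<in> T" for t and k :: int
  proof -
    have c: "continuous_on {-pi..pi} (\<lambda>q. f q t * char_exp (- of_int k) q)" "continuous_on {-pi..pi} (\<lambda>q. f' q t * char_exp (- of_int k) q)"
      by (intro continuous_intros continuous_on_compose_pair[OF smooth_family_continuous[OF Suc.prems(1)]]
          continuous_on_compose_pair[OF smooth_family_continuous[OF f'(2)]])+
    have eq: "(LINT q:{-pi..pi}|lborel. f q t * char_exp (- of_int k) q) = integral {-pi..pi} (\<lambda>q. f q t * char_exp (- of_int k) q)"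
      "(LINT q:{-pi..pi}|lborel. f' q t * char_exp (- of_int k) q) = integral {-pi..pi} (\<lambda>q. f' q t * char_exp (- of_int k) q)"
      by (intro set_borel_integral_eq_integral set_integrable_continuous_interval c)+
    have "((\<lambda>q. f q t * char_exp (- of_int k) q) has_vector_derivative
        (f' q t * char_exp (- of_int k) q - \<i> * of_int k * (f q t * char_exp (- of_int k) q))) (at q within {-pi..pi})" for q
    proof -
      have "((\<lambda>q. char_exp (- of_int k) q) has_vector_derivative (- \<i> * of_int k * char_exp (- of_int k) q)) (at q within {-pi..pi})"
        using char_exp_has_vector_derivative[of "- of_int k" q] by simp
      from has_vector_derivative_mult[OF has_vector_derivative_at_within[OF f'(1)] this]
      show ?thesis by (simp add: algebra_simps)
    qed
    then have "((\<lambda>q. f' q t * char_exp (- of_int k) q - \<i> * of_int k * (f q t * char_exp (- of_int k) q)) has_integral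
       (f pi t * char_exp (- of_int k) pi - f (-pi) t * char_exp (- of_int k) (-pi))) {-pi..pi}"
      by (intro fundamental_theorem_of_calculus) auto
    moreover have "f pi t = f (-pi) t" using Suc.prems(2)[OF t, of 0] by simp
    moreover have "char_exp (- of_int k) pi = char_exp (- of_int k) (-pi)"
      using char_exp_periodic[of "-k" "-pi"] by simp
    ultimately have "integral {-pi..pi} (\<lambda>q. f' q t * char_exp (- of_int k) q - \<i> * of_int k * (f q t * char_exp (- of_int k) q)) = 0"
      by (simp add: integral_unique)
    moreover have "integral {-pi..pi} (\<lambda>q. f' q t * char_exp (- of_int k) q - \<i> * of_int k * (f q t * char_exp (- of_int k) q))
       = integral {-pi..pi} (\<lambda>q. f' q t * char_exp (- of_int k) q) - \<i> * of_int k * integral {-pi..pi} (\<lambda>q. f q t * char_exp (- of_int k) q)"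
      by (subst integral_diff) (auto intro!: integrable_continuous_real c continuous_intros)
    ultimately have "integral {-pi..pi} (\<lambda>q. f' q t * char_exp (- of_int k) q) = \<i> * of_int k * integral {-pi..pi} (\<lambda>q. f q t * char_exp (- of_int k) q)"
      by simp
    then have "cmod (LINT q:{-pi..pi}|lborel. f' q t * char_exp (- of_int k) q) = \<bar>of_int k\<bar> * cmod (LINT q:{-pi..pi}|lborel. f q t * char_exp (- of_int k) q)"
      unfolding eq by (simp add: norm_mult)
    then show ?thesis using B(2)[OF t, of k] by (simp add: algebra_simps)
  qed
  then show ?case using B(1) by blast
qed

section \<open>Plane waves and their superpositions\<close>

lemma vec2_eq: "(vector [a, b] :: real^2) = a *\<^sub>R axis 1 1 + b *\<^sub>R axis 2 1" for a b :: real
  by (auto simp: vec_eq_iff forall_2 axis_def vector_2)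

lemma continuous_on_circ [continuous_intros]:
  "continuous_on S f \<Longrightarrow> continuous_on S (\<lambda>x. circ (f x))"
  unfolding circ_def vec2_eq by (intro continuous_intros continuous_on_compose2[of UNIV cos] continuous_on_compose2[of UNIV sin]) auto

lemma continuous_on_perp [continuous_intros]:
  "continuous_on S f \<Longrightarrow> continuous_on S (\<lambda>x. perp (f x))"
  unfolding perp_def vec2_eq by (intro continuous_intros)

lemma inner_perp:
  "perp x \<bullet> perp y = x \<bullet> y" "x \<bullet> perp x = 0" "perp x \<bullet> x = 0" "perp (perp x) = - x"
  "norm (perp x) = norm x" "perp (c *\<^sub>R x) = c *\<^sub>R perp x"
proof -
  show 1: "perp x \<bullet> perp y = x \<bullet> y" for x y by (simp add: perp_def inner_vec_def sum_2)
  show "x \<bullet> perp x = 0" "perp x \<bullet> x = 0" by (simp_all add: perp_def inner_vec_def sum_2)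
  show "perp (perp x) = - x" by (simp add: perp_def vec_eq_iff forall_2)
  show "norm (perp x) = norm x" using 1[of x x] by (simp add: norm_eq_sqrt_inner)
  show "perp (c *\<^sub>R x) = c *\<^sub>R perp x" by (simp add: perp_def vec_eq_iff forall_2)
qed

lemma norm_circ [simp]: "norm (circ t) = 1"
  by (simp add: circ_def norm_eq_sqrt_inner inner_vec_def sum_2 power2_eq_square[symmetric])

lemma circ_add_2pi: "circ (t + 2 * pi) = circ t"
  by (simp add: circ_def)

lemma circ_in_interval: obtains s where "s \<in> {0..2 * pi}" "circ s = circ t"
proof -
  define s where "s = t - 2 * pi * of_int \<lfloor>t / (2 * pi)\<rfloor>"
  have t: "t = 2 * pi * (t / (2 * pi))" by simp
  then have s: "s = 2 * pi * (t / (2 * pi) - of_int \<lfloor>t / (2 * pi)\<rfloor>)"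
    unfolding s_def right_diff_distrib by simp
  have "0 \<le> t / (2 * pi) - of_int \<lfloor>t / (2 * pi)\<rfloor>" "t / (2 * pi) - of_int \<lfloor>t / (2 * pi)\<rfloor> \<le> 1" by linarith+
  then have "0 \<le> s" "s \<le> 2 * pi * 1" unfolding s by (simp, intro mult_left_mono) auto
  moreover have "s = t + 2 * pi * of_int (- \<lfloor>t / (2 * pi)\<rfloor>)" by (simp add: s_def)
  then have "sin s = sin t \<and> cos s = cos t" using sin_cos_eq_iff by blast
  ultimately show ?thesis using that[of s] by (simp add: circ_def)
qed

lemma smooth_family_char_exp:
  fixes e :: "'t::topological_space \<Rightarrow> 'a::euclidean_space"
  assumes "continuous_on UNIV e"
  shows "smooth_family (\<lambda>x t. char_exp 1 (x \<bullet> e t))"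
proof -
  have "smooth_family (\<lambda>p (t::'t). 1 * char_exp 1 p)"
  proof (rule smooth_family_coinduct[where X="\<lambda>f. \<exists>c. f = (\<lambda>p (t::'t). c * char_exp 1 p)"], goal_cases)
    case (2 f)
    then show ?case by (auto intro!: continuous_intros)
  next
    case (3 f)
    then obtain c where f: "f = (\<lambda>p (t::'t). c * char_exp 1 p)" by auto
    have "((\<lambda>p. c * char_exp 1 p) has_derivative (\<lambda>v. (of_real v * c * \<i>) * char_exp 1 p)) (at p)" for p
    proof (rule has_derivative_eq_rhs)
      show "((\<lambda>p. c * char_exp 1 p) has_derivative (\<lambda>v. c * (v *\<^sub>R (\<i> * of_real 1 * char_exp 1 p)))) (at p)"
        using char_exp_has_vector_derivative[of 1 p UNIV] unfolding has_vector_derivative_def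
        by (rule has_derivative_mult_right)
    qed (auto simp: scaleR_conv_of_real)
    then show ?case unfolding f by (intro exI[of _ "\<lambda>v p t. (of_real v * c * \<i>) * char_exp 1 p"]) blast
  qed blast
  then have "smooth_family (\<lambda>p (t::'t). char_exp 1 p)" by simp
  from smooth_family_compose[OF this smooth_family_inner[OF assms]] show ?thesis .
qed

lemma char_exp_1: "char_exp 1 (\<sigma> * p) = char_exp \<sigma> p"
  by (simp add: char_exp_cis)

lemma smooth_char_exp: "smooth (\<lambda>x. char_exp \<sigma> (x \<bullet> v))"
proof -
  have "smooth_family (\<lambda>x (t::real). char_exp 1 (x \<bullet> (\<sigma> *\<^sub>R v)))"
    by (intro smooth_family_char_exp continuous_intros)
  then show ?thesis by (simp add: smooth_iff_smooth_family char_exp_1)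
qed

lemma has_derivative_char_exp_inner:
  "((\<lambda>x. c * char_exp \<sigma> (x \<bullet> v)) has_derivative (\<lambda>h. of_real (h \<bullet> v) * (c * (\<i> * of_real \<sigma>) * char_exp \<sigma> (x \<bullet> v)))) (at x)"
proof -
  have "((\<lambda>x. char_exp \<sigma> (x \<bullet> v)) has_derivative (\<lambda>h. (h \<bullet> v) *\<^sub>R (\<i> * of_real \<sigma> * char_exp \<sigma> (x \<bullet> v)))) (at x)"
    by (rule has_derivative_compose[where f="\<lambda>x. x \<bullet> v" and g="char_exp \<sigma>"])
       (use char_exp_has_vector_derivative[of \<sigma> "x \<bullet> v" UNIV] in \<open>auto simp: has_vector_derivative_def intro!: derivative_eq_intros\<close>)
  from has_derivative_mult_right[OF this, of c] show ?thesis
    by (rule has_derivative_eq_rhs) (auto simp: scaleR_conv_of_real)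
qed

text \<open>Coefficients that decay faster than any power of the frequency, uniformly in the parameter. The bounds are
  given in summable form, since the enumeration of the frequencies is arbitrary.\<close>

definition rapid :: "(nat \<Rightarrow> real) \<Rightarrow> (nat \<Rightarrow> 't \<Rightarrow> complex) \<Rightarrow> bool" where
  "rapid \<nu> a \<longleftrightarrow> (\<forall>M. \<exists>B. summable B \<and> (\<forall>n t. cmod (a n t) * (1 + \<bar>\<nu> n\<bar>) ^ M \<le> B n))"

definition superpose :: "(nat \<Rightarrow> real) \<Rightarrow> ('t \<Rightarrow> 'a::euclidean_space) \<Rightarrow> (nat \<Rightarrow> 't \<Rightarrow> complex) \<Rightarrow> 'a \<Rightarrow> 't \<Rightarrow> complex" where
  "superpose \<nu> e a x t = (\<Sum>n. a n t * char_exp (\<nu> n) (x \<bullet> e t))"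

lemma rapidE:
  assumes "rapid \<nu> a"
  obtains B where "summable B" "\<And>n t. cmod (a n t) * (1 + \<bar>\<nu> n\<bar>) ^ M \<le> B n" "\<And>n. B n \<ge> 0"
proof -
  obtain B where B: "summable B" "\<And>n t. cmod (a n t) * (1 + \<bar>\<nu> n\<bar>) ^ M \<le> B n"
    using assms unfolding rapid_def by blast
  moreover have "B n \<ge> 0" for n using B(2)[of n undefined] by (meson mult_nonneg_nonneg norm_ge_zero order_trans zero_le_power add_nonneg_nonneg zero_le_one abs_ge_zero)
  ultimately show ?thesis using that by blast
qed

lemma rapid_mult:
  assumes "rapid \<nu> a" "\<And>n t. cmod (c n t) \<le> C * (1 + \<bar>\<nu> n\<bar>) ^ m"
  shows "rapid \<nu> (\<lambda>n t. a n t * c n t)"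
  unfolding rapid_def
proof
  fix M
  obtain B where B: "summable B" "\<And>n t. cmod (a n t) * (1 + \<bar>\<nu> n\<bar>) ^ (M + m) \<le> B n" by (rule rapidE[OF assms(1)]) blast
  have "cmod (a n t * c n t) * (1 + \<bar>\<nu> n\<bar>) ^ M \<le> \<bar>C\<bar> * B n" for n t
  proof -
    have "cmod (a n t * c n t) * (1 + \<bar>\<nu> n\<bar>) ^ M \<le> cmod (a n t) * (\<bar>C\<bar> * (1 + \<bar>\<nu> n\<bar>) ^ m) * (1 + \<bar>\<nu> n\<bar>) ^ M"
      unfolding norm_mult
      by (intro mult_right_mono mult_left_mono order_trans[OF assms(2)]) auto
    also have "\<dots> = \<bar>C\<bar> * (cmod (a n t) * (1 + \<bar>\<nu> n\<bar>) ^ (M + m))" by (simp add: power_add)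
    also have "\<dots> \<le> \<bar>C\<bar> * B n" by (intro mult_left_mono B) auto
    finally show ?thesis .
  qed
  then show "\<exists>B. summable B \<and> (\<forall>n t. cmod (a n t * c n t) * (1 + \<bar>\<nu> n\<bar>) ^ M \<le> B n)"
    using summable_mult[OF B(1)] by blast
qed

lemma superpose_sums:
  assumes "rapid \<nu> a" shows "(\<lambda>n. a n t * char_exp (\<nu> n) (x \<bullet> e t)) sums superpose \<nu> e a x t"
proof -
  obtain B where B: "summable B" "\<And>n t. cmod (a n t) * (1 + \<bar>\<nu> n\<bar>) ^ 0 \<le> B n" by (rule rapidE[OF assms]) blast
  have "summable (\<lambda>n. a n t * char_exp (\<nu> n) (x \<bullet> e t))"
    by (rule summable_comparison_test'[OF B(1), of 0]) (use B(2) in \<open>auto simp: norm_mult\<close>)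
  then show ?thesis unfolding superpose_def by (rule summable_sums)
qed

lemma superpose_continuous:
  assumes "rapid \<nu> a" "\<And>n. continuous_on UNIV (a n)" "continuous_on UNIV e"
  shows "continuous_on UNIV (\<lambda>z. superpose \<nu> e a (fst z) (snd z))"
proof -
  obtain B where B: "summable B" "\<And>n t. cmod (a n t) * (1 + \<bar>\<nu> n\<bar>) ^ 0 \<le> B n" by (rule rapidE[OF assms(1)]) blast
  have "uniform_limit UNIV (\<lambda>N z. \<Sum>n<N. a n (snd z) * char_exp (\<nu> n) (fst z \<bullet> e (snd z)))
     (\<lambda>z. superpose \<nu> e a (fst z) (snd z)) sequentially"
    unfolding superpose_def
    by (rule Weierstrass_m_test[OF _ B(1)]) (use B(2) in \<open>auto simp: norm_mult\<close>)
  moreover have "continuous_on UNIV (\<lambda>z. \<Sum>n<N. a n (snd z) * char_exp (\<nu> n) (fst z \<bullet> e (snd z)))" for N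
    by (intro continuous_intros continuous_fst_snd assms)
  ultimately show ?thesis by (intro uniform_limit_theorem[rotated]) (auto intro: always_eventually)
qed

text \<open>Term by term differentiation: the coefficients of the differentiated series are again rapidly
  decreasing, so it converges uniformly.\<close>

lemma superpose_has_derivative:
  assumes a: "rapid \<nu> a" and e: "\<And>t. norm (e t) \<le> 1"
  shows "((\<lambda>x. superpose \<nu> e a x t) has_derivative
      (\<lambda>v. of_real (v \<bullet> e t) * superpose \<nu> e (\<lambda>n t. a n t * (\<i> * of_real (\<nu> n))) x t)) (at x)"
proof -
  define a' where "a' n t = a n t * (\<i> * of_real (\<nu> n))" for n t
  have a': "rapid \<nu> a'" unfolding a'_def
    by (rule rapid_mult[OF a, where C=1 and m=1]) (auto simp: norm_mult)
  obtain B where B: "summable B" "\<And>n t. cmod (a' n t) * (1 + \<bar>\<nu> n\<bar>) ^ 0 \<le> B n" by (rule rapidE[OF a']) blast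
  have ul: "uniform_limit UNIV (\<lambda>N x. \<Sum>n<N. a' n t * char_exp (\<nu> n) (x \<bullet> e t))
     (\<lambda>x. superpose \<nu> e a' x t) sequentially"
    unfolding superpose_def
    by (rule Weierstrass_m_test[OF _ B(1)]) (use B(2) in \<open>auto simp: norm_mult\<close>)
  have "\<exists>g. \<forall>x\<in>UNIV. (\<lambda>n. a n t * char_exp (\<nu> n) (x \<bullet> e t)) sums g x \<and>
     (g has_derivative (\<lambda>v. of_real (v \<bullet> e t) * superpose \<nu> e a' x t)) (at x within UNIV)"
  proof (rule has_derivative_series[where f'="\<lambda>n x v. of_real (v \<bullet> e t) * (a' n t * char_exp (\<nu> n) (x \<bullet> e t))"])
    show "((\<lambda>x. a n t * char_exp (\<nu> n) (x \<bullet> e t)) has_derivative (\<lambda>v. of_real (v \<bullet> e t) * (a' n t * char_exp (\<nu> n) (x \<bullet> e t)))) (at x within UNIV)" for n x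
      unfolding a'_def using has_derivative_char_exp_inner[of "a n t" "\<nu> n" "e t" x] by simp
    fix \<epsilon> :: real assume \<epsilon>: "\<epsilon> > 0"
    from uniform_limitD[OF ul \<epsilon>]
    show "\<forall>\<^sub>F N in sequentially. \<forall>x\<in>UNIV. \<forall>h. norm ((\<Sum>n<N. of_real (h \<bullet> e t) * (a' n t * char_exp (\<nu> n) (x \<bullet> e t))) -
         of_real (h \<bullet> e t) * superpose \<nu> e a' x t) \<le> \<epsilon> * norm h"
    proof eventually_elim
      case (elim N)
      show ?case
      proof safe
        fix x h
        have "norm ((\<Sum>n<N. of_real (h \<bullet> e t) * (a' n t * char_exp (\<nu> n) (x \<bullet> e t))) - of_real (h \<bullet> e t) * superpose \<nu> e a' x t)
            = \<bar>h \<bullet> e t\<bar> * norm ((\<Sum>n<N. a' n t * char_exp (\<nu> n) (x \<bullet> e t)) - superpose \<nu> e a' x t)"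
          by (simp add: sum_distrib_left[symmetric] right_diff_distrib[symmetric] norm_mult)
        also have "\<dots> \<le> (norm h * 1) * \<epsilon>"
          using elim order_trans[OF Cauchy_Schwarz_ineq2[of h "e t"] mult_left_mono[OF e norm_ge_zero]]
          by (intro mult_mono) (auto simp: dist_norm less_imp_le)
        finally show "norm ((\<Sum>n<N. of_real (h \<bullet> e t) * (a' n t * char_exp (\<nu> n) (x \<bullet> e t))) - of_real (h \<bullet> e t) * superpose \<nu> e a' x t) \<le> \<epsilon> * norm h"
          by (simp add: mult.commute)
      qed
    qed
  next
    show "(\<lambda>n. a n t * char_exp (\<nu> n) (0 \<bullet> e t)) sums superpose \<nu> e a 0 t" by (rule superpose_sums[OF a])
  qed auto
  then obtain g where g: "\<And>x. (\<lambda>n. a n t * char_exp (\<nu> n) (x \<bullet> e t)) sums g x"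
    "\<And>x. (g has_derivative (\<lambda>v. of_real (v \<bullet> e t) * superpose \<nu> e a' x t)) (at x)" by auto
  have "g = (\<lambda>x. superpose \<nu> e a x t)" using g(1) superpose_sums[OF a] sums_unique2 by blast
  then show ?thesis using g(2) by (simp add: a'_def[abs_def])
qed

lemma superpose_cmult:
  assumes "rapid \<nu> a"
  shows "superpose \<nu> e (\<lambda>n t. a n t * c t) x t = c t * superpose \<nu> e a x t"
  using sums_mult[OF superpose_sums[OF assms, where x=x and t=t and e=e], of "c t"]
  by (simp add: superpose_def sums_iff mult_ac)

lemma superpose_partial:
  assumes a: "rapid \<nu> a" and e: "\<And>t. norm (e t) \<le> 1"
  shows "((\<lambda>x. superpose \<nu> e a x t) has_derivative
      (\<lambda>v. superpose \<nu> e (\<lambda>n t. a n t * (\<i> * of_real (\<nu> n)) * of_real (v \<bullet> e t)) x t)) (at x)"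
    and "v \<in> Basis \<Longrightarrow> rapid \<nu> (\<lambda>n t. a n t * (\<i> * of_real (\<nu> n)) * of_real (v \<bullet> e t))"
    and "v \<in> Basis \<Longrightarrow> cmod (a n t * (\<i> * of_real (\<nu> n)) * of_real (v \<bullet> e t)) \<le> cmod (a n t) * (1 + \<bar>\<nu> n\<bar>)"
proof -
  have a': "rapid \<nu> (\<lambda>n t. a n t * (\<i> * of_real (\<nu> n)))"
    by (rule rapid_mult[OF a, where C=1 and m=1]) (auto simp: norm_mult)
  show "((\<lambda>x. superpose \<nu> e a x t) has_derivative
      (\<lambda>v. superpose \<nu> e (\<lambda>n t. a n t * (\<i> * of_real (\<nu> n)) * of_real (v \<bullet> e t)) x t)) (at x)"
    unfolding superpose_cmult[OF a'] by (rule superpose_has_derivative[OF a e])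
  have le: "\<bar>v \<bullet> e t\<bar> \<le> 1" if "v \<in> Basis" for t v
    using Cauchy_Schwarz_ineq2[of v "e t"] e[of t] that by simp
  show "rapid \<nu> (\<lambda>n t. a n t * (\<i> * of_real (\<nu> n)) * of_real (v \<bullet> e t))" if "v \<in> Basis"
    by (rule rapid_mult[OF a', where C=1 and m=0]) (use le[OF that] in \<open>auto\<close>)
  show "cmod (a n t * (\<i> * of_real (\<nu> n)) * of_real (v \<bullet> e t)) \<le> cmod (a n t) * (1 + \<bar>\<nu> n\<bar>)" if "v \<in> Basis"
    using mult_mono[of "\<bar>\<nu> n\<bar>" "1 + \<bar>\<nu> n\<bar>" "\<bar>v \<bullet> e t\<bar>" 1] le[OF that, of t]
    by (simp add: norm_mult mult.assoc mult_left_mono)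
qed

lemma superpose_smooth_family:
  assumes "rapid \<nu> a" "\<And>n. continuous_on UNIV (a n)" "continuous_on UNIV e" "\<And>t. norm (e t) \<le> 1"
  shows "smooth_family (superpose \<nu> e a)"
proof (rule smooth_family_coinduct[where X="\<lambda>f. \<exists>a. rapid \<nu> a \<and> (\<forall>n. continuous_on UNIV (a n)) \<and> f = superpose \<nu> e a"], goal_cases)
  case (2 f)
  then show ?case using superpose_continuous[OF _ _ assms(3)] by blast
next
  case (3 f)
  then obtain a where a: "rapid \<nu> a" "\<And>n. continuous_on UNIV (a n)" "f = superpose \<nu> e a" by blast
  have "continuous_on UNIV (\<lambda>t. a n t * (\<i> * of_real (\<nu> n)) * of_real (v \<bullet> e t))" for n v
    by (intro continuous_intros a assms)
  then have "\<exists>a'. rapid \<nu> a' \<and> (\<forall>n. continuous_on UNIV (a' n)) \<and>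
      superpose \<nu> e (\<lambda>n t. a n t * (\<i> * of_real (\<nu> n)) * of_real (b \<bullet> e t)) = superpose \<nu> e a'" if "b \<in> Basis" for b
    using superpose_partial(2)[where e=e, OF a(1) assms(4) that] by blast
  then show ?case
    using superpose_partial(1)[where e=e, OF a(1) assms(4)] unfolding a(3)
    by (intro exI[of _ "\<lambda>v. superpose \<nu> e (\<lambda>n t. a n t * (\<i> * of_real (\<nu> n)) * of_real (v \<bullet> e t))"] conjI allI ballI) blast+
qed (use assms in auto)

lemma superpose_iter_deriv:
  fixes e :: "'t \<Rightarrow> 'a::euclidean_space"
  assumes "rapid \<nu> a" "\<And>t. norm (e t) \<le> 1" "set vs \<subseteq> Basis"
  shows "\<exists>a'. rapid \<nu> a' \<and> (\<forall>n t. cmod (a' n t) \<le> cmod (a n t) * (1 + \<bar>\<nu> n\<bar>) ^ length vs) \<and>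
     (\<forall>t. iter_deriv vs (\<lambda>x. superpose \<nu> e a x t) = (\<lambda>x. superpose \<nu> e a' x t))"
  using assms(3)
proof (induction vs)
  case (Cons v vs)
  then obtain a' where a': "rapid \<nu> a'" "\<And>n t. cmod (a' n t) \<le> cmod (a n t) * (1 + \<bar>\<nu> n\<bar>) ^ length vs"
    "\<And>t. iter_deriv vs (\<lambda>x. superpose \<nu> e a x t) = (\<lambda>x. superpose \<nu> e a' x t)" by auto
  have v: "v \<in> Basis" using Cons by auto
  let ?a = "\<lambda>n t. a' n t * (\<i> * of_real (\<nu> n)) * of_real (v \<bullet> e t)"
  note p = superpose_partial[where e=e, OF a'(1) assms(2)]
  have "iter_deriv (v # vs) (\<lambda>x. superpose \<nu> e a x t) = (\<lambda>x. superpose \<nu> e ?a x t)" for t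
    using frechet_derivative_at[OF p(1), symmetric] by (simp add: a'(3))
  moreover have "cmod (?a n t) \<le> cmod (a n t) * (1 + \<bar>\<nu> n\<bar>) ^ length (v # vs)" for n t
  proof -
    have "cmod (?a n t) \<le> cmod (a' n t) * (1 + \<bar>\<nu> n\<bar>)" by (rule p(3)[OF v])
    also have "\<dots> \<le> cmod (a n t) * (1 + \<bar>\<nu> n\<bar>) ^ length vs * (1 + \<bar>\<nu> n\<bar>)" by (rule mult_right_mono[OF a'(2)]) auto
    finally show ?thesis by (simp add: mult_ac)
  qed
  ultimately show ?case using p(2)[OF v] by blast
qed (use assms in auto)

lemma superpose_deriv_bound:
  fixes e :: "'t \<Rightarrow> 'a::euclidean_space"
  assumes a: "rapid \<nu> a" and e: "\<And>t. norm (e t) \<le> 1"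
    and B: "summable B" "\<And>n. cmod (a n t) * (1 + \<bar>\<nu> n\<bar>) ^ N \<le> B n"
  shows "deriv_bound N K (suminf B) (\<lambda>x. superpose \<nu> e a x t)"
  unfolding deriv_bound_def
proof (intro allI impI ballI)
  fix vs :: "'a list" and x assume vs: "set vs \<subseteq> Basis" "length vs \<le> N"
  obtain a' where a': "rapid \<nu> a'" "\<And>n t. cmod (a' n t) \<le> cmod (a n t) * (1 + \<bar>\<nu> n\<bar>) ^ length vs"
    "\<And>t. iter_deriv vs (\<lambda>x. superpose \<nu> e a x t) = (\<lambda>x. superpose \<nu> e a' x t)"
    using superpose_iter_deriv[where e=e, OF a e vs(1)] by blast
  have "cmod (a' n t) \<le> B n" for n
  proof -
    have "cmod (a' n t) \<le> cmod (a n t) * (1 + \<bar>\<nu> n\<bar>) ^ length vs" by (rule a')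
    also have "\<dots> \<le> cmod (a n t) * (1 + \<bar>\<nu> n\<bar>) ^ N" using vs by (intro mult_left_mono power_increasing) auto
    finally show ?thesis using B(2)[of n] by linarith
  qed
  then have "norm (superpose \<nu> e a' x t) \<le> suminf B"
    unfolding superpose_def by (intro norm_suminf_le B(1)) (simp add: norm_mult)
  then show "norm (iter_deriv vs (\<lambda>x. superpose \<nu> e a x t) x) \<le> suminf B" by (simp add: a'(3))
qed

lemma smooth_family_deriv_bound_uniform:
  fixes f :: "'a::euclidean_space \<Rightarrow> 't::topological_space \<Rightarrow> complex"
  assumes "smooth_family f" "compact K" "compact T"
  shows "\<exists>B\<ge>0. \<forall>t\<in>T. deriv_bound N K B (\<lambda>x. f x t)"
proof -
  let ?V = "{vs :: 'a list. set vs \<subseteq> Basis \<and> length vs \<le> N}"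
  have fin: "finite ?V" using finite_lists_length_le[of "Basis :: 'a set" N] by simp
  have "\<forall>vs\<in>?V. \<exists>B. \<forall>x\<in>K. \<forall>t\<in>T. norm (iter_deriv vs (\<lambda>x. f x t) x) \<le> B"
  proof
    fix vs assume "vs \<in> ?V"
    then have sm: "smooth_family (\<lambda>x t. iter_deriv vs (\<lambda>x. f x t) x)"
      using smooth_family_iter_deriv[OF assms(1)] by auto
    define h where "h z = iter_deriv vs (\<lambda>x. f x (snd z)) (fst z)" for z
    have "continuous_on UNIV h" using smooth_family_continuous[OF sm] by (simp add: h_def[abs_def])
    then have "compact (h ` (K \<times> T))"
      by (intro compact_continuous_image compact_Times assms) (auto intro: continuous_on_subset)
    then obtain B where "\<forall>y\<in>h ` (K \<times> T). norm y \<le> B"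
      unfolding compact_eq_bounded_closed bounded_iff by blast
    then show "\<exists>B. \<forall>x\<in>K. \<forall>t\<in>T. norm (iter_deriv vs (\<lambda>x. f x t) x) \<le> B"
      by (intro exI[of _ B]) (auto simp: h_def)
  qed
  from bchoice[OF this] obtain B where B: "\<forall>vs\<in>?V. \<forall>x\<in>K. \<forall>t\<in>T. norm (iter_deriv vs (\<lambda>x. f x t) x) \<le> B vs" ..
  have "B vs \<le> (\<Sum>vs\<in>?V. \<bar>B vs\<bar>)" if "vs \<in> ?V" for vs
    using member_le_sum[of vs ?V "\<lambda>vs. \<bar>B vs\<bar>"] that fin by auto
  note le = this
  have "norm (iter_deriv vs (\<lambda>x. f x t) x) \<le> (\<Sum>vs\<in>?V. \<bar>B vs\<bar>)"
    if "set vs \<subseteq> Basis" "length vs \<le> N" "x \<in> K" "t \<in> T" for vs x t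
  proof (rule order_trans)
    show "norm (iter_deriv vs (\<lambda>x. f x t) x) \<le> B vs" using B that by simp
  qed (use that le in simp)
  then show ?thesis
    unfolding deriv_bound_def by (intro exI[of _ "\<Sum>vs\<in>?V. \<bar>B vs\<bar>"]) (simp add: sum_nonneg)
qed

text \<open>A distribution may be applied term by term. The tail of the series is itself a superposition of plane
  waves, so its derivatives are bounded by the tail of a convergent series.\<close>

lemma distribution_superpose:
  fixes u :: "('a::euclidean_space \<Rightarrow> complex) \<Rightarrow> complex" and a :: "nat \<Rightarrow> 't::topological_space \<Rightarrow> complex"
  assumes u: "compact_distribution u" and a: "rapid \<nu> a" "\<And>n. continuous_on UNIV (a n)"
    and e: "continuous_on UNIV e" "\<And>t. norm (e t) \<le> 1" and f: "smooth f"
  shows "(\<lambda>n. a n t * u (\<lambda>x. char_exp (\<nu> n) (x \<bullet> e t) * f x)) sums u (\<lambda>x. superpose \<nu> e a x t * f x)"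
proof -
  obtain K N C where K: "compact K" "C \<ge> 0"
    "\<And>\<phi> B. smooth \<phi> \<Longrightarrow> 0 \<le> B \<Longrightarrow> deriv_bound N K B \<phi> \<Longrightarrow> norm (u \<phi>) \<le> C * B" by (rule distribution_boundE[OF u]) blast
  obtain W where W: "W \<ge> 0" "deriv_bound N K W f"
    using smooth_family_deriv_bound_uniform[OF smooth_smooth_family[OF f, where 't=real] K(1), of "{0}" N] by auto
  obtain B where B: "summable B" "\<And>n t. cmod (a n t) * (1 + \<bar>\<nu> n\<bar>) ^ N \<le> B n" "\<And>n. B n \<ge> 0" by (rule rapidE[OF a(1)]) blast
  \<comment> \<open>The tail from index \<open>m\<close> on and its majorant.\<close>
  define am where "am m n t = (if n < m then 0 else a n t)" for m n t
  define Bm where "Bm m n = (if n < m then 0 else B n)" for m n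
  have am: "rapid \<nu> (am m)" for m
    using rapid_mult[OF a(1), of "\<lambda>n t. if n < m then 0 else 1" 1 0] by (simp add: am_def[abs_def] if_distrib cong: if_cong)
  have amc: "continuous_on UNIV (am m n)" for m n using a(2) by (cases "n < m") (simp_all add: am_def[abs_def])
  have smT: "smooth (\<lambda>x. superpose \<nu> e (am m) x t)" for m
    using smooth_family_smooth[OF superpose_smooth_family[OF am amc e]] .
  have smS: "smooth (\<lambda>x. superpose \<nu> e a x t)"
    using smooth_family_smooth[OF superpose_smooth_family[OF a e]] .
  have smt: "smooth (\<lambda>x. a n t * (char_exp (\<nu> n) (x \<bullet> e t) * f x))" for n
    by (intro smooth_intros smooth_char_exp f)
  have Bm: "Bm m sums (suminf B - (\<Sum>n<m. B n))" for m
  proof -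
    have "(\<lambda>n. B n - (if n \<in> {..<m} then B n else 0)) sums (suminf B - (\<Sum>n\<in>{..<m}. B n))"
      by (intro sums_diff summable_sums B sums_If_finite_set) auto
    then show ?thesis by (rule sums_cong[THEN iffD1, rotated]) (auto simp: Bm_def)
  qed
  have key: "superpose \<nu> e a x t * f x - (\<Sum>n<m. a n t * (char_exp (\<nu> n) (x \<bullet> e t) * f x)) = superpose \<nu> e (am m) x t * f x" for m x
  proof -
    have "(\<lambda>n. a n t * char_exp (\<nu> n) (x \<bullet> e t) - (if n \<in> {..<m} then a n t * char_exp (\<nu> n) (x \<bullet> e t) else 0)) sums
       (superpose \<nu> e a x t - (\<Sum>n\<in>{..<m}. a n t * char_exp (\<nu> n) (x \<bullet> e t)))"
      by (intro sums_diff superpose_sums a sums_If_finite_set) auto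
    moreover have "(\<lambda>n. a n t * char_exp (\<nu> n) (x \<bullet> e t) - (if n \<in> {..<m} then a n t * char_exp (\<nu> n) (x \<bullet> e t) else 0))
        = (\<lambda>n. am m n t * char_exp (\<nu> n) (x \<bullet> e t))" by (auto simp: am_def)
    ultimately have S: "(\<lambda>n. am m n t * char_exp (\<nu> n) (x \<bullet> e t)) sums (superpose \<nu> e a x t - (\<Sum>n<m. a n t * char_exp (\<nu> n) (x \<bullet> e t)))"
      by simp
    from sums_unique2[OF superpose_sums[where a="am m" and e=e and x=x and t=t, OF am] S]
    show ?thesis by (simp add: left_diff_distrib sum_distrib_right mult.assoc)
  qed
  have est: "norm (u (\<lambda>x. superpose \<nu> e a x t * f x) - (\<Sum>n<m. a n t * u (\<lambda>x. char_exp (\<nu> n) (x \<bullet> e t) * f x)))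
     \<le> C * (2 ^ N * (suminf B - (\<Sum>n<m. B n)) * W)" for m
  proof -
    have "deriv_bound N K (suminf B - (\<Sum>n<m. B n)) (\<lambda>x. superpose \<nu> e (am m) x t)"
      using superpose_deriv_bound[OF am e(2) sums_summable[OF Bm], of m t N m K] B(2,3) sums_unique[OF Bm, of m]
      by (auto simp: am_def Bm_def)
    from deriv_bound_mult[OF smT f this W(2)]
    have "norm (u (\<lambda>x. superpose \<nu> e (am m) x t * f x)) \<le> C * (2 ^ N * (suminf B - (\<Sum>n<m. B n)) * W)"
      using W(1) sum_le_suminf[OF B(1), of "{..<m}"] B(3) by (intro K(3) smooth_intros smT f) auto
    moreover have "u (\<lambda>x. superpose \<nu> e (am m) x t * f x) = u (\<lambda>x. superpose \<nu> e a x t * f x) - (\<Sum>n<m. a n t * u (\<lambda>x. char_exp (\<nu> n) (x \<bullet> e t) * f x))"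
    proof -
      have "u (\<lambda>x. superpose \<nu> e (am m) x t * f x) = u (\<lambda>x. superpose \<nu> e a x t * f x) - u (\<lambda>x. \<Sum>n<m. a n t * (char_exp (\<nu> n) (x \<bullet> e t) * f x))"
        unfolding key[symmetric]
        by (intro distribution_diff[OF u] smooth_intros smS f conjunct1[OF distribution_sum[OF u]] smt) auto
      also have "u (\<lambda>x. \<Sum>n<m. a n t * (char_exp (\<nu> n) (x \<bullet> e t) * f x)) = (\<Sum>n<m. u (\<lambda>x. a n t * (char_exp (\<nu> n) (x \<bullet> e t) * f x)))"
        using smt by (intro conjunct2[OF distribution_sum[OF u]]) auto
      also have "\<dots> = (\<Sum>n<m. a n t * u (\<lambda>x. char_exp (\<nu> n) (x \<bullet> e t) * f x))"
        by (intro sum.cong refl distribution_cmult[OF u] smooth_intros smooth_char_exp f)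
      finally show ?thesis .
    qed
    ultimately show ?thesis by simp
  qed
  have "(\<lambda>m. C * (2 ^ N * (suminf B - (\<Sum>n<m. B n)) * W)) \<longlonglongrightarrow> C * (2 ^ N * (suminf B - suminf B) * W)"
    by (intro tendsto_intros summable_LIMSEQ B)
  then have "(\<lambda>m. C * (2 ^ N * (suminf B - (\<Sum>n<m. B n)) * W)) \<longlonglongrightarrow> 0" by simp
  from Lim_null_comparison[OF always_eventually[OF allI[OF est]] this]
  have "(\<lambda>m. u (\<lambda>x. superpose \<nu> e a x t * f x) - (\<Sum>n<m. a n t * u (\<lambda>x. char_exp (\<nu> n) (x \<bullet> e t) * f x))) \<longlonglongrightarrow> 0" .
  from tendsto_diff[OF tendsto_const[of "u (\<lambda>x. superpose \<nu> e a x t * f x)"] this]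
  show ?thesis by (simp add: sums_def)
qed

section \<open>The partial Fourier transform of the weighted X-ray transform\<close>

text \<open>Formally, the Fourier transform in \<open>p\<close> of the weighted transform, at the frequency \<open>\<sigma>\<close> and along the
  lines of direction \<open>circ t\<close>.\<close>

definition line_ft :: "(real^2 \<Rightarrow> real^2 \<Rightarrow> complex) \<Rightarrow> ((real^2 \<Rightarrow> complex) \<Rightarrow> complex) \<Rightarrow> real \<Rightarrow> real \<Rightarrow> complex" where
  "line_ft w g \<sigma> t = g (\<lambda>y. char_exp (- \<sigma>) (y \<bullet> perp (circ t)) * w y (circ t))"

lemma smooth_weight_family:
  assumes "smooth_weight w" shows "smooth_family (\<lambda>x t. w x (circ t))"
proof -
  have "smooth (\<lambda>(x, t). w x (circ t))" using assms by (simp add: smooth_weight_def)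
  from smooth_prod_smooth_family[OF this] show ?thesis by simp
qed

lemma smooth_weight_smooth:
  assumes "smooth_weight w" shows "smooth (\<lambda>x. w x (circ t))"
  using smooth_family_smooth[OF smooth_weight_family[OF assms]] .

lemma line_ft_circ: "circ s = circ t \<Longrightarrow> line_ft w g \<sigma> s = line_ft w g \<sigma> t"
  by (simp add: line_ft_def)

lemma line_ft_continuous:
  assumes w: "smooth_weight w" and g: "compact_distribution g"
  shows "continuous_on UNIV (\<lambda>z. line_ft w g (fst z) (snd z))"
proof -
  have "smooth_family (\<lambda>x (z::real \<times> real). char_exp 1 (x \<bullet> (- fst z *\<^sub>R perp (circ (snd z)))) * w x (circ (snd z)))"
    by (intro smooth_family_intros smooth_family_char_exp continuous_intros
        smooth_family_reparam[OF smooth_weight_family[OF w], where h=snd])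
  from distribution_family_continuous[OF g this] show ?thesis
    by (simp add: line_ft_def char_exp_cis)
qed

text \<open>A distribution has finite order \<open>N\<close>, and \<open>N\<close> derivatives of a plane wave of frequency \<open>\<sigma>\<close> cost
  \<open>|\<sigma>|\<^sup>N\<close>.\<close>

lemma line_ft_growth:
  assumes w: "smooth_weight w" and g: "compact_distribution g"
  shows "\<exists>C N. \<forall>\<sigma> t. cmod (line_ft w g \<sigma> t) \<le> C * (1 + \<bar>\<sigma>\<bar>) ^ N"
proof -
  obtain K N C where K: "compact K" "C \<ge> 0"
    "\<And>\<phi> B. smooth \<phi> \<Longrightarrow> 0 \<le> B \<Longrightarrow> deriv_bound N K B \<phi> \<Longrightarrow> norm (g \<phi>) \<le> C * B" by (rule distribution_boundE[OF g]) blast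
  obtain W where W: "W \<ge> 0" "\<And>t. t \<in> {0..2 * pi} \<Longrightarrow> deriv_bound N K W (\<lambda>x. w x (circ t))"
    using smooth_family_deriv_bound_uniform[OF smooth_weight_family[OF w] K(1) compact_Icc[of 0 "2 * pi"], of N] by blast
  have e: "deriv_bound N K ((1 + \<bar>\<sigma>\<bar>) ^ N) (\<lambda>x. char_exp (- \<sigma>) (x \<bullet> perp (circ t)))" for \<sigma> t
  proof -
    \<comment> \<open>a single plane wave is a superposition with one nonzero coefficient\<close>
    define a where "a n s = (if n = (0::nat) then 1 else 0 :: complex)" for n and s :: real
    have su: "(\<lambda>n. if n = (0::nat) then (1 + \<bar>\<sigma>\<bar>) ^ M else 0) sums (1 + \<bar>\<sigma>\<bar>) ^ M" for M
      using sums_single[of 0 "\<lambda>n. (1 + \<bar>\<sigma>\<bar>) ^ M"] by simp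
    have ra: "rapid (\<lambda>n. - \<sigma>) a" unfolding rapid_def
      using sums_summable[OF su] by (auto simp: a_def intro!: exI[of _ "\<lambda>n. if n = (0::nat) then (1 + \<bar>\<sigma>\<bar>) ^ M else 0" for M])
    have "deriv_bound N K (\<Sum>n. if n = (0::nat) then (1 + \<bar>\<sigma>\<bar>) ^ N else 0) (\<lambda>x. superpose (\<lambda>n. - \<sigma>) (\<lambda>s. perp (circ s)) a x t)"
      by (rule superpose_deriv_bound[OF ra _ sums_summable[OF su]]) (auto simp: inner_perp a_def)
    moreover have "superpose (\<lambda>n. - \<sigma>) (\<lambda>s. perp (circ s)) a x t = char_exp (- \<sigma>) (x \<bullet> perp (circ t))" for x
    proof -
      have "(\<lambda>n. a n t * char_exp (- \<sigma>) (x \<bullet> perp (circ t))) sums char_exp (- \<sigma>) (x \<bullet> perp (circ t))"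
        using sums_single[of 0 "\<lambda>n. char_exp (- \<sigma>) (x \<bullet> perp (circ t))"] by (simp add: a_def if_distrib if_distribR cong: if_cong)
      then show ?thesis unfolding superpose_def by (rule sums_unique[symmetric])
    qed
    ultimately show ?thesis by (simp add: sums_unique[OF su, symmetric])
  qed
  have "cmod (line_ft w g \<sigma> t) \<le> (C * 2 ^ N * W) * (1 + \<bar>\<sigma>\<bar>) ^ N" for \<sigma> t
  proof -
    obtain s where s: "s \<in> {0..2 * pi}" "circ s = circ t" using circ_in_interval by blast
    have "cmod (line_ft w g \<sigma> s) \<le> C * (2 ^ N * (1 + \<bar>\<sigma>\<bar>) ^ N * W)"
      unfolding line_ft_def
      by (intro K(3) deriv_bound_mult smooth_intros smooth_char_exp smooth_weight_smooth w e W s mult_nonneg_nonneg) auto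
    then show ?thesis using line_ft_circ[OF s(2)] by (simp add: mult_ac)
  qed
  then show ?thesis by blast
qed

subsection \<open>The sampling formula\<close>

lemma int_decode_growth: "real (j + 1) \<le> 2 * (1 + \<bar>real_of_int (int_decode j)\<bar>)"
proof -
  have "real (int_encode n + 1) \<le> 2 * (1 + \<bar>real_of_int n\<bar>)" for n
    by (auto simp: int_encode_def sum_encode_def)
  from this[of "int_decode j"] show ?thesis by simp
qed

text \<open>Two extra powers of the frequency pay for the summability along the enumeration.\<close>

lemma rapid_int_decode:
  assumes "\<And>M. \<exists>B. \<forall>n t. cmod (a n t) * (1 + \<bar>of_int n\<bar>) ^ M \<le> B"
  shows "rapid (\<lambda>j. of_int (int_decode j)) (\<lambda>j. a (int_decode j))"
  unfolding rapid_def
proof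
  fix M
  obtain B where B: "\<And>n t. cmod (a n t) * (1 + \<bar>of_int n\<bar>) ^ (M + 2) \<le> B" using assms by blast
  have "cmod (a (int_decode j) t) * (1 + \<bar>of_int (int_decode j)\<bar>) ^ M \<le> 4 * \<bar>B\<bar> * (1 / real (Suc j) ^ 2)" for j t
  proof -
    let ?n = "real_of_int (int_decode j)"
    have "real (Suc j) ^ 2 \<le> (2 * (1 + \<bar>?n\<bar>)) ^ 2"
      using int_decode_growth[of j] by (intro power_mono) auto
    then have q: "real (Suc j) ^ 2 \<le> 4 * (1 + \<bar>?n\<bar>) ^ 2" unfolding power_mult_distrib by simp
    have "cmod (a (int_decode j) t) * (1 + \<bar>?n\<bar>) ^ M * real (Suc j) ^ 2 \<le> cmod (a (int_decode j) t) * (1 + \<bar>?n\<bar>) ^ M * (4 * (1 + \<bar>?n\<bar>) ^ 2)"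
      by (intro mult_left_mono q) auto
    also have "\<dots> = 4 * (cmod (a (int_decode j) t) * (1 + \<bar>?n\<bar>) ^ (M + 2))" by (simp add: power_add power2_eq_square)
    also have "\<dots> \<le> 4 * \<bar>B\<bar>" using B[of "int_decode j" t] by linarith
    finally show ?thesis by (simp add: pos_le_divide_eq del: of_nat_Suc)
  qed
  moreover have "summable (\<lambda>j. 4 * \<bar>B\<bar> * (1 / real (Suc j) ^ 2))"
    using inverse_power_summable[of 2, where 'a=real] 
    by (intro summable_mult) (subst summable_Suc_iff, simp add: inverse_eq_divide)
  ultimately show "\<exists>B. summable B \<and> (\<forall>j t. cmod (a (int_decode j) t) * (1 + \<bar>of_int (int_decode j)\<bar>) ^ M \<le> B j)" by blast
qed

lemma one_plus_power_le:
  fixes x :: real assumes "x \<ge> 0" shows "(1 + x) ^ M \<le> 2 ^ M * (1 + x ^ M)"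
proof (cases "x \<le> 1")
  case True
  then have "(1 + x) ^ M \<le> 2 ^ M" using assms by (intro power_mono) auto
  then show ?thesis using assms by (simp add: algebra_simps add_increasing2)
next
  case False
  then have "(1 + x) ^ M \<le> (2 * x) ^ M" using assms by (intro power_mono) auto
  then show ?thesis by (simp add: power_mult_distrib algebra_simps add_increasing)
qed

lemma smooth_family_fourier_rapid:
  fixes f :: "real \<Rightarrow> 't::topological_space \<Rightarrow> complex"
  assumes "smooth_family f" and "compact T"
    and "\<And>n t. t \<in> T \<Longrightarrow> iter_deriv (replicate n 1) (\<lambda>x. f x t) pi = iter_deriv (replicate n 1) (\<lambda>x. f x t) (-pi)"
  shows "\<exists>B\<ge>0. \<forall>t\<in>T. \<forall>k::int. cmod (LINT q:{-pi..pi}|lborel. f q t * char_exp (- of_int k) q) * (1 + \<bar>of_int k\<bar>) ^ M \<le> B"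
proof -
  obtain B0 B1 where B: "B0 \<ge> 0" "B1 \<ge> 0"
    "\<And>t k. t \<in> T \<Longrightarrow> \<bar>of_int k\<bar> ^ 0 * cmod (LINT q:{-pi..pi}|lborel. f q t * char_exp (- of_int k) q) \<le> B0"
    "\<And>t k. t \<in> T \<Longrightarrow> \<bar>of_int k\<bar> ^ M * cmod (LINT q:{-pi..pi}|lborel. f q t * char_exp (- of_int k) q) \<le> B1"
    using smooth_family_fourier_decay[OF assms, of 0] smooth_family_fourier_decay[OF assms, of M] by blast
  have "cmod (LINT q:{-pi..pi}|lborel. f q t * char_exp (- of_int k) q) * (1 + \<bar>of_int k\<bar>) ^ M \<le> 2 ^ M * (B0 + B1)" if "t \<in> T" for t and k :: int
  proof -
    have "cmod (LINT q:{-pi..pi}|lborel. f q t * char_exp (- of_int k) q) * (1 + \<bar>of_int k\<bar>) ^ M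
       \<le> cmod (LINT q:{-pi..pi}|lborel. f q t * char_exp (- of_int k) q) * (2 ^ M * (1 + \<bar>of_int k\<bar> ^ M))"
      by (intro mult_left_mono one_plus_power_le) auto
    also have "\<dots> = 2 ^ M * (cmod (LINT q:{-pi..pi}|lborel. f q t * char_exp (- of_int k) q)
        + \<bar>of_int k\<bar> ^ M * cmod (LINT q:{-pi..pi}|lborel. f q t * char_exp (- of_int k) q))" by (simp add: algebra_simps)
    also have "\<dots> \<le> 2 ^ M * (B0 + B1)" using B(3,4)[OF that, of k] by (intro mult_left_mono add_mono) auto
    finally show ?thesis .
  qed
  then show ?thesis using B by (intro exI[of _ "2 ^ M * (B0 + B1)"]) auto
qed

text \<open>Oversampling. For \<open>c = a - b\<close> the function \<open>e\<^bsup>-icp\<^esup>\<close>, cut off smoothly between \<open>R\<close> and \<open>\<pi>\<close>, extends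
  periodically and so is a Fourier series \<open>\<Sum>\<^sub>n C\<^sub>n e\<^bsup>inp\<^esup>\<close> with rapidly decreasing coefficients. Near the support of \<open>g\<close>,
  where \<open>|y \<bullet> \<theta>\<^sup>\<bottom>| < \<pi>\<close>, this gives
  \<open>e\<^bsup>-iay\<bullet>\<theta>\<^sup>\<bottom>\<^esup> = \<Sum>\<^sub>n C\<^sub>n e\<^bsup>-i(b-n)y\<bullet>\<theta>\<^sup>\<bottom>\<^esup>\<close>, to which \<open>g\<close> is applied term by term. The coefficients depend on
  neither the weight nor the distribution, so the formula adds up over several of them.\<close>

lemma sampling_formula:
  assumes R: "0 \<le> R" "R < pi"
  obtains C :: "real \<Rightarrow> int \<Rightarrow> complex" where
    "\<And>M. \<exists>B\<ge>0. \<forall>c\<in>{-1..1}. \<forall>n. cmod (C c n) * (1 + \<bar>of_int n\<bar>) ^ M \<le> B"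
    "\<And>w g a b t. smooth_weight w \<Longrightarrow> compact_distribution g \<Longrightarrow> dist_support g \<subseteq> cball 0 R \<Longrightarrow> \<bar>a - b\<bar> \<le> 1 \<Longrightarrow>
       (\<lambda>j. C (a - b) (int_decode j) * line_ft w g (b - of_int (int_decode j)) t) sums line_ft w g a t"
proof -
  \<comment> \<open>The points that divide the interval from \<open>R\<close> to \<open>pi\<close> into thirds.\<close>
  define r where "r = (2 * R + pi) / 3"
  define r' where "r' = (R + 2 * pi) / 3"
  have r: "0 \<le> r" "R < r" "r < r'" "r' < pi" using R by (auto simp: r_def r'_def)
  define f where "f p c = bump (0::real) r r' p * char_exp 1 (p * (- c))" for p c
  have fs: "smooth_family f"
  proof -
    have "smooth_family (\<lambda>p c::real. char_exp 1 (p \<bullet> (- c)))" by (intro smooth_family_char_exp continuous_intros)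
    then show ?thesis unfolding f_def[abs_def] by (intro smooth_family_intros smooth_family_bump) simp
  qed
  have fz: "iter_deriv vs (\<lambda>p. f p c) p = 0" if "r' < \<bar>p\<bar>" for vs c p
  proof (rule iter_deriv_zero_open)
    show "open {p::real. r' < \<bar>p\<bar>}" by (intro open_Collect_less continuous_intros)
  qed (use bump_eq_0[OF r(1,3), of _ "0::real"] that in \<open>auto simp: f_def\<close>)
  define C where "C c n = (LINT q:{-pi..pi}|lborel. f q c * char_exp (- of_int n) q) / (2 * pi)" for c n
  have Cb: "\<exists>B\<ge>0. \<forall>c\<in>{-1..1}. \<forall>n. cmod (C c n) * (1 + \<bar>of_int n\<bar>) ^ M \<le> B" for M
  proof -
    obtain B where B: "B \<ge> 0" "\<And>c k. c \<in> {-1..1} \<Longrightarrow> cmod (LINT q:{-pi..pi}|lborel. f q c * char_exp (- of_int k) q) * (1 + \<bar>of_int k\<bar>) ^ M \<le> B"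
      using smooth_family_fourier_rapid[OF fs compact_Icc, of "-1" 1 M] fz r(4) by auto
    have "cmod (C c n) * (1 + \<bar>of_int n\<bar>) ^ M \<le> B / (2 * pi)" if "c \<in> {-1..1}" for c n
      using divide_right_mono[OF B(2)[OF that, of n], of "2 * pi"] by (simp add: C_def norm_divide norm_mult)
    then show ?thesis using B(1) by (intro exI[of _ "B / (2 * pi)"]) auto
  qed
  have rap: "rapid (\<lambda>j. of_int (int_decode j)) (\<lambda>j (t::real). C c (int_decode j))" if c: "c \<in> {-1..1}" for c
    using Cb c by (intro rapid_int_decode) blast
  have inv: "superpose (\<lambda>j. of_int (int_decode j)) e (\<lambda>j t. C c (int_decode j)) x t = f (x \<bullet> e t) c"
    if c: "c \<in> {-1..1}" and x: "\<bar>x \<bullet> e t\<bar> \<le> pi" for c x and e :: "real \<Rightarrow> real^2" and t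
  proof -
    have xin: "x \<bullet> e t \<in> {-pi..-pi + 2 * pi}" using x by auto
    obtain B where B: "summable B" "\<And>j (t::real). cmod (C c (int_decode j)) * (1 + \<bar>of_int (int_decode j)\<bar>) ^ 0 \<le> B j"
      by (rule rapidE[OF rap[OF c]]) blast
    have Csum: "summable (\<lambda>j. cmod (C c (int_decode j)))"
      by (rule summable_comparison_test'[OF B(1), of 0]) (use B(2) in auto)
    have cont: "continuous_on {-pi..pi} (\<lambda>q. f q c)"
      by (rule continuous_on_compose_pair[OF smooth_family_continuous[OF fs]]) (intro continuous_intros)+
    have "f pi c = f (-pi) c" using fz[of pi "[]"] fz[of "-pi" "[]"] r by simp
    then have "(\<lambda>j. C c (int_decode j) * char_exp (of_int (int_decode j)) (x \<bullet> e t)) sums f (x \<bullet> e t) c"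
      using fourier_inversion[of "-pi" "\<lambda>q. f q c" "x \<bullet> e t"] cont Csum xin by (simp add: C_def)
    then show ?thesis unfolding superpose_def by (rule sums_unique[symmetric])
  qed
  have "(\<lambda>j. C (a - b) (int_decode j) * line_ft w g (b - of_int (int_decode j)) t) sums line_ft w g a t"
    if w: "smooth_weight w" and g: "compact_distribution g" and supp: "dist_support g \<subseteq> cball 0 R" and ab: "\<bar>a - b\<bar> \<le> 1"
    for w g a b t
  proof -
    define c where "c = a - b"
    have c: "c \<in> {-1..1}" using ab by (auto simp: c_def)
    let ?e = "\<lambda>s. perp (circ s)"
    \<comment> \<open>The periodic extension of the cut off exponential, and the weighted plane wave of frequency \<open>b\<close>.\<close>
    define S where "S x = superpose (\<lambda>j. of_int (int_decode j)) ?e (\<lambda>j t. C c (int_decode j)) x t" for x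
    define F where "F x = char_exp (- b) (x \<bullet> ?e t) * w x (circ t)" for x
    have smF: "smooth F" unfolding F_def[abs_def] by (intro smooth_intros smooth_char_exp smooth_weight_smooth w)
    have ce: "continuous_on UNIV ?e" by (intro continuous_intros)
    have ne: "norm (?e s) \<le> 1" for s by (simp add: inner_perp)
    have smS: "smooth S" unfolding S_def[abs_def]
      by (intro smooth_family_smooth superpose_smooth_family rap c ce ne continuous_intros)
    let ?A = "\<lambda>x. char_exp (- a) (x \<bullet> ?e t) * w x (circ t)"
    have smA: "smooth ?A" by (intro smooth_intros smooth_char_exp smooth_weight_smooth w)
    have "(\<lambda>j. C c (int_decode j) * g (\<lambda>x. char_exp (of_int (int_decode j)) (x \<bullet> ?e t) * F x)) sums g (\<lambda>x. S x * F x)"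
      unfolding S_def by (rule distribution_superpose[OF g rap[OF c] _ ce ne smF]) (intro continuous_intros)
    moreover have "g (\<lambda>x. char_exp (of_int n) (x \<bullet> ?e t) * F x) = line_ft w g (b - of_int n) t" for n
      by (simp add: line_ft_def F_def mult.assoc[symmetric] char_exp_mult)
    moreover have "g (\<lambda>x. ?A x - S x * F x) = 0"
    proof (rule distribution_zero_off_support[OF g _ open_ball])
      show "dist_support g \<subseteq> ball 0 r" using supp r by auto
      fix x :: "real^2" assume x: "x \<in> ball 0 r"
      have "\<bar>x \<bullet> ?e t\<bar> \<le> norm x * 1" using Cauchy_Schwarz_ineq2[of x "?e t"] by (simp add: inner_perp)
      then have xr: "\<bar>x \<bullet> ?e t\<bar> \<le> r" using x by simp
      then have "S x = char_exp (- c) (x \<bullet> ?e t)"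
        unfolding S_def using inv[OF c, of x ?e t] r bump_eq_1[OF r(1,3), of "x \<bullet> ?e t" 0]
        by (simp add: f_def char_exp_cis mult.commute)
      then have "S x * F x = ?A x"
        by (simp add: F_def mult.assoc[symmetric] char_exp_mult c_def)
      then show "?A x - S x * F x = 0" by simp
    qed (intro smooth_intros smA smS smF)
    then have "line_ft w g a t = g (\<lambda>x. S x * F x)"
      using distribution_diff[OF g smA smooth_intros(2)[OF smS smF]] by (simp add: line_ft_def)
    ultimately show ?thesis by (simp add: c_def)
  qed
  with Cb show ?thesis using that[of C] by blast
qed

subsection \<open>Pairing the transform with smoothed test functions\<close>

lemma smooth_Z_family:
  assumes "smooth_Z \<psi>" shows "smooth_family (\<lambda>p t. \<psi> (line_pt p (circ t)))"
proof -
  have "smooth (\<lambda>(p, t). \<psi> (line_pt p (circ t)))" using assms by (simp add: smooth_Z_def)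
  from smooth_prod_smooth_family[OF this] show ?thesis by simp
qed

lemma iter_deriv_periodic:
  fixes f :: "real \<Rightarrow> complex"
  assumes "smooth f" "\<And>x. f (x + c) = f x" "set vs \<subseteq> Basis"
  shows "iter_deriv vs f (x + c) = iter_deriv vs f x"
  using assms(3)
proof (induction vs arbitrary: x)
  case (Cons v vs)
  define h where "h = iter_deriv vs f"
  have per: "h (x + c) = h x" for x using Cons by (simp add: h_def)
  have d: "(h has_derivative frechet_derivative h (at x)) (at x)" for x
    unfolding h_def using iter_deriv_has_derivative[OF assms(1)] Cons.prems by simp
  have "((\<lambda>x. h (x + c)) has_derivative (\<lambda>v. frechet_derivative h (at (x + c)) v)) (at x)"
    by (rule has_derivative_compose[where f="\<lambda>x. x + c" and g=h, OF _ d]) (auto intro!: derivative_eq_intros)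
  then have "(h has_derivative (\<lambda>v. frechet_derivative h (at (x + c)) v)) (at x)" by (simp add: per)
  from frechet_derivative_at[OF this] show ?case by (simp add: h_def)
qed (use assms in auto)

lemma fourier_coeff_Z_char:
  "fourier_coeff_Z \<psi> k \<theta> = (LINT q:{-pi..pi}|lborel. \<psi> (line_pt q \<theta>) * char_exp (- of_int k) q) / (2 * pi)"
  unfolding fourier_coeff_Z_def char_exp_def by (simp add: mult.commute field_simps)

lemma fourier_coeff_Z_continuous:
  assumes "smooth_Z \<psi>" shows "continuous_on UNIV (\<lambda>t. fourier_coeff_Z \<psi> k (circ t))"
proof -
  have c: "continuous_on UNIV (\<lambda>z. \<psi> (line_pt (snd z) (circ (fst z))) * char_exp (- of_int k) (snd z))"
    by (intro continuous_intros continuous_on_compose_pair[OF smooth_family_continuous[OF smooth_Z_family[OF assms]]])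
  have "fourier_coeff_Z \<psi> k (circ t) = integral {-pi..pi} (\<lambda>q. \<psi> (line_pt q (circ t)) * char_exp (- of_int k) q) / (2 * pi)" for t
    unfolding fourier_coeff_Z_char
    by (subst set_borel_integral_eq_integral(2))
       (auto intro!: set_integrable_continuous_interval continuous_on_compose_pair[OF c, of _ "\<lambda>_. t" "\<lambda>q. q", simplified] continuous_intros)
  moreover have "continuous_on UNIV (\<lambda>t. integral {-pi..pi} (\<lambda>q. \<psi> (line_pt q (circ t)) * char_exp (- of_int k) q))"
    using c by (intro continuous_on_family_integral) simp
  ultimately show ?thesis by (auto intro!: continuous_intros)
qed

lemma fourier_coeff_Z_decay:
  assumes "smooth_Z \<psi>" "periodic_Z \<psi>"
  shows "\<exists>B. \<forall>k t. cmod (fourier_coeff_Z \<psi> k (circ t)) * (1 + \<bar>of_int k\<bar>) ^ M \<le> B"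
proof -
  note sm = smooth_Z_family[OF assms(1)]
  have "iter_deriv (replicate n 1) (\<lambda>p. \<psi> (line_pt p (circ t))) pi = iter_deriv (replicate n 1) (\<lambda>p. \<psi> (line_pt p (circ t))) (-pi)" for n t
  proof -
    have "iter_deriv (replicate n 1) (\<lambda>p. \<psi> (line_pt p (circ t))) (-pi + 2 * pi) = iter_deriv (replicate n 1) (\<lambda>p. \<psi> (line_pt p (circ t))) (-pi)"
      using assms(2) by (intro iter_deriv_periodic smooth_family_smooth[OF sm]) (auto simp: periodic_Z_def set_replicate_conv_if)
    then show ?thesis by simp
  qed
  from smooth_family_fourier_rapid[OF sm compact_Icc[of 0 "2 * pi"] this, of M]
  obtain B where B: "B \<ge> 0" "\<And>t k. t \<in> {0..2 * pi} \<Longrightarrow>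
     cmod (LINT q:{-pi..pi}|lborel. \<psi> (line_pt q (circ t)) * char_exp (- of_int k) q) * (1 + \<bar>of_int k\<bar>) ^ M \<le> B" by blast
  have "cmod (fourier_coeff_Z \<psi> k (circ t)) * (1 + \<bar>of_int k\<bar>) ^ M \<le> B / (2 * pi)" for k t
  proof -
    obtain s where s: "s \<in> {0..2 * pi}" "circ s = circ t" using circ_in_interval by blast
    show ?thesis using divide_right_mono[OF B(2)[OF s(1), of k], of "2 * pi"]
      by (simp add: fourier_coeff_Z_char norm_divide norm_mult s(2))
  qed
  then show ?thesis by blast
qed

definition bessel_weight :: "real \<Rightarrow> int \<Rightarrow> real" where
  "bessel_weight s k = (1 + (of_int k)\<^sup>2) powr (s / 2)"

lemma bessel_weight_pos: "bessel_weight s k > 0"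
  using add_pos_nonneg[OF zero_less_one zero_le_power2[of "real_of_int k"]] by (auto simp: bessel_weight_def)

lemma bessel_weight_bound: "bessel_weight s k \<le> (1 + \<bar>of_int k\<bar>) ^ nat \<lceil>\<bar>s\<bar>\<rceil>"
proof -
  let ?k = "\<bar>real_of_int k\<bar>"
  have 1: "1 + (real_of_int k)\<^sup>2 \<le> (1 + ?k)\<^sup>2" by (simp add: power2_sum)
  have "bessel_weight s k \<le> (1 + (of_int k)\<^sup>2) powr (\<bar>s\<bar> / 2)"
    unfolding bessel_weight_def by (intro powr_mono) auto
  also have "\<dots> \<le> ((1 + ?k)\<^sup>2) powr (\<bar>s\<bar> / 2)" by (intro powr_mono2 1) auto
  also have "\<dots> = (1 + ?k) powr \<bar>s\<bar>"
  proof -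
    have "(1 + ?k)\<^sup>2 = (1 + ?k) powr 2" using powr_realpow[of "1 + ?k" 2] by (simp add: add_pos_nonneg)
    then show ?thesis unfolding \<open>(1 + ?k)\<^sup>2 = (1 + ?k) powr 2\<close> powr_powr by simp
  qed
  also have "\<dots> \<le> (1 + ?k) powr (real (nat \<lceil>\<bar>s\<bar>\<rceil>))" by (intro powr_mono) linarith+
  also have "\<dots> = (1 + ?k) ^ nat \<lceil>\<bar>s\<bar>\<rceil>" by (rule powr_realpow) (simp add: add_pos_nonneg)
  finally show ?thesis .
qed

text \<open>The Bessel potential acts on the Fourier series of the test function in \<open>p\<close>, and
  each term of the series is a plane wave in the direction \<open>\<theta>\<^sup>\<bottom>\<close>. Distribution, integral over the
  angle and sum may all be interchanged. The pairing is bilinear, so the coefficient of frequency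
  \<open>k\<close> meets the frequency \<open>-k\<close> of the transform.\<close>

lemma xray_bessel_sums:
  assumes w: "smooth_weight w" and g: "compact_distribution g" and \<psi>: "smooth_Z \<psi>" "periodic_Z \<psi>"
  shows "(\<lambda>j. let k = int_decode j in integral {0..2 * pi} (\<lambda>t. of_real (bessel_weight s k) * fourier_coeff_Z \<psi> k (circ t) * line_ft w g (- of_int k) t))
           sums xray w g (bessel_Z s \<psi>)"
proof -
  define a where "a k t = of_real (bessel_weight s k) * fourier_coeff_Z \<psi> k (circ t)" for k t
  let ?\<nu> = "\<lambda>j. real_of_int (int_decode j)" and ?a = "\<lambda>j. a (int_decode j)" and ?e = "\<lambda>t. perp (circ t)"
  have rap: "rapid ?\<nu> ?a"
  proof (rule rapid_int_decode)
    fix M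
    let ?m = "nat \<lceil>\<bar>s\<bar>\<rceil>"
    obtain B where B: "\<And>k t. cmod (fourier_coeff_Z \<psi> k (circ t)) * (1 + \<bar>of_int k\<bar>) ^ (?m + M) \<le> B"
      using fourier_coeff_Z_decay[OF \<psi>] by blast
    have "cmod (a k t) * (1 + \<bar>of_int k\<bar>) ^ M \<le> B" for k t
    proof -
      have "cmod (a k t) * (1 + \<bar>of_int k\<bar>) ^ M = bessel_weight s k * (cmod (fourier_coeff_Z \<psi> k (circ t)) * (1 + \<bar>of_int k\<bar>) ^ M)"
        using bessel_weight_pos[of s k] by (simp add: a_def norm_mult)
      also have "\<dots> \<le> (1 + \<bar>of_int k\<bar>) ^ ?m * (cmod (fourier_coeff_Z \<psi> k (circ t)) * (1 + \<bar>of_int k\<bar>) ^ M)"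
        by (intro mult_right_mono bessel_weight_bound) auto
      also have "\<dots> \<le> B" using B[of k t] by (simp add: power_add mult_ac)
      finally show ?thesis .
    qed
    then show "\<exists>B. \<forall>k t. cmod (a k t) * (1 + \<bar>of_int k\<bar>) ^ M \<le> B" by blast
  qed
  have ac: "continuous_on UNIV (a k)" for k
    unfolding a_def[abs_def] by (intro continuous_intros fourier_coeff_Z_continuous \<psi>)
  have ce: "continuous_on UNIV ?e" by (intro continuous_intros)
  have ne: "norm (?e t) \<le> 1" for t by (simp add: inner_perp)
  have fam: "smooth_family (\<lambda>x t. superpose ?\<nu> ?e ?a x t * w x (circ t))"
    by (intro smooth_family_intros superpose_smooth_family rap ac ce ne smooth_weight_family w)
  have bz: "bessel_Z s \<psi> (x - (x \<bullet> circ t) *\<^sub>R circ t, circ t) = superpose ?\<nu> ?e ?a x t" for x t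
  proof -
    have "(x - (x \<bullet> circ t) *\<^sub>R circ t) \<bullet> perp (circ t) = x \<bullet> ?e t" by (simp add: inner_diff_left inner_perp)
    then have "bessel_Z s \<psi> (x - (x \<bullet> circ t) *\<^sub>R circ t, circ t) = (\<Sum>\<^sub>\<infinity>k. a k t * char_exp (of_int k) (x \<bullet> ?e t))"
      by (simp add: bessel_Z_def a_def bessel_weight_def char_exp_def)
    moreover obtain B where B: "summable B" "\<And>j t. cmod (?a j t) * (1 + \<bar>?\<nu> j\<bar>) ^ 0 \<le> B j" by (rule rapidE[OF rap]) blast
    have "summable (\<lambda>j. norm (a (int_decode j) t * char_exp (of_int (int_decode j)) (x \<bullet> ?e t)))"
      by (rule summable_comparison_test'[OF B(1), of 0]) (use B(2) in \<open>auto simp: norm_mult\<close>)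
    from int_decode_sums(1)[OF this] have "superpose ?\<nu> ?e ?a x t = (\<Sum>\<^sub>\<infinity>k. a k t * char_exp (of_int k) (x \<bullet> ?e t))"
      unfolding superpose_def by (rule sums_unique[symmetric])
    ultimately show ?thesis by simp
  qed
  have "xray_transpose w (bessel_Z s \<psi>) = (\<lambda>x. integral {0..2 * pi} (\<lambda>t. superpose ?\<nu> ?e ?a x t * w x (circ t)))"
  proof
    fix x
    have "xray_transpose w (bessel_Z s \<psi>) x = (LINT t:{0..2 * pi}|lborel. superpose ?\<nu> ?e ?a x t * w x (circ t))"
      unfolding xray_transpose_def bz by (simp add: mult.commute)
    also have "\<dots> = integral {0..2 * pi} (\<lambda>t. superpose ?\<nu> ?e ?a x t * w x (circ t))"
      by (intro set_borel_integral_eq_integral set_integrable_continuous_interval smooth_family_section[OF fam])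
    finally show "xray_transpose w (bessel_Z s \<psi>) x = integral {0..2 * pi} (\<lambda>t. superpose ?\<nu> ?e ?a x t * w x (circ t))" .
  qed
  then have "xray w g (bessel_Z s \<psi>) = integral {0..2 * pi} (\<lambda>t. g (\<lambda>x. superpose ?\<nu> ?e ?a x t * w x (circ t)))"
    unfolding xray_def by (simp add: distribution_integral[OF g fam])
  moreover have "(\<lambda>j. ?a j t * line_ft w g (- ?\<nu> j) t) sums g (\<lambda>x. superpose ?\<nu> ?e ?a x t * w x (circ t))" for t
    using distribution_superpose[OF g rap ac ce ne smooth_weight_smooth[OF w], of t t] by (simp add: line_ft_def)
  then have eq: "g (\<lambda>x. superpose ?\<nu> ?e ?a x t * w x (circ t)) = (\<Sum>j. ?a j t * line_ft w g (- ?\<nu> j) t)" for t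
    by (simp add: sums_iff)
  obtain C N where CN: "\<And>\<sigma> t. cmod (line_ft w g \<sigma> t) \<le> C * (1 + \<bar>\<sigma>\<bar>) ^ N" using line_ft_growth[OF w g] by blast
  obtain B where B: "summable B" "\<And>j t. cmod (?a j t) * (1 + \<bar>?\<nu> j\<bar>) ^ N \<le> B j" by (rule rapidE[OF rap]) blast
  have le: "cmod (?a j t * line_ft w g (- ?\<nu> j) t) \<le> \<bar>C\<bar> * B j" for j t
  proof -
    have "cmod (?a j t * line_ft w g (- ?\<nu> j) t) \<le> cmod (?a j t) * (\<bar>C\<bar> * (1 + \<bar>?\<nu> j\<bar>) ^ N)"
      unfolding norm_mult using CN[of "- ?\<nu> j" t]
      by (intro mult_left_mono order_trans[OF CN] ) (auto intro!: mult_right_mono)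
    also have "\<dots> \<le> \<bar>C\<bar> * B j" using mult_left_mono[OF B(2)[of j t], of "\<bar>C\<bar>"] by (simp add: mult_ac)
    finally show ?thesis .
  qed
  have cont: "continuous_on UNIV (\<lambda>t. ?a j t * line_ft w g (- ?\<nu> j) t)" for j
    by (intro continuous_intros ac continuous_on_compose_pair[OF line_ft_continuous[OF w g]])
  have ul: "uniform_limit {0..2 * pi} (\<lambda>n t. \<Sum>j<n. ?a j t * line_ft w g (- ?\<nu> j) t)
     (\<lambda>t. \<Sum>j. ?a j t * line_ft w g (- ?\<nu> j) t) sequentially"
    by (rule Weierstrass_m_test[OF le summable_mult[OF B(1)]])
  have "(\<lambda>n. integral {0..2 * pi} (\<lambda>t. \<Sum>j<n. ?a j t * line_ft w g (- ?\<nu> j) t)) \<longlonglongrightarrow>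
      integral {0..2 * pi} (\<lambda>t. \<Sum>j. ?a j t * line_ft w g (- ?\<nu> j) t)"
  proof -
    have "continuous_on (cbox 0 (2 * pi)) (\<lambda>t. \<Sum>j<n. ?a j t * line_ft w g (- ?\<nu> j) t)" for n
      by (intro continuous_on_sum continuous_on_subset[OF cont]) auto
    then obtain I J where IJ: "\<And>n. ((\<lambda>t. \<Sum>j<n. ?a j t * line_ft w g (- ?\<nu> j) t) has_integral I n) (cbox 0 (2 * pi))"
      "((\<lambda>t. \<Sum>j. ?a j t * line_ft w g (- ?\<nu> j) t) has_integral J) (cbox 0 (2 * pi))" "I \<longlonglongrightarrow> J"
      by (rule uniform_limit_integral_cbox[OF ul[folded cbox_interval] _ sequentially_bot]) blast
    have "I = (\<lambda>n. integral {0..2 * pi} (\<lambda>t. \<Sum>j<n. ?a j t * line_ft w g (- ?\<nu> j) t))"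
      by (rule ext) (rule integral_unique[OF IJ(1)[unfolded cbox_interval], symmetric])
    then show ?thesis using IJ(2,3) by (simp add: integral_unique)
  qed
  moreover have "integral {0..2 * pi} (\<lambda>t. \<Sum>j<n. ?a j t * line_ft w g (- ?\<nu> j) t) = (\<Sum>j<n. integral {0..2 * pi} (\<lambda>t. ?a j t * line_ft w g (- ?\<nu> j) t))" for n
    by (intro integral_sum integrable_continuous_real continuous_on_subset[OF cont]) auto
  ultimately show ?thesis
    unfolding sums_def by (simp add: eq Let_def a_def mult.assoc)
qed

section \<open>Square integrable functions on the manifold of lines\<close>

text \<open>Completeness of \<open>L\<^sup>2\<close> for series whose blocks are controlled by a convergent series. Along a
  subsequence with tails below \<open>4\<^bsup>-i\<^esup>\<close> the partial sums converge almost everywhere, because the measure is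
  finite and so the increments are summable in \<open>L\<^sup>1\<close>; Fatou's lemma then bounds the distance of the
  limit from every partial sum. Convergence is stated only weakly, against bounded functions.\<close>

lemma (in finite_measure) riesz_fischer:
  fixes u :: "nat \<Rightarrow> 'a \<Rightarrow> complex" and l :: "nat \<Rightarrow> real"
  assumes u [measurable]: "\<And>j. u j \<in> borel_measurable M" and l: "summable l"
    and int: "\<And>m n. m \<le> n \<Longrightarrow> integrable M (\<lambda>x. (cmod (\<Sum>j=m..<n. u j x))\<^sup>2)"
    and le: "\<And>m n. m \<le> n \<Longrightarrow> (LINT x|M. (cmod (\<Sum>j=m..<n. u j x))\<^sup>2) \<le> (\<Sum>j=m..<n. l j)"
  obtains F where "F \<in> borel_measurable M" "integrable M (\<lambda>x. (cmod (F x))\<^sup>2)"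
    "\<And>h H. h \<in> borel_measurable M \<Longrightarrow> (\<And>x. cmod (h x) \<le> H) \<Longrightarrow>
       (\<lambda>n. \<Sum>j<n. LINT x|M. u j x * h x) \<longlonglongrightarrow> (LINT x|M. F x * h x)"
proof -
  define \<mu> where "\<mu> = measure M (space M)"
  have l0: "l j \<ge> 0" for j
  proof -
    have "0 \<le> (LINT x|M. (cmod (\<Sum>j=j..<Suc j. u j x))\<^sup>2)" by (rule Bochner_Integration.integral_nonneg) simp
    also have "\<dots> \<le> l j" using le[of j "Suc j"] by simp
    finally show ?thesis .
  qed
  define T where "T n = suminf l - (\<Sum>j<n. l j)" for n
  have T0: "T n \<ge> 0" for n using sum_le_suminf[OF l, of "{..<n}"] l0 by (simp add: T_def)
  have Tl: "(\<Sum>j=m..<n. l j) \<le> T m" if "m \<le> n" for m n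
  proof -
    have "(\<Sum>j<n. l j) = (\<Sum>j<m. l j) + (\<Sum>j=m..<n. l j)"
      using sum.atLeastLessThan_concat[of 0 m n l] that by (simp add: atLeast0LessThan)
    moreover have "(\<Sum>j<n. l j) \<le> suminf l" using sum_le_suminf[OF l, of "{..<n}"] l0 by simp
    ultimately show ?thesis by (simp add: T_def)
  qed
  have Tlim: "T \<longlonglongrightarrow> 0"
    using tendsto_diff[OF tendsto_const[of "suminf l"] summable_LIMSEQ[OF l]] by (simp add: T_def[abs_def])
  define S where "S n x = (\<Sum>j<n. u j x)" for n x
  have Sm [measurable]: "S n \<in> borel_measurable M" for n unfolding S_def[abs_def] by measurable
  have SD: "S n x - S m x = (\<Sum>j=m..<n. u j x)" if "m \<le> n" for m n x
    using sum.atLeastLessThan_concat[of 0 m n "\<lambda>j. u j x"] that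
    unfolding S_def atLeast0LessThan by (metis add_diff_cancel_left' le0)
  have "\<exists>r. \<forall>i. T (r i) < (1 / 4) ^ i \<and> r i < r (Suc i)"
  proof (rule dependent_nat_choice)
    show "\<exists>x. T x < (1 / 4) ^ 0" using order_tendstoD(2)[OF Tlim, of 1] by (auto simp: eventually_sequentially)
    fix x i
    have "\<forall>\<^sub>F y in sequentially. T y < (1 / 4) ^ Suc i" by (rule order_tendstoD(2)[OF Tlim]) simp
    then obtain N where N: "\<And>n. n \<ge> N \<Longrightarrow> T n < (1 / 4) ^ Suc i" by (auto simp: eventually_sequentially)
    show "\<exists>y. T y < (1 / 4) ^ Suc i \<and> x < y" using N[of "max N (Suc x)"] by (intro exI[of _ "max N (Suc x)"]) auto
  qed
  then obtain r where r: "\<And>i. T (r i) < (1 / 4) ^ i" "\<And>i. r i < r (Suc i)" by blast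
  have rmono: "strict_mono r" using r(2) by (simp add: strict_mono_Suc_iff)
  define D where "D i x = S (r (Suc i)) x - S (r i) x" for i x
  have Dm [measurable]: "D i \<in> borel_measurable M" for i unfolding D_def[abs_def] by measurable
  have D2: "integrable M (\<lambda>x. (cmod (D i x))\<^sup>2)" "(LINT x|M. (cmod (D i x))\<^sup>2) \<le> (1 / 4) ^ i" for i
  proof -
    have s: "r i \<le> r (Suc i)" using r(2)[of i] by simp
    show "integrable M (\<lambda>x. (cmod (D i x))\<^sup>2)" using int[OF s] by (simp add: D_def SD[OF s])
    show "(LINT x|M. (cmod (D i x))\<^sup>2) \<le> (1 / 4) ^ i"
      using order_trans[OF le[OF s] Tl[OF s]] r(1)[of i] by (simp add: D_def SD[OF s])
  qed
  have D1: "integrable M (\<lambda>x. cmod (D i x))" "(LINT x|M. cmod (D i x)) \<le> (\<mu> + 1) * (1 / 2) ^ i" for i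
  proof -
    let ?c = "(1 / 2 :: real) ^ i"
    \<comment> \<open>This elementary inequality takes the place of the Cauchy-Schwarz inequality.\<close>
    have pt: "cmod z \<le> ?c + (cmod z)\<^sup>2 / ?c" for z
    proof (cases "cmod z \<le> ?c")
      case False
      then have "cmod z * ?c \<le> (cmod z)\<^sup>2" by (simp add: power2_eq_square mult_left_mono)
      then have "cmod z \<le> (cmod z)\<^sup>2 / ?c" by (simp add: pos_le_divide_eq del: power_one_over)
      then show ?thesis by (simp add: add_increasing)
    qed (simp add: add_increasing2)
    have i: "integrable M (\<lambda>x. ?c + (cmod (D i x))\<^sup>2 / ?c)" using D2(1) by simp
    show i1: "integrable M (\<lambda>x. cmod (D i x))"
      by (rule Bochner_Integration.integrable_bound[OF i]) (use pt in \<open>auto simp: abs_of_nonneg add_nonneg_nonneg\<close>)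
    have "(LINT x|M. cmod (D i x)) \<le> (LINT x|M. ?c + (cmod (D i x))\<^sup>2 / ?c)"
      by (intro integral_mono i i1 pt)
    also have "\<dots> = \<mu> * ?c + (LINT x|M. (cmod (D i x))\<^sup>2) / ?c"
      using D2(1) by (simp add: \<mu>_def)
    also have "\<dots> \<le> \<mu> * ?c + (1 / 4) ^ i / ?c" by (intro add_left_mono divide_right_mono D2) auto
    also have "(1 / 4 :: real) ^ i / ?c = ?c" by (simp add: power_divide[symmetric])
    finally show "(LINT x|M. cmod (D i x)) \<le> (\<mu> + 1) * (1 / 2) ^ i" by (simp add: algebra_simps)
  qed
  have "AE x in M. convergent (\<lambda>i. S (r i) x)"
  proof -
    have "(\<integral>\<^sup>+x. (\<Sum>i. ennreal (cmod (D i x))) \<partial>M) = (\<Sum>i. \<integral>\<^sup>+x. ennreal (cmod (D i x)) \<partial>M)"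
      by (rule nn_integral_suminf) auto
    also have "\<dots> \<le> (\<Sum>i. ennreal ((\<mu> + 1) * (1 / 2) ^ i))"
      by (intro suminf_le) (auto simp: nn_integral_eq_integral D1 ennreal_leI)
    also have "\<dots> = ennreal (\<Sum>i. (\<mu> + 1) * (1 / 2) ^ i)"
      by (rule suminf_ennreal2) (auto simp: \<mu>_def intro!: summable_mult mult_nonneg_nonneg add_nonneg_nonneg)
    finally have "(\<integral>\<^sup>+x. (\<Sum>i. ennreal (cmod (D i x))) \<partial>M) \<noteq> \<infinity>" by (auto simp: top_unique)
    then have "AE x in M. (\<Sum>i. ennreal (cmod (D i x))) \<noteq> \<infinity>"
      by (intro nn_integral_noteq_infinite) auto
    then show ?thesis
    proof eventually_elim
      case (elim x)
      then have "summable (\<lambda>i. cmod (D i x))" by (intro summable_suminf_not_top) auto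
      then have "summable (\<lambda>i. D i x)" by (rule summable_norm_cancel)
      then have "convergent (\<lambda>n. \<Sum>i<n. D i x)" by (simp add: summable_iff_convergent)
      moreover have "(\<Sum>i<n. D i x) = S (r n) x - S (r 0) x" for n
        by (induction n) (auto simp: D_def)
      ultimately have "convergent (\<lambda>n. S (r n) x - S (r 0) x)" by simp
      from convergent_add[OF this convergent_const[of "S (r 0) x"]] show ?case by simp
    qed
  qed
  define F where "F x = lim (\<lambda>i. S (r i) x)" for x
  have Fm [measurable]: "F \<in> borel_measurable M" unfolding F_def[abs_def] by (rule borel_measurable_lim_metric) auto
  have Flim: "AE x in M. (\<lambda>i. S (r i) x) \<longlonglongrightarrow> F x"
    using \<open>AE x in M. convergent (\<lambda>i. S (r i) x)\<close> by eventually_elim (auto simp: F_def convergent_LIMSEQ_iff)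
  have tail: "(\<integral>\<^sup>+x. ennreal ((cmod (F x - S n x))\<^sup>2) \<partial>M) \<le> ennreal (T n)" for n
  proof -
    have "(\<integral>\<^sup>+x. ennreal ((cmod (F x - S n x))\<^sup>2) \<partial>M) \<le> (\<integral>\<^sup>+x. liminf (\<lambda>i. ennreal ((cmod (S (r i) x - S n x))\<^sup>2)) \<partial>M)"
    proof (rule nn_integral_mono_AE)
      show "AE x in M. ennreal ((cmod (F x - S n x))\<^sup>2) \<le> liminf (\<lambda>i. ennreal ((cmod (S (r i) x - S n x))\<^sup>2))"
        using Flim
      proof eventually_elim
        case (elim x)
        have "(\<lambda>i. ennreal ((cmod (S (r i) x - S n x))\<^sup>2)) \<longlonglongrightarrow> ennreal ((cmod (F x - S n x))\<^sup>2)"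
          by (intro tendsto_intros tendsto_ennrealI elim)
        then show ?case by (subst lim_imp_Liminf[OF sequentially_bot]) auto
      qed
    qed
    also have "\<dots> \<le> liminf (\<lambda>i. \<integral>\<^sup>+x. ennreal ((cmod (S (r i) x - S n x))\<^sup>2) \<partial>M)"
      by (rule nn_integral_liminf) auto
    also have "\<dots> \<le> liminf (\<lambda>i::nat. ennreal (T n))"
    proof (rule Liminf_mono)
      have "\<forall>\<^sub>F i in sequentially. n \<le> r i"
        using filterlim_subseq[OF rmono] by (simp add: filterlim_at_top)
      then show "\<forall>\<^sub>F i in sequentially. (\<integral>\<^sup>+x. ennreal ((cmod (S (r i) x - S n x))\<^sup>2) \<partial>M) \<le> ennreal (T n)"
      proof eventually_elim
        case (elim i)
        have "(\<integral>\<^sup>+x. ennreal ((cmod (S (r i) x - S n x))\<^sup>2) \<partial>M) = ennreal (LINT x|M. (cmod (\<Sum>j=n..<r i. u j x))\<^sup>2)"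
          using int[OF elim] by (simp add: SD[OF elim] nn_integral_eq_integral)
        also have "\<dots> \<le> ennreal (T n)" by (intro ennreal_leI order_trans[OF le[OF elim] Tl[OF elim]])
        finally show ?case .
      qed
    qed
    also have "\<dots> = ennreal (T n)" by (simp add: Liminf_const)
    finally show ?thesis .
  qed
  have t2: "integrable M (\<lambda>x. (cmod (F x - S n x))\<^sup>2)" "(LINT x|M. (cmod (F x - S n x))\<^sup>2) \<le> T n" for n
  proof -
    show i: "integrable M (\<lambda>x. (cmod (F x - S n x))\<^sup>2)"
      by (rule integrableI_bounded) (use tail[of n] in \<open>auto simp: top_unique less_top[symmetric]\<close>)
    show "(LINT x|M. (cmod (F x - S n x))\<^sup>2) \<le> T n"
      using tail[of n] T0[of n] by (simp add: nn_integral_eq_integral[OF i])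
  qed
  show ?thesis
  proof (rule that[OF Fm])
    show "integrable M (\<lambda>x. (cmod (F x))\<^sup>2)" using t2(1)[of 0] by (simp add: S_def)
    fix h :: "'a \<Rightarrow> complex" and H assume h [measurable]: "h \<in> borel_measurable M" and H: "\<And>x. cmod (h x) \<le> H"
    have b: "integrable M (\<lambda>x. f x * h x)" if "f \<in> borel_measurable M" "integrable M (\<lambda>x. (cmod (f x))\<^sup>2)" for f
    proof (rule Bochner_Integration.integrable_bound[of M "\<lambda>x. (1 + (cmod (f x))\<^sup>2) * \<bar>H\<bar>"])
      show "integrable M (\<lambda>x. (1 + (cmod (f x))\<^sup>2) * \<bar>H\<bar>)" using that(2) by simp
      have "cmod z \<le> 1 + (cmod z)\<^sup>2" for z :: complex
      proof -
        have "(cmod z - 1 / 2)\<^sup>2 = (cmod z)\<^sup>2 - cmod z + 1 / 4" by (simp add: power2_eq_square field_simps)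
        then show ?thesis using zero_le_power2[of "cmod z - 1 / 2"] by linarith
      qed
      then have "cmod (f x * h x) \<le> (1 + (cmod (f x))\<^sup>2) * \<bar>H\<bar>" for x
        unfolding norm_mult by (intro mult_mono order_trans[OF H abs_ge_self]) auto
      then show "AE x in M. norm (f x * h x) \<le> norm ((1 + (cmod (f x))\<^sup>2) * \<bar>H\<bar>)"
        by (auto simp: abs_of_nonneg add_nonneg_nonneg)
    qed (use that in auto)
    have uint: "integrable M (\<lambda>x. u j x * h x)" for j
      using int[of j "Suc j"] by (intro b) auto
    have Fint: "integrable M (\<lambda>x. F x * h x)" using t2(1)[of 0] by (intro b) (auto simp: S_def)
    have est: "cmod ((LINT x|M. F x * h x) - (\<Sum>j<n. LINT x|M. u j x * h x)) \<le> (\<bar>H\<bar> * (\<mu> + 1)) * sqrt (T n + 1 / (Suc n))" for n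
    proof -
      define c where "c = sqrt (T n + 1 / (Suc n))"
      have c: "c > 0" "T n \<le> c\<^sup>2" using T0[of n] by (auto simp: c_def add_nonneg_pos intro!: add_nonneg_nonneg)
      have pt: "cmod z \<le> c + (cmod z)\<^sup>2 / c" for z
      proof (cases "cmod z \<le> c")
        case False
        then have "cmod z * c \<le> (cmod z)\<^sup>2" using c(1) by (simp add: power2_eq_square mult_left_mono)
        then have "cmod z \<le> (cmod z)\<^sup>2 / c" using c(1) by (simp add: pos_le_divide_eq)
        then show ?thesis using c(1) by simp
      qed (use c(1) in \<open>simp add: add_increasing2\<close>)
      have "(LINT x|M. F x * h x) - (\<Sum>j<n. LINT x|M. u j x * h x) = (LINT x|M. (F x - S n x) * h x)"
      proof -
        have "(\<Sum>j<n. LINT x|M. u j x * h x) = (LINT x|M. (\<Sum>j<n. u j x * h x))"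
          using uint by (intro Bochner_Integration.integral_sum[symmetric]) auto
        also have "\<dots> = (LINT x|M. S n x * h x)" by (simp add: S_def sum_distrib_right)
        finally have "(\<Sum>j<n. LINT x|M. u j x * h x) = (LINT x|M. S n x * h x)" .
        moreover have "integrable M (\<lambda>x. S n x * h x)" unfolding S_def sum_distrib_right using uint by simp
        ultimately show ?thesis using Fint by (simp add: left_diff_distrib)
      qed
      also have "cmod \<dots> \<le> (LINT x|M. cmod ((F x - S n x) * h x))" by (rule integral_norm_bound)
      also have "\<dots> \<le> (LINT x|M. \<bar>H\<bar> * (c + (cmod (F x - S n x))\<^sup>2 / c))"
      proof (rule integral_mono)
        show "integrable M (\<lambda>x. cmod ((F x - S n x) * h x))" by (intro integrable_norm b t2) auto
        show "cmod ((F x - S n x) * h x) \<le> \<bar>H\<bar> * (c + (cmod (F x - S n x))\<^sup>2 / c)" for x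
          unfolding norm_mult using mult_mono[OF pt[of "F x - S n x"] order_trans[OF H abs_ge_self, of x]] c(1)
          by (simp add: mult.commute add_nonneg_nonneg)
      qed (use t2(1) in auto)
      also have "\<dots> = \<bar>H\<bar> * (\<mu> * c + (LINT x|M. (cmod (F x - S n x))\<^sup>2) / c)"
        using t2(1)[of n] by (simp add: \<mu>_def)
      also have "\<dots> \<le> \<bar>H\<bar> * (\<mu> * c + c\<^sup>2 / c)"
        using c t2(2)[of n] by (intro mult_left_mono add_left_mono divide_right_mono) auto
      also have "\<dots> = (\<bar>H\<bar> * (\<mu> + 1)) * c" using c(1) by (simp add: power2_eq_square algebra_simps)
      finally show ?thesis by (simp add: c_def)
    qed
    have "(\<lambda>n. (\<bar>H\<bar> * (\<mu> + 1)) * sqrt (T n + 1 / (Suc n))) \<longlonglongrightarrow> (\<bar>H\<bar> * (\<mu> + 1)) * sqrt (0 + 0)"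
      by (intro tendsto_intros Tlim LIMSEQ_Suc[OF lim_1_over_n])
    then have "(\<lambda>n. (\<bar>H\<bar> * (\<mu> + 1)) * sqrt (T n + 1 / (Suc n))) \<longlonglongrightarrow> 0" by simp
    from Lim_null_comparison[OF always_eventually[OF allI[OF est]] this]
    have "(\<lambda>n. (LINT x|M. F x * h x) - (\<Sum>j<n. LINT x|M. u j x * h x)) \<longlonglongrightarrow> 0" .
    from tendsto_diff[OF tendsto_const[of "LINT x|M. F x * h x"] this]
    show "(\<lambda>n. \<Sum>j<n. LINT x|M. u j x * h x) \<longlonglongrightarrow> (LINT x|M. F x * h x)" by simp
  qed
qed

subsection \<open>Coordinates on the manifold of lines\<close>

text \<open>A measurable right inverse of \<^const>\<open>circ\<close>.\<close>

definition angle :: "real^2 \<Rightarrow> real" where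
  "angle \<theta> = Arg2pi (Complex (\<theta> $ 1) (\<theta> $ 2))"

lemma circ_angle: assumes "norm \<theta> = 1" shows "circ (angle \<theta>) = \<theta>"
proof -
  have "cmod (Complex (\<theta> $ 1) (\<theta> $ 2)) = 1"
    using assms by (simp add: cmod_def norm_vec_def L2_set_def sum_2)
  then have "Complex (\<theta> $ 1) (\<theta> $ 2) = cis (angle \<theta>)"
    using Arg2pi_eq[of "Complex (\<theta> $ 1) (\<theta> $ 2)"] by (simp add: angle_def cis_conv_exp)
  then have "cos (angle \<theta>) = \<theta> $ 1" "sin (angle \<theta>) = \<theta> $ 2" by (auto simp: complex_eq_iff)
  then show ?thesis by (simp add: circ_def vec_eq_iff forall_2)
qed

lemma angle_bounds: "0 \<le> angle \<theta>" "angle \<theta> \<le> 2 * pi"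
  using Arg2pi_ge_0 Arg2pi_lt_2pi by (auto simp: angle_def less_imp_le)

lemma borel_measurable_Arg2pi: "Arg2pi \<in> borel_measurable borel"
proof -
  have cl: "closed (\<real>\<^sub>\<ge>\<^sub>0 :: complex set)" by (rule closed_nonneg_Reals_complex)
  have "Arg2pi = (\<lambda>z. if z \<in> \<real>\<^sub>\<ge>\<^sub>0 then 0 else Arg2pi z)"
    by (auto simp: fun_eq_iff nonneg_Reals_def Arg2pi_of_real)
  moreover have "(\<lambda>z. if z \<in> \<real>\<^sub>\<ge>\<^sub>0 then 0 else Arg2pi z) \<in> borel_measurable borel"
  proof (subst measurable_If_restrict_space_iff)
    show "{x \<in> space borel. x \<in> (\<real>\<^sub>\<ge>\<^sub>0 :: complex set)} \<in> sets borel" using cl by simp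
    have "continuous_on {x. x \<notin> \<real>\<^sub>\<ge>\<^sub>0} Arg2pi"
      by (rule continuous_at_imp_continuous_on) (auto intro: continuous_at_Arg2pi)
    then show "(\<lambda>x. 0) \<in> borel_measurable (restrict_space borel {x. x \<in> (\<real>\<^sub>\<ge>\<^sub>0 :: complex set)}) \<and>
      Arg2pi \<in> borel_measurable (restrict_space borel {x. x \<notin> (\<real>\<^sub>\<ge>\<^sub>0 :: complex set)})"
      by (simp add: borel_measurable_continuous_on_restrict)
  qed
  ultimately show ?thesis by simp
qed

lemma measurable_angle [measurable]: "angle \<in> borel_measurable borel"
proof -
  have "(\<lambda>\<theta>::real^2. Complex (\<theta> $ 1) (\<theta> $ 2)) \<in> borel_measurable borel"
    unfolding Complex_eq by (intro borel_measurable_continuous_onI continuous_intros)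
  from measurable_compose[OF this borel_measurable_Arg2pi] show ?thesis by (simp add: angle_def[abs_def])
qed

lemma continuous_on_line_pt: "continuous_on UNIV (\<lambda>x. line_pt (fst x) (circ (snd x)))"
  unfolding line_pt_def by (intro continuous_intros)

abbreviation "Z_rect \<equiv> {-pi<..pi} \<times> {0..<2 * pi}"

lemma Z_rect_sets [measurable]: "Z_rect \<in> sets (borel :: (real \<times> real) measure)"
  unfolding borel_prod[symmetric] by (intro pair_measureI) auto

lemma measurable_line_pt [measurable]:
  "(\<lambda>x. line_pt (fst x) (circ (snd x))) \<in> borel_measurable borel"
  by (intro borel_measurable_continuous_onI continuous_on_line_pt)

lemma Z_measure_eq: "Z_measure = distr (restrict_space lborel Z_rect) borel (\<lambda>x. line_pt (fst x) (circ (snd x)))"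
  by (simp add: Z_measure_def case_prod_unfold)

lemma sets_Z_measure [simp, measurable_cong]: "sets Z_measure = sets borel"
  by (simp add: Z_measure_def)

lemma measurable_restrict_line_pt:
  "(\<lambda>x. line_pt (fst x) (circ (snd x))) \<in> restrict_space lborel Z_rect \<rightarrow>\<^sub>M borel"
  by (rule measurable_restrict_space1) simp

lemma integrable_Z_iff:
  fixes h :: "(real^2) \<times> (real^2) \<Rightarrow> 'b::{banach, second_countable_topology}"
  assumes "h \<in> borel_measurable borel"
  shows "integrable Z_measure h \<longleftrightarrow> integrable lborel (\<lambda>x. indicator Z_rect x *\<^sub>R h (line_pt (fst x) (circ (snd x))))"
  unfolding Z_measure_eq integrable_distr_eq[OF measurable_restrict_line_pt assms]
  by (subst integrable_restrict_space) (auto simp: space_lborel)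

lemma integral_Z:
  fixes h :: "(real^2) \<times> (real^2) \<Rightarrow> 'b::{banach, second_countable_topology}"
  assumes "h \<in> borel_measurable borel"
  shows "(LINT \<zeta>|Z_measure. h \<zeta>) = (LINT x|lborel. indicator Z_rect x *\<^sub>R h (line_pt (fst x) (circ (snd x))))"
  unfolding Z_measure_eq integral_distr[OF measurable_restrict_line_pt assms]
  by (subst integral_restrict_space) (auto simp: space_lborel)

lemma finite_measure_Z: "finite_measure Z_measure"
proof (rule finite_measureI)
  have "emeasure lborel Z_rect = emeasure (lborel \<Otimes>\<^sub>M lborel) Z_rect" by (simp add: lborel_prod)
  also have "\<dots> = emeasure lborel {-pi<..pi} * emeasure lborel {0..<2 * pi}"
    by (intro lborel.emeasure_pair_measure_Times) auto
  also have "\<dots> < \<infinity>" by (simp add: ennreal_mult_less_top)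
  finally show "emeasure Z_measure (space Z_measure) \<noteq> \<infinity>"
    unfolding Z_measure_eq by (subst emeasure_distr[OF measurable_restrict_line_pt])
      (auto simp: emeasure_restrict_space space_restrict_space)
qed

lemma set_integral_half_open:
  fixes f :: "real \<Rightarrow> 'b::{banach, second_countable_topology}"
  assumes [measurable]: "f \<in> borel_measurable borel"
  shows "(LINT x:{a<..b}|lborel. f x) = (LINT x:{a..b}|lborel. f x)"
    and "(LINT x:{a..<b}|lborel. f x) = (LINT x:{a..b}|lborel. f x)"
  unfolding set_lebesgue_integral_def
  by (rule integral_cong_AE; (measurable)?; use AE_lborel_singleton[of a] AE_lborel_singleton[of b] in \<open>eventually_elim, auto simp: indicator_def\<close>)+

lemma integral_Z_iterated:
  fixes h :: "(real^2) \<times> (real^2) \<Rightarrow> 'b::{banach, second_countable_topology}"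
  assumes [measurable]: "h \<in> borel_measurable borel" and int: "integrable Z_measure h"
  shows "(LINT \<zeta>|Z_measure. h \<zeta>) = (LINT t:{0..2 * pi}|lborel. LINT p:{-pi..pi}|lborel. h (line_pt p (circ t)))"
proof -
  define k where "k p t = indicator Z_rect (p, t) *\<^sub>R h (line_pt p (circ t))" for p t
  have [measurable]: "(\<lambda>x. h (line_pt (fst x) (circ (snd x)))) \<in> borel_measurable (borel \<Otimes>\<^sub>M borel)"
    using measurable_compose[OF measurable_line_pt assms(1)] by (simp add: borel_prod)
  have lp: "(\<lambda>p. h (line_pt p (circ t))) \<in> borel_measurable borel" for t
  proof -
    have "(\<lambda>p. line_pt p (circ t)) \<in> borel_measurable borel"
      unfolding line_pt_def by (intro borel_measurable_continuous_onI continuous_intros)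
    from measurable_compose[OF this assms(1)] show ?thesis .
  qed
  have "integrable (lborel \<Otimes>\<^sub>M lborel) (case_prod k)"
    using int unfolding integrable_Z_iff[OF assms(1)] by (simp add: lborel_prod k_def case_prod_unfold)
  from lborel_pair.integral_snd[OF this]
  have "(LINT x|lborel. k (fst x) (snd x)) = (LINT t|lborel. LINT p|lborel. k p t)"
    by (simp add: lborel_prod case_prod_unfold)
  then have "(LINT \<zeta>|Z_measure. h \<zeta>) = (LINT t|lborel. LINT p|lborel. k p t)"
    unfolding integral_Z[OF assms(1)] by (simp add: k_def)
  also have "\<dots> = (LINT t:{0..<2 * pi}|lborel. LINT p:{-pi<..pi}|lborel. h (line_pt p (circ t)))"
    unfolding set_lebesgue_integral_def k_def
    by (intro Bochner_Integration.integral_cong refl) (auto simp: indicator_def cong: if_cong)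
  also have "\<dots> = (LINT t:{0..<2 * pi}|lborel. LINT p:{-pi..pi}|lborel. h (line_pt p (circ t)))"
    by (simp only: set_integral_half_open(1)[OF lp])
  also have "\<dots> = (LINT t:{0..2 * pi}|lborel. LINT p:{-pi..pi}|lborel. h (line_pt p (circ t)))"
  proof (rule set_integral_half_open(2))
    have "(\<lambda>(t, p). indicator {-pi..pi} p *\<^sub>R h (line_pt p (circ t))) \<in> borel_measurable (borel \<Otimes>\<^sub>M lborel)"
    proof -
      have "(\<lambda>x. line_pt (snd x) (circ (fst x))) \<in> borel_measurable (borel :: (real \<times> real) measure)"
        unfolding line_pt_def by (intro borel_measurable_continuous_onI continuous_intros)
      from measurable_compose[OF this assms(1)]
      have [measurable]: "(\<lambda>x. h (line_pt (snd x) (circ (fst x)))) \<in> borel_measurable (borel \<Otimes>\<^sub>M borel)" by (simp add: borel_prod)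
      have "(\<lambda>x. indicator {-pi..pi} (snd x) *\<^sub>R h (line_pt (snd x) (circ (fst x)))) \<in> borel_measurable (borel \<Otimes>\<^sub>M borel)"
        by measurable
      then show ?thesis by (simp add: case_prod_unfold cong: measurable_cong_sets sets_pair_measure_cong)
    qed
    from lborel.borel_measurable_lebesgue_integral[OF this]
    show "(\<lambda>t. LINT p:{-pi..pi}|lborel. h (line_pt p (circ t))) \<in> borel_measurable borel"
      by (simp add: set_lebesgue_integral_def)
  qed
  finally show ?thesis .
qed

lemma line_pt_coords:
  assumes "norm \<theta> = 1" shows "fst (line_pt p \<theta>) \<bullet> perp (snd (line_pt p \<theta>)) = p"
  using assms by (simp add: line_pt_def inner_perp norm_eq_1)

text \<open>The characters of the torus of pairs \<open>(p, t)\<close>, as functions on the manifold of lines.\<close>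

definition Z_mode :: "int \<Rightarrow> int \<Rightarrow> (real^2) \<times> (real^2) \<Rightarrow> complex" where
  "Z_mode k m \<zeta> = char_exp (of_int k) (fst \<zeta> \<bullet> perp (snd \<zeta>)) * char_exp (of_int m) (angle (snd \<zeta>))"

lemma char_exp_circ: "circ s = circ t \<Longrightarrow> char_exp (of_int m) s = char_exp (of_int m) t"
proof -
  assume "circ s = circ t"
  then have "cis s = cis t" by (simp add: circ_def vec_eq_iff forall_2 complex_eq_iff)
  then have "cis s powi m = cis t powi m" by simp
  then show ?thesis by (simp add: char_exp_cis cis_power_int)
qed

lemma Z_mode_line_pt: "Z_mode k m (line_pt p (circ t)) = char_exp (of_int k) p * char_exp (of_int m) t"
  using char_exp_circ[OF circ_angle[of "circ t"], of m]
  by (simp add: Z_mode_def line_pt_coords) (simp add: line_pt_def)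

lemma measurable_Z_coord [measurable]:
  "(\<lambda>\<zeta>. fst \<zeta> \<bullet> perp (snd \<zeta>)) \<in> borel_measurable borel" "(\<lambda>\<zeta>::(real^2) \<times> (real^2). angle (snd \<zeta>)) \<in> borel_measurable borel"
proof -
  show "(\<lambda>\<zeta>. fst \<zeta> \<bullet> perp (snd \<zeta>)) \<in> borel_measurable borel"
    by (intro borel_measurable_continuous_onI continuous_intros)
  have "(snd :: (real^2) \<times> (real^2) \<Rightarrow> _) \<in> borel_measurable borel"
    by (intro borel_measurable_continuous_onI continuous_intros)
  from measurable_compose[OF this measurable_angle]
  show "(\<lambda>\<zeta>::(real^2) \<times> (real^2). angle (snd \<zeta>)) \<in> borel_measurable borel" .
qed

lemma measurable_Z_mode [measurable]: "Z_mode k m \<in> borel_measurable borel"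
  unfolding Z_mode_def[abs_def] by measurable

lemma norm_Z_mode [simp]: "cmod (Z_mode k m \<zeta>) = 1"
  by (simp add: Z_mode_def norm_mult)

lemma Z_mode_mult_cnj: "Z_mode k m \<zeta> * cnj (Z_mode k' m' \<zeta>) = Z_mode (k - k') (m - m') \<zeta>"
proof -
  have "Z_mode k m \<zeta> * cnj (Z_mode k' m' \<zeta>) = (char_exp (of_int k) (fst \<zeta> \<bullet> perp (snd \<zeta>)) * char_exp (- of_int k') (fst \<zeta> \<bullet> perp (snd \<zeta>)))
     * (char_exp (of_int m) (angle (snd \<zeta>)) * char_exp (- of_int m') (angle (snd \<zeta>)))"
    by (simp add: Z_mode_def mult_ac)
  then show ?thesis by (simp add: char_exp_mult Z_mode_def)
qed

lemma integral_Z_mode: "(LINT \<zeta>|Z_measure. Z_mode k m \<zeta>) = (if k = 0 \<and> m = 0 then complex_of_real ((2 * pi)\<^sup>2) else 0)"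
proof -
  interpret finite_measure Z_measure by (rule finite_measure_Z)
  have "integrable Z_measure (Z_mode k m)" by (rule integrable_const_bound[where B=1]) auto
  then have "(LINT \<zeta>|Z_measure. Z_mode k m \<zeta>) = (LINT t:{0..2 * pi}|lborel. (LINT p:{-pi..pi}|lborel. char_exp (of_int k) p * char_exp (of_int m) t))"
    by (subst integral_Z_iterated) (auto simp: Z_mode_line_pt)
  also have "\<dots> = (LINT t:{0..2 * pi}|lborel. (LINT p:{-pi..pi}|lborel. char_exp (of_int k) p) * char_exp (of_int m) t)"
    by simp
  also have "\<dots> = (LINT p:{-pi..-pi + 2 * pi}|lborel. char_exp (of_int k) p) * (LINT t:{0..0 + 2 * pi}|lborel. char_exp (of_int m) t)"
    by simp
  also have "\<dots> = (if k = 0 \<and> m = 0 then complex_of_real ((2 * pi)\<^sup>2) else 0)"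
    unfolding char_exp_integral by (simp add: power2_eq_square)
  finally show ?thesis .
qed

section \<open>The Sobolev norm on the manifold of lines\<close>

lemma fourier_coeff_Z_mode: "fourier_coeff_Z (Z_mode k m) k' (circ t) = (if k' = k then char_exp (of_int m) t else 0)"
proof -
  have "fourier_coeff_Z (Z_mode k m) k' (circ t) = (LINT q:{-pi..pi}|lborel. char_exp (of_int (k - k')) q * char_exp (of_int m) t) / (2 * pi)"
  proof -
    have "char_exp (of_int k) q * char_exp (of_int m) t * char_exp (- of_int k') q
        = char_exp (of_int k) q * char_exp (- of_int k') q * char_exp (of_int m) t" for q by (simp only: mult_ac)
    then show ?thesis unfolding fourier_coeff_Z_char Z_mode_line_pt by (simp only: char_exp_mult) simp
  qed
  also have "\<dots> = (LINT q:{-pi..-pi + 2 * pi}|lborel. char_exp (of_int (k - k')) q) * char_exp (of_int m) t / (2 * pi)"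
    by simp
  finally show ?thesis unfolding char_exp_integral by simp
qed

lemma smooth_Z_mode: "smooth_Z (Z_mode k m)" "periodic_Z (Z_mode k m)"
proof -
  have "(\<lambda>(p, t). Z_mode k m (line_pt p (circ t))) = (\<lambda>x. char_exp 1 (x \<bullet> (of_int k, of_int m)))"
    by (auto simp: Z_mode_line_pt char_exp_cis inner_prod_def cis_mult mult.commute)
  then show "smooth_Z (Z_mode k m)" unfolding smooth_Z_def by (simp add: smooth_char_exp)
  have "Z_mode k m (line_pt (p + 2 * pi) \<theta>) = Z_mode k m (line_pt p \<theta>)" if "norm \<theta> = 1" for p \<theta>
    using circ_angle[OF that] Z_mode_line_pt[of k m _ "angle \<theta>"] by (simp add: char_exp_periodic)
  then show "periodic_Z (Z_mode k m)" by (simp add: periodic_Z_def)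
qed

lemma sums_int_decode_single:
  fixes c :: "'b::real_normed_vector"
  shows "(\<lambda>j. if int_decode j = k then c else 0) sums c"
proof -
  have "(\<lambda>j. if int_decode j = k then c else 0) = (\<lambda>j. if j = int_encode k then c else 0)"
    by (intro ext if_cong) auto
  then show ?thesis using sums_single[of "int_encode k" "\<lambda>j. c"] by simp
qed

text \<open>The Fourier coefficient in \<open>p\<close> of the Bessel potential of the transform, as a function of the angle. The sign of the
  frequency comes from the bilinear pairing.\<close>

definition mode :: "(real \<Rightarrow> real \<Rightarrow> complex) \<Rightarrow> real \<Rightarrow> int \<Rightarrow> real \<Rightarrow> complex" where
  "mode A s k t = of_real (bessel_weight s k) * A (- of_int k) t"

definition mode_norm :: "(real \<Rightarrow> real \<Rightarrow> complex) \<Rightarrow> real \<Rightarrow> int \<Rightarrow> real" where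
  "mode_norm A s k = (LINT t:{0..2 * pi}|lborel. (cmod (mode A s k t))\<^sup>2)"

lemma mode_norm_nonneg: "mode_norm A s k \<ge> 0"
  unfolding mode_norm_def set_lebesgue_integral_def by (intro Bochner_Integration.integral_nonneg) auto

text \<open>All that is needed about the distribution on the manifold of lines is how it pairs with Bessel
  potentials of test functions.\<close>

context
  fixes A :: "real \<Rightarrow> real \<Rightarrow> complex" and v :: "((real^2) \<times> (real^2) \<Rightarrow> complex) \<Rightarrow> complex" and s :: real
  assumes A_cont: "continuous_on UNIV (\<lambda>z. A (fst z) (snd z))"
    and A_circ: "\<And>\<sigma> t t'. circ t = circ t' \<Longrightarrow> A \<sigma> t = A \<sigma> t'"
    and v: "\<And>\<psi>. smooth_Z \<psi> \<Longrightarrow> periodic_Z \<psi> \<Longrightarrow>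
       (\<lambda>j. let k = int_decode j in integral {0..2 * pi} (\<lambda>t. of_real (bessel_weight s k) * fourier_coeff_Z \<psi> k (circ t) * A (- of_int k) t))
          sums v (bessel_Z s \<psi>)"
begin

lemma mode_continuous: "continuous_on S (mode A s k)"
  unfolding mode_def[abs_def]
  by (intro continuous_intros continuous_on_compose_pair[OF A_cont])

lemma mode_circ: "circ t = circ t' \<Longrightarrow> mode A s k t = mode A s k t'"
  using A_circ[of t t' "- of_int k"] by (simp add: mode_def)

lemma v_Z_mode: "v (bessel_Z s (Z_mode k m)) = (LINT t:{0..2 * pi}|lborel. mode A s k t * char_exp (of_int m) t)"
proof -
  have c: "continuous_on {0..2 * pi} (\<lambda>t. mode A s k t * char_exp (of_int m) t)"
    by (intro continuous_intros mode_continuous)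
  have "(let k' = int_decode j in integral {0..2 * pi} (\<lambda>t. of_real (bessel_weight s k') * fourier_coeff_Z (Z_mode k m) k' (circ t) * A (- of_int k') t))
      = (if int_decode j = k then integral {0..2 * pi} (\<lambda>t. mode A s k t * char_exp (of_int m) t) else 0)" for j
  proof -
    have "(\<lambda>t. of_real (bessel_weight s k') * (if k' = k then char_exp (of_int m) t else 0) * A (- of_int k') t)
       = (if k' = k then (\<lambda>t. mode A s k t * char_exp (of_int m) t) else (\<lambda>t. 0))" for k'
      by (auto simp: mode_def fun_eq_iff)
    then show ?thesis unfolding fourier_coeff_Z_mode Let_def by simp
  qed
  then have "(\<lambda>j. if int_decode j = k then integral {0..2 * pi} (\<lambda>t. mode A s k t * char_exp (of_int m) t) else 0) sums v (bessel_Z s (Z_mode k m))"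
    using v[OF smooth_Z_mode[of k m]] by simp
  from sums_unique2[OF this sums_int_decode_single]
  show ?thesis using set_borel_integral_eq_integral(2)[OF set_integrable_continuous_interval[OF c]] by simp
qed

text \<open>Testing with the characters identifies the Fourier coefficients of the square integrable
  function that represents the Bessel potential. Bessel's inequality on the torus bounds their squares, and by
  Parseval in the angle these add up to the norms of the modes.\<close>

lemma sobolev_Z_imp_summable:
  assumes "sobolev_Z s v" shows "summable (\<lambda>j. mode_norm A s (int_decode j))"
proof -
  obtain F where F: "F \<in> borel_measurable Z_measure" "integrable Z_measure (\<lambda>\<zeta>. (cmod (F \<zeta>))\<^sup>2)"
    "\<And>\<psi>. smooth_Z \<psi> \<Longrightarrow> periodic_Z \<psi> \<Longrightarrow> v (bessel_Z s \<psi>) = (LINT \<zeta>|Z_measure. F \<zeta> * \<psi> \<zeta>)"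
    using assms unfolding sobolev_Z_def by blast
  interpret finite_measure Z_measure by (rule finite_measure_Z)
  define c where "c k m = (LINT t:{0..2 * pi}|lborel. mode A s k t * char_exp (of_int m) t)" for k m
  define N where "N = 2 * pi * (LINT \<zeta>|Z_measure. (cmod (F \<zeta>))\<^sup>2)"
  have bes: "(\<Sum>i\<in>I. (cmod (c (fst i) (snd i)))\<^sup>2) \<le> 2 * pi * N" if "finite I" for I
  proof -
    define E where "E i = Z_mode (- fst i) (- snd i)" for i
    have cE: "(LINT \<zeta>|Z_measure. F \<zeta> * cnj (E i \<zeta>)) = c (fst i) (snd i)" for i
    proof -
      have "cnj (E i \<zeta>) = Z_mode (fst i) (snd i) \<zeta>" for \<zeta> by (simp add: Z_mode_def E_def)
      then show ?thesis using F(3)[OF smooth_Z_mode[of "fst i" "snd i"]] v_Z_mode[of "fst i" "snd i"] by (simp add: c_def)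
    qed
    have "(\<Sum>i\<in>I. (cmod (LINT \<zeta>|Z_measure. F \<zeta> * cnj (E i \<zeta>)))\<^sup>2) \<le> (2 * pi)\<^sup>2 * (LINT \<zeta>|Z_measure. (cmod (F \<zeta>))\<^sup>2)"
    proof (rule bessel_inequality[OF F(1,2) that])
      show "(LINT \<zeta>|Z_measure. E i \<zeta> * cnj (E j \<zeta>)) = (if i = j then complex_of_real ((2 * pi)\<^sup>2) else 0)" for i j
        unfolding E_def Z_mode_mult_cnj integral_Z_mode by (rule if_cong) (auto simp: prod_eq_iff)
    qed (auto simp: E_def)
    also have "\<dots> = 2 * pi * N" by (simp add: N_def power2_eq_square)
    finally show ?thesis unfolding cE .
  qed
  have fin: "(\<Sum>k\<in>S. mode_norm A s k) \<le> N" if S: "finite S" for S :: "int set"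
  proof (rule field_le_epsilon)
    fix e :: real assume e: "e > 0"
    define d where "d = e / (real (card S) + 1)"
    have d: "d > 0" "real (card S) * d \<le> e" using e by (auto simp: d_def field_simps)
    have "\<forall>k. \<exists>I. finite I \<and> mode_norm A s k \<le> (\<Sum>m\<in>I. (cmod (LINT t:{0..2 * pi}|lborel. mode A s k t * char_exp (- of_int m) t))\<^sup>2) / (2 * pi) + d"
    proof
      fix k
      have "mode A s k (0 + 2 * pi) = mode A s k 0" using mode_circ[OF circ_add_2pi[of 0]] by simp
      then obtain J where "finite J" "(LINT t:{0..0 + 2 * pi}|lborel. (cmod (mode A s k t))\<^sup>2) \<le>
         (\<Sum>m\<in>J. (cmod (LINT t:{0..0 + 2 * pi}|lborel. mode A s k t * char_exp (- of_int m) t))\<^sup>2) / (2 * pi) + d"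
        by (rule parseval_approx[OF mode_continuous _ d(1)]) blast
      then show "\<exists>I. finite I \<and> mode_norm A s k \<le> (\<Sum>m\<in>I. (cmod (LINT t:{0..2 * pi}|lborel. mode A s k t * char_exp (- of_int m) t))\<^sup>2) / (2 * pi) + d"
        unfolding mode_norm_def by (intro exI[of _ J]) simp
    qed
    from choice[OF this] obtain I where "\<forall>k. finite (I k) \<and> mode_norm A s k \<le>
       (\<Sum>m\<in>I k. (cmod (LINT t:{0..2 * pi}|lborel. mode A s k t * char_exp (- of_int m) t))\<^sup>2) / (2 * pi) + d" ..
    then have I: "\<And>k. finite (I k)" "\<And>k. mode_norm A s k \<le> (\<Sum>m\<in>I k. (cmod (c k (- m)))\<^sup>2) / (2 * pi) + d"
      by (simp_all add: c_def)
    have "(\<Sum>k\<in>S. mode_norm A s k) \<le> (\<Sum>k\<in>S. (\<Sum>m\<in>I k. (cmod (c k (- m)))\<^sup>2) / (2 * pi) + d)"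
      by (intro sum_mono I)
    also have "\<dots> = (\<Sum>k\<in>S. \<Sum>m\<in>I k. (cmod (c k (- m)))\<^sup>2) / (2 * pi) + card S * d"
      by (simp add: sum.distrib sum_divide_distrib)
    also have "(\<Sum>k\<in>S. \<Sum>m\<in>I k. (cmod (c k (- m)))\<^sup>2) = (\<Sum>i\<in>(\<lambda>x. (fst x, - snd x)) ` Sigma S I. (cmod (c (fst i) (snd i)))\<^sup>2)"
    proof -
      have "(\<Sum>k\<in>S. \<Sum>m\<in>I k. (cmod (c k (- m)))\<^sup>2) = (\<Sum>x\<in>Sigma S I. (cmod (c (fst x) (- snd x)))\<^sup>2)"
        using S I(1) by (simp add: sum.Sigma case_prod_unfold)
      then show ?thesis by (subst sum.reindex) (auto simp: inj_on_def prod_eq_iff)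
    qed
    also have "\<dots> \<le> 2 * pi * N" using S I(1) by (intro bes) auto
    finally have "(\<Sum>k\<in>S. mode_norm A s k) \<le> 2 * pi * N / (2 * pi) + card S * d" by (simp add: divide_right_mono)
    then show "(\<Sum>k\<in>S. mode_norm A s k) \<le> N + e" using d(2) by simp
  qed
  have "(\<Sum>j<n. mode_norm A s (int_decode j)) \<le> N" for n
    using fin[of "int_decode ` {..<n}"] by (simp add: sum.reindex[OF inj_on_subset[OF inj_int_decode subset_UNIV]])
  then show ?thesis by (intro summableI_nonneg_bounded mode_norm_nonneg)
qed

text \<open>The modes, each multiplied by its character in \<open>p\<close>, are orthogonal on the manifold, so their series converges
  in \<open>L\<^sup>2\<close> to the desired function.\<close>

lemma summable_imp_sobolev_Z:
  assumes sm: "summable (\<lambda>j. mode_norm A s (int_decode j))" shows "sobolev_Z s v"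
proof -
  interpret finite_measure Z_measure by (rule finite_measure_Z)
  define U where "U k \<zeta> = mode A s k (angle (snd \<zeta>)) * Z_mode (- k) 0 \<zeta> / (2 * pi)" for k \<zeta>
  have mode_meas [measurable]: "mode A s k \<in> borel_measurable borel" for k
    by (intro borel_measurable_continuous_onI mode_continuous)
  have Um [measurable]: "U k \<in> borel_measurable borel" for k unfolding U_def[abs_def] by measurable
  have Ul: "U k (line_pt p (circ t)) = mode A s k t * char_exp (- of_int k) p / (2 * pi)" for k p t
    using mode_circ[OF circ_angle[of "circ t"], of k]
    by (simp add: U_def Z_mode_line_pt) (simp add: line_pt_def)
  have mode_bound: "\<exists>B. \<forall>t. cmod (mode A s k t) \<le> B" for k
  proof -
    have "compact (mode A s k ` {0..2 * pi})" by (intro compact_continuous_image mode_continuous) auto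
    then obtain B where B: "\<forall>y\<in>mode A s k ` {0..2 * pi}. cmod y \<le> B" unfolding compact_eq_bounded_closed bounded_iff by blast
    have "cmod (mode A s k t) \<le> B" for t
    proof -
      obtain t0 where t0: "t0 \<in> {0..2 * pi}" "circ t0 = circ t" using circ_in_interval by blast
      then have "cmod (mode A s k t0) \<le> B" using B by blast
      then show ?thesis using mode_circ[OF t0(2)] by simp
    qed
    then show ?thesis by blast
  qed
  have Ub: "\<exists>B. \<forall>\<zeta>. cmod (U k \<zeta>) \<le> B" for k
  proof -
    obtain B where "\<And>t. cmod (mode A s k t) \<le> B" using mode_bound by blast
    then have "cmod (U k \<zeta>) \<le> B / (2 * pi)" for \<zeta>
      by (simp add: U_def norm_mult norm_divide divide_right_mono)
    then show ?thesis by blast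
  qed
  have bint: "integrable Z_measure f" if f: "f \<in> borel_measurable borel" "\<exists>B. \<forall>\<zeta>. cmod (f \<zeta>) \<le> B" for f :: "_ \<Rightarrow> complex"
  proof -
    obtain B where "\<And>\<zeta>. cmod (f \<zeta>) \<le> B" using f(2) by blast
    then show ?thesis using f(1) by (intro integrable_const_bound[where B=B]) auto
  qed
  have UU: "(LINT \<zeta>|Z_measure. U k \<zeta> * cnj (U k' \<zeta>)) = (if k = k' then complex_of_real (mode_norm A s k / (2 * pi)) else 0)" for k k'
  proof -
    obtain B B' where "\<And>\<zeta>. cmod (U k \<zeta>) \<le> B" "\<And>\<zeta>. cmod (U k' \<zeta>) \<le> B'" using Ub by metis
    then have "cmod (U k \<zeta> * cnj (U k' \<zeta>)) \<le> B * B'" for \<zeta>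
      unfolding norm_mult complex_mod_cnj by (intro mult_mono) (auto intro: order_trans[OF norm_ge_zero])
    then have "integrable Z_measure (\<lambda>\<zeta>. U k \<zeta> * cnj (U k' \<zeta>))" by (intro bint) auto
    then have "(LINT \<zeta>|Z_measure. U k \<zeta> * cnj (U k' \<zeta>)) =
        (LINT t:{0..2 * pi}|lborel. LINT p:{-pi..pi}|lborel. U k (line_pt p (circ t)) * cnj (U k' (line_pt p (circ t))))"
      by (intro integral_Z_iterated) auto
    also have "\<dots> = (LINT t:{0..2 * pi}|lborel. LINT p:{-pi..pi}|lborel. (mode A s k t * cnj (mode A s k' t) / (2 * pi)\<^sup>2) * char_exp (of_int (k' - k)) p)"
    proof -
      have "char_exp (of_int (k' - k)) p = char_exp (of_int k') p * char_exp (- of_int k) p" for p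
        by (simp add: char_exp_mult)
      then have "mode A s k t * char_exp (- of_int k) p / (2 * pi) * cnj (mode A s k' t * char_exp (- of_int k') p / (2 * pi))
          = (mode A s k t * cnj (mode A s k' t) / (2 * pi)\<^sup>2) * char_exp (of_int (k' - k)) p" for p t
        by (simp add: power2_eq_square)
      then show ?thesis unfolding Ul by (simp only:)
    qed
    also have "\<dots> = (LINT t:{0..2 * pi}|lborel. (mode A s k t * cnj (mode A s k' t) / (2 * pi)\<^sup>2) * (LINT p:{-pi..-pi + 2 * pi}|lborel. char_exp (of_int (k' - k)) p))"
      by simp
    also have "\<dots> = (if k = k' then complex_of_real (mode_norm A s k / (2 * pi)) else 0)"
    proof (cases "k = k'")
      case True
      have "(mode A s k t * cnj (mode A s k' t) / (2 * pi)\<^sup>2) * (LINT p:{-pi..-pi + 2 * pi}|lborel. char_exp (of_int (k' - k)) p)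
          = complex_of_real ((cmod (mode A s k t))\<^sup>2 / (2 * pi))" for t
        unfolding char_exp_integral using True
        by (simp only: of_real_divide complex_norm_square) (simp add: power2_eq_square)
      then show ?thesis using True by (simp add: mode_norm_def set_lebesgue_integral_def scaleR_conv_of_real
            of_real_mult[symmetric] del: of_real_mult of_real_divide)
    next
      case False
      then show ?thesis unfolding char_exp_integral by simp
    qed
    finally show ?thesis .
  qed
  define u where "u j = U (int_decode j)" for j
  have um: "u j \<in> borel_measurable borel" for j by (simp add: u_def)
  have norms: "integrable Z_measure (\<lambda>\<zeta>. (cmod (\<Sum>j=m..<n. u j \<zeta>))\<^sup>2)"
    "(LINT \<zeta>|Z_measure. (cmod (\<Sum>j=m..<n. u j \<zeta>))\<^sup>2) = (\<Sum>j=m..<n. mode_norm A s (int_decode j) / (2 * pi))" for m n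
  proof -
    have "integrable Z_measure (\<lambda>\<zeta>. u i \<zeta> * cnj (u j \<zeta>))" for i j
    proof -
      obtain B B' where "\<And>\<zeta>. cmod (u i \<zeta>) \<le> B" "\<And>\<zeta>. cmod (u j \<zeta>) \<le> B'" unfolding u_def using Ub by metis
      then have "cmod (u i \<zeta> * cnj (u j \<zeta>)) \<le> B * B'" for \<zeta>
        unfolding norm_mult complex_mod_cnj by (intro mult_mono) (auto intro: order_trans[OF norm_ge_zero])
      then show ?thesis using um by (intro bint) auto
    qed
    then have hb: "has_bochner_integral Z_measure (\<lambda>\<zeta>. u i \<zeta> * cnj (u j \<zeta>)) (if i = j then complex_of_real (mode_norm A s (int_decode j) / (2 * pi)) else 0)" for i j
      using UU[of "int_decode i" "int_decode j"] by (simp add: has_bochner_integral_iff u_def inj_eq[OF inj_int_decode])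
    have "has_bochner_integral Z_measure (\<lambda>\<zeta>. \<Sum>i=m..<n. \<Sum>j=m..<n. u i \<zeta> * cnj (u j \<zeta>))
       (\<Sum>i=m..<n. \<Sum>j=m..<n. if i = j then complex_of_real (mode_norm A s (int_decode j) / (2 * pi)) else 0)"
      by (intro has_bochner_integral_sum hb)
    moreover have "(\<Sum>i=m..<n. \<Sum>j=m..<n. u i \<zeta> * cnj (u j \<zeta>)) = complex_of_real ((cmod (\<Sum>j=m..<n. u j \<zeta>))\<^sup>2)" for \<zeta>
      by (simp only: complex_norm_square cnj_sum sum_product)
    moreover have "(\<Sum>i=m..<n. \<Sum>j=m..<n. if i = j then complex_of_real (mode_norm A s (int_decode j) / (2 * pi)) else 0)
        = complex_of_real (\<Sum>j=m..<n. mode_norm A s (int_decode j) / (2 * pi))" by simp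
    ultimately have "has_bochner_integral Z_measure (\<lambda>\<zeta>. complex_of_real ((cmod (\<Sum>j=m..<n. u j \<zeta>))\<^sup>2)) (complex_of_real (\<Sum>j=m..<n. mode_norm A s (int_decode j) / (2 * pi)))"
      by simp
    from has_bochner_integral_bounded_linear[OF bounded_linear_Re this]
    have "has_bochner_integral Z_measure (\<lambda>\<zeta>. (cmod (\<Sum>j=m..<n. u j \<zeta>))\<^sup>2) (\<Sum>j=m..<n. mode_norm A s (int_decode j) / (2 * pi))"
      by (simp only: Re_complex_of_real)
    then show "integrable Z_measure (\<lambda>\<zeta>. (cmod (\<Sum>j=m..<n. u j \<zeta>))\<^sup>2)"
      "(LINT \<zeta>|Z_measure. (cmod (\<Sum>j=m..<n. u j \<zeta>))\<^sup>2) = (\<Sum>j=m..<n. mode_norm A s (int_decode j) / (2 * pi))"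
      by (auto simp: has_bochner_integral_iff)
  qed
  have um': "u j \<in> borel_measurable Z_measure" for j using um by simp
  obtain F where F: "F \<in> borel_measurable Z_measure" "integrable Z_measure (\<lambda>\<zeta>. (cmod (F \<zeta>))\<^sup>2)"
    "\<And>h H. h \<in> borel_measurable Z_measure \<Longrightarrow> (\<And>\<zeta>. cmod (h \<zeta>) \<le> H) \<Longrightarrow>
       (\<lambda>n. \<Sum>j<n. LINT \<zeta>|Z_measure. u j \<zeta> * h \<zeta>) \<longlonglongrightarrow> (LINT \<zeta>|Z_measure. F \<zeta> * h \<zeta>)"
    by (rule riesz_fischer[OF um' summable_divide[OF sm, of "2 * pi"] norms(1) eq_refl[OF norms(2)]]) blast+
  \<comment> \<open>A test function is determined by smoothness on the manifold only and may fail to be measurable elsewhere, so the candidate is set to zero off the manifold.\<close>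
  define Zp :: "((real^2) \<times> (real^2)) set" where
    "Zp = {\<zeta>. norm (snd \<zeta>) = 1 \<and> fst \<zeta> \<bullet> snd \<zeta> = 0 \<and> \<bar>fst \<zeta> \<bullet> perp (snd \<zeta>)\<bar> \<le> pi}"
  have "closed Zp" unfolding Zp_def
    by (intro closed_Collect_conj closed_Collect_eq closed_Collect_le continuous_intros)
  then have Zps [measurable]: "Zp \<in> sets borel" by simp
  define F' where "F' \<zeta> = indicator Zp \<zeta> * F \<zeta>" for \<zeta>
  show ?thesis unfolding sobolev_Z_def
  proof (intro exI[of _ F'] conjI allI impI)
    have [measurable]: "F \<in> borel_measurable borel" using F(1) by simp
    show F'm: "F' \<in> borel_measurable Z_measure" unfolding F'_def[abs_def] by simp
    show "integrable Z_measure (\<lambda>\<zeta>. (cmod (F' \<zeta>))\<^sup>2)"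
    proof (rule Bochner_Integration.integrable_bound[OF F(2)])
      show "AE \<zeta> in Z_measure. norm ((cmod (F' \<zeta>))\<^sup>2) \<le> norm ((cmod (F \<zeta>))\<^sup>2)"
        by (auto simp: F'_def indicator_def)
    qed (use F'm in auto)
    fix \<psi> assume \<psi>: "smooth_Z \<psi>" "periodic_Z \<psi>"
    define P where "P p t = \<psi> (line_pt p (circ t))" for p t
    have Pc: "continuous_on UNIV (\<lambda>z. P (fst z) (snd z))"
      unfolding P_def by (rule smooth_family_continuous[OF smooth_Z_family[OF \<psi>(1)]])
    have "compact ((\<lambda>z. P (fst z) (snd z)) ` ({-pi..pi} \<times> {0..2 * pi}))"
      by (intro compact_continuous_image compact_Times continuous_on_subset[OF Pc]) auto
    then obtain H where "\<forall>y\<in>(\<lambda>z. P (fst z) (snd z)) ` ({-pi..pi} \<times> {0..2 * pi}). cmod y \<le> H"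
      unfolding compact_eq_bounded_closed bounded_iff by blast
    then have H: "cmod (P p t) \<le> H" if "p \<in> {-pi..pi}" "t \<in> {0..2 * pi}" for p t using that by force
    define h where "h \<zeta> = indicator Zp \<zeta> * P (fst \<zeta> \<bullet> perp (snd \<zeta>)) (angle (snd \<zeta>))" for \<zeta>
    have hb: "cmod (h \<zeta>) \<le> \<bar>H\<bar>" for \<zeta>
      using H[of "fst \<zeta> \<bullet> perp (snd \<zeta>)" "angle (snd \<zeta>)"] angle_bounds[of "snd \<zeta>"]
      by (cases "\<zeta> \<in> Zp") (auto simp: h_def Zp_def abs_le_iff)
    have Pm: "(\<lambda>z. P (fst z) (snd z)) \<in> borel_measurable (borel \<Otimes>\<^sub>M borel)"
      unfolding borel_prod by (rule borel_measurable_continuous_onI[OF Pc])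
    have "(\<lambda>\<zeta>. (fst \<zeta> \<bullet> perp (snd \<zeta>), angle (snd \<zeta>))) \<in> borel \<rightarrow>\<^sub>M borel \<Otimes>\<^sub>M borel" by measurable
    from measurable_compose[OF this Pm]
    have [measurable]: "(\<lambda>\<zeta>. P (fst \<zeta> \<bullet> perp (snd \<zeta>)) (angle (snd \<zeta>))) \<in> borel_measurable borel" by simp
    have hm [measurable]: "h \<in> borel_measurable borel" unfolding h_def[abs_def] by measurable
    \<comment> \<open>on the part of the manifold that carries the measure, the test function is determined by its values in coordinates\<close>
    have h\<psi>: "F' \<zeta> * \<psi> \<zeta> = F \<zeta> * h \<zeta>" for \<zeta>
    proof (cases "\<zeta> \<in> Zp")
      case True
      obtain z \<theta> where z: "\<zeta> = (z, \<theta>)" by (cases \<zeta>)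
      have n: "norm \<theta> = 1" "z \<bullet> \<theta> = 0" using True by (auto simp: Zp_def z)
      have "z = (z \<bullet> perp \<theta>) *\<^sub>R perp \<theta>"
      proof -
        have "\<theta> \<bullet> \<theta> = 1" using n(1) by (simp add: norm_eq_1)
        then have 1: "\<theta> $ 1 * \<theta> $ 1 + \<theta> $ 2 * \<theta> $ 2 = 1" by (simp add: inner_vec_def sum_2)
        have 2: "z $ 1 * \<theta> $ 1 + z $ 2 * \<theta> $ 2 = 0" using n(2) by (simp add: inner_vec_def sum_2)
        have "z $ 1 = (z $ 1 * (- \<theta> $ 2) + z $ 2 * \<theta> $ 1) * (- \<theta> $ 2)"
          "z $ 2 = (z $ 1 * (- \<theta> $ 2) + z $ 2 * \<theta> $ 1) * \<theta> $ 1" using 1 2 by algebra+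
        then show ?thesis by (simp add: vec_eq_iff forall_2 perp_def inner_vec_def sum_2)
      qed
      then have "\<zeta> = line_pt (z \<bullet> perp \<theta>) (circ (angle \<theta>))" by (simp add: z line_pt_def circ_angle[OF n(1)])
      then have "\<psi> \<zeta> = \<psi> (line_pt (z \<bullet> perp \<theta>) (circ (angle \<theta>)))" by (rule arg_cong)
      then have "\<psi> \<zeta> = P (fst \<zeta> \<bullet> perp (snd \<zeta>)) (angle (snd \<zeta>))" by (simp only: P_def z fst_conv snd_conv)
      then show ?thesis using True by (simp add: F'_def h_def)
    qed (simp add: F'_def h_def)
    have hl: "h (line_pt p (circ t)) = P p t" if "p \<in> {-pi..pi}" for p t
    proof -
      have "line_pt p (circ t) \<in> Zp" using that line_pt_coords[of "circ t" p]
        by (auto simp: Zp_def line_pt_def inner_perp)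
      moreover have "P p (angle (circ t)) = P p t" using circ_angle[of "circ t"] by (simp add: P_def)
      ultimately show ?thesis using line_pt_coords[of "circ t" p] by (simp add: h_def) (simp add: line_pt_def)
    qed
    have "(LINT \<zeta>|Z_measure. U k \<zeta> * h \<zeta>) = integral {0..2 * pi} (\<lambda>t. of_real (bessel_weight s k) * fourier_coeff_Z \<psi> k (circ t) * A (- of_int k) t)" for k
    proof -
      obtain B where "\<And>\<zeta>. cmod (U k \<zeta>) \<le> B" using Ub by blast
      then have "cmod (U k \<zeta> * h \<zeta>) \<le> B * \<bar>H\<bar>" for \<zeta>
        unfolding norm_mult by (intro mult_mono hb) (auto intro: order_trans[OF norm_ge_zero])
      then have "integrable Z_measure (\<lambda>\<zeta>. U k \<zeta> * h \<zeta>)" by (intro bint) auto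
      then have "(LINT \<zeta>|Z_measure. U k \<zeta> * h \<zeta>) = (LINT t:{0..2 * pi}|lborel. LINT p:{-pi..pi}|lborel. U k (line_pt p (circ t)) * h (line_pt p (circ t)))"
        by (intro integral_Z_iterated) auto
      also have "\<dots> = (LINT t:{0..2 * pi}|lborel. LINT p:{-pi..pi}|lborel. (mode A s k t / (2 * pi)) * (P p t * char_exp (- of_int k) p))"
        by (intro set_lebesgue_integral_cong allI impI) (auto simp: Ul hl)
      also have "\<dots> = (LINT t:{0..2 * pi}|lborel. of_real (bessel_weight s k) * fourier_coeff_Z \<psi> k (circ t) * A (- of_int k) t)"
        unfolding set_integral_mult_right by (simp add: fourier_coeff_Z_char mode_def P_def mult_ac)
      also have "\<dots> = integral {0..2 * pi} (\<lambda>t. of_real (bessel_weight s k) * fourier_coeff_Z \<psi> k (circ t) * A (- of_int k) t)"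
        by (intro set_borel_integral_eq_integral set_integrable_continuous_interval continuous_intros
            continuous_on_compose_pair[OF A_cont] continuous_on_subset[OF fourier_coeff_Z_continuous[OF \<psi>(1)]]) auto
      finally show ?thesis .
    qed
    then have "(\<lambda>j. LINT \<zeta>|Z_measure. u j \<zeta> * h \<zeta>) sums v (bessel_Z s \<psi>)"
      using v[OF \<psi>] by (simp add: u_def Let_def)
    moreover have "(\<lambda>j. LINT \<zeta>|Z_measure. u j \<zeta> * h \<zeta>) sums (LINT \<zeta>|Z_measure. F \<zeta> * h \<zeta>)"
      unfolding sums_def using F(3)[of h "\<bar>H\<bar>"] hb by simp
    ultimately have "v (bessel_Z s \<psi>) = (LINT \<zeta>|Z_measure. F \<zeta> * h \<zeta>)" by (rule sums_unique2)
    then show "v (bessel_Z s \<psi>) = (LINT \<zeta>|Z_measure. F' \<zeta> * \<psi> \<zeta>)" by (simp add: h\<psi>)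
  qed
qed

end

section \<open>Integration over the plane\<close>

lemma Basis_vec2: "(Basis :: (real^2) set) = {axis 1 1, axis 2 1}"
  by (auto simp: Basis_vec_def UNIV_2)

lemma prod_Basis_vec2: "(\<Prod>b\<in>(Basis :: (real^2) set). f b) = f (axis 1 1) * f (axis 2 1)"
  unfolding Basis_vec2 by (subst prod.insert) (auto simp: axis_eq_axis)

lemma inner_axis_vec2: "(x :: real^2) \<bullet> axis i 1 = x $ i"
  by (simp add: inner_axis)

lemma continuous_on_vec2 [continuous_intros]:
  "continuous_on S f \<Longrightarrow> continuous_on S g \<Longrightarrow> continuous_on S (\<lambda>x. vector [f x, g x] :: real^2)"
  unfolding vec2_eq by (intro continuous_intros)

lemma measurable_vec2: "(\<lambda>x. vector [fst x, snd x] :: real^2) \<in> borel_measurable borel"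
  by (intro borel_measurable_continuous_onI continuous_intros)

lemma lborel_vec2: "(lborel :: (real^2) measure) = distr lborel borel (\<lambda>x :: real \<times> real. vector [fst x, snd x])"
proof (rule lborel_eqI)
  fix l u :: "real^2" assume le: "\<And>b. b \<in> Basis \<Longrightarrow> l \<bullet> b \<le> u \<bullet> b"
  have le': "l $ 1 \<le> u $ 1" "l $ 2 \<le> u $ 2" using le[of "axis 1 1"] le[of "axis 2 1"] by (auto simp: Basis_vec2 inner_axis_vec2)
  have "(\<lambda>x :: real \<times> real. vector [fst x, snd x] :: real^2) -` box l u = box (l $ 1, l $ 2) (u $ 1, u $ 2)"
    by (auto simp: box_def Basis_vec2 Basis_prod_def inner_axis_vec2)
  then have "emeasure (distr lborel borel (\<lambda>x :: real \<times> real. vector [fst x, snd x])) (box l u) = emeasure lborel (box (l $ 1, l $ 2) (u $ 1, u $ 2))"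
    using measurable_vec2 by (subst emeasure_distr) auto
  also have "\<dots> = ennreal ((u $ 1 - l $ 1) * (u $ 2 - l $ 2))"
    using le' by (subst emeasure_lborel_box) (auto simp: Basis_prod_def)
  finally show "emeasure (distr lborel borel (\<lambda>x :: real \<times> real. vector [fst x, snd x])) (box l u) = ennreal (\<Prod>b\<in>Basis. (u - l) \<bullet> b)"
    by (simp add: prod_Basis_vec2 inner_axis_vec2)
qed simp

lemma integrable_vec2_iff:
  fixes f :: "real^2 \<Rightarrow> 'b::{banach, second_countable_topology}"
  assumes "f \<in> borel_measurable borel"
  shows "integrable lborel f \<longleftrightarrow> integrable (lborel \<Otimes>\<^sub>M lborel) (\<lambda>(x, y). f (vector [x, y]))"
  by (subst lborel_vec2, subst integrable_distr_eq) (use assms measurable_vec2 in \<open>auto simp: lborel_prod case_prod_unfold\<close>)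

lemma integral_vec2:
  fixes f :: "real^2 \<Rightarrow> 'b::{banach, second_countable_topology}"
  assumes "f \<in> borel_measurable borel"
  shows "(LINT x|lborel. f x) = (LINT z|(lborel \<Otimes>\<^sub>M lborel). (case z of (x, y) \<Rightarrow> f (vector [x, y])))"
  by (subst lborel_vec2, subst integral_distr) (use assms measurable_vec2 in \<open>auto simp: lborel_prod case_prod_unfold\<close>)

lemma integral_plane_affine:
  fixes f :: "real^2 \<Rightarrow> 'b::{banach, second_countable_topology}"
  assumes [measurable]: "f \<in> borel_measurable borel" and c: "c \<noteq> 0"
  shows "(LINT x|lborel. f x) = c\<^sup>2 *\<^sub>R (LINT x|lborel. f (t + c *\<^sub>R x))"
    and "integrable lborel f \<longleftrightarrow> integrable lborel (\<lambda>x. f (t + c *\<^sub>R x))"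
proof -
  have m [measurable]: "(\<lambda>x::real^2. t + c *\<^sub>R x) \<in> borel_measurable borel"
    by (intro borel_measurable_continuous_onI continuous_intros)
  have fm: "(\<lambda>x. f (t + c *\<^sub>R x)) \<in> borel_measurable borel" by measurable
  have eq: "(lborel :: (real^2) measure) = density (distr lborel borel (\<lambda>x. t + c *\<^sub>R x)) (\<lambda>_. ennreal (c\<^sup>2))"
    using lborel_affine[OF c, of t] by (simp add: ennreal_power[symmetric])
  show "(LINT x|lborel. f x) = c\<^sup>2 *\<^sub>R (LINT x|lborel. f (t + c *\<^sub>R x))"
    by (subst eq, subst integral_density) (auto simp: integral_distr)
  show "integrable lborel f \<longleftrightarrow> integrable lborel (\<lambda>x. f (t + c *\<^sub>R x))"
  proof -
    have "integrable lborel f \<longleftrightarrow> integrable lborel (\<lambda>x. c\<^sup>2 *\<^sub>R f (t + c *\<^sub>R x))"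
      by (subst eq, subst integrable_density) (auto simp: integrable_distr_eq)
    also have "\<dots> \<longleftrightarrow> integrable lborel (\<lambda>x. f (t + c *\<^sub>R x))"
    proof
      assume a: "integrable lborel (\<lambda>x. c\<^sup>2 *\<^sub>R f (t + c *\<^sub>R x))"
      have i: "integrable lborel (\<lambda>x. inverse (c\<^sup>2) *\<^sub>R (c\<^sup>2 *\<^sub>R f (t + c *\<^sub>R x)))"
        by (rule integrable_scaleR_right) (rule a)
      have "(\<lambda>x. inverse (c\<^sup>2) *\<^sub>R (c\<^sup>2 *\<^sub>R f (t + c *\<^sub>R x))) = (\<lambda>x. f (t + c *\<^sub>R x))" using c by simp
      from i[unfolded this] show "integrable lborel (\<lambda>x. f (t + c *\<^sub>R x))" .
    qed auto
    finally show ?thesis .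
  qed
qed

lemma integrable_inverse_square: "integrable lborel (\<lambda>x::real. inverse (1 + x\<^sup>2))"
  using integrable_inverse_1_plus_square by (simp add: set_integrable_def einterval_def)

text \<open>The fourth power splits into an integrable factor for each of the two coordinates.\<close>

lemma integrable_decay:
  fixes f :: "real^2 \<Rightarrow> 'b::{banach, second_countable_topology}"
  assumes [measurable]: "f \<in> borel_measurable borel" and C: "\<And>x. (1 + norm x) ^ 4 * norm (f x) \<le> C"
  shows "integrable lborel f"
proof -
  let ?h = "\<lambda>x::real^2. inverse (1 + (x $ 1)\<^sup>2) * inverse (1 + (x $ 2)\<^sup>2)"
  have hm: "?h \<in> borel_measurable borel"
    by (intro borel_measurable_continuous_onI continuous_intros) (auto simp: add_nonneg_eq_0_iff)
  define q where "q x y = inverse (1 + x\<^sup>2) * inverse (1 + y\<^sup>2)" for x y :: real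
  have "integrable (lborel \<Otimes>\<^sub>M lborel) (\<lambda>(x, y). q x y)"
  proof (rule lborel_pair.Fubini_integrable)
    show "(\<lambda>(x, y). q x y) \<in> borel_measurable (lborel \<Otimes>\<^sub>M lborel)" unfolding q_def by measurable
    show "integrable lborel (\<lambda>x. LINT y|lborel. norm (case (x, y) of (x, y) \<Rightarrow> q x y))"
      using integrable_inverse_square by (simp add: abs_mult q_def)
    show "AE x in lborel. integrable lborel (\<lambda>y. case (x, y) of (x, y) \<Rightarrow> q x y)"
      using integrable_inverse_square by (simp add: q_def)
  qed
  then have "integrable lborel ?h" by (simp add: integrable_vec2_iff[OF hm] case_prod_unfold q_def)
  then have "integrable lborel (\<lambda>x. \<bar>C\<bar> * ?h x)" by simp
  then show ?thesis
  proof (rule Bochner_Integration.integrable_bound)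
    show "AE x in lborel. norm (f x) \<le> norm (\<bar>C\<bar> * ?h x)"
    proof (intro AE_I2)
      fix x :: "real^2"
      let ?q = "(1 + (x $ 1)\<^sup>2) * (1 + (x $ 2)\<^sup>2)"
      have n2: "(norm x)\<^sup>2 = (x $ 1)\<^sup>2 + (x $ 2)\<^sup>2"
        by (simp add: norm_vec_def L2_set_def sum_2)
      have "?q \<le> (1 + (norm x)\<^sup>2) * (1 + (norm x)\<^sup>2)" by (intro mult_mono) (auto simp: n2)
      also have "\<dots> \<le> (1 + norm x)\<^sup>2 * (1 + norm x)\<^sup>2"
        by (intro mult_mono) (auto simp: power2_sum)
      also have "\<dots> = (1 + norm x) ^ 4" by (simp add: power_add[symmetric])
      finally have q: "?q \<le> (1 + norm x) ^ 4" .
      have "?q * norm (f x) \<le> (1 + norm x) ^ 4 * norm (f x)" by (intro mult_right_mono q) auto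
      also have "\<dots> \<le> \<bar>C\<bar>" using C[of x] by linarith
      finally have "?q * norm (f x) \<le> \<bar>C\<bar>" .
      moreover have "?q > 0" by (intro mult_pos_pos add_pos_nonneg) auto
      ultimately have "norm (f x) \<le> \<bar>C\<bar> / ?q" by (simp add: pos_le_divide_eq mult.commute)
      also have "\<dots> = norm (\<bar>C\<bar> * ?h x)" by (simp add: abs_mult divide_inverse)
      finally show "norm (f x) \<le> norm (\<bar>C\<bar> * ?h x)" .
    qed
  qed simp
qed

section \<open>The Fourier transform of a Schwartz function decays\<close>

text \<open>By Fubini, the integral of the derivative over unit segments in the direction \<open>b\<close> is the
  difference of the integrals of two translates of \<open>g\<close>.\<close>

lemma integral_partial_derivative_zero:
  fixes g :: "real^2 \<Rightarrow> complex"
  assumes d: "\<And>x. (g has_derivative D x) (at x)" and c: "continuous_on UNIV (\<lambda>x. D x b)" and b: "norm b = 1"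
    and C: "\<And>x. (1 + norm x) ^ 4 * norm (g x) \<le> C" "\<And>x. (1 + norm x) ^ 4 * norm (D x b) \<le> C"
  shows "(LINT x|lborel. D x b) = 0"
proof -
  have gc: "continuous_on UNIV g" using d by (auto intro!: has_derivative_continuous_on)
  have gm [measurable]: "g \<in> borel_measurable borel" and Dm [measurable]: "(\<lambda>x. D x b) \<in> borel_measurable borel"
    using gc c by (auto intro: borel_measurable_continuous_onI)
  have gi: "integrable lborel g" and Di: "integrable lborel (\<lambda>x. D x b)"
    by (rule integrable_decay[OF _ C(1)]; simp) (rule integrable_decay[OF _ C(2)]; simp)
  define k where "k s x = indicator {0..1} s *\<^sub>R D (s *\<^sub>R b + 1 *\<^sub>R x) b" for s :: real and x
  have km: "case_prod k \<in> borel_measurable (lborel \<Otimes>\<^sub>M lborel)"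
  proof -
    have "(\<lambda>z::real \<times> (real^2). D (fst z *\<^sub>R b + 1 *\<^sub>R snd z) b) \<in> borel_measurable borel"
      by (intro borel_measurable_continuous_onI continuous_on_compose2[OF c] continuous_intros) auto
    then have [measurable]: "(\<lambda>z::real \<times> (real^2). D (fst z *\<^sub>R b + 1 *\<^sub>R snd z) b) \<in> borel_measurable (borel \<Otimes>\<^sub>M borel)"
      by (simp add: borel_prod)
    have "(\<lambda>z. indicator {0..1} (fst z) *\<^sub>R D (fst z *\<^sub>R b + 1 *\<^sub>R snd z) b) \<in> borel_measurable (borel \<Otimes>\<^sub>M borel)"
      by measurable
    then show ?thesis by (simp add: k_def case_prod_unfold cong: measurable_cong_sets sets_pair_measure_cong)
  qed
  have tr: "(LINT x|lborel. f (t + 1 *\<^sub>R x)) = (LINT x|lborel. f x)" if "f \<in> borel_measurable borel"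
    for f :: "real^2 \<Rightarrow> 'c::{banach, second_countable_topology}" and t
    using integral_plane_affine(1)[OF that, of 1 t] by simp
  have kint: "integrable (lborel \<Otimes>\<^sub>M lborel) (case_prod k)"
  proof (rule lborel_pair.Fubini_integrable[OF km])
    have "(LINT x|lborel. norm (case (s, x) of (s, x) \<Rightarrow> k s x)) = indicator {0..1} s * (LINT x|lborel. norm (D x b))" for s
      using tr[of "\<lambda>x. norm (D x b)" "s *\<^sub>R b"] by (simp add: k_def)
    then show "integrable lborel (\<lambda>s. LINT x|lborel. norm (case (s, x) of (s, x) \<Rightarrow> k s x))" by simp
    have "integrable lborel (\<lambda>x. D (s *\<^sub>R b + 1 *\<^sub>R x) b)" for s
      using integral_plane_affine(2)[OF Dm, of 1 "s *\<^sub>R b"] Di by simp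
    then show "AE s in lborel. integrable lborel (\<lambda>x. case (s, x) of (s, x) \<Rightarrow> k s x)" by (simp add: k_def)
  qed
  have "(LINT s|lborel. k s x) = g (b + 1 *\<^sub>R x) - g x" for x
  proof -
    have "((\<lambda>s. D (s *\<^sub>R b + 1 *\<^sub>R x) b) has_integral (g (1 *\<^sub>R b + 1 *\<^sub>R x) - g (0 *\<^sub>R b + 1 *\<^sub>R x))) {0..1}"
    proof (rule fundamental_theorem_of_calculus)
      fix s :: real
      have "((\<lambda>s. g (s *\<^sub>R b + 1 *\<^sub>R x)) has_derivative (\<lambda>h. D (s *\<^sub>R b + 1 *\<^sub>R x) (h *\<^sub>R b))) (at s within {0..1})"
        by (rule has_derivative_compose[where f="\<lambda>s. s *\<^sub>R b + 1 *\<^sub>R x" and g=g, OF _ d]) (auto intro!: derivative_eq_intros)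
      then show "((\<lambda>s. g (s *\<^sub>R b + 1 *\<^sub>R x)) has_vector_derivative D (s *\<^sub>R b + 1 *\<^sub>R x) b) (at s within {0..1})"
        unfolding has_vector_derivative_def
        by (rule has_derivative_eq_rhs) (simp add: linear_scale[OF has_derivative_linear[OF d]])
    qed simp
    moreover have "set_integrable lborel {0..1} (\<lambda>s. D (s *\<^sub>R b + 1 *\<^sub>R x) b)"
      by (intro set_integrable_continuous_interval continuous_on_compose2[OF c] continuous_intros) auto
    ultimately have "(LINT s:{0..1}|lborel. D (s *\<^sub>R b + 1 *\<^sub>R x) b) = g (b + 1 *\<^sub>R x) - g x"
      by (simp add: set_borel_integral_eq_integral integral_unique)
    then show ?thesis by (simp add: k_def set_lebesgue_integral_def)
  qed
  then have "(LINT x|lborel. LINT s|lborel. k s x) = (LINT x|lborel. g (b + 1 *\<^sub>R x) - g x)" by simp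
  also have "\<dots> = (LINT x|lborel. g (b + 1 *\<^sub>R x)) - (LINT x|lborel. g x)"
    using integral_plane_affine(2)[OF gm, of 1 b] gi by (intro Bochner_Integration.integral_diff) auto
  also have "\<dots> = 0" using tr[OF gm, of b] by simp
  finally have "0 = (LINT s|lborel. LINT x|lborel. k s x)"
    using lborel_pair.Fubini_integral[OF kint] by simp
  also have "\<dots> = (LINT x|lborel. D x b)" using tr[OF Dm] by (simp add: k_def)
  finally show ?thesis by simp
qed

definition ft :: "(real^2 \<Rightarrow> complex) \<Rightarrow> real^2 \<Rightarrow> complex" where
  "ft f \<xi> = (LINT x|lborel. char_exp 1 (x \<bullet> \<xi>) * f x)"

lemma inv_fourier_ft: "inv_fourier G \<phi> = 1 / (2 * complex_of_real pi)\<^sup>2 * (LINT \<xi>|lborel. G \<xi> * ft \<phi> \<xi>)"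
  by (simp add: inv_fourier_def ft_def char_exp_def)

lemma schwartz_partial:
  assumes "schwartz \<phi>" "b \<in> Basis" shows "schwartz (\<lambda>x. frechet_derivative \<phi> (at x) b)"
  unfolding schwartz_def
proof (intro conjI allI impI)
  show "smooth (\<lambda>x. frechet_derivative \<phi> (at x) b)" using assms smooth_partial by (auto simp: schwartz_def)
  fix vs :: "'a list" and N assume vs: "set vs \<subseteq> Basis"
  obtain C where "\<forall>x. (1 + norm x) ^ N * norm (iter_deriv (vs @ [b]) \<phi> x) \<le> C"
    using assms vs unfolding schwartz_def by (metis Un_subset_iff empty_set empty_subsetI insert_subset list.simps(15) set_append)
  then show "\<exists>C. \<forall>x. (1 + norm x) ^ N * norm (iter_deriv vs (\<lambda>x. frechet_derivative \<phi> (at x) b) x) \<le> C"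
    by (auto simp: iter_deriv_append)
qed

lemma schwartz_bound:
  assumes "schwartz \<phi>" obtains C where "\<And>x. (1 + norm x) ^ N * norm (\<phi> x) \<le> C"
proof -
  have "\<exists>C. \<forall>x. (1 + norm x) ^ N * norm (iter_deriv [] \<phi> x) \<le> C"
    using assms unfolding schwartz_def by (metis empty_set empty_subsetI)
  then show ?thesis using that by auto
qed

lemma schwartz_measurable: "schwartz \<phi> \<Longrightarrow> \<phi> \<in> borel_measurable borel"
  by (auto simp: schwartz_def intro: borel_measurable_continuous_onI smooth_continuous)

lemma schwartz_integrable:
  fixes \<phi> :: "real^2 \<Rightarrow> complex"
  assumes "schwartz \<phi>" shows "integrable lborel \<phi>"
  by (rule schwartz_bound[OF assms, of 4], rule integrable_decay[OF schwartz_measurable[OF assms]])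

lemma char_exp_times_integrable:
  fixes f :: "real^2 \<Rightarrow> complex"
  assumes "integrable lborel f" shows "integrable lborel (\<lambda>x. char_exp \<sigma> (x \<bullet> \<xi>) * f x)"
  by (rule Bochner_Integration.integrable_bound[OF assms])
     (use borel_measurable_integrable[OF assms] in \<open>auto simp: norm_mult\<close>)

lemma ft_partial:
  assumes \<phi>: "schwartz \<phi>" and b: "b \<in> Basis"
  shows "ft (\<lambda>x. frechet_derivative \<phi> (at x) b) \<xi> = - (\<i> * of_real (b \<bullet> \<xi>)) * ft \<phi> \<xi>"
proof -
  have sm: "smooth \<phi>" using \<phi> by (simp add: schwartz_def)
  let ?E = "\<lambda>x. char_exp 1 (x \<bullet> \<xi>)"
  let ?d = "\<lambda>x. frechet_derivative \<phi> (at x) b"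
  define D where "D x v = ?E x * frechet_derivative \<phi> (at x) v + of_real (v \<bullet> \<xi>) * (\<i> * ?E x) * \<phi> x" for x v
  have "((\<lambda>x. ?E x * \<phi> x) has_derivative D x) (at x)" for x
  proof -
    have "(?E has_derivative (\<lambda>v. of_real (v \<bullet> \<xi>) * (\<i> * ?E x))) (at x)"
      using has_derivative_char_exp_inner[of 1 1 \<xi> x] by simp
    from has_derivative_mult[OF this smooth_has_derivative[OF sm]] show ?thesis by (simp add: D_def[abs_def])
  qed
  moreover have "continuous_on UNIV (\<lambda>x. D x b)"
    unfolding D_def by (intro continuous_intros smooth_continuous smooth_partial sm b)
  moreover obtain C0 where C0: "\<And>x. (1 + norm x) ^ 4 * norm (\<phi> x) \<le> C0" by (rule schwartz_bound[OF \<phi>]) blast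
  moreover obtain C1 where C1: "\<And>x. (1 + norm x) ^ 4 * norm (?d x) \<le> C1" by (rule schwartz_bound[OF schwartz_partial[OF \<phi> b]]) blast
  have "(1 + norm x) ^ 4 * norm (?E x * \<phi> x) \<le> \<bar>C1\<bar> + (1 + \<bar>b \<bullet> \<xi>\<bar>) * \<bar>C0\<bar>" for x
  proof -
    have "0 \<le> \<bar>b \<bullet> \<xi>\<bar> * \<bar>C0\<bar>" by simp
    then show ?thesis unfolding norm_mult norm_char_exp mult_1 distrib_right using C0[of x] by linarith
  qed
  moreover have "(1 + norm x) ^ 4 * norm (D x b) \<le> \<bar>C1\<bar> + (1 + \<bar>b \<bullet> \<xi>\<bar>) * \<bar>C0\<bar>" for x
  proof -
    have "norm (D x b) \<le> norm (?d x) + \<bar>b \<bullet> \<xi>\<bar> * norm (\<phi> x)"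
      unfolding D_def by (rule order_trans[OF norm_triangle_ineq]) (simp add: norm_mult)
    then have "(1 + norm x) ^ 4 * norm (D x b) \<le> (1 + norm x) ^ 4 * (norm (?d x) + \<bar>b \<bullet> \<xi>\<bar> * norm (\<phi> x))"
      by (intro mult_left_mono) auto
    also have "\<dots> = (1 + norm x) ^ 4 * norm (?d x) + \<bar>b \<bullet> \<xi>\<bar> * ((1 + norm x) ^ 4 * norm (\<phi> x))" by (simp add: algebra_simps)
    also have "\<dots> \<le> \<bar>C1\<bar> + \<bar>b \<bullet> \<xi>\<bar> * \<bar>C0\<bar>"
      using C0[of x] C1[of x] by (intro add_mono mult_left_mono) auto
    also have "\<dots> \<le> \<bar>C1\<bar> + (1 + \<bar>b \<bullet> \<xi>\<bar>) * \<bar>C0\<bar>" by (simp add: algebra_simps)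
    finally show ?thesis .
  qed
  moreover have "norm b = 1" using b by simp
  ultimately have "(LINT x|lborel. D x b) = 0"
    using integral_partial_derivative_zero[of "\<lambda>x. ?E x * \<phi> x" D b] by blast
  moreover have "(LINT x|lborel. D x b) = ft ?d \<xi> + \<i> * of_real (b \<bullet> \<xi>) * ft \<phi> \<xi>"
  proof -
    have "D x b = ?E x * ?d x + (\<i> * of_real (b \<bullet> \<xi>)) * (?E x * \<phi> x)" for x by (simp add: D_def mult_ac)
    then have "(LINT x|lborel. D x b) = (LINT x|lborel. ?E x * ?d x) + (LINT x|lborel. (\<i> * of_real (b \<bullet> \<xi>)) * (?E x * \<phi> x))"
      using schwartz_integrable[OF \<phi>] schwartz_integrable[OF schwartz_partial[OF \<phi> b]]
      by (simp only:) (intro Bochner_Integration.integral_add integrable_mult_right char_exp_times_integrable)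
    then show ?thesis by (simp add: ft_def)
  qed
  ultimately show ?thesis by (simp add: eq_neg_iff_add_eq_0)
qed

text \<open>Each derivative of the Schwartz function gains one power of the corresponding coordinate of \<open>\<xi>\<close>.\<close>

lemma ft_decay:
  assumes "schwartz \<phi>"
  shows "\<exists>C\<ge>0. \<forall>\<xi>. (1 + norm \<xi>) ^ M * norm (ft \<phi> \<xi>) \<le> C"
proof -
  have pw: "\<exists>C\<ge>0. \<forall>\<xi>. \<bar>b \<bullet> \<xi>\<bar> ^ M * norm (ft \<phi> \<xi>) \<le> C" if bB: "b \<in> Basis" for b M
    using assms
  proof (induction M arbitrary: \<phi>)
    case 0
    have "norm (ft \<phi> \<xi>) \<le> (LINT x|lborel. norm (\<phi> x))" for \<xi>
      unfolding ft_def by (rule order_trans[OF integral_norm_bound]) (simp add: norm_mult)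
    then show ?case by (intro exI[of _ "LINT x|lborel. norm (\<phi> x)"]) auto
  next
    case (Suc M)
    obtain C where "C \<ge> 0" "\<And>\<xi>. \<bar>b \<bullet> \<xi>\<bar> ^ M * norm (ft (\<lambda>x. frechet_derivative \<phi> (at x) b) \<xi>) \<le> C"
      using Suc.IH[OF schwartz_partial[OF Suc.prems bB]] by blast
    then show ?case unfolding ft_partial[OF Suc.prems bB]
      by (intro exI[of _ C]) (auto simp: norm_mult mult_ac)
  qed
  have "\<forall>b\<in>Basis. \<exists>C. C \<ge> 0 \<and> (\<forall>\<xi>. \<bar>b \<bullet> \<xi>\<bar> ^ M * norm (ft \<phi> \<xi>) \<le> C)" using pw by blast
  from bchoice[OF this] obtain C where C: "\<And>b. b \<in> Basis \<Longrightarrow> C b \<ge> 0" "\<And>b \<xi>. b \<in> Basis \<Longrightarrow> \<bar>b \<bullet> \<xi>\<bar> ^ M * norm (ft \<phi> \<xi>) \<le> C b" by blast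
  obtain C0 where C0: "C0 \<ge> 0" "\<And>\<xi>. norm (ft \<phi> \<xi>) \<le> C0" using pw[of "axis 1 1" 0] by (auto simp: Basis_vec2)
  have "(1 + norm \<xi>) ^ M * norm (ft \<phi> \<xi>) \<le> 2 ^ M * (C0 + 2 ^ M * (C (axis 1 1) + C (axis 2 1)))" for \<xi>
  proof -
    define x y where "x = \<bar>axis 1 1 \<bullet> \<xi>\<bar>" and "y = \<bar>axis 2 1 \<bullet> \<xi>\<bar>"
    have "norm \<xi> \<le> (\<Sum>b\<in>Basis. \<bar>\<xi> \<bullet> b\<bar>)" by (rule norm_le_l1)
    also have "\<dots> = x + y" unfolding Basis_vec2 by (subst sum.insert) (auto simp: axis_eq_axis x_def y_def inner_commute)
    finally have "norm \<xi> \<le> 2 * max x y" by linarith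
    then have "norm \<xi> ^ M \<le> (2 * max x y) ^ M" by (intro power_mono) auto
    also have "\<dots> \<le> 2 ^ M * (x ^ M + y ^ M)"
      unfolding power_mult_distrib by (intro mult_left_mono) (auto simp: max_def x_def y_def)
    finally have nM: "norm \<xi> ^ M \<le> 2 ^ M * (x ^ M + y ^ M)" .
    have "(1 + norm \<xi>) ^ M * norm (ft \<phi> \<xi>) \<le> 2 ^ M * (1 + norm \<xi> ^ M) * norm (ft \<phi> \<xi>)"
      by (intro mult_right_mono one_plus_power_le) auto
    also have "\<dots> \<le> 2 ^ M * (1 + 2 ^ M * (x ^ M + y ^ M)) * norm (ft \<phi> \<xi>)"
      using nM by (intro mult_right_mono mult_left_mono) auto
    also have "\<dots> = 2 ^ M * (norm (ft \<phi> \<xi>) + 2 ^ M * (x ^ M * norm (ft \<phi> \<xi>) + y ^ M * norm (ft \<phi> \<xi>)))" by (simp add: algebra_simps)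
    also have "\<dots> \<le> 2 ^ M * (C0 + 2 ^ M * (C (axis 1 1) + C (axis 2 1)))"
      unfolding x_def y_def by (intro mult_left_mono add_mono C C0) (auto simp: Basis_vec2)
    finally show ?thesis .
  qed
  moreover have "0 \<le> 2 ^ M * (C0 + 2 ^ M * (C (axis 1 1) + C (axis 2 1)))"
    using C(1) C0(1) by (simp add: Basis_vec2)
  ultimately show ?thesis by blast
qed

lemma ft_measurable:
  fixes f :: "real^2 \<Rightarrow> complex"
  assumes "f \<in> borel_measurable borel" shows "ft f \<in> borel_measurable borel"
proof -
  have "(\<lambda>z::(real^2) \<times> (real^2). char_exp 1 (snd z \<bullet> fst z)) \<in> borel_measurable borel"
    by (intro borel_measurable_continuous_onI continuous_intros)
  then have [measurable]: "(\<lambda>z::(real^2) \<times> (real^2). char_exp 1 (snd z \<bullet> fst z)) \<in> borel_measurable (borel \<Otimes>\<^sub>M borel)"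
    by (simp add: borel_prod)
  have "(\<lambda>z. char_exp 1 (snd z \<bullet> fst z) * f (snd z)) \<in> borel_measurable (borel \<Otimes>\<^sub>M borel)"
    using assms by measurable
  then have "(\<lambda>(\<xi>, x). char_exp 1 (x \<bullet> \<xi>) * f x) \<in> borel_measurable (borel \<Otimes>\<^sub>M lborel)"
    by (simp add: case_prod_unfold cong: measurable_cong_sets sets_pair_measure_cong)
  from lborel.borel_measurable_lebesgue_integral[OF this] show ?thesis by (simp add: ft_def[abs_def])
qed

section \<open>Gaussian test functions\<close>

text \<open>Polynomials times a fixed modulated Gaussian. The class is closed under differentiation, which
  gives the Schwartz property without computing derivatives.\<close>

inductive gaussian_span :: "real \<Rightarrow> real^2 \<Rightarrow> (real^2 \<Rightarrow> complex) \<Rightarrow> bool" for c \<eta> where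
  gaussian: "gaussian_span c \<eta> (\<lambda>x. char_exp 1 (x \<bullet> \<eta>) * of_real (exp (- c * (x \<bullet> x))))"
| affine: "gaussian_span c \<eta> f \<Longrightarrow> gaussian_span c \<eta> (\<lambda>x. (\<alpha> + \<beta> * of_real (x \<bullet> b)) * f x)"
| add: "gaussian_span c \<eta> f \<Longrightarrow> gaussian_span c \<eta> g \<Longrightarrow> gaussian_span c \<eta> (\<lambda>x. f x + g x)"

lemma gaussian_span_const: "gaussian_span c \<eta> f \<Longrightarrow> gaussian_span c \<eta> (\<lambda>x. \<alpha> * f x)"
  using affine[of c \<eta> f \<alpha> 0 0] by simp

lemma gaussian_decay:
  fixes r c :: real assumes "r \<ge> 0" "c > 0"
  shows "(1 + r) ^ N * exp (- c * r\<^sup>2) \<le> exp (real N ^ 2 / (4 * c))"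
proof -
  have "(1 + r) ^ N \<le> exp r ^ N" using assms by (intro power_mono exp_ge_add_one_self) auto
  also have "\<dots> = exp (real N * r)" by (simp add: exp_of_nat_mult)
  finally have "(1 + r) ^ N * exp (- c * r\<^sup>2) \<le> exp (real N * r) * exp (- c * r\<^sup>2)" by (intro mult_right_mono) auto
  also have "\<dots> = exp (real N * r - c * r\<^sup>2)" by (simp add: exp_add[symmetric])
  also have "\<dots> \<le> exp (real N ^ 2 / (4 * c))"
  proof -
    have "0 \<le> (2 * c * r - real N)\<^sup>2 / (4 * c)" using assms by simp
    also have "\<dots> = c * r\<^sup>2 - real N * r + real N ^ 2 / (4 * c)"
      using assms by (simp add: power2_eq_square field_simps)
    finally show ?thesis by simp
  qed
  finally show ?thesis .
qed

lemma gaussian_span_decay: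
  assumes "gaussian_span c \<eta> f" "c > 0"
  shows "\<exists>C. \<forall>x. (1 + norm x) ^ N * norm (f x) \<le> C"
  using assms(1)
proof (induction arbitrary: N)
  case gaussian
  show ?case
  proof (intro exI allI)
    fix x :: "real^2"
    show "(1 + norm x) ^ N * norm (char_exp 1 (x \<bullet> \<eta>) * complex_of_real (exp (- c * (x \<bullet> x)))) \<le> exp (real N ^ 2 / (4 * c))"
      using gaussian_decay[OF norm_ge_zero[of x] assms(2), of N] by (simp add: norm_mult power2_norm_eq_inner)
  qed
next
  case (affine f \<alpha> \<beta> b)
  obtain C where C: "\<And>x. (1 + norm x) ^ Suc N * norm (f x) \<le> C" using affine.IH by blast
  let ?k = "norm \<alpha> + norm \<beta> * norm b"
  have "(1 + norm x) ^ N * norm ((\<alpha> + \<beta> * of_real (x \<bullet> b)) * f x) \<le> ?k * \<bar>C\<bar>" for x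
  proof -
    have "norm (\<alpha> + \<beta> * of_real (x \<bullet> b)) \<le> norm \<alpha> + norm \<beta> * \<bar>x \<bullet> b\<bar>"
      by (rule order_trans[OF norm_triangle_ineq]) (simp add: norm_mult)
    also have "\<dots> \<le> norm \<alpha> + norm \<beta> * (norm x * norm b)"
      by (intro add_left_mono mult_left_mono Cauchy_Schwarz_ineq2) auto
    also have "\<dots> \<le> ?k * (1 + norm x)" by (simp add: algebra_simps)
    finally have "norm (\<alpha> + \<beta> * of_real (x \<bullet> b)) \<le> ?k * (1 + norm x)" .
    then have "(1 + norm x) ^ N * norm ((\<alpha> + \<beta> * of_real (x \<bullet> b)) * f x) \<le> (1 + norm x) ^ N * (?k * (1 + norm x) * norm (f x))"
      unfolding norm_mult by (intro mult_left_mono mult_right_mono) auto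
    also have "\<dots> = ?k * ((1 + norm x) ^ Suc N * norm (f x))" by (simp add: algebra_simps)
    also have "\<dots> \<le> ?k * \<bar>C\<bar>" using C[of x] by (intro mult_left_mono) auto
    finally show ?thesis .
  qed
  then show ?case by blast
next
  case (add f g)
  obtain C D where C: "\<And>x. (1 + norm x) ^ N * norm (f x) \<le> C" and D: "\<And>x. (1 + norm x) ^ N * norm (g x) \<le> D"
    using add.IH by metis
  have "(1 + norm x) ^ N * norm (f x + g x) \<le> C + D" for x
  proof -
    have "(1 + norm x) ^ N * norm (f x + g x) \<le> (1 + norm x) ^ N * (norm (f x) + norm (g x))"
      by (intro mult_left_mono norm_triangle_ineq) auto
    then show ?thesis using C[of x] D[of x] by (simp add: distrib_left)
  qed
  then show ?case by blast
qed

lemma gaussian_span_derivative: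
  assumes "gaussian_span c \<eta> f"
  shows "\<exists>f'. (\<forall>x. (f has_derivative (\<lambda>v. f' v x)) (at x)) \<and> (\<forall>v. gaussian_span c \<eta> (f' v))"
  using assms
proof induction
  case gaussian
  let ?E = "\<lambda>x. char_exp 1 (x \<bullet> \<eta>)" and ?g = "\<lambda>x::real^2. complex_of_real (exp (- c * (x \<bullet> x)))"
  let ?f = "\<lambda>x. ?E x * ?g x"
  have "(?f has_derivative (\<lambda>v. (\<i> * of_real (v \<bullet> \<eta>) + of_real (- 2 * c) * of_real (x \<bullet> v)) * ?f x)) (at x)" for x
  proof -
    have "(?E has_derivative (\<lambda>v. of_real (v \<bullet> \<eta>) * (\<i> * ?E x))) (at x)"
      using has_derivative_char_exp_inner[of 1 1 \<eta> x] by simp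
    moreover have "(?g has_derivative (\<lambda>v. of_real ((- c * (x \<bullet> v + v \<bullet> x)) * exp (- c * (x \<bullet> x))))) (at x)"
      by (intro has_derivative_of_real has_derivative_exp has_derivative_mult_right has_derivative_inner has_derivative_ident)
    ultimately have "(?f has_derivative (\<lambda>v. ?E x * of_real ((- c * (x \<bullet> v + v \<bullet> x)) * exp (- c * (x \<bullet> x))) + of_real (v \<bullet> \<eta>) * (\<i> * ?E x) * ?g x)) (at x)"
      by (rule has_derivative_mult)
    then show ?thesis
      by (rule has_derivative_eq_rhs) (auto simp: fun_eq_iff inner_commute algebra_simps)
  qed
  then show ?case
    by (intro exI[of _ "\<lambda>v x. (\<i> * of_real (v \<bullet> \<eta>) + of_real (- 2 * c) * of_real (x \<bullet> v)) * ?f x"] conjI allI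
        gaussian_span.affine gaussian_span.gaussian)
next
  case (affine f \<alpha> \<beta> b)
  then obtain f' where f': "\<And>x. (f has_derivative (\<lambda>v. f' v x)) (at x)" "\<And>v. gaussian_span c \<eta> (f' v)" by blast
  have "((\<lambda>x. (\<alpha> + \<beta> * of_real (x \<bullet> b)) * f x) has_derivative
      (\<lambda>v. (\<alpha> + \<beta> * of_real (x \<bullet> b)) * f' v x + (\<beta> * of_real (v \<bullet> b)) * f x)) (at x)" for x
    by (rule has_derivative_mult[OF _ f'(1)]) (auto intro!: derivative_eq_intros)
  then show ?case
    by (intro exI[of _ "\<lambda>v x. (\<alpha> + \<beta> * of_real (x \<bullet> b)) * f' v x + (\<beta> * of_real (v \<bullet> b)) * f x"] conjI allI
        gaussian_span.add gaussian_span.affine gaussian_span_const f' affine.hyps)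
next
  case (add f g)
  then obtain f' g' where f': "\<And>x. (f has_derivative (\<lambda>v. f' v x)) (at x)" "\<And>v. gaussian_span c \<eta> (f' v)"
    and g': "\<And>x. (g has_derivative (\<lambda>v. g' v x)) (at x)" "\<And>v. gaussian_span c \<eta> (g' v)" by blast
  show ?case
    by (intro exI[of _ "\<lambda>v x. f' v x + g' v x"] conjI allI has_derivative_add f' g' gaussian_span.add)
qed

lemma gaussian_schwartz:
  assumes c: "c > 0"
  shows "schwartz (\<lambda>x::real^2. char_exp 1 (x \<bullet> \<eta>) * of_real (exp (- c * (x \<bullet> x))))"
proof -
  have sm: "smooth f" if "gaussian_span c \<eta> f" for f
  proof -
    have "smooth_family (\<lambda>x (t::real). f x)"
    proof (rule smooth_family_coinduct[where X="\<lambda>g. \<exists>f. gaussian_span c \<eta> f \<and> g = (\<lambda>x t. f x)"], goal_cases)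
      case (2 g)
      then obtain f where f: "gaussian_span c \<eta> f" "g = (\<lambda>x t. f x)" by blast
      obtain f' where "\<And>x. (f has_derivative (\<lambda>v. f' v x)) (at x)" using gaussian_span_derivative[OF f(1)] by blast
      then have "continuous_on UNIV f" by (intro has_derivative_continuous_on[of UNIV f "\<lambda>x v. f' v x"]) simp
      then show ?case unfolding f(2) by (rule continuous_fst_snd)
    next
      case (3 g)
      then obtain f where f: "gaussian_span c \<eta> f" "g = (\<lambda>x t. f x)" by blast
      obtain f' where "\<And>x. (f has_derivative (\<lambda>v. f' v x)) (at x)" "\<And>v. gaussian_span c \<eta> (f' v)"
        using gaussian_span_derivative[OF f(1)] by blast
      then show ?case unfolding f(2) by (intro exI[of _ "\<lambda>v x t. f' v x"]) blast
    qed (use that in blast)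
    then show ?thesis by (simp add: smooth_iff_smooth_family)
  qed
  have it: "gaussian_span c \<eta> (iter_deriv vs f)" if "gaussian_span c \<eta> f" for vs f
  proof (induction vs)
    case (Cons v vs)
    obtain f' where f': "\<And>x. (iter_deriv vs f has_derivative (\<lambda>v. f' v x)) (at x)" "\<And>v. gaussian_span c \<eta> (f' v)"
      using gaussian_span_derivative[OF Cons] by blast
    show ?case using frechet_derivative_at[OF f'(1), symmetric] f'(2)[of v] by simp
  qed (use that in simp)
  show ?thesis unfolding schwartz_def
    using sm[OF gaussian] gaussian_span_decay[OF it[OF gaussian] c] by blast
qed

lemma gaussian_integrable_1d: "integrable lborel (\<lambda>x. exp (- x\<^sup>2 / 2) :: real)"
proof -
  have "integrable lborel (\<lambda>x. sqrt (2 * pi) * std_normal_density x)" by simp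
  then show ?thesis by (simp add: std_normal_density_def)
qed

lemma gaussian_ft_1d:
  "(LINT x|lborel. char_exp \<omega> x * of_real (exp (- x\<^sup>2 / 2))) = of_real (sqrt (2 * pi) * exp (- \<omega>\<^sup>2 / 2))"
proof -
  have "(LINT x|std_normal_distribution. char_exp \<omega> x) = complex_of_real (exp (- \<omega>\<^sup>2 / 2))"
    using fun_cong[OF char_std_normal_distribution, of \<omega>] by (simp add: char_def char_exp_def mult_ac)
  moreover have "(LINT x|std_normal_distribution. char_exp \<omega> x) = (LINT x|lborel. std_normal_density x *\<^sub>R char_exp \<omega> x)"
    by (subst integral_density) auto
  moreover have "std_normal_density x *\<^sub>R char_exp \<omega> x = (1 / sqrt (2 * pi)) *\<^sub>R (char_exp \<omega> x * of_real (exp (- x\<^sup>2 / 2)))" for x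
    by (simp add: std_normal_density_def scaleR_conv_of_real)
  ultimately have "(1 / sqrt (2 * pi)) *\<^sub>R (LINT x|lborel. char_exp \<omega> x * of_real (exp (- x\<^sup>2 / 2))) = complex_of_real (exp (- \<omega>\<^sup>2 / 2))"
    by simp
  then have "sqrt (2 * pi) *\<^sub>R ((1 / sqrt (2 * pi)) *\<^sub>R (LINT x|lborel. char_exp \<omega> x * of_real (exp (- x\<^sup>2 / 2)))) = sqrt (2 * pi) *\<^sub>R complex_of_real (exp (- \<omega>\<^sup>2 / 2))"
    by simp
  then show ?thesis by (simp add: scaleR_conv_of_real)
qed

lemma inner_vec2: "(x :: real^2) \<bullet> y = x $ 1 * y $ 1 + x $ 2 * y $ 2"
  by (simp add: inner_vec_def sum_2)

lemma gaussian_ft_std: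
  "ft (\<lambda>x. of_real (exp (- (x \<bullet> x) / 2))) \<omega> = of_real (2 * pi * exp (- (\<omega> \<bullet> \<omega>) / 2))"
proof -
  let ?e = "\<lambda>\<omega> x. char_exp \<omega> x * of_real (exp (- x\<^sup>2 / 2))"
  have m: "(\<lambda>x::real^2. char_exp 1 (x \<bullet> \<omega>) * of_real (exp (- (x \<bullet> x) / 2))) \<in> borel_measurable borel"
    by (intro borel_measurable_continuous_onI continuous_intros) auto
  have i1: "integrable lborel (?e \<omega>)" for \<omega>
    by (rule Bochner_Integration.integrable_bound[OF gaussian_integrable_1d]) (auto simp: norm_mult)
  have eq: "char_exp 1 ((vector [x, y] :: real^2) \<bullet> \<omega>) * of_real (exp (- ((vector [x, y] :: real^2) \<bullet> vector [x, y]) / 2)) = ?e (\<omega> $ 1) x * ?e (\<omega> $ 2) y" for x y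
  proof -
    have "char_exp 1 ((vector [x, y] :: real^2) \<bullet> \<omega>) = char_exp (\<omega> $ 1) x * char_exp (\<omega> $ 2) y"
      by (simp add: inner_vec2 char_exp_cis cis_mult mult.commute)
    moreover have "exp (- ((vector [x, y] :: real^2) \<bullet> vector [x, y]) / 2) = exp (- x\<^sup>2 / 2) * exp (- y\<^sup>2 / 2)"
      by (simp add: inner_vec2 power2_eq_square exp_add[symmetric] field_simps)
    ultimately show ?thesis by simp
  qed
  have ip: "integrable (lborel \<Otimes>\<^sub>M lborel) (\<lambda>(x, y). ?e (\<omega> $ 1) x * ?e (\<omega> $ 2) y)"
  proof (rule lborel_pair.Fubini_integrable)
    show "integrable lborel (\<lambda>x. LINT y|lborel. norm (case (x, y) of (x, y) \<Rightarrow> ?e (\<omega> $ 1) x * ?e (\<omega> $ 2) y))"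
      using gaussian_integrable_1d by (simp add: norm_mult)
    show "AE x in lborel. integrable lborel (\<lambda>y. case (x, y) of (x, y) \<Rightarrow> ?e (\<omega> $ 1) x * ?e (\<omega> $ 2) y)"
      using i1 by simp
  qed measurable
  have "ft (\<lambda>x. of_real (exp (- (x \<bullet> x) / 2))) \<omega> = (LINT z|(lborel \<Otimes>\<^sub>M lborel). (case z of (x, y) \<Rightarrow> ?e (\<omega> $ 1) x * ?e (\<omega> $ 2) y))"
    unfolding ft_def integral_vec2[OF m] eq ..
  also have "\<dots> = (LINT x|lborel. LINT y|lborel. ?e (\<omega> $ 1) x * ?e (\<omega> $ 2) y)"
    using lborel_pair.integral_fst[OF ip] by simp
  also have "\<dots> = (LINT x|lborel. ?e (\<omega> $ 1) x) * (LINT y|lborel. ?e (\<omega> $ 2) y)" by simp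
  also have "\<dots> = of_real (2 * pi * exp (- (\<omega> \<bullet> \<omega>) / 2))"
  proof -
    have "(sqrt (2 * pi) * exp (- (\<omega> $ 1)\<^sup>2 / 2)) * (sqrt (2 * pi) * exp (- (\<omega> $ 2)\<^sup>2 / 2))
       = (sqrt (2 * pi) * sqrt (2 * pi)) * (exp (- (\<omega> $ 1)\<^sup>2 / 2) * exp (- (\<omega> $ 2)\<^sup>2 / 2))" by (simp only: mult_ac)
    also have "\<dots> = 2 * pi * exp (- (\<omega> $ 1)\<^sup>2 / 2 + - (\<omega> $ 2)\<^sup>2 / 2)" unfolding exp_add by simp
    also have "- (\<omega> $ 1)\<^sup>2 / 2 + - (\<omega> $ 2)\<^sup>2 / 2 = - (\<omega> \<bullet> \<omega>) / 2" by (simp add: inner_vec2 power2_eq_square field_simps)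
    finally show ?thesis by (simp only: gaussian_ft_1d of_real_mult[symmetric])
  qed
  finally show ?thesis .
qed

text \<open>The modulation and the width are chosen such that the Fourier transform is a Gaussian centred at \<open>\<eta>\<close> that
  concentrates there as \<open>n\<close> grows.\<close>

lemma gaussian_ft:
  assumes n: "n > 0"
  shows "ft (\<lambda>x. char_exp 1 (x \<bullet> (- \<eta>)) * of_real (exp (- (1 / (2 * n\<^sup>2)) * (x \<bullet> x)))) \<xi> =
    of_real (2 * pi * n\<^sup>2 * exp (- (n\<^sup>2 * ((\<xi> - \<eta>) \<bullet> (\<xi> - \<eta>))) / 2))"
proof -
  let ?f = "\<lambda>x::real^2. char_exp 1 (x \<bullet> \<xi>) * (char_exp 1 (x \<bullet> (- \<eta>)) * of_real (exp (- (1 / (2 * n\<^sup>2)) * (x \<bullet> x))))"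
  have m: "?f \<in> borel_measurable borel"
    by (intro borel_measurable_continuous_onI continuous_intros)
  have "?f (0 + n *\<^sub>R x) = char_exp 1 (x \<bullet> (n *\<^sub>R (\<xi> - \<eta>))) * of_real (exp (- (x \<bullet> x) / 2))" for x
  proof -
    have "char_exp 1 ((n *\<^sub>R x) \<bullet> \<xi>) * char_exp 1 ((n *\<^sub>R x) \<bullet> (- \<eta>)) = char_exp 1 (x \<bullet> (n *\<^sub>R (\<xi> - \<eta>)))"
      by (simp add: char_exp_cis cis_mult inner_diff_right right_diff_distrib)
    moreover have "- (1 / (2 * n\<^sup>2)) * ((n *\<^sub>R x) \<bullet> (n *\<^sub>R x)) = - (x \<bullet> x) / 2"
      using n by (simp add: power2_eq_square)
    ultimately show ?thesis by (simp add: mult.assoc[symmetric])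
  qed
  then have "ft (\<lambda>x. char_exp 1 (x \<bullet> (- \<eta>)) * of_real (exp (- (1 / (2 * n\<^sup>2)) * (x \<bullet> x)))) \<xi>
     = n\<^sup>2 *\<^sub>R ft (\<lambda>x. of_real (exp (- (x \<bullet> x) / 2))) (n *\<^sub>R (\<xi> - \<eta>))"
    unfolding ft_def using integral_plane_affine(1)[OF m, of n 0] n by simp
  also have "\<dots> = of_real (2 * pi * n\<^sup>2 * exp (- (n\<^sup>2 * ((\<xi> - \<eta>) \<bullet> (\<xi> - \<eta>))) / 2))"
    unfolding gaussian_ft_std by (simp add: scaleR_conv_of_real[where 'a=complex] power2_eq_square mult_ac)
  finally show ?thesis .
qed

section \<open>Functions annihilated by all Gaussians\<close>

text \<open>The positive and the negative part define two measures that agree on the boxes, a generator of the Borel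
  sets that is closed under intersections.\<close>

lemma zero_on_boxes_imp_AE_zero_real:
  fixes H :: "real^2 \<Rightarrow> real"
  assumes [measurable]: "H \<in> borel_measurable borel"
    and int: "\<And>l u. integrable lborel (\<lambda>x. indicator (box l u) x * H x)"
    and zero: "\<And>l u. (LINT x|lborel. indicator (box l u) x * H x) = 0"
  shows "AE x in lborel. H x = 0"
proof -
  let ?P = "density lborel (\<lambda>x. ennreal (max 0 (H x)))" and ?N = "density lborel (\<lambda>x. ennreal (max 0 (- H x)))"
  let ?E = "range (\<lambda>(a, b). box a b :: (real^2) set)"
  have em: "emeasure ?P (box l u) = ennreal (LINT x|lborel. indicator (box l u) x * max 0 (H x))"
    "emeasure ?N (box l u) = ennreal (LINT x|lborel. indicator (box l u) x * max 0 (- H x))"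
    "(LINT x|lborel. indicator (box l u) x * max 0 (H x)) = (LINT x|lborel. indicator (box l u) x * max 0 (- H x))" for l u
  proof -
    have i: "integrable lborel (\<lambda>x. indicator (box l u) x * max 0 (H x))" "integrable lborel (\<lambda>x. indicator (box l u) x * max 0 (- H x))"
      by (rule Bochner_Integration.integrable_bound[OF int[of l u]]; simp add: abs_mult mult_left_mono)+
    show "emeasure ?P (box l u) = ennreal (LINT x|lborel. indicator (box l u) x * max 0 (H x))"
      by (subst emeasure_density) (auto simp: nn_integral_eq_integral[OF i(1), symmetric] intro!: nn_integral_cong split: split_indicator)
    show "emeasure ?N (box l u) = ennreal (LINT x|lborel. indicator (box l u) x * max 0 (- H x))"
      by (subst emeasure_density) (auto simp: nn_integral_eq_integral[OF i(2), symmetric] intro!: nn_integral_cong split: split_indicator)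
    have "(LINT x|lborel. indicator (box l u) x * H x) = (LINT x|lborel. indicator (box l u) x * max 0 (H x) - indicator (box l u) x * max 0 (- H x))"
      by (intro Bochner_Integration.integral_cong refl) (auto simp: max_def split: split_indicator)
    also have "\<dots> = (LINT x|lborel. indicator (box l u) x * max 0 (H x)) - (LINT x|lborel. indicator (box l u) x * max 0 (- H x))"
      using i by (rule Bochner_Integration.integral_diff)
    finally show "(LINT x|lborel. indicator (box l u) x * max 0 (H x)) = (LINT x|lborel. indicator (box l u) x * max 0 (- H x))"
      using zero[of l u] by simp
  qed
  have "?P = ?N"
  proof (rule measure_eqI_generator_eq)
    show "Int_stable ?E" by (auto simp: Int_stable_def box_Int_box)
    show "?E \<subseteq> Pow UNIV" "sets ?P = sigma_sets UNIV ?E" "sets ?N = sigma_sets UNIV ?E"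
      by (simp_all add: borel_eq_box)
    show "range (\<lambda>n::nat. box (- real n *\<^sub>R One) (real n *\<^sub>R One)) \<subseteq> ?E" by auto
    show "(\<Union>n::nat. box (- real n *\<^sub>R One) (real n *\<^sub>R One)) = (UNIV :: (real^2) set)"
      using UN_box_eq_UNIV by simp
    show "emeasure ?P X = emeasure ?N X" if "X \<in> ?E" for X using that em by auto
    show "emeasure ?P (box (- real n *\<^sub>R One) (real n *\<^sub>R One)) \<noteq> \<infinity>" for n by (subst em(1)) simp
  qed
  then have "AE x in lborel. ennreal (max 0 (H x)) = ennreal (max 0 (- H x))"
    by (subst (asm) sigma_finite_measure.density_unique_iff[OF lborel.sigma_finite_measure_axioms]) auto
  then show ?thesis by eventually_elim (auto simp: max_def split: if_splits)
qed

lemma zero_on_boxes_imp_AE_zero: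
  fixes H :: "real^2 \<Rightarrow> complex"
  assumes [measurable]: "H \<in> borel_measurable borel"
    and int: "\<And>l u. integrable lborel (\<lambda>x. indicator (box l u) x *\<^sub>R H x)"
    and zero: "\<And>l u. (LINT x|lborel. indicator (box l u) x *\<^sub>R H x) = 0"
  shows "AE x in lborel. H x = 0"
proof -
  have hb: "has_bochner_integral lborel (\<lambda>x. indicator (box l u) x *\<^sub>R H x) 0" for l u
    using int zero by (simp add: has_bochner_integral_iff)
  have "AE x in lborel. Re (H x) = 0"
    using has_bochner_integral_bounded_linear[OF bounded_linear_Re hb]
    by (intro zero_on_boxes_imp_AE_zero_real) (auto simp: has_bochner_integral_iff)
  moreover have "AE x in lborel. Im (H x) = 0"
    using has_bochner_integral_bounded_linear[OF bounded_linear_Im hb]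
    by (intro zero_on_boxes_imp_AE_zero_real) (auto simp: has_bochner_integral_iff)
  ultimately show ?thesis by eventually_elim (simp add: complex_eq_iff)
qed

lemma gaussian_integrable:
  assumes "a > 0" shows "integrable lborel (\<lambda>z::real^2. exp (- a * (z \<bullet> z)))"
proof (rule integrable_decay)
  show "(\<lambda>z::real^2. exp (- a * (z \<bullet> z))) \<in> borel_measurable borel"
    by (intro borel_measurable_continuous_onI continuous_intros)
  show "(1 + norm x) ^ 4 * norm (exp (- a * (x \<bullet> x))) \<le> exp (real 4 ^ 2 / (4 * a))" for x :: "real^2"
    using gaussian_decay[OF norm_ge_zero[of x] assms, of 4] by (simp add: power2_norm_eq_inner)
qed

text \<open>Integrating the hypothesis over the centres \<open>\<eta>\<close> in a box shows that \<open>H\<close> annihilates the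
  indicator function of the box smoothed by a narrow Gaussian. As the width tends to zero, dominated convergence
  yields the integral of \<open>H\<close> over the box; the majorants are multiples of \<open>|H|\<close> times a wide
  Gaussian.\<close>

lemma annihilated_by_gaussians:
  fixes H :: "real^2 \<Rightarrow> complex"
  assumes Hm [measurable]: "H \<in> borel_measurable borel"
    and int: "\<And>a. a > 0 \<Longrightarrow> integrable lborel (\<lambda>\<xi>. exp (- a * (\<xi> \<bullet> \<xi>)) *\<^sub>R H \<xi>)"
    and zero: "\<And>n \<eta>. n > 0 \<Longrightarrow> (LINT \<xi>|lborel. H \<xi> * of_real (exp (- (n\<^sup>2 * ((\<xi> - \<eta>) \<bullet> (\<xi> - \<eta>))) / 2))) = 0"
  shows "AE \<xi> in lborel. H \<xi> = 0"
proof (rule zero_on_boxes_imp_AE_zero[OF Hm])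
  fix l u :: "real^2"
  let ?B = "box l u"
  obtain R where R: "R > 0" "?B \<subseteq> ball 0 R" using bounded_subset_ballD[OF bounded_box] by blast
  define \<gamma> where "\<gamma> z = exp (- (z \<bullet> z) / 2) / (2 * pi)" for z :: "real^2"
  have \<gamma>m [measurable]: "\<gamma> \<in> borel_measurable borel" unfolding \<gamma>_def[abs_def]
    by (intro borel_measurable_continuous_onI continuous_intros) auto
  have \<gamma>i: "integrable lborel \<gamma>"
  proof -
    have "integrable lborel (\<lambda>z::real^2. exp (- (1 / 2) * (z \<bullet> z)) / (2 * pi))"
      using gaussian_integrable[of "1 / 2"] by simp
    then show ?thesis
      by (rule Bochner_Integration.integrable_cong[OF refl, THEN iffD1, rotated]) (simp add: \<gamma>_def)
  qed
  have \<gamma>1: "(LINT z|lborel. \<gamma> z) = 1"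
  proof -
    have "of_real (LINT z|lborel. \<gamma> z) = (LINT z|lborel. complex_of_real (\<gamma> z))" by (rule integral_of_real[OF \<gamma>i, symmetric])
    also have "\<dots> = ft (\<lambda>x. of_real (exp (- (x \<bullet> x) / 2))) 0 / (2 * pi)"
      by (simp add: ft_def char_exp_def \<gamma>_def)
    also have "\<dots> = 1" unfolding gaussian_ft_std by simp
    finally show ?thesis by (metis of_real_1 of_real_eq_iff)
  qed
  define W where "W n \<xi> = (LINT z|lborel. indicator ?B (\<xi> + (1 / n) *\<^sub>R z) * \<gamma> z)" for n \<xi>
  have shift [measurable]: "(\<lambda>x::real^2. \<xi> + c *\<^sub>R x) \<in> borel_measurable borel" for \<xi> c
    by (intro borel_measurable_continuous_onI continuous_intros)
  have Wi: "integrable lborel (\<lambda>z. indicator ?B (\<xi> + (1 / n) *\<^sub>R z) * \<gamma> z)" for n \<xi>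
    by (rule Bochner_Integration.integrable_bound[OF \<gamma>i]) (auto simp: indicator_def)
  \<comment> \<open>the smoothed indicator tends to the indicator off the boundary of the box\<close>
  have Wlim: "(\<lambda>k. W (real (Suc k)) \<xi>) \<longlonglongrightarrow> indicator ?B \<xi>" if "\<xi> \<notin> frontier ?B" for \<xi>
  proof -
    have "(\<lambda>k. LINT z|lborel. indicator ?B (\<xi> + (1 / real (Suc k)) *\<^sub>R z) * \<gamma> z) \<longlonglongrightarrow> (LINT z|lborel. indicator ?B \<xi> * \<gamma> z)"
    proof (rule integral_dominated_convergence[OF _ _ \<gamma>i])
      show "AE z in lborel. (\<lambda>k. indicator ?B (\<xi> + (1 / real (Suc k)) *\<^sub>R z) * \<gamma> z) \<longlonglongrightarrow> indicator ?B \<xi> * \<gamma> z"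
      proof (intro AE_I2 tendsto_mult_right)
        fix z :: "real^2"
        have "(\<lambda>k. \<xi> + (1 / real (Suc k)) *\<^sub>R z) \<longlonglongrightarrow> \<xi> + 0 *\<^sub>R z"
          by (intro tendsto_intros LIMSEQ_Suc[OF lim_1_over_n])
        then have lim: "(\<lambda>k. \<xi> + (1 / real (Suc k)) *\<^sub>R z) \<longlonglongrightarrow> \<xi>" by simp
        have "isCont (indicator ?B :: _ \<Rightarrow> real) \<xi>" using that by (simp add: isCont_indicator)
        from isCont_tendsto_compose[OF this lim]
        show "(\<lambda>k. indicator ?B (\<xi> + (1 / real (Suc k)) *\<^sub>R z) :: real) \<longlonglongrightarrow> indicator ?B \<xi>" .
      qed
    qed (auto simp: indicator_def \<gamma>_def)
    then show ?thesis by (simp add: W_def \<gamma>1)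
  qed
  define J where "J = (LINT z|lborel. exp (- (1 / 4) * (z \<bullet> (z::real^2))) / (2 * pi))"
  have Ji: "integrable lborel (\<lambda>z. exp (- (1 / 4) * (z \<bullet> (z::real^2))) / (2 * pi))"
    using gaussian_integrable[of "1 / 4"] by simp
  have J0: "J \<ge> 0" unfolding J_def by (intro Bochner_Integration.integral_nonneg) auto
  \<comment> \<open>Uniformly in \<open>n\<close>, the smoothed indicator has Gaussian tails: far from the box, \<open>z\<close> must be large to reach it.\<close>
  have Wbound: "\<bar>W n \<xi>\<bar> \<le> (exp (R\<^sup>2 / 4) + J) * exp (- (1 / 16) * (\<xi> \<bullet> \<xi>))" if n: "n \<ge> 1" for n \<xi>
  proof -
    have W0: "W n \<xi> \<ge> 0" unfolding W_def by (intro Bochner_Integration.integral_nonneg) (auto simp: \<gamma>_def)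
    show ?thesis
    proof (cases "norm \<xi> < 2 * R")
      case True
      have "W n \<xi> \<le> (LINT z|lborel. \<gamma> z)" unfolding W_def
        by (intro integral_mono Wi \<gamma>i) (auto simp: indicator_def \<gamma>_def)
      also have "\<dots> \<le> exp (R\<^sup>2 / 4) * exp (- (1 / 16) * (\<xi> \<bullet> \<xi>))"
      proof -
        have "(norm \<xi>)\<^sup>2 \<le> (2 * R)\<^sup>2" using True by (intro power_mono) auto
        then show ?thesis unfolding \<gamma>1 by (simp add: exp_add[symmetric] power2_norm_eq_inner power_mult_distrib)
      qed
      also have "\<dots> \<le> (exp (R\<^sup>2 / 4) + J) * exp (- (1 / 16) * (\<xi> \<bullet> \<xi>))" using J0 by (intro mult_right_mono) auto
      finally show ?thesis using W0 by simp
    next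
      case False
      have pt: "indicator ?B (\<xi> + (1 / n) *\<^sub>R z) * \<gamma> z \<le> exp (- (1 / 16) * (\<xi> \<bullet> \<xi>)) * (exp (- (1 / 4) * (z \<bullet> z)) / (2 * pi))" for z
      proof (cases "\<xi> + (1 / n) *\<^sub>R z \<in> ?B")
        case True
        then have "norm (\<xi> + (1 / n) *\<^sub>R z) < R" using R by auto
        moreover have "norm \<xi> \<le> norm (\<xi> + (1 / n) *\<^sub>R z) + norm ((1 / n) *\<^sub>R z)"
          using norm_triangle_ineq4[of "\<xi> + (1 / n) *\<^sub>R z" "(1 / n) *\<^sub>R z"] by simp
        moreover have "norm ((1 / n) *\<^sub>R z) \<le> norm z" using n by (simp add: divide_le_eq mult_le_cancel_left1)
        ultimately have "norm \<xi> / 2 \<le> norm z" using False by linarith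
        then have "(norm \<xi> / 2)\<^sup>2 \<le> (norm z)\<^sup>2" by (intro power_mono) auto
        then have le: "(\<xi> \<bullet> \<xi>) / 4 \<le> z \<bullet> z" by (simp add: power_divide power2_norm_eq_inner)
        have "\<gamma> z = exp (- (1 / 4) * (z \<bullet> z) + - (1 / 4) * (z \<bullet> z)) / (2 * pi)" by (simp add: \<gamma>_def)
        also have "\<dots> \<le> exp (- (1 / 16) * (\<xi> \<bullet> \<xi>) + - (1 / 4) * (z \<bullet> z)) / (2 * pi)"
          using le by (intro divide_right_mono) auto
        finally have "\<gamma> z \<le> exp (- (1 / 16) * (\<xi> \<bullet> \<xi>)) * (exp (- (1 / 4) * (z \<bullet> z)) / (2 * pi))"
          by (simp only: exp_add times_divide_eq_right)
        then show ?thesis using True by simp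
      qed simp
      have "W n \<xi> \<le> (LINT z|lborel. exp (- (1 / 16) * (\<xi> \<bullet> \<xi>)) * (exp (- (1 / 4) * (z \<bullet> (z::real^2))) / (2 * pi)))"
        unfolding W_def
      proof (rule integral_mono)
        show "integrable lborel (\<lambda>z. exp (- (1 / 16) * (\<xi> \<bullet> \<xi>)) * (exp (- (1 / 4) * (z \<bullet> (z::real^2))) / (2 * pi)))"
          by (intro integrable_mult_right Ji)
      qed (use Wi pt in auto)
      also have "\<dots> = J * exp (- (1 / 16) * (\<xi> \<bullet> \<xi>))" by (simp add: J_def)
      also have "\<dots> \<le> (exp (R\<^sup>2 / 4) + J) * exp (- (1 / 16) * (\<xi> \<bullet> \<xi>))" by (intro mult_right_mono) auto
      finally show ?thesis using W0 by simp
    qed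
  qed
  have Wm: "W n \<in> borel_measurable borel" for n
  proof -
    have "(\<lambda>x::(real^2) \<times> (real^2). fst x + (1 / n) *\<^sub>R snd x) \<in> borel_measurable borel"
      by (intro borel_measurable_continuous_onI continuous_intros)
    then have [measurable]: "(\<lambda>x::(real^2) \<times> (real^2). fst x + (1 / n) *\<^sub>R snd x) \<in> borel_measurable (borel \<Otimes>\<^sub>M borel)"
      by (simp add: borel_prod)
    have "(\<lambda>x. indicator ?B (fst x + (1 / n) *\<^sub>R snd x) * \<gamma> (snd x)) \<in> borel_measurable (borel \<Otimes>\<^sub>M borel)"
      by measurable
    then have "(\<lambda>(\<xi>, z). indicator ?B (\<xi> + (1 / n) *\<^sub>R z) * \<gamma> z) \<in> borel_measurable (borel \<Otimes>\<^sub>M lborel)"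
      by (simp add: case_prod_unfold cong: measurable_cong_sets sets_pair_measure_cong)
    from lborel.borel_measurable_lebesgue_integral[OF this] show ?thesis by (simp add: W_def[abs_def])
  qed
  have Bi: "integrable lborel (\<lambda>x. indicator ?B x *\<^sub>R H x)"
  proof (rule Bochner_Integration.integrable_bound[OF integrable_scaleR_right[OF int[of 1], of "exp (R\<^sup>2)"]])
    have "norm (indicator ?B x *\<^sub>R H x) \<le> norm (exp (R\<^sup>2) *\<^sub>R exp (- 1 * (x \<bullet> x)) *\<^sub>R H x)" for x
    proof (cases "x \<in> ?B")
      case True
      then have "(norm x)\<^sup>2 \<le> R\<^sup>2" using R by (intro power_mono) auto
      then have "1 \<le> exp (R\<^sup>2) * exp (- 1 * (x \<bullet> x))" by (simp add: exp_add[symmetric] power2_norm_eq_inner)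
      from mult_right_mono[OF this norm_ge_zero[of "H x"]] show ?thesis using True by (simp add: mult.assoc)
    qed simp
    then show "AE x in lborel. norm (indicator ?B x *\<^sub>R H x) \<le> norm (exp (R\<^sup>2) *\<^sub>R exp (- 1 * (x \<bullet> x)) *\<^sub>R H x)" by simp
  qed auto
  then show "integrable lborel (\<lambda>x. indicator ?B x *\<^sub>R H x)" .
  have WH0: "(LINT \<xi>|lborel. W n \<xi> *\<^sub>R H \<xi>) = 0" if n: "n \<ge> 1" for n
  proof -
    define g where "g \<xi> \<eta> = exp (- (n\<^sup>2 * ((\<xi> - \<eta>) \<bullet> (\<xi> - \<eta>))) / 2)" for \<xi> \<eta> :: "real^2"
    define k where "k \<eta> \<xi> = (indicator ?B \<eta> * g \<xi> \<eta>) *\<^sub>R H \<xi>" for \<eta> \<xi>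
    have gm: "(\<lambda>x. g (snd x) (fst x)) \<in> borel_measurable (borel \<Otimes>\<^sub>M borel)"
      unfolding borel_prod g_def by (intro borel_measurable_continuous_onI continuous_intros) auto
    have "(\<lambda>x. (indicator ?B (fst x) * g (snd x) (fst x)) *\<^sub>R H (snd x)) \<in> borel_measurable (borel \<Otimes>\<^sub>M borel)"
      using gm by measurable
    then have km: "case_prod k \<in> borel_measurable (lborel \<Otimes>\<^sub>M lborel)"
      by (simp add: k_def case_prod_unfold cong: measurable_cong_sets sets_pair_measure_cong)
    let ?h = "\<lambda>\<xi>. exp (- (1 / 4) * (\<xi> \<bullet> \<xi>)) *\<^sub>R H \<xi>"
    define d where "d \<eta> \<xi> = indicator ?B \<eta> * (exp (R\<^sup>2 / 2) * norm (?h \<xi>))" for \<eta> \<xi> :: "real^2"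
    have hm: "?h \<in> borel_measurable borel" using borel_measurable_integrable[OF int[of "1 / 4"]] by simp
    have hn: "integrable lborel (\<lambda>\<xi>. norm (?h \<xi>))" using int[of "1 / 4"] by (intro integrable_norm) simp
    have di: "integrable (lborel \<Otimes>\<^sub>M lborel) (case_prod d)"
    proof (rule lborel_pair.Fubini_integrable)
      have "(\<lambda>x. indicator ?B (fst x) * (exp (R\<^sup>2 / 2) * norm (?h (snd x)))) \<in> borel_measurable (borel \<Otimes>\<^sub>M borel)"
        using measurable_compose[OF measurable_snd hm] by measurable
      then show "case_prod d \<in> borel_measurable (lborel \<Otimes>\<^sub>M lborel)"
        by (simp add: d_def case_prod_unfold cong: measurable_cong_sets sets_pair_measure_cong)
      have "(LINT \<xi>|lborel. norm (case (\<eta>, \<xi>) of (\<eta>, \<xi>) \<Rightarrow> d \<eta> \<xi>)) = indicator ?B \<eta> * (exp (R\<^sup>2 / 2) * (LINT \<xi>|lborel. norm (?h \<xi>)))" for \<eta>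
        by (simp add: d_def abs_mult)
      moreover have "integrable lborel (\<lambda>\<eta>. indicator ?B \<eta> * (exp (R\<^sup>2 / 2) * (LINT \<xi>|lborel. norm (?h \<xi>))) :: real)"
        using emeasure_bounded_finite[OF bounded_box[of l u]] by (intro integrable_mult_left integrable_real_indicator) auto
      ultimately show "integrable lborel (\<lambda>\<eta>. LINT \<xi>|lborel. norm (case (\<eta>, \<xi>) of (\<eta>, \<xi>) \<Rightarrow> d \<eta> \<xi>))" by simp
      show "AE \<eta> in lborel. integrable lborel (\<lambda>\<xi>. case (\<eta>, \<xi>) of (\<eta>, \<xi>) \<Rightarrow> d \<eta> \<xi>)"
        unfolding prod.case d_def by (intro AE_I2 integrable_mult_right hn)
    qed
    have ki: "integrable (lborel \<Otimes>\<^sub>M lborel) (case_prod k)"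
    proof (rule Bochner_Integration.integrable_bound[OF di km])
      have "norm (k \<eta> \<xi>) \<le> norm (d \<eta> \<xi>)" for \<eta> \<xi>
      proof (cases "\<eta> \<in> ?B")
        case True
        then have "(norm \<eta>)\<^sup>2 \<le> R\<^sup>2" using R by (intro power_mono) auto
        then have \<eta>R: "\<eta> \<bullet> \<eta> \<le> R\<^sup>2" by (simp add: power2_norm_eq_inner)
        have sq: "0 \<le> (\<xi> - 2 *\<^sub>R \<eta>) \<bullet> (\<xi> - 2 *\<^sub>R \<eta>)" by simp
        moreover have "(\<xi> - 2 *\<^sub>R \<eta>) \<bullet> (\<xi> - 2 *\<^sub>R \<eta>) = \<xi> \<bullet> \<xi> - 4 * (\<xi> \<bullet> \<eta>) + 4 * (\<eta> \<bullet> \<eta>)"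
          "(\<xi> - \<eta>) \<bullet> (\<xi> - \<eta>) = \<xi> \<bullet> \<xi> - 2 * (\<xi> \<bullet> \<eta>) + \<eta> \<bullet> \<eta>"
          by (simp_all add: inner_diff_left inner_diff_right inner_commute)
        ultimately have "\<xi> \<bullet> \<xi> / 4 \<le> (\<xi> - \<eta>) \<bullet> (\<xi> - \<eta>) / 2 + \<eta> \<bullet> \<eta> / 2" by linarith
        moreover have "(\<xi> - \<eta>) \<bullet> (\<xi> - \<eta>) \<le> n\<^sup>2 * ((\<xi> - \<eta>) \<bullet> (\<xi> - \<eta>))"
          using mult_right_mono[OF one_le_power[OF n, of 2], of "(\<xi> - \<eta>) \<bullet> (\<xi> - \<eta>)"] by simp
        ultimately have "g \<xi> \<eta> \<le> exp (R\<^sup>2 / 2 + - (1 / 4) * (\<xi> \<bullet> \<xi>))" using \<eta>R by (simp add: g_def)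
        also have "\<dots> = exp (R\<^sup>2 / 2) * exp (- (1 / 4) * (\<xi> \<bullet> \<xi>))" by (simp only: exp_add)
        finally have "g \<xi> \<eta> * norm (H \<xi>) \<le> exp (R\<^sup>2 / 2) * exp (- (1 / 4) * (\<xi> \<bullet> \<xi>)) * norm (H \<xi>)" by (intro mult_right_mono) auto
        moreover have "g \<xi> \<eta> \<ge> 0" by (simp add: g_def)
        ultimately show ?thesis using True by (simp add: k_def d_def abs_mult mult.assoc)
      qed (simp add: k_def)
      then show "AE x in lborel \<Otimes>\<^sub>M lborel. norm (case_prod k x) \<le> norm (case_prod d x)" by (auto simp: case_prod_unfold)
    qed
    have "(LINT \<xi>|lborel. LINT \<eta>|lborel. k \<eta> \<xi>) = (LINT \<eta>|lborel. LINT \<xi>|lborel. k \<eta> \<xi>)"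
      using lborel_pair.Fubini_integral[OF ki] .
    also have "\<dots> = 0"
    proof -
      have "(LINT \<xi>|lborel. k \<eta> \<xi>) = 0" for \<eta>
      proof -
        have "k \<eta> \<xi> = indicator ?B \<eta> *\<^sub>R (H \<xi> * of_real (g \<xi> \<eta>))" for \<xi> by (simp add: k_def scaleR_conv_of_real)
        then have "(LINT \<xi>|lborel. k \<eta> \<xi>) = indicator ?B \<eta> *\<^sub>R (LINT \<xi>|lborel. H \<xi> * of_real (g \<xi> \<eta>))" by simp
        also have "\<dots> = 0" using zero[of n \<eta>] n by (simp add: g_def)
        finally show ?thesis .
      qed
      then show ?thesis by simp
    qed
    finally have z: "(LINT \<xi>|lborel. LINT \<eta>|lborel. k \<eta> \<xi>) = 0" .
    have "(LINT \<eta>|lborel. k \<eta> \<xi>) = (2 * pi / n\<^sup>2) *\<^sub>R (W n \<xi> *\<^sub>R H \<xi>)" for \<xi>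
    proof -
      have "(\<lambda>\<eta>. g \<xi> \<eta>) \<in> borel_measurable borel" unfolding g_def by (intro borel_measurable_continuous_onI continuous_intros) auto
      then have m: "(\<lambda>\<eta>. indicator ?B \<eta> * g \<xi> \<eta>) \<in> borel_measurable borel" by measurable
      have "g \<xi> (\<xi> + (1 / n) *\<^sub>R z) = 2 * pi * \<gamma> z" for z
        using n by (simp add: g_def \<gamma>_def power2_eq_square)
      then have "(LINT \<eta>|lborel. indicator ?B \<eta> * g \<xi> \<eta>) = (1 / n)\<^sup>2 * (LINT z|lborel. (2 * pi) * (indicator ?B (\<xi> + (1 / n) *\<^sub>R z) * \<gamma> z))"
        using integral_plane_affine(1)[OF m, of "1 / n" \<xi>] n by (simp add: mult_ac)
      also have "\<dots> = 2 * pi / n\<^sup>2 * W n \<xi>" unfolding W_def integral_mult_right_zero by (simp add: power_divide)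
      finally have "(LINT \<eta>|lborel. indicator ?B \<eta> * g \<xi> \<eta>) = 2 * pi / n\<^sup>2 * W n \<xi>" .
      moreover have "integrable lborel (\<lambda>\<eta>. indicator ?B \<eta> * g \<xi> \<eta>)"
      proof (rule Bochner_Integration.integrable_bound[OF _ _ AE_I2])
        show "integrable lborel (indicator ?B :: _ \<Rightarrow> real)"
          using emeasure_bounded_finite[OF bounded_box[of l u]] by (intro integrable_real_indicator) auto
        show "norm (indicator ?B \<eta> * g \<xi> \<eta>) \<le> norm (indicator ?B \<eta> :: real)" for \<eta>
          by (auto simp: indicator_def g_def)
      qed (use m in simp)
      ultimately show ?thesis by (simp add: k_def)
    qed
    then have "(LINT \<xi>|lborel. (2 * pi / n\<^sup>2) *\<^sub>R (W n \<xi> *\<^sub>R H \<xi>)) = 0" using z by (simp only:)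
    then have "(2 * pi / n\<^sup>2) *\<^sub>R (LINT \<xi>|lborel. W n \<xi> *\<^sub>R H \<xi>) = 0" unfolding integral_scaleR_right .
    then show ?thesis using n by simp
  qed
  have "(\<lambda>k. LINT \<xi>|lborel. W (real (Suc k)) \<xi> *\<^sub>R H \<xi>) \<longlonglongrightarrow> (LINT \<xi>|lborel. indicator ?B \<xi> *\<^sub>R H \<xi>)"
  proof (rule integral_dominated_convergence)
    let ?d = "\<lambda>\<xi>. (exp (R\<^sup>2 / 4) + J) * norm (exp (- (1 / 16) * (\<xi> \<bullet> \<xi>)) *\<^sub>R H \<xi>)"
    show "integrable lborel ?d" using int[of "1 / 16"] by (intro integrable_mult_right integrable_norm) simp
    show "AE \<xi> in lborel. norm (W (real (Suc k)) \<xi> *\<^sub>R H \<xi>) \<le> ?d \<xi>" for k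
    proof (intro AE_I2)
      fix \<xi>
      have "\<bar>W (real (Suc k)) \<xi>\<bar> * norm (H \<xi>) \<le> (exp (R\<^sup>2 / 4) + J) * exp (- (1 / 16) * (\<xi> \<bullet> \<xi>)) * norm (H \<xi>)"
        by (intro mult_right_mono Wbound) auto
      then show "norm (W (real (Suc k)) \<xi> *\<^sub>R H \<xi>) \<le> ?d \<xi>" by (simp add: mult.assoc)
    qed
    have "negligible (frontier ?B)" by (intro negligible_convex_frontier convex_box)
    then have "frontier ?B \<in> null_sets lborel"
      by (simp add: negligible_iff_null_sets null_sets_completion_iff)
    from AE_not_in[OF this]
    show "AE \<xi> in lborel. (\<lambda>k. W (real (Suc k)) \<xi> *\<^sub>R H \<xi>) \<longlonglongrightarrow> indicator ?B \<xi> *\<^sub>R H \<xi>"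
      by eventually_elim (intro tendsto_scaleR Wlim tendsto_const)
    show "(\<lambda>\<xi>. W (real (Suc k)) \<xi> *\<^sub>R H \<xi>) \<in> borel_measurable lborel" for k using Wm by simp
  qed simp
  then have "(\<lambda>k. 0) \<longlonglongrightarrow> (LINT \<xi>|lborel. indicator ?B \<xi> *\<^sub>R H \<xi>)" using WH0 by simp
  then show "(LINT \<xi>|lborel. indicator ?B \<xi> *\<^sub>R H \<xi>) = 0" by (simp add: LIMSEQ_const_iff)
qed

section \<open>The Sobolev norm on the plane\<close>

lemma inv_fourier_add:
  assumes G: "G1 \<in> borel_measurable borel" "G2 \<in> borel_measurable borel"
    and b: "\<And>\<xi>. cmod (G1 \<xi>) \<le> C1 * (1 + norm \<xi>) ^ N1" "\<And>\<xi>. cmod (G2 \<xi>) \<le> C2 * (1 + norm \<xi>) ^ N2"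
    and \<phi>: "schwartz \<phi>"
  shows "inv_fourier G1 \<phi> + inv_fourier G2 \<phi> = inv_fourier (\<lambda>\<xi>. G1 \<xi> + G2 \<xi>) \<phi>"
proof -
  have "integrable lborel (\<lambda>\<xi>. G \<xi> * ft \<phi> \<xi>)"
    if "G \<in> borel_measurable borel" "\<And>\<xi>. cmod (G \<xi>) \<le> C * (1 + norm \<xi>) ^ N" for G C N
  proof -
    obtain D where D: "D \<ge> 0" "\<And>\<xi>. (1 + norm \<xi>) ^ (4 + N) * norm (ft \<phi> \<xi>) \<le> D" using ft_decay[OF \<phi>] by blast
    have "(1 + norm \<xi>) ^ 4 * norm (G \<xi> * ft \<phi> \<xi>) \<le> \<bar>C\<bar> * D" for \<xi>
    proof -
      have "cmod (G \<xi>) \<le> \<bar>C\<bar> * (1 + norm \<xi>) ^ N"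
        by (rule order_trans[OF that(2)]) (auto intro!: mult_right_mono)
      then have "(1 + norm \<xi>) ^ 4 * norm (G \<xi> * ft \<phi> \<xi>) \<le> (1 + norm \<xi>) ^ 4 * (\<bar>C\<bar> * (1 + norm \<xi>) ^ N * norm (ft \<phi> \<xi>))"
        unfolding norm_mult by (intro mult_left_mono mult_right_mono) auto
      also have "\<dots> = \<bar>C\<bar> * ((1 + norm \<xi>) ^ (4 + N) * norm (ft \<phi> \<xi>))" by (simp only: power_add mult_ac)
      also have "\<dots> \<le> \<bar>C\<bar> * D" by (intro mult_left_mono D) auto
      finally show ?thesis .
    qed
    then show ?thesis using that(1) ft_measurable[OF schwartz_measurable[OF \<phi>]]
      by (intro integrable_decay[where C="\<bar>C\<bar> * D"]) auto
  qed
  from this[OF G(1) b(1)] this[OF G(2) b(2)]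
  show ?thesis unfolding inv_fourier_ft by (simp add: distrib_right add_divide_distrib)
qed

lemma bessel_plane_bound: "(1 + (norm x)\<^sup>2) powr r \<le> (1 + norm (x::'a::real_normed_vector)) ^ nat \<lceil>2 * \<bar>r\<bar>\<rceil>"
proof -
  let ?k = "norm x"
  have 1: "1 + ?k\<^sup>2 \<le> (1 + ?k)\<^sup>2" by (simp add: power2_sum)
  have "(1 + ?k\<^sup>2) powr r \<le> (1 + ?k\<^sup>2) powr \<bar>r\<bar>" by (intro powr_mono) auto
  also have "\<dots> \<le> ((1 + ?k)\<^sup>2) powr \<bar>r\<bar>" by (intro powr_mono2 1) auto
  also have "\<dots> = (1 + ?k) powr (2 * \<bar>r\<bar>)"
  proof -
    have "(1 + ?k)\<^sup>2 = (1 + ?k) powr 2" using powr_realpow[of "1 + ?k" 2] by (simp add: add_pos_nonneg)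
    then show ?thesis by (simp only: powr_powr)
  qed
  also have "\<dots> \<le> (1 + ?k) powr (real (nat \<lceil>2 * \<bar>r\<bar>\<rceil>))" by (intro powr_mono) (linarith, simp)
  also have "\<dots> = (1 + ?k) ^ nat \<lceil>2 * \<bar>r\<bar>\<rceil>" by (rule powr_realpow) (simp add: add_pos_nonneg)
  finally show ?thesis .
qed

text \<open>A distribution has only one Fourier transform. Another representing function \<open>G'\<close> need not have polynomial
  growth, but it is integrable against Gaussians by the weighted \<open>L\<^sup>2\<close> condition; testing with the functions of
  \<open>gaussian_ft\<close> shows that \<open>G' - G\<close> is annihilated by all Gaussians.\<close>

lemma sobolev_inv_fourier_iff:
  assumes Gm: "G \<in> borel_measurable borel" and Gb: "\<And>\<xi>. cmod (G \<xi>) \<le> C * (1 + norm \<xi>) ^ N"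
    and u: "\<And>\<phi>. schwartz \<phi> \<Longrightarrow> u \<phi> = inv_fourier G \<phi>"
  shows "sobolev r u \<longleftrightarrow> integrable lborel (\<lambda>\<xi>. (1 + (norm \<xi>)\<^sup>2) powr r * (cmod (G \<xi>))\<^sup>2)"
proof
  assume "integrable lborel (\<lambda>\<xi>. (1 + (norm \<xi>)\<^sup>2) powr r * (cmod (G \<xi>))\<^sup>2)"
  then show "sobolev r u" unfolding sobolev_def using Gm u by (intro exI[of _ G]) auto
next
  assume "sobolev r u"
  then obtain G' where G'm: "G' \<in> borel_measurable lborel"
    and G'i: "integrable lborel (\<lambda>\<xi>. (1 + (norm \<xi>)\<^sup>2) powr r * (cmod (G' \<xi>))\<^sup>2)"
    and G'u: "\<And>\<phi>. schwartz \<phi> \<Longrightarrow> u \<phi> = inv_fourier G' \<phi>" unfolding sobolev_def by blast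
  note [measurable] = Gm
  have [measurable]: "G' \<in> borel_measurable borel" using G'm by simp
  have em [measurable]: "(\<lambda>\<xi>::real^2. exp (- a * (\<xi> \<bullet> \<xi>))) \<in> borel_measurable borel" for a
    by (intro borel_measurable_continuous_onI continuous_intros)
  have i1: "integrable lborel (\<lambda>\<xi>. exp (- a * (\<xi> \<bullet> \<xi>)) *\<^sub>R G \<xi>)" if a: "a > 0" for a
  proof (rule integrable_decay[where C="exp (real (4 + N) ^ 2 / (4 * a)) * \<bar>C\<bar>"])
    fix \<xi> :: "real^2"
    have "cmod (G \<xi>) \<le> \<bar>C\<bar> * (1 + norm \<xi>) ^ N"
      by (rule order_trans[OF Gb]) (auto intro!: mult_right_mono)
    then have "(1 + norm \<xi>) ^ 4 * norm (exp (- a * (\<xi> \<bullet> \<xi>)) *\<^sub>R G \<xi>) \<le> (1 + norm \<xi>) ^ 4 * (exp (- a * (\<xi> \<bullet> \<xi>)) * (\<bar>C\<bar> * (1 + norm \<xi>) ^ N))"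
      unfolding norm_scaleR by (intro mult_left_mono) auto
    also have "\<dots> = (1 + norm \<xi>) ^ (4 + N) * exp (- a * (norm \<xi>)\<^sup>2) * \<bar>C\<bar>"
      by (simp only: power_add mult_ac power2_norm_eq_inner)
    also have "\<dots> \<le> exp (real (4 + N) ^ 2 / (4 * a)) * \<bar>C\<bar>"
      by (intro mult_right_mono gaussian_decay a) auto
    finally show "(1 + norm \<xi>) ^ 4 * norm (exp (- a * (\<xi> \<bullet> \<xi>)) *\<^sub>R G \<xi>) \<le> exp (real (4 + N) ^ 2 / (4 * a)) * \<bar>C\<bar>" .
  qed simp
  have i2: "integrable lborel (\<lambda>\<xi>. exp (- a * (\<xi> \<bullet> \<xi>)) *\<^sub>R G' \<xi>)" if a: "a > 0" for a
  proof -
    let ?m = "nat \<lceil>2 * \<bar>- r\<bar>\<rceil>"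
    let ?q = "\<lambda>\<xi>::real^2. (1 + (norm \<xi>)\<^sup>2) powr (- r) * exp (- (2 * a) * (\<xi> \<bullet> \<xi>))"
    have qi: "integrable lborel ?q"
    proof (rule integrable_decay[where C="exp (real (4 + ?m) ^ 2 / (4 * (2 * a)))"])
      fix \<xi> :: "real^2"
      have "(1 + norm \<xi>) ^ 4 * norm (?q \<xi>) \<le> (1 + norm \<xi>) ^ 4 * ((1 + norm \<xi>) ^ ?m * exp (- (2 * a) * (norm \<xi>)\<^sup>2))"
        using bessel_plane_bound[of \<xi> "- r"] by (auto simp: power2_norm_eq_inner abs_mult intro!: mult_left_mono mult_right_mono)
      also have "\<dots> = (1 + norm \<xi>) ^ (4 + ?m) * exp (- (2 * a) * (norm \<xi>)\<^sup>2)" by (simp only: power_add mult_ac)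
      also have "\<dots> \<le> exp (real (4 + ?m) ^ 2 / (4 * (2 * a)))" by (intro gaussian_decay) (use a in auto)
      finally show "(1 + norm \<xi>) ^ 4 * norm (?q \<xi>) \<le> exp (real (4 + ?m) ^ 2 / (4 * (2 * a)))" .
    qed measurable
    show ?thesis
    proof (rule Bochner_Integration.integrable_bound[OF Bochner_Integration.integrable_add[OF G'i qi]])
      have "norm (exp (- a * (\<xi> \<bullet> \<xi>)) *\<^sub>R G' \<xi>) \<le> (1 + (norm \<xi>)\<^sup>2) powr r * (cmod (G' \<xi>))\<^sup>2 + ?q \<xi>" for \<xi>
      proof -
        let ?p = "1 + (norm \<xi>)\<^sup>2"
        have p: "?p > 0" by (simp add: add_pos_nonneg)
        define x where "x = ?p powr (r / 2) * cmod (G' \<xi>)"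
        define y where "y = ?p powr (- r / 2) * exp (- a * (\<xi> \<bullet> \<xi>))"
        have xy: "x * y = exp (- a * (\<xi> \<bullet> \<xi>)) * cmod (G' \<xi>)"
          using p by (simp add: x_def y_def powr_add[symmetric] powr_minus field_simps)
        have x2: "x\<^sup>2 = ?p powr r * (cmod (G' \<xi>))\<^sup>2" using p by (simp add: x_def power_mult_distrib powr_power)
        have y2: "y\<^sup>2 = ?q \<xi>" using p by (simp add: y_def power_mult_distrib powr_power exp_of_nat_mult[symmetric] exp_double[symmetric])
        have "x * y \<le> x\<^sup>2 + y\<^sup>2" using sum_squares_bound[of x y] zero_le_power2[of x] zero_le_power2[of y] by linarith
        then show ?thesis unfolding xy x2 y2 by simp
      qed
      then show "AE \<xi> in lborel. norm (exp (- a * (\<xi> \<bullet> \<xi>)) *\<^sub>R G' \<xi>) \<le> norm ((1 + (norm \<xi>)\<^sup>2) powr r * (cmod (G' \<xi>))\<^sup>2 + ?q \<xi>)"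
        by (intro AE_I2) (auto intro: order_trans[OF _ abs_ge_self])
    qed simp
  qed
  have "AE \<xi> in lborel. G' \<xi> - G \<xi> = 0"
  proof (rule annihilated_by_gaussians)
    show "(\<lambda>\<xi>. G' \<xi> - G \<xi>) \<in> borel_measurable borel" by measurable
    show "integrable lborel (\<lambda>\<xi>. exp (- a * (\<xi> \<bullet> \<xi>)) *\<^sub>R (G' \<xi> - G \<xi>))" if "a > 0" for a
      using i1[OF that] i2[OF that] by (simp add: scaleR_diff_right)
    fix n :: real and \<eta> :: "real^2" assume n: "n > 0"
    let ?g = "\<lambda>\<xi>. exp (- (n\<^sup>2 * ((\<xi> - \<eta>) \<bullet> (\<xi> - \<eta>))) / 2)"
    have gm [measurable]: "?g \<in> borel_measurable borel"
      by (intro borel_measurable_continuous_onI continuous_intros) auto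
    have gi: "integrable lborel (\<lambda>\<xi>. F \<xi> * of_real (?g \<xi>))"
      if F: "F \<in> borel_measurable borel" "\<And>a. a > 0 \<Longrightarrow> integrable lborel (\<lambda>\<xi>. exp (- a * (\<xi> \<bullet> \<xi>)) *\<^sub>R F \<xi>)" for F :: "real^2 \<Rightarrow> complex"
    proof -
      have "integrable lborel (\<lambda>\<xi>. exp (n\<^sup>2 * (\<eta> \<bullet> \<eta>) / 2) *\<^sub>R (exp (- (n\<^sup>2 / 4) * (\<xi> \<bullet> \<xi>)) *\<^sub>R F \<xi>))"
        using n by (intro integrable_scaleR_right F) auto
      then show ?thesis
      proof (rule Bochner_Integration.integrable_bound)
        have "cmod (F \<xi> * of_real (?g \<xi>)) \<le> norm (exp (n\<^sup>2 * (\<eta> \<bullet> \<eta>) / 2) *\<^sub>R (exp (- (n\<^sup>2 / 4) * (\<xi> \<bullet> \<xi>)) *\<^sub>R F \<xi>))" for \<xi>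
        proof -
          have "0 \<le> n\<^sup>2 * ((\<xi> - 2 *\<^sub>R \<eta>) \<bullet> (\<xi> - 2 *\<^sub>R \<eta>))" by simp
          moreover have "n\<^sup>2 * ((\<xi> - 2 *\<^sub>R \<eta>) \<bullet> (\<xi> - 2 *\<^sub>R \<eta>)) = n\<^sup>2 * (\<xi> \<bullet> \<xi>) - 4 * (n\<^sup>2 * (\<xi> \<bullet> \<eta>)) + 4 * (n\<^sup>2 * (\<eta> \<bullet> \<eta>))"
            by (simp add: inner_diff_left inner_diff_right inner_commute algebra_simps)
          moreover have "n\<^sup>2 * ((\<xi> - \<eta>) \<bullet> (\<xi> - \<eta>)) = n\<^sup>2 * (\<xi> \<bullet> \<xi>) - 2 * (n\<^sup>2 * (\<xi> \<bullet> \<eta>)) + n\<^sup>2 * (\<eta> \<bullet> \<eta>)"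
            by (simp add: inner_diff_left inner_diff_right inner_commute algebra_simps)
          moreover have "- (n\<^sup>2 / 4) * (\<xi> \<bullet> \<xi>) = - (n\<^sup>2 * (\<xi> \<bullet> \<xi>)) / 4" by simp
          ultimately have "- (n\<^sup>2 * ((\<xi> - \<eta>) \<bullet> (\<xi> - \<eta>))) / 2 \<le> n\<^sup>2 * (\<eta> \<bullet> \<eta>) / 2 + - (n\<^sup>2 / 4) * (\<xi> \<bullet> \<xi>)"
            by linarith
          then have "?g \<xi> \<le> exp (n\<^sup>2 * (\<eta> \<bullet> \<eta>) / 2 + - (n\<^sup>2 / 4) * (\<xi> \<bullet> \<xi>))"
            by (simp only: exp_le_cancel_iff)
          also have "\<dots> = exp (n\<^sup>2 * (\<eta> \<bullet> \<eta>) / 2) * exp (- (n\<^sup>2 / 4) * (\<xi> \<bullet> \<xi>))" by (simp only: exp_add)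
          finally have "cmod (F \<xi>) * ?g \<xi> \<le> cmod (F \<xi>) * (exp (n\<^sup>2 * (\<eta> \<bullet> \<eta>) / 2) * exp (- (n\<^sup>2 / 4) * (\<xi> \<bullet> \<xi>)))"
            by (intro mult_left_mono) auto
          then show ?thesis by (simp add: norm_mult mult_ac)
        qed
        then show "AE \<xi> in lborel. norm (F \<xi> * of_real (?g \<xi>)) \<le> norm (exp (n\<^sup>2 * (\<eta> \<bullet> \<eta>) / 2) *\<^sub>R (exp (- (n\<^sup>2 / 4) * (\<xi> \<bullet> \<xi>)) *\<^sub>R F \<xi>))" by simp
      qed (use F(1) in measurable)
    qed
    have nn: "1 / (2 * n\<^sup>2) > 0" using n by simp
    let ?\<phi> = "\<lambda>x. char_exp 1 (x \<bullet> (- \<eta>)) * of_real (exp (- (1 / (2 * n\<^sup>2)) * (x \<bullet> x)))"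
    have "inv_fourier G' ?\<phi> = inv_fourier G ?\<phi>"
      using trans[OF G'u[OF gaussian_schwartz[OF nn, of "- \<eta>"], symmetric] u[OF gaussian_schwartz[OF nn, of "- \<eta>"]]] .
    moreover have "inv_fourier F ?\<phi> = 1 / (2 * complex_of_real pi)\<^sup>2 * (of_real (2 * pi * n\<^sup>2) * (LINT \<xi>|lborel. F \<xi> * of_real (?g \<xi>)))" for F
    proof -
      have "F \<xi> * ft ?\<phi> \<xi> = of_real (2 * pi * n\<^sup>2) * (F \<xi> * of_real (?g \<xi>))" for \<xi>
        unfolding gaussian_ft[OF n] by (simp add: mult_ac)
      then show ?thesis unfolding inv_fourier_ft by (simp only: integral_mult_right_zero)
    qed
    ultimately have "(LINT \<xi>|lborel. G' \<xi> * of_real (?g \<xi>)) = (LINT \<xi>|lborel. G \<xi> * of_real (?g \<xi>))"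
      using n by simp
    then show "(LINT \<xi>|lborel. (G' \<xi> - G \<xi>) * of_real (?g \<xi>)) = 0"
      using gi[OF _ i1] gi[OF _ i2] by (simp add: left_diff_distrib)
  qed
  then show "integrable lborel (\<lambda>\<xi>. (1 + (norm \<xi>)\<^sup>2) powr r * (cmod (G \<xi>))\<^sup>2)"
    using G'i by (subst integrable_cong_AE[where g="\<lambda>\<xi>. (1 + (norm \<xi>)\<^sup>2) powr r * (cmod (G' \<xi>))\<^sup>2"]) auto
qed

section \<open>Polar coordinates\<close>

lemma has_derivative_vec_nth [derivative_intros]: "((\<lambda>x::real^'n. x $ i) has_derivative (\<lambda>v. v $ i)) (at x within S)"
  by (rule bounded_linear_imp_has_derivative[OF bounded_linear_vec_nth])

lemma perp_circ: "perp (circ t) = (- sin t) *\<^sub>R axis 1 1 + cos t *\<^sub>R axis 2 1"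
  by (simp add: perp_def circ_def vec_eq_iff forall_2 axis_def)

lemma circ_inj:
  assumes "circ t = circ t'" "0 \<le> t" "t < 2 * pi" "0 \<le> t'" "t' < 2 * pi" shows "t = t'"
proof -
  have "sin t = sin t' \<and> cos t = cos t'" using assms(1) by (simp add: circ_def vec_eq_iff forall_2)
  then obtain n :: int where n: "t = t' + 2 * pi * n" using sin_cos_eq_iff by blast
  then have "\<bar>2 * pi * n\<bar> < 2 * pi * 1" using assms by auto
  then have "\<bar>real_of_int n\<bar> < 1" by (simp add: abs_mult)
  then show ?thesis using n by simp
qed

lemma set_integrable_lebesgue_iff:
  fixes f :: "real^2 \<Rightarrow> real"
  assumes "f \<in> borel_measurable borel" "S \<in> sets borel"
  shows "f absolutely_integrable_on S \<longleftrightarrow> integrable lborel (\<lambda>x. indicator S x *\<^sub>R f x)"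
  unfolding set_integrable_def by (rule integrable_completion) (use assms in simp)

text \<open>The coordinates \<open>\<xi> = -\<epsilon>\<sigma>\<theta>\<^sup>\<bottom>\<close> are those in which the symbol of the
  operator with sign \<open>\<epsilon>\<close> is evaluated at the direction \<open>\<theta>\<close>.\<close>

lemma polar_integrable_iff:
  fixes K :: "real^2 \<Rightarrow> real" and \<epsilon> :: real
  assumes Km: "K \<in> borel_measurable borel" and K0: "\<And>x. K x \<ge> 0" and \<epsilon>: "\<epsilon> = 1 \<or> \<epsilon> = -1"
  shows "integrable lborel K \<longleftrightarrow>
    (\<integral>\<^sup>+t. indicator {0..<2 * pi} t * (\<integral>\<^sup>+\<sigma>. indicator {0<..} \<sigma> * ennreal (\<sigma> * K ((- \<epsilon> * \<sigma>) *\<^sub>R perp (circ t))) \<partial>lborel) \<partial>lborel) < \<infinity>"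
proof -
  have \<epsilon>2: "\<epsilon> * \<epsilon> = 1" "\<epsilon> \<noteq> 0" "\<bar>\<epsilon>\<bar> = 1" using \<epsilon> by auto
  define S where "S = {x::real^2. 0 < x $ 1 \<and> 0 \<le> x $ 2 \<and> x $ 2 < 2 * pi}"
  define g where "g x = (\<epsilon> * (x $ 1 * sin (x $ 2))) *\<^sub>R axis 1 1 + (- \<epsilon> * (x $ 1 * cos (x $ 2))) *\<^sub>R (axis 2 1 :: real^2)" for x :: "real^2"
  define g' where "g' x v = (\<epsilon> * (v $ 1 * sin (x $ 2) + x $ 1 * (cos (x $ 2) * v $ 2))) *\<^sub>R (axis 1 1 :: real^2)
     + (- \<epsilon> * (v $ 1 * cos (x $ 2) - x $ 1 * (sin (x $ 2) * v $ 2))) *\<^sub>R (axis 2 1 :: real^2)" for x v :: "real^2"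
  have gp: "g x = (- \<epsilon> * x $ 1) *\<^sub>R perp (circ (x $ 2))" for x
    by (simp add: g_def perp_circ scaleR_add_right algebra_simps)
  have Sb: "S \<in> sets borel"
  proof -
    have "open {x::real^2. 0 < x $ 1}" "closed {x::real^2. 0 \<le> x $ 2}" "open {x::real^2. x $ 2 < 2 * pi}"
      by (intro open_Collect_less closed_Collect_le continuous_intros)+
    then have "{x::real^2. 0 < x $ 1} \<inter> ({x. 0 \<le> x $ 2} \<inter> {x. x $ 2 < 2 * pi}) \<in> sets borel" by auto
    then show ?thesis by (simp add: S_def Int_def)
  qed
  have der: "(g has_derivative g' x) (at x within S)" for x :: "real^2"
    unfolding g_def[abs_def] g'_def[abs_def]
    by (auto intro!: derivative_eq_intros simp: fun_eq_iff algebra_simps)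
  have det: "det (matrix (g' x)) = x $ 1" for x
  proof -
    have "det (matrix (g' x)) = (\<epsilon> * \<epsilon>) * (x $ 1 * ((sin (x $ 2))\<^sup>2 + (cos (x $ 2))\<^sup>2))"
      by (simp add: det_2 matrix_def g'_def axis_def power2_eq_square algebra_simps
          del: sin_cos_squared_add sin_cos_squared_add2 sin_cos_squared_add3)
    then show ?thesis by (simp add: \<epsilon>2)
  qed
  have inj: "inj_on g S"
  proof (rule inj_onI)
    fix x y assume x: "x \<in> S" and y: "y \<in> S" and eq: "g x = g y"
    have "norm (g x) = x $ 1" "norm (g y) = y $ 1" using x y \<epsilon>2 by (auto simp: gp inner_perp S_def abs_mult)
    then have 1: "x $ 1 = y $ 1" using eq by simp
    then have "perp (circ (x $ 2)) = perp (circ (y $ 2))" using eq x \<epsilon>2 unfolding gp by (auto simp: S_def)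
    then have "perp (perp (circ (x $ 2))) = perp (perp (circ (y $ 2)))" by simp
    then have "circ (x $ 2) = circ (y $ 2)" by (simp add: inner_perp)
    then have "x $ 2 = y $ 2" using x y by (intro circ_inj) (auto simp: S_def)
    then show "x = y" using 1 by (simp add: vec_eq_iff forall_2)
  qed
  have img: "g ` S = - {0}"
  proof (intro subset_antisym subsetI)
    fix y assume "y \<in> g ` S"
    then obtain x where x: "x \<in> S" "y = g x" by blast
    then have "norm y \<noteq> 0" using \<epsilon>2 by (auto simp: gp inner_perp S_def abs_mult)
    then show "y \<in> - {0}" by auto
  next
    fix \<xi> :: "real^2" assume "\<xi> \<in> - {0}"
    then have \<xi>: "\<xi> \<noteq> 0" by simp
    define \<theta> where "\<theta> = (\<epsilon> / norm \<xi>) *\<^sub>R perp \<xi>"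
    have n: "norm \<theta> = 1" using \<xi> \<epsilon>2 by (simp add: \<theta>_def inner_perp)
    define x :: "real^2" where "x = vector [norm \<xi>, angle \<theta>]"
    have "x \<in> S" using \<xi> angle_bounds(1)[of \<theta>] Arg2pi_lt_2pi by (simp add: S_def x_def angle_def)
    moreover have "g x = \<xi>"
    proof -
      have "g x = (- \<epsilon> * norm \<xi>) *\<^sub>R perp \<theta>" by (simp add: gp x_def circ_angle[OF n])
      also have "perp \<theta> = (\<epsilon> / norm \<xi>) *\<^sub>R (- \<xi>)" by (simp add: \<theta>_def inner_perp)
      finally show ?thesis using \<xi> \<epsilon>2 by simp
    qed
    ultimately show "\<xi> \<in> g ` S" by blast
  qed
  have gm: "g \<in> borel_measurable borel"
    unfolding g_def[abs_def]
    by (intro borel_measurable_continuous_onI continuous_intros continuous_on_compose2[of UNIV sin] continuous_on_compose2[of UNIV cos]) auto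
  have Kg: "(\<lambda>x. K (g x)) \<in> borel_measurable borel" using measurable_compose[OF gm Km] .
  have x1: "(\<lambda>x::real^2. x $ 1) \<in> borel_measurable borel"
    by (intro borel_measurable_continuous_onI continuous_intros)
  have Dm: "(\<lambda>x. \<bar>x $ 1\<bar> * K (g x)) \<in> borel_measurable borel" using Kg x1 by simp
  \<comment> \<open>The change of variables theorem is about functions with values in Euclidean spaces \<open>real ^ 'n\<close>.\<close>
  let ?L = "\<lambda>x. vec (K x) :: real^1"
  have "(\<lambda>x. \<bar>det (matrix (g' x))\<bar> *\<^sub>R ?L (g x)) absolutely_integrable_on S \<longleftrightarrow> ?L absolutely_integrable_on (g ` S)"
    using has_absolute_integral_change_of_variables[of S g g' ?L, OF _ der inj] Sb by auto
  then have "(\<lambda>x. \<bar>x $ 1\<bar> * K (g x)) absolutely_integrable_on S \<longleftrightarrow> K absolutely_integrable_on (- {0})"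
    by (simp add: absolutely_integrable_on_1_iff det img)
  then have "integrable lborel (\<lambda>x. indicator S x *\<^sub>R (\<bar>x $ 1\<bar> * K (g x))) \<longleftrightarrow> integrable lborel (\<lambda>x. indicator (- {0}) x *\<^sub>R K x)"
    using set_integrable_lebesgue_iff[OF Dm Sb] set_integrable_lebesgue_iff[OF Km, of "- {0}"] by simp
  also have "integrable lborel (\<lambda>x. indicator (- {0}) x *\<^sub>R K x) \<longleftrightarrow> integrable lborel K"
  proof (rule integrable_cong_AE)
    show "AE x in lborel. indicator (- {0}) x *\<^sub>R K x = K x"
      using AE_lborel_singleton[of 0] by eventually_elim auto
  qed (use Km in auto)
  finally have 1: "integrable lborel K \<longleftrightarrow> integrable lborel (\<lambda>x. indicator S x *\<^sub>R (\<bar>x $ 1\<bar> * K (g x)))" by blast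
  have hm: "(\<lambda>x. indicator S x *\<^sub>R (\<bar>x $ 1\<bar> * K (g x))) \<in> borel_measurable borel" using Dm Sb by simp
  define F where "F \<sigma> t = indicator {0<..} \<sigma> * (indicator {0..<2 * pi} t * (\<sigma> * K ((- \<epsilon> * \<sigma>) *\<^sub>R perp (circ t))))" for \<sigma> t :: real
  have F: "indicator S (vector [\<sigma>, t] :: real^2) *\<^sub>R (\<bar>(vector [\<sigma>, t] :: real^2) $ 1\<bar> * K (g (vector [\<sigma>, t]))) = F \<sigma> t" for \<sigma> t
    by (auto simp: F_def S_def gp indicator_def)
  have Fm: "case_prod F \<in> borel_measurable (lborel \<Otimes>\<^sub>M lborel)"
  proof -
    have "(\<lambda>z. indicator S (vector [fst z, snd z] :: real^2) *\<^sub>R (\<bar>(vector [fst z, snd z] :: real^2) $ 1\<bar> * K (g (vector [fst z, snd z])))) \<in> borel_measurable borel"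
      using measurable_compose[OF measurable_vec2 hm] by simp
    then show ?thesis unfolding F by (simp add: lborel_prod case_prod_unfold)
  qed
  have "integrable lborel K \<longleftrightarrow> integrable (lborel \<Otimes>\<^sub>M lborel) (case_prod F)"
    unfolding 1 integrable_vec2_iff[OF hm] F by (simp add: case_prod_unfold)
  also have "\<dots> \<longleftrightarrow> (\<integral>\<^sup>+z. ennreal (case_prod F z) \<partial>(lborel \<Otimes>\<^sub>M lborel)) < \<infinity>"
  proof -
    have "norm (case_prod F z) = case_prod F z" for z
      using K0 by (auto simp: F_def indicator_def case_prod_unfold)
    then show ?thesis using Fm unfolding integrable_iff_bounded by simp
  qed
  also have "(\<integral>\<^sup>+z. ennreal (case_prod F z) \<partial>(lborel \<Otimes>\<^sub>M lborel)) = (\<integral>\<^sup>+t. \<integral>\<^sup>+\<sigma>. ennreal (F \<sigma> t) \<partial>lborel \<partial>lborel)"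
  proof -
    have "(\<lambda>z. ennreal (case_prod F z)) \<in> borel_measurable (lborel \<Otimes>\<^sub>M lborel)" using Fm by simp
    from lborel_pair.nn_integral_snd[OF this] show ?thesis by simp
  qed
  also have "\<dots> = (\<integral>\<^sup>+t. indicator {0..<2 * pi} t * (\<integral>\<^sup>+\<sigma>. indicator {0<..} \<sigma> * ennreal (\<sigma> * K ((- \<epsilon> * \<sigma>) *\<^sub>R perp (circ t))) \<partial>lborel) \<partial>lborel)"
    unfolding F_def
    by (intro nn_integral_cong) (auto simp: indicator_def intro!: nn_integral_cong)
  finally show ?thesis .
qed

section \<open>Discrete convolutions and lattice sums\<close>

lemma nn_integral_int_decode: "(\<integral>\<^sup>+k. f k \<partial>count_space (UNIV :: int set)) = (\<Sum>j. f (int_decode j))"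
  using nn_integral_bij_count_space[OF bij_int_decode, of f] by (simp add: nn_integral_count_space_nat)

text \<open>Young's inequality \<open>\<ell>\<^sup>1 * \<ell>\<^sup>2 \<subseteq> \<ell>\<^sup>2\<close>: split \<open>\<gamma>\<close> into two square roots, apply the Cauchy-Schwarz inequality and exchange the
  sums.\<close>

lemma young_int:
  fixes \<gamma> :: "int \<Rightarrow> ennreal" and V :: "int \<Rightarrow> ennreal"
  assumes \<gamma>: "\<And>n. \<gamma> n = ennreal (c n)" "\<And>n. c n \<ge> 0"
  shows "(\<integral>\<^sup>+k. (\<integral>\<^sup>+n. \<gamma> n * V (k - n) \<partial>count_space UNIV)\<^sup>2 \<partial>count_space UNIV)
      \<le> (\<integral>\<^sup>+n. \<gamma> n \<partial>count_space UNIV)\<^sup>2 * (\<integral>\<^sup>+k. (V k)\<^sup>2 \<partial>count_space UNIV)"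
proof -
  let ?I = "count_space (UNIV :: int set)"
  let ?G = "\<integral>\<^sup>+n. \<gamma> n \<partial>?I"
  have sq: "ennreal (sqrt (c n)) * ennreal (sqrt (c n)) = \<gamma> n" for n
    using \<gamma> by (simp add: ennreal_mult'[symmetric])
  have cs: "(\<integral>\<^sup>+n. \<gamma> n * V (k - n) \<partial>?I)\<^sup>2 \<le> ?G * (\<integral>\<^sup>+n. \<gamma> n * (V (k - n))\<^sup>2 \<partial>?I)" for k
  proof -
    have "(\<integral>\<^sup>+n. ennreal (sqrt (c n)) * (ennreal (sqrt (c n)) * V (k - n)) \<partial>?I)\<^sup>2 \<le>
       (\<integral>\<^sup>+n. (ennreal (sqrt (c n)))\<^sup>2 \<partial>?I) * (\<integral>\<^sup>+n. (ennreal (sqrt (c n)) * V (k - n))\<^sup>2 \<partial>?I)"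
      by (rule Cauchy_Schwarz_nn_integral) auto
    moreover have "ennreal (sqrt (c n)) * (ennreal (sqrt (c n)) * V (k - n)) = \<gamma> n * V (k - n)" for n
      by (simp only: mult.assoc[symmetric] sq)
    moreover have "(ennreal (sqrt (c n)))\<^sup>2 = \<gamma> n" for n by (simp only: power2_eq_square sq)
    moreover from this have "(ennreal (sqrt (c n)) * V (k - n))\<^sup>2 = \<gamma> n * (V (k - n))\<^sup>2" for n
      by (simp only: power_mult_distrib)
    ultimately show ?thesis by simp
  qed
  have shift: "(\<integral>\<^sup>+k. (V (k - n))\<^sup>2 \<partial>?I) = (\<integral>\<^sup>+k. (V k)\<^sup>2 \<partial>?I)" for n
  proof -
    have "bij_betw (\<lambda>k. k - n) (UNIV :: int set) UNIV" by (rule bij_betwI[of _ _ _ "\<lambda>k. k + n"]) auto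
    from nn_integral_bij_count_space[OF this, of "\<lambda>k. (V k)\<^sup>2"] show ?thesis .
  qed
  have "(\<integral>\<^sup>+k. (\<integral>\<^sup>+n. \<gamma> n * V (k - n) \<partial>?I)\<^sup>2 \<partial>?I) \<le> (\<integral>\<^sup>+k. ?G * (\<integral>\<^sup>+n. \<gamma> n * (V (k - n))\<^sup>2 \<partial>?I) \<partial>?I)"
    by (intro nn_integral_mono cs)
  also have "\<dots> = ?G * (\<integral>\<^sup>+k. \<integral>\<^sup>+n. \<gamma> n * (V (k - n))\<^sup>2 \<partial>?I \<partial>?I)" by (rule nn_integral_cmult) auto
  also have "(\<integral>\<^sup>+k. \<integral>\<^sup>+n. \<gamma> n * (V (k - n))\<^sup>2 \<partial>?I \<partial>?I) = (\<integral>\<^sup>+n. \<integral>\<^sup>+k. \<gamma> n * (V (k - n))\<^sup>2 \<partial>?I \<partial>?I)"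
    by (rule nn_integral_count_space_nn_integral) auto
  also have "\<dots> = (\<integral>\<^sup>+n. \<gamma> n * (\<integral>\<^sup>+k. (V k)\<^sup>2 \<partial>?I) \<partial>?I)"
    by (simp add: nn_integral_cmult shift)
  also have "\<dots> = ?G * (\<integral>\<^sup>+k. (V k)\<^sup>2 \<partial>?I)" by (rule nn_integral_multc) auto
  finally show ?thesis by (simp add: power2_eq_square mult.assoc)
qed

lemma nn_integral_unit_cells:
  fixes F :: "real \<Rightarrow> ennreal"
  assumes [measurable]: "F \<in> borel_measurable borel"
  shows "(\<integral>\<^sup>+\<sigma>. F \<sigma> \<partial>lborel) = (\<integral>\<^sup>+b. indicator {0..<1} b * (\<Sum>j. F (of_int (int_decode j) + b)) \<partial>lborel)"
proof -
  have "(\<integral>\<^sup>+b. indicator {0..<1} b * (\<Sum>j. F (of_int (int_decode j) + b)) \<partial>lborel) = (\<Sum>j. \<integral>\<^sup>+b. indicator {0..<1} b * F (of_int (int_decode j) + b) \<partial>lborel)"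
    unfolding ennreal_suminf_cmult[symmetric] by (rule nn_integral_suminf) measurable
  also have "\<dots> = (\<Sum>j. \<integral>\<^sup>+\<sigma>. indicator {0..<1} (\<sigma> - of_int (int_decode j)) * F \<sigma> \<partial>lborel)"
  proof (rule suminf_cong)
    fix j
    have "(\<lambda>\<sigma>. indicator {0..<1} (\<sigma> - of_int (int_decode j)) * F \<sigma>) \<in> borel_measurable borel" by measurable
    from nn_integral_real_affine[OF this, of 1 "of_int (int_decode j)"]
    show "(\<integral>\<^sup>+b. indicator {0..<1} b * F (of_int (int_decode j) + b) \<partial>lborel) = (\<integral>\<^sup>+\<sigma>. indicator {0..<1} (\<sigma> - of_int (int_decode j)) * F \<sigma> \<partial>lborel)"
      by simp
  qed
  also have "\<dots> = (\<integral>\<^sup>+\<sigma>. (\<Sum>j. indicator {0..<1} (\<sigma> - of_int (int_decode j)) * F \<sigma>) \<partial>lborel)"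
    by (rule nn_integral_suminf[symmetric]) measurable
  also have "\<dots> = (\<integral>\<^sup>+\<sigma>. F \<sigma> \<partial>lborel)"
  proof (rule nn_integral_cong)
    fix \<sigma> :: real
    have "(indicator {0..<1} (\<sigma> - of_int (int_decode j)) :: ennreal) = (if j = int_encode \<lfloor>\<sigma>\<rfloor> then 1 else 0)" for j
    proof -
      have "\<sigma> - of_int (int_decode j) \<in> {0..<1} \<longleftrightarrow> int_decode j = \<lfloor>\<sigma>\<rfloor>"
        by (auto simp: floor_unique) linarith+
      also have "\<dots> \<longleftrightarrow> j = int_encode \<lfloor>\<sigma>\<rfloor>" by (metis int_decode_inverse int_encode_inverse)
      finally show ?thesis by (simp add: indicator_def)
    qed
    then have "(\<lambda>j. indicator {0..<1} (\<sigma> - of_int (int_decode j)) * F \<sigma>) = (\<lambda>j. if j = int_encode \<lfloor>\<sigma>\<rfloor> then F \<sigma> else 0)" by auto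
    then show "(\<Sum>j. indicator {0..<1} (\<sigma> - of_int (int_decode j)) * F \<sigma>) = F \<sigma>"
      using sums_single[of "int_encode \<lfloor>\<sigma>\<rfloor>" "\<lambda>j. F \<sigma>"] by (simp add: sums_iff)
  qed
  finally show ?thesis by simp
qed

text \<open>Peetre's inequality, for exponents of either sign: \<open>1 + a\<^sup>2\<close> is at most \<open>(2 (1 + |a - b|))\<^sup>2 (1 + b\<^sup>2)\<close>, and the roles of \<open>a\<close>
  and \<open>b\<close> may be exchanged.\<close>

lemma peetre:
  fixes x y s :: real
  shows "(1 + x\<^sup>2) powr (s / 2) \<le> (2 * (1 + \<bar>x - y\<bar>)) ^ nat \<lceil>\<bar>s\<bar>\<rceil> * (1 + y\<^sup>2) powr (s / 2)"
proof -
  let ?d = "2 * (1 + \<bar>x - y\<bar>)"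
  have key: "1 + a\<^sup>2 \<le> ?d\<^sup>2 * (1 + b\<^sup>2)" if "\<bar>a - b\<bar> = \<bar>x - y\<bar>" for a b
  proof -
    have "a\<^sup>2 \<le> 2 * (a - b)\<^sup>2 + 2 * b\<^sup>2" using zero_le_power2[of "a - 2 * b"] by (simp add: power2_eq_square algebra_simps)
    moreover have "?d\<^sup>2 * (1 + b\<^sup>2) = ?d\<^sup>2 + ?d\<^sup>2 * b\<^sup>2" by (simp add: algebra_simps)
    moreover have d2: "?d\<^sup>2 = 4 + 8 * \<bar>a - b\<bar> + 4 * (a - b)\<^sup>2" unfolding that[symmetric] by (simp add: power2_eq_square algebra_simps abs_mult_self_eq)
    moreover have "4 * b\<^sup>2 \<le> ?d\<^sup>2 * b\<^sup>2" unfolding d2 by (intro mult_right_mono) (auto simp: add_nonneg_nonneg)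
    moreover have "0 \<le> (a - b)\<^sup>2" "0 \<le> b\<^sup>2" "0 \<le> \<bar>a - b\<bar>" by auto
    ultimately show ?thesis
      by (smt (verit))
  qed
  have pos: "1 + x\<^sup>2 > 0" "1 + y\<^sup>2 > 0" by (auto intro: add_pos_nonneg)
  have dpow: "(?d\<^sup>2) powr (\<bar>s\<bar> / 2) \<le> ?d ^ nat \<lceil>\<bar>s\<bar>\<rceil>"
  proof -
    have "?d\<^sup>2 = ?d powr 2" using powr_realpow[of ?d 2] by simp
    then have "(?d\<^sup>2) powr (\<bar>s\<bar> / 2) = ?d powr \<bar>s\<bar>" by (simp only: powr_powr) simp
    also have "\<dots> \<le> ?d powr (real (nat \<lceil>\<bar>s\<bar>\<rceil>))" by (intro powr_mono) (linarith, simp)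
    also have "\<dots> = ?d ^ nat \<lceil>\<bar>s\<bar>\<rceil>" by (rule powr_realpow) (simp add: add_pos_nonneg)
    finally show ?thesis .
  qed
  show ?thesis
  proof (cases "s \<ge> 0")
    case True
    have "(1 + x\<^sup>2) powr (s / 2) \<le> (?d\<^sup>2 * (1 + y\<^sup>2)) powr (s / 2)" using True pos key[of x y] by (intro powr_mono2) auto
    also have "\<dots> = (?d\<^sup>2) powr (\<bar>s\<bar> / 2) * (1 + y\<^sup>2) powr (s / 2)" using True pos by (simp add: powr_mult)
    also have "\<dots> \<le> ?d ^ nat \<lceil>\<bar>s\<bar>\<rceil> * (1 + y\<^sup>2) powr (s / 2)" by (intro mult_right_mono dpow) auto
    finally show ?thesis .
  next
    case False
    have "(1 + y\<^sup>2) powr (\<bar>s\<bar> / 2) \<le> (?d\<^sup>2 * (1 + x\<^sup>2)) powr (\<bar>s\<bar> / 2)" using pos key[of y x] by (intro powr_mono2) auto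
    also have "\<dots> = (?d\<^sup>2) powr (\<bar>s\<bar> / 2) * (1 + x\<^sup>2) powr (\<bar>s\<bar> / 2)" using pos by (simp add: powr_mult)
    also have "\<dots> \<le> ?d ^ nat \<lceil>\<bar>s\<bar>\<rceil> * (1 + x\<^sup>2) powr (\<bar>s\<bar> / 2)" by (intro mult_right_mono dpow) auto
    finally have *: "(1 + y\<^sup>2) powr (\<bar>s\<bar> / 2) \<le> ?d ^ nat \<lceil>\<bar>s\<bar>\<rceil> * (1 + x\<^sup>2) powr (\<bar>s\<bar> / 2)" .
    have "z powr (s / 2) = inverse (z powr (\<bar>s\<bar> / 2))" for z :: real using False by (simp add: powr_minus[symmetric])
    moreover have "(1 + x\<^sup>2) powr (\<bar>s\<bar> / 2) > 0" "(1 + y\<^sup>2) powr (\<bar>s\<bar> / 2) > 0" using pos by auto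
    ultimately show ?thesis using * by (simp add: field_simps)
  qed
qed

section \<open>Energies on the two sides\<close>

lemma ennreal_norm_sums_le:
  fixes f :: "nat \<Rightarrow> 'b::banach"
  assumes "f sums l" shows "ennreal (norm l) \<le> (\<Sum>j. ennreal (norm (f j)))"
proof (cases "(\<Sum>j. ennreal (norm (f j))) = \<top>")
  case False
  then have sm: "summable (\<lambda>j. norm (f j))" by (intro summable_suminf_not_top) auto
  have "norm l \<le> (\<Sum>j. norm (f j))" using summable_norm[OF sm] sums_unique[OF assms] by simp
  then show ?thesis using suminf_ennreal2[OF norm_ge_zero sm] by (simp add: ennreal_leI)
qed simp

lemma continuous_on_pair_sections:
  fixes f :: "real \<Rightarrow> real \<Rightarrow> 'b::topological_space"
  assumes "continuous_on UNIV (\<lambda>z. f (fst z) (snd z))"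
  shows "continuous_on S (\<lambda>x. f x t)" "continuous_on S (f x)"
  by (rule continuous_on_compose_pair[OF assms]; intro continuous_intros)+

text \<open>The two families of norms to be compared: \<open>energy\<close> integrates over the
  frequency, \<open>lattice_energy\<close> sums over a translate of the integers. The variant
  \<open>half_shifted\<close> trades half a derivative for the Jacobian \<open>|\<sigma>|\<close> of polar coordinates, and
  \<open>plane_density\<close> is the integrand of the Sobolev norm on the plane.\<close>

definition weighted :: "(real \<Rightarrow> real \<Rightarrow> complex) \<Rightarrow> real \<Rightarrow> real \<Rightarrow> real \<Rightarrow> real" where
  "weighted A s \<sigma> t = (1 + \<sigma>\<^sup>2) powr (s / 2) * cmod (A \<sigma> t)"

definition lattice_energy :: "(real \<Rightarrow> real \<Rightarrow> complex) \<Rightarrow> real \<Rightarrow> real \<Rightarrow> real \<Rightarrow> ennreal" where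
  "lattice_energy A s b t = (\<integral>\<^sup>+k. (ennreal (weighted A s (of_int k + b) t))\<^sup>2 \<partial>count_space UNIV)"

definition energy :: "(real \<Rightarrow> real \<Rightarrow> complex) \<Rightarrow> real \<Rightarrow> real \<Rightarrow> ennreal" where
  "energy A s t = (\<integral>\<^sup>+\<sigma>. (ennreal (weighted A s \<sigma> t))\<^sup>2 \<partial>lborel)"

definition half_shifted :: "(real \<Rightarrow> real \<Rightarrow> complex) \<Rightarrow> real \<Rightarrow> real \<Rightarrow> real \<Rightarrow> real" where
  "half_shifted A s \<sigma> t = \<bar>\<sigma>\<bar> * ((1 + \<sigma>\<^sup>2) powr (s - 1/2) * (cmod (A \<sigma> t))\<^sup>2)"

definition plane_density :: "(real \<Rightarrow> real \<Rightarrow> complex) \<Rightarrow> real \<Rightarrow> real \<Rightarrow> real^2 \<Rightarrow> real" where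
  "plane_density A s \<epsilon> \<xi> = (1 + (norm \<xi>)\<^sup>2) powr (s - 1/2) * (cmod (A (- \<epsilon> * norm \<xi>) (angle (\<epsilon> *\<^sub>R (perp \<xi> /\<^sub>R norm \<xi>)))))\<^sup>2"

definition half_energy :: "(real \<Rightarrow> real \<Rightarrow> complex) \<Rightarrow> real \<Rightarrow> real \<Rightarrow> ennreal" where
  "half_energy A s t = (\<integral>\<^sup>+\<sigma>. ennreal (half_shifted A s \<sigma> t) \<partial>lborel)"

lemma plane_symbol_measurable:
  fixes A :: "real \<Rightarrow> real \<Rightarrow> complex"
  assumes "continuous_on UNIV (\<lambda>z. A (fst z) (snd z))"
  shows "(\<lambda>\<xi>. A (- \<epsilon> * norm \<xi>) (angle (\<epsilon> *\<^sub>R (perp \<xi> /\<^sub>R norm \<xi>)))) \<in> borel_measurable borel"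
proof -
  have "continuous_on UNIV perp" unfolding perp_def by (intro continuous_intros)
  then have [measurable]: "perp \<in> borel_measurable borel" by (rule borel_measurable_continuous_onI)
  have "(\<lambda>\<xi>. (- \<epsilon> * norm \<xi>, angle (\<epsilon> *\<^sub>R (perp \<xi> /\<^sub>R norm \<xi>)))) \<in> borel_measurable borel"
    by (intro borel_measurable_Pair) measurable
  from measurable_compose[OF this borel_measurable_continuous_onI[OF assms]] show ?thesis by simp
qed

text \<open>The properties of the Fourier transform in \<open>p\<close> that the comparison uses: continuity, a sampling
  formula, dependence on the direction only, and polynomial growth.\<close>

context
  fixes A :: "real \<Rightarrow> real \<Rightarrow> complex" and s D :: real and N :: nat and C :: "real \<Rightarrow> int \<Rightarrow> complex"
  assumes A_cont: "continuous_on UNIV (\<lambda>z. A (fst z) (snd z))"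
    and C_decay: "\<And>M. \<exists>B\<ge>0. \<forall>c\<in>{-1..1}. \<forall>n. cmod (C c n) * (1 + \<bar>of_int n\<bar>) ^ M \<le> B"
    and C_sums: "\<And>a b t. \<bar>a - b\<bar> \<le> 1 \<Longrightarrow> (\<lambda>j. C (a - b) (int_decode j) * A (b - of_int (int_decode j)) t) sums A a t"
    and A_circ: "\<And>\<sigma> t t'. circ t = circ t' \<Longrightarrow> A \<sigma> t = A \<sigma> t'"
    and A_growth: "\<And>\<sigma> t. cmod (A \<sigma> t) \<le> D * (1 + \<bar>\<sigma>\<bar>) ^ N"
begin

lemma weighted_nonneg: "weighted A s \<sigma> t \<ge> 0" by (simp add: weighted_def)

lemma A_section_measurable [measurable]: "(\<lambda>\<sigma>. A \<sigma> t) \<in> borel_measurable borel" "A \<sigma> \<in> borel_measurable borel"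
  by (intro borel_measurable_continuous_onI continuous_on_pair_sections[OF A_cont])+

lemma A_pair_measurable [measurable]: "(\<lambda>z. A (snd z) (fst z)) \<in> borel_measurable (lborel \<Otimes>\<^sub>M lborel)"
proof -
  have "continuous_on UNIV (\<lambda>z::real \<times> real. A (snd z) (fst z))"
    by (rule continuous_on_compose_pair[OF A_cont]) (intro continuous_intros)+
  then show ?thesis by (simp add: lborel_prod borel_measurable_continuous_onI)
qed

lemma weighted_section_measurable [measurable]: "(\<lambda>\<sigma>. weighted A s \<sigma> t) \<in> borel_measurable borel" "weighted A s \<sigma> \<in> borel_measurable borel"
  unfolding weighted_def[abs_def] by measurable

lemma lattice_energy_sums: "lattice_energy A s b t = (\<Sum>j. (ennreal (weighted A s (of_int (int_decode j) + b) t))\<^sup>2)"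
  unfolding lattice_energy_def by (rule nn_integral_int_decode)

text \<open>The sampling formula writes the values on one translate of the lattice as a convolution of those on
  another. Peetre's inequality moves the weight inside at the cost of a power of \<open>1 + |n|\<close>, which the rapid
  decay of the coefficients absorbs, and Young's inequality bounds the convolution.\<close>

lemma lattice_energy_comparable:
  obtains Q :: ennreal where "Q < \<infinity>" "\<And>b b' t. \<bar>b - b'\<bar> \<le> 1 \<Longrightarrow> lattice_energy A s b t \<le> Q * lattice_energy A s b' t"
proof -
  define m where "m = nat \<lceil>\<bar>s\<bar>\<rceil>"
  \<comment> \<open>Here \<open>m\<close> powers pay for the change of weight and two for summability.\<close>
  obtain B where B: "B \<ge> 0" "\<And>c n. c \<in> {-1..1} \<Longrightarrow> cmod (C c n) * (1 + \<bar>of_int n\<bar>) ^ (m + 2) \<le> B"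
    using C_decay[of "m + 2"] by blast
  define c where "c n = 4 ^ m * (B / (1 + \<bar>real_of_int n\<bar>) ^ 2)" for n
  have c0: "c n \<ge> 0" for n using B by (simp add: c_def)
  define \<Gamma> where "\<Gamma> = (\<integral>\<^sup>+n. ennreal (c n) \<partial>count_space UNIV)"
  have \<Gamma>: "\<Gamma> < \<infinity>"
  proof -
    have "summable (\<lambda>j. c (int_decode j))"
    proof (rule summable_comparison_test'[of "\<lambda>j. 4 ^ m * (B * 4) * (1 / real (Suc j) ^ 2)" 0])
      have "summable (\<lambda>j. 1 / real (Suc j) ^ 2)"
        using summable_Suc_iff[of "\<lambda>j. 1 / real j ^ 2"] inverse_power_summable[of 2, where 'a=real] by (simp add: inverse_eq_divide)
      then show "summable (\<lambda>j. 4 ^ m * (B * 4) * (1 / real (Suc j) ^ 2))" by (rule summable_mult)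
      fix j
      let ?n = "real_of_int (int_decode j)"
      have "real (Suc j) ^ 2 \<le> (2 * (1 + \<bar>?n\<bar>)) ^ 2" using int_decode_growth[of j] by (intro power_mono) auto
      then have "1 / (1 + \<bar>?n\<bar>) ^ 2 \<le> 4 * (1 / real (Suc j) ^ 2)" unfolding power_mult_distrib
        by (simp add: field_simps add_pos_nonneg del: of_nat_Suc)
      then have "4 ^ m * B * (1 / (1 + \<bar>?n\<bar>) ^ 2) \<le> 4 ^ m * B * (4 * (1 / real (Suc j) ^ 2))" using B by (intro mult_left_mono) auto
      then show "norm (c (int_decode j)) \<le> 4 ^ m * (B * 4) * (1 / real (Suc j) ^ 2)" using c0[of "int_decode j"] by (simp add: c_def)
    qed
    from ennreal_suminf_neq_top[OF this c0] show ?thesis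
      unfolding \<Gamma>_def nn_integral_int_decode by (simp add: less_top[symmetric])
  qed
  have step: "ennreal (weighted A s (of_int k + b) t) \<le> (\<integral>\<^sup>+n. ennreal (c n) * ennreal (weighted A s (of_int (k - n) + b') t) \<partial>count_space UNIV)"
    if bb: "\<bar>b - b'\<bar> \<le> 1" for b b' t k
  proof -
    let ?a = "of_int k + b" and ?f = "\<lambda>n. C (b - b') n * A (of_int k + b' - of_int n) t"
    have "(\<lambda>j. ?f (int_decode j)) sums A ?a t" using C_sums[of ?a "of_int k + b'" t] bb by simp
    from ennreal_norm_sums_le[OF this]
    have "ennreal ((1 + ?a\<^sup>2) powr (s / 2)) * ennreal (cmod (A ?a t)) \<le> ennreal ((1 + ?a\<^sup>2) powr (s / 2)) * (\<Sum>j. ennreal (norm (?f (int_decode j))))"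
      by (rule mult_left_mono) simp
    also have "\<dots> = (\<Sum>j. ennreal ((1 + ?a\<^sup>2) powr (s / 2)) * ennreal (norm (?f (int_decode j))))"
      by (rule ennreal_suminf_cmult[symmetric])
    also have "\<dots> \<le> (\<Sum>j. ennreal (c (int_decode j)) * ennreal (weighted A s (of_int (k - int_decode j) + b') t))"
    proof (intro suminf_le summableI)
      fix j
      let ?n = "int_decode j"
      let ?x = "of_int (k - ?n) + b'"
      have xe: "of_int k + b' - of_int ?n = ?x" by simp
      have "\<bar>?a - ?x\<bar> \<le> 1 + \<bar>real_of_int ?n\<bar>" using bb by simp
      then have "2 * (1 + \<bar>?a - ?x\<bar>) \<le> 4 * (1 + \<bar>real_of_int ?n\<bar>)"
        using abs_ge_zero[of "real_of_int ?n"] by argo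
      then have "(2 * (1 + \<bar>?a - ?x\<bar>)) ^ m \<le> (4 * (1 + \<bar>real_of_int ?n\<bar>)) ^ m" by (intro power_mono) auto
      then have w: "(1 + ?a\<^sup>2) powr (s / 2) \<le> (4 * (1 + \<bar>real_of_int ?n\<bar>)) ^ m * (1 + ?x\<^sup>2) powr (s / 2)"
        by (intro order_trans[OF peetre[of ?a s ?x]] mult_right_mono) (auto simp: m_def)
      have "cmod (C (b - b') ?n) * (1 + \<bar>of_int ?n\<bar>) ^ m * (1 + \<bar>of_int ?n\<bar>) ^ 2 \<le> B"
        using B(2)[of "b - b'" ?n] bb unfolding power_add mult.assoc by (simp add: abs_le_iff)
      then have cb: "cmod (C (b - b') ?n) * (1 + \<bar>of_int ?n\<bar>) ^ m \<le> B / (1 + \<bar>real_of_int ?n\<bar>) ^ 2"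
        by (subst pos_le_divide_eq) (auto simp: add_pos_nonneg)
      have "(1 + ?a\<^sup>2) powr (s / 2) * norm (?f ?n) \<le> (4 * (1 + \<bar>real_of_int ?n\<bar>)) ^ m * (1 + ?x\<^sup>2) powr (s / 2) * norm (?f ?n)"
        by (intro mult_right_mono w) auto
      also have "\<dots> = 4 ^ m * (cmod (C (b - b') ?n) * (1 + \<bar>of_int ?n\<bar>) ^ m) * weighted A s ?x t"
        unfolding weighted_def xe norm_mult power_mult_distrib by (simp only: mult_ac)
      also have "\<dots> \<le> 4 ^ m * (B / (1 + \<bar>real_of_int ?n\<bar>) ^ 2) * weighted A s ?x t"
        by (intro mult_right_mono mult_left_mono cb weighted_nonneg) auto
      finally have "(1 + ?a\<^sup>2) powr (s / 2) * norm (?f ?n) \<le> c ?n * weighted A s ?x t" by (simp add: c_def)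
      then have "ennreal ((1 + ?a\<^sup>2) powr (s / 2) * norm (?f ?n)) \<le> ennreal (c ?n * weighted A s ?x t)" by (rule ennreal_leI)
      then show "ennreal ((1 + ?a\<^sup>2) powr (s / 2)) * ennreal (norm (?f ?n)) \<le> ennreal (c ?n) * ennreal (weighted A s ?x t)"
        using c0 by (simp only: ennreal_mult[OF powr_ge_zero norm_ge_zero] ennreal_mult[OF c0 weighted_nonneg])
    qed
    finally show ?thesis unfolding nn_integral_int_decode by (simp add: weighted_def ennreal_mult)
  qed
  show ?thesis
  proof (rule that[of "\<Gamma>\<^sup>2"])
    show "\<Gamma>\<^sup>2 < \<infinity>" using \<Gamma> by (simp add: power2_eq_square ennreal_mult_less_top)
    fix b b' t :: real assume bb: "\<bar>b - b'\<bar> \<le> 1"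
    have "lattice_energy A s b t \<le> (\<integral>\<^sup>+k. (\<integral>\<^sup>+n. ennreal (c n) * ennreal (weighted A s (of_int (k - n) + b') t) \<partial>count_space UNIV)\<^sup>2 \<partial>count_space UNIV)"
      unfolding lattice_energy_def by (intro nn_integral_mono power_mono step bb) auto
    also have "\<dots> \<le> \<Gamma>\<^sup>2 * lattice_energy A s b' t"
      unfolding \<Gamma>_def lattice_energy_def
      by (rule young_int[of "\<lambda>n. ennreal (c n)" c "\<lambda>k. ennreal (weighted A s (of_int k + b') t)"]) (auto simp: c0)
    finally show "lattice_energy A s b t \<le> \<Gamma>\<^sup>2 * lattice_energy A s b' t" .
  qed
qed

lemma weighted_pair_measurable [measurable]: "(\<lambda>z. weighted A s (snd z) (fst z)) \<in> borel_measurable (lborel \<Otimes>\<^sub>M lborel)"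
  unfolding weighted_def by measurable

lemma energy_measurable [measurable]: "energy A s \<in> borel_measurable borel"
proof -
  have "(\<lambda>t. \<integral>\<^sup>+\<sigma>. (\<lambda>(t, \<sigma>). (ennreal (weighted A s \<sigma> t))\<^sup>2) (t, \<sigma>) \<partial>lborel) \<in> borel_measurable lborel"
    by (rule lborel.borel_measurable_nn_integral_fst) (simp add: case_prod_unfold)
  then show ?thesis by (simp add: energy_def[abs_def])
qed

lemma lattice_energy_measurable [measurable]: "lattice_energy A s b \<in> borel_measurable borel"
  unfolding lattice_energy_sums[abs_def] by measurable

text \<open>The integral over the line is the average of the sums over the translates of the lattice by \<open>b\<close> in the unit interval,
  all of which are comparable to the one with \<open>b = 0\<close>.\<close>

lemma finite_energy_iff_lattice:
  "(\<integral>\<^sup>+t. indicator {0..<2 * pi} t * energy A s t \<partial>lborel) < \<infinity> \<longleftrightarrow>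
   (\<integral>\<^sup>+t. indicator {0..<2 * pi} t * lattice_energy A s 0 t \<partial>lborel) < \<infinity>"
proof -
  obtain Q :: ennreal where Q: "Q < \<infinity>" "\<And>b b' t. \<bar>b - b'\<bar> \<le> 1 \<Longrightarrow> lattice_energy A s b t \<le> Q * lattice_energy A s b' t"
    by (rule lattice_energy_comparable) blast
  have one: "(\<integral>\<^sup>+b. indicator {0..<1::real} b * a \<partial>lborel) = a" for a :: ennreal
  proof -
    have "(\<integral>\<^sup>+b. indicator {0..<1::real} b * a \<partial>lborel) = (\<integral>\<^sup>+b. indicator {0..<1::real} b \<partial>lborel) * a"
      by (rule nn_integral_multc) simp
    then show ?thesis by simp
  qed
  have en: "energy A s t = (\<integral>\<^sup>+b. indicator {0..<1} b * lattice_energy A s b t \<partial>lborel)" for t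
    unfolding energy_def lattice_energy_sums by (rule nn_integral_unit_cells) measurable
  have mb: "(\<lambda>b. lattice_energy A s b t) \<in> borel_measurable borel" for t
    unfolding lattice_energy_sums by measurable
  have up: "energy A s t \<le> Q * lattice_energy A s 0 t" for t
  proof -
    have "energy A s t \<le> (\<integral>\<^sup>+b. indicator {0..<1::real} b * (Q * lattice_energy A s 0 t) \<partial>lborel)"
      unfolding en by (intro nn_integral_mono) (auto simp: indicator_def intro!: Q(2))
    then show ?thesis unfolding one .
  qed
  have lo: "lattice_energy A s 0 t \<le> Q * energy A s t" for t
  proof -
    have "(\<integral>\<^sup>+b. indicator {0..<1::real} b * lattice_energy A s 0 t \<partial>lborel) \<le> (\<integral>\<^sup>+b. Q * (indicator {0..<1::real} b * lattice_energy A s b t) \<partial>lborel)"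
      by (intro nn_integral_mono) (auto simp: indicator_def intro!: Q(2))
    also have "\<dots> = Q * energy A s t" unfolding en using mb by (intro nn_integral_cmult) auto
    finally show ?thesis unfolding one .
  qed
  have "(\<integral>\<^sup>+t. indicator {0..<2 * pi} t * energy A s t \<partial>lborel) \<le> (\<integral>\<^sup>+t. Q * (indicator {0..<2 * pi} t * lattice_energy A s 0 t) \<partial>lborel)"
    by (intro nn_integral_mono) (auto simp: indicator_def intro!: up)
  also have "\<dots> = Q * (\<integral>\<^sup>+t. indicator {0..<2 * pi} t * lattice_energy A s 0 t \<partial>lborel)" by (rule nn_integral_cmult) measurable
  finally have 1: "(\<integral>\<^sup>+t. indicator {0..<2 * pi} t * energy A s t \<partial>lborel) \<le> Q * (\<integral>\<^sup>+t. indicator {0..<2 * pi} t * lattice_energy A s 0 t \<partial>lborel)" .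
  have "(\<integral>\<^sup>+t. indicator {0..<2 * pi} t * lattice_energy A s 0 t \<partial>lborel) \<le> (\<integral>\<^sup>+t. Q * (indicator {0..<2 * pi} t * energy A s t) \<partial>lborel)"
    by (intro nn_integral_mono) (auto simp: indicator_def intro!: lo)
  also have "\<dots> = Q * (\<integral>\<^sup>+t. indicator {0..<2 * pi} t * energy A s t \<partial>lborel)" by (rule nn_integral_cmult) measurable
  finally have 2: "(\<integral>\<^sup>+t. indicator {0..<2 * pi} t * lattice_energy A s 0 t \<partial>lborel) \<le> Q * (\<integral>\<^sup>+t. indicator {0..<2 * pi} t * energy A s t \<partial>lborel)" .
  show ?thesis
  proof
    assume "(\<integral>\<^sup>+t. indicator {0..<2 * pi} t * energy A s t \<partial>lborel) < \<infinity>"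
    then show "(\<integral>\<^sup>+t. indicator {0..<2 * pi} t * lattice_energy A s 0 t \<partial>lborel) < \<infinity>"
      using 2 Q(1) by (auto simp: ennreal_mult_less_top intro: le_less_trans)
  next
    assume "(\<integral>\<^sup>+t. indicator {0..<2 * pi} t * lattice_energy A s 0 t \<partial>lborel) < \<infinity>"
    then show "(\<integral>\<^sup>+t. indicator {0..<2 * pi} t * energy A s t \<partial>lborel) < \<infinity>"
      using 1 Q(1) by (auto simp: ennreal_mult_less_top intro: le_less_trans)
  qed
qed

lemma finite_lattice_energy_iff_summable:
  "(\<integral>\<^sup>+t. indicator {0..<2 * pi} t * lattice_energy A s 0 t \<partial>lborel) < \<infinity> \<longleftrightarrow> summable (\<lambda>j. mode_norm A s (int_decode j))"
proof -
  have mn: "ennreal (mode_norm A s k) = (\<integral>\<^sup>+t. indicator {0..<2 * pi} t * (ennreal (weighted A s (of_int (- k)) t))\<^sup>2 \<partial>lborel)" for k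
  proof -
    have sq: "(cmod (mode A s k t))\<^sup>2 = (weighted A s (of_int (- k)) t)\<^sup>2" for t
      by (simp add: mode_def weighted_def bessel_weight_def norm_mult)
    have c: "continuous_on {0..2 * pi} (\<lambda>t. (weighted A s (of_int (- k)) t)\<^sup>2)"
      unfolding weighted_def by (intro continuous_intros continuous_on_pair_sections(2)[OF A_cont])
    have i: "integrable lborel (\<lambda>t. indicator {0..2 * pi} t *\<^sub>R (weighted A s (of_int (- k)) t)\<^sup>2)"
      using borel_integrable_atLeastAtMost'[OF c] by (simp add: set_integrable_def)
    have "mode_norm A s k = (LINT t:{0..2 * pi}|lborel. (weighted A s (of_int (- k)) t)\<^sup>2)"
      by (simp add: mode_norm_def sq)
    then have "ennreal (mode_norm A s k) = (\<integral>\<^sup>+t. ennreal (indicator {0..2 * pi} t *\<^sub>R (weighted A s (of_int (- k)) t)\<^sup>2) \<partial>lborel)"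
      using nn_integral_eq_integral[OF i] by (simp add: set_lebesgue_integral_def)
    also have "\<dots> = (\<integral>\<^sup>+t. indicator {0..<2 * pi} t * (ennreal (weighted A s (of_int (- k)) t))\<^sup>2 \<partial>lborel)"
    proof (rule nn_integral_cong_AE)
      show "AE t in lborel. ennreal (indicator {0..2 * pi} t *\<^sub>R (weighted A s (of_int (- k)) t)\<^sup>2) = indicator {0..<2 * pi} t * (ennreal (weighted A s (of_int (- k)) t))\<^sup>2"
        using AE_lborel_singleton[of "2 * pi"] by eventually_elim (auto simp: indicator_def ennreal_power weighted_nonneg)
    qed
    finally show ?thesis .
  qed
  note n0 = mode_norm_nonneg
  have "(\<integral>\<^sup>+t. indicator {0..<2 * pi} t * lattice_energy A s 0 t \<partial>lborel)
      = (\<Sum>j. \<integral>\<^sup>+t. indicator {0..<2 * pi} t * (ennreal (weighted A s (of_int (int_decode j) + 0) t))\<^sup>2 \<partial>lborel)"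
    unfolding lattice_energy_sums ennreal_suminf_cmult[symmetric] by (rule nn_integral_suminf) measurable
  also have "\<dots> = (\<Sum>j. ennreal (mode_norm A s (- int_decode j)))" unfolding mn by simp
  also have "\<dots> = (\<integral>\<^sup>+k. ennreal (mode_norm A s (- k)) \<partial>count_space UNIV)" by (simp add: nn_integral_int_decode)
  also have "\<dots> = (\<integral>\<^sup>+k. ennreal (mode_norm A s k) \<partial>count_space UNIV)"
    by (rule nn_integral_bij_count_space) (rule bij_betwI[of _ _ _ uminus]; simp)
  also have "\<dots> = (\<Sum>j. ennreal (mode_norm A s (int_decode j)))" by (rule nn_integral_int_decode)
  finally have e: "(\<integral>\<^sup>+t. indicator {0..<2 * pi} t * lattice_energy A s 0 t \<partial>lborel) = (\<Sum>j. ennreal (mode_norm A s (int_decode j)))" .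
  show ?thesis unfolding e
  proof
    assume "(\<Sum>j. ennreal (mode_norm A s (int_decode j))) < \<infinity>"
    then show "summable (\<lambda>j. mode_norm A s (int_decode j))" by (intro summable_suminf_not_top n0) auto
  next
    assume "summable (\<lambda>j. mode_norm A s (int_decode j))"
    then show "(\<Sum>j. ennreal (mode_norm A s (int_decode j))) < \<infinity>" using ennreal_suminf_neq_top[OF _ n0] by (simp add: less_top[symmetric])
  qed
qed


lemma half_shifted_nonneg: "half_shifted A s \<sigma> t \<ge> 0" by (simp add: half_shifted_def)

lemma half_shifted_measurable [measurable]: "(\<lambda>\<sigma>. half_shifted A s \<sigma> t) \<in> borel_measurable borel"
  "(\<lambda>z. half_shifted A s (snd z) (fst z)) \<in> borel_measurable (lborel \<Otimes>\<^sub>M lborel)"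
  unfolding half_shifted_def by measurable

lemma weighted_square: "(weighted A s \<sigma> t)\<^sup>2 = (1 + \<sigma>\<^sup>2) powr s * (cmod (A \<sigma> t))\<^sup>2"
proof -
  have "((1 + \<sigma>\<^sup>2) powr (s / 2))\<^sup>2 = (1 + \<sigma>\<^sup>2) powr s" by (simp add: power2_eq_square powr_add[symmetric])
  then show ?thesis by (simp add: weighted_def power_mult_distrib)
qed

lemma half_power_split: "(1 + \<sigma>\<^sup>2) powr s = sqrt (1 + \<sigma>\<^sup>2) * (1 + \<sigma>\<^sup>2) powr (s - 1/2)" for \<sigma> :: real
proof -
  have "1 + \<sigma>\<^sup>2 > 0" by (simp add: add_pos_nonneg)
  then have "sqrt (1 + \<sigma>\<^sup>2) = (1 + \<sigma>\<^sup>2) powr (1/2)" by (simp add: powr_half_sqrt)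
  then show ?thesis by (simp add: powr_add[symmetric])
qed

lemma half_shifted_le: "half_shifted A s \<sigma> t \<le> (weighted A s \<sigma> t)\<^sup>2"
proof -
  have "\<bar>\<sigma>\<bar> \<le> sqrt (1 + \<sigma>\<^sup>2)" by (rule real_le_rsqrt) simp
  then have "\<bar>\<sigma>\<bar> * ((1 + \<sigma>\<^sup>2) powr (s - 1/2) * (cmod (A \<sigma> t))\<^sup>2) \<le> sqrt (1 + \<sigma>\<^sup>2) * ((1 + \<sigma>\<^sup>2) powr (s - 1/2) * (cmod (A \<sigma> t))\<^sup>2)"
    by (rule mult_right_mono) simp
  then show ?thesis unfolding half_shifted_def weighted_square half_power_split by (simp only: mult.assoc)
qed

text \<open>For \<open>|\<sigma>| \<ge> 1\<close> the weights \<open>|\<sigma>|\<close> and \<open>(1 + \<sigma>\<^sup>2)\<^bsup>1/2\<^esup>\<close> are comparable; for smaller \<open>\<sigma>\<close> the function \<open>A\<close> is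
  bounded.\<close>

lemma weighted_le_half_shifted:
  obtains B where "B \<ge> 0" "\<And>\<sigma> t. (weighted A s \<sigma> t)\<^sup>2 \<le> 2 * half_shifted A s \<sigma> t + B * indicator {-1..1} \<sigma>"
proof
  let ?B = "2 powr \<bar>s\<bar> * (\<bar>D\<bar> * 2 ^ N)\<^sup>2"
  show "?B \<ge> 0" by simp
  fix \<sigma> t :: real
  show "(weighted A s \<sigma> t)\<^sup>2 \<le> 2 * half_shifted A s \<sigma> t + ?B * indicator {-1..1} \<sigma>"
  proof (cases "\<bar>\<sigma>\<bar> \<le> 1")
    case True
    then have q: "\<sigma>\<^sup>2 \<le> 1" using abs_square_le_1 by blast
    have "(1 + \<sigma>\<^sup>2) powr s \<le> (1 + \<sigma>\<^sup>2) powr \<bar>s\<bar>" by (intro powr_mono) auto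
    also have "\<dots> \<le> 2 powr \<bar>s\<bar>" using q by (intro powr_mono2) (auto simp: add_nonneg_nonneg)
    finally have p: "(1 + \<sigma>\<^sup>2) powr s \<le> 2 powr \<bar>s\<bar>" .
    have "cmod (A \<sigma> t) \<le> \<bar>D\<bar> * (1 + \<bar>\<sigma>\<bar>) ^ N" by (rule order_trans[OF A_growth]) (auto intro!: mult_right_mono)
    also have "\<dots> \<le> \<bar>D\<bar> * 2 ^ N" using True by (intro mult_left_mono power_mono) auto
    finally have "(cmod (A \<sigma> t))\<^sup>2 \<le> (\<bar>D\<bar> * 2 ^ N)\<^sup>2" by (rule power_mono) simp
    then have "(weighted A s \<sigma> t)\<^sup>2 \<le> ?B" unfolding weighted_square by (intro mult_mono p) auto
    then show ?thesis using True half_shifted_nonneg[of \<sigma> t] by (simp add: indicator_def abs_le_iff)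
  next
    case False
    then have "1 \<le> \<sigma>\<^sup>2" using abs_square_le_1[of \<sigma>] by linarith
    then have "sqrt (1 + \<sigma>\<^sup>2) \<le> 2 * \<bar>\<sigma>\<bar>" by (intro real_le_lsqrt) (auto simp: power_mult_distrib)
    then have "sqrt (1 + \<sigma>\<^sup>2) * ((1 + \<sigma>\<^sup>2) powr (s - 1/2) * (cmod (A \<sigma> t))\<^sup>2) \<le> 2 * \<bar>\<sigma>\<bar> * ((1 + \<sigma>\<^sup>2) powr (s - 1/2) * (cmod (A \<sigma> t))\<^sup>2)"
      by (rule mult_right_mono) simp
    then have "(weighted A s \<sigma> t)\<^sup>2 \<le> 2 * half_shifted A s \<sigma> t" unfolding half_shifted_def weighted_square half_power_split by (simp only: mult.assoc)
    then show ?thesis by (simp add: add_increasing2)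
  qed
qed

lemma half_energy_measurable [measurable]: "half_energy A s \<in> borel_measurable borel"
proof -
  have "(\<lambda>t. \<integral>\<^sup>+\<sigma>. (\<lambda>(t, \<sigma>). ennreal (half_shifted A s \<sigma> t)) (t, \<sigma>) \<partial>lborel) \<in> borel_measurable lborel"
    by (rule lborel.borel_measurable_nn_integral_fst) (simp add: case_prod_unfold)
  then show ?thesis by (simp add: half_energy_def[abs_def])
qed

lemma finite_energy_iff_half:
  "(\<integral>\<^sup>+t. indicator {0..<2 * pi} t * energy A s t \<partial>lborel) < \<infinity> \<longleftrightarrow>
   (\<integral>\<^sup>+t. indicator {0..<2 * pi} t * half_energy A s t \<partial>lborel) < \<infinity>"
proof
  have "half_energy A s t \<le> energy A s t" for t
    unfolding half_energy_def energy_def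
    by (intro nn_integral_mono) (simp add: ennreal_power weighted_nonneg half_shifted_le ennreal_leI)
  then have "(\<integral>\<^sup>+t. indicator {0..<2 * pi} t * half_energy A s t \<partial>lborel) \<le> (\<integral>\<^sup>+t. indicator {0..<2 * pi} t * energy A s t \<partial>lborel)"
    by (intro nn_integral_mono mult_left_mono) auto
  then show "(\<integral>\<^sup>+t. indicator {0..<2 * pi} t * half_energy A s t \<partial>lborel) < \<infinity>"
    if "(\<integral>\<^sup>+t. indicator {0..<2 * pi} t * energy A s t \<partial>lborel) < \<infinity>" using that by (rule le_less_trans)
next
  assume fin: "(\<integral>\<^sup>+t. indicator {0..<2 * pi} t * half_energy A s t \<partial>lborel) < \<infinity>"
  obtain B where B: "B \<ge> 0" "\<And>\<sigma> t. (weighted A s \<sigma> t)\<^sup>2 \<le> 2 * half_shifted A s \<sigma> t + B * indicator {-1..1} \<sigma>"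
    by (rule weighted_le_half_shifted) blast
  have "energy A s t \<le> 2 * half_energy A s t + ennreal (2 * B)" for t
  proof -
    have "energy A s t \<le> (\<integral>\<^sup>+\<sigma>. 2 * ennreal (half_shifted A s \<sigma> t) + ennreal B * indicator {-1..1} \<sigma> \<partial>lborel)"
      unfolding energy_def
    proof (rule nn_integral_mono)
      fix \<sigma>
      have "ennreal ((weighted A s \<sigma> t)\<^sup>2) \<le> ennreal (2 * half_shifted A s \<sigma> t + B * indicator {-1..1} \<sigma>)" by (intro ennreal_leI B)
      also have "\<dots> = 2 * ennreal (half_shifted A s \<sigma> t) + ennreal B * indicator {-1..1} \<sigma>"
        using B(1) half_shifted_nonneg[of \<sigma> t] by (simp add: ennreal_plus ennreal_mult indicator_def)
      finally show "(ennreal (weighted A s \<sigma> t))\<^sup>2 \<le> 2 * ennreal (half_shifted A s \<sigma> t) + ennreal B * indicator {-1..1} \<sigma>"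
        by (simp add: ennreal_power weighted_nonneg)
    qed
    also have "\<dots> = (\<integral>\<^sup>+\<sigma>. 2 * ennreal (half_shifted A s \<sigma> t) \<partial>lborel) + (\<integral>\<^sup>+\<sigma>. ennreal B * indicator {-1..1::real} \<sigma> \<partial>lborel)"
      by (rule nn_integral_add) measurable
    also have "\<dots> = 2 * half_energy A s t + ennreal B * 2"
      unfolding half_energy_def by (simp add: nn_integral_cmult nn_integral_cmult_indicator)
    also have "ennreal B * 2 = ennreal (2 * B)" using B(1) by (simp add: ennreal_mult mult.commute)
    finally show ?thesis .
  qed
  then have "(\<integral>\<^sup>+t. indicator {0..<2 * pi} t * energy A s t \<partial>lborel)
      \<le> (\<integral>\<^sup>+t. 2 * (indicator {0..<2 * pi} t * half_energy A s t) + ennreal (2 * B) * indicator {0..<2 * pi} t \<partial>lborel)"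
    by (intro nn_integral_mono) (auto simp: indicator_def)
  also have "\<dots> = (\<integral>\<^sup>+t. 2 * (indicator {0..<2 * pi} t * half_energy A s t) \<partial>lborel) + (\<integral>\<^sup>+t. ennreal (2 * B) * indicator {0..<2 * pi} t \<partial>lborel)"
    by (rule nn_integral_add) measurable
  also have "\<dots> = 2 * (\<integral>\<^sup>+t. indicator {0..<2 * pi} t * half_energy A s t \<partial>lborel) + ennreal (2 * B) * ennreal (2 * pi)"
    by (simp add: nn_integral_cmult nn_integral_cmult_indicator)
  also have "\<dots> < \<infinity>" using fin by (simp add: ennreal_mult_less_top)
  finally show "(\<integral>\<^sup>+t. indicator {0..<2 * pi} t * energy A s t \<partial>lborel) < \<infinity>" .
qed

lemma plane_density_integrable_iff:
  assumes \<epsilon>: "\<epsilon> = 1 \<or> \<epsilon> = -1"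
  shows "integrable lborel (plane_density A s \<epsilon>) \<longleftrightarrow>
    (\<integral>\<^sup>+t. indicator {0..<2 * pi} t * (\<integral>\<^sup>+\<sigma>. indicator {0<..} \<sigma> * ennreal (half_shifted A s (- \<epsilon> * \<sigma>) t) \<partial>lborel) \<partial>lborel) < \<infinity>"
proof -
  have \<epsilon>2: "\<epsilon> * \<epsilon> = 1" "\<bar>\<epsilon>\<bar> = 1" using \<epsilon> by auto
  have m: "plane_density A s \<epsilon> \<in> borel_measurable borel"
    unfolding plane_density_def[abs_def] using plane_symbol_measurable[OF A_cont, of \<epsilon>] by measurable
  have "\<sigma> * plane_density A s \<epsilon> ((- \<epsilon> * \<sigma>) *\<^sub>R perp (circ t)) = half_shifted A s (- \<epsilon> * \<sigma>) t" if \<sigma>: "\<sigma> > 0" for \<sigma> t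
  proof -
    let ?\<xi> = "(- \<epsilon> * \<sigma>) *\<^sub>R perp (circ t)"
    have n: "norm ?\<xi> = \<sigma>" using \<sigma> \<epsilon>2 by (simp add: inner_perp abs_mult)
    have "perp ?\<xi> = (- \<epsilon> * \<sigma>) *\<^sub>R perp (perp (circ t))" by (simp only: inner_perp)
    also have "\<dots> = (\<epsilon> * \<sigma>) *\<^sub>R circ t" by (simp add: inner_perp)
    finally have p: "perp ?\<xi> = (\<epsilon> * \<sigma>) *\<^sub>R circ t" .
    have a: "\<epsilon> *\<^sub>R (perp ?\<xi> /\<^sub>R norm ?\<xi>) = circ t" unfolding n p using \<sigma> \<epsilon> by auto
    have "A (- \<epsilon> * norm ?\<xi>) (angle (\<epsilon> *\<^sub>R (perp ?\<xi> /\<^sub>R norm ?\<xi>))) = A (- \<epsilon> * \<sigma>) t"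
      by (subst a, subst n) (rule A_circ[OF circ_angle[OF norm_circ]])
    moreover have "(- \<epsilon> * \<sigma>)\<^sup>2 = \<sigma>\<^sup>2" "\<bar>- \<epsilon> * \<sigma>\<bar> = \<sigma>" using \<epsilon> \<sigma> by auto
    ultimately show ?thesis unfolding plane_density_def half_shifted_def n by simp
  qed
  then have "(\<integral>\<^sup>+\<sigma>. indicator {0<..} \<sigma> * ennreal (\<sigma> * plane_density A s \<epsilon> ((- \<epsilon> * \<sigma>) *\<^sub>R perp (circ t))) \<partial>lborel)
      = (\<integral>\<^sup>+\<sigma>. indicator {0<..} \<sigma> * ennreal (half_shifted A s (- \<epsilon> * \<sigma>) t) \<partial>lborel)" for t
    by (intro nn_integral_cong) (auto simp: indicator_def)
  then show ?thesis using polar_integrable_iff[OF m _ \<epsilon>] by (simp add: plane_density_def)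
qed

text \<open>The two signs are the half lines of negative and positive frequencies.\<close>

lemma half_energy_split:
  "half_energy A s t = (\<integral>\<^sup>+\<sigma>. indicator {0<..} \<sigma> * ennreal (half_shifted A s (- 1 * \<sigma>) t) \<partial>lborel)
      + (\<integral>\<^sup>+\<sigma>. indicator {0<..} \<sigma> * ennreal (half_shifted A s (- (-1) * \<sigma>) t) \<partial>lborel)"
proof -
  have "half_energy A s t = (\<integral>\<^sup>+\<sigma>. indicator {..<0} \<sigma> * ennreal (half_shifted A s \<sigma> t) + indicator {0<..} \<sigma> * ennreal (half_shifted A s \<sigma> t) \<partial>lborel)"
    unfolding half_energy_def by (intro nn_integral_cong) (auto simp: indicator_def half_shifted_def)
  also have "\<dots> = (\<integral>\<^sup>+\<sigma>. indicator {..<0} \<sigma> * ennreal (half_shifted A s \<sigma> t) \<partial>lborel) + (\<integral>\<^sup>+\<sigma>. indicator {0<..} \<sigma> * ennreal (half_shifted A s \<sigma> t) \<partial>lborel)"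
    by (rule nn_integral_add) measurable
  also have "(\<integral>\<^sup>+\<sigma>. indicator {..<0} \<sigma> * ennreal (half_shifted A s \<sigma> t) \<partial>lborel) = (\<integral>\<^sup>+\<sigma>. indicator {0<..} \<sigma> * ennreal (half_shifted A s (- 1 * \<sigma>) t) \<partial>lborel)"
  proof -
    have "(\<lambda>\<sigma>. indicator {..<0} \<sigma> * ennreal (half_shifted A s \<sigma> t)) \<in> borel_measurable borel" by measurable
    from nn_integral_real_affine[OF this, of "-1" 0] show ?thesis
      by simp (intro nn_integral_cong, auto simp: indicator_def)
  qed
  finally show ?thesis by simp
qed

lemma summable_mode_norm_iff_plane_densities:
  "summable (\<lambda>j. mode_norm A s (int_decode j)) \<longleftrightarrow>
   integrable lborel (plane_density A s 1) \<and> integrable lborel (plane_density A s (-1))"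
proof -
  let ?P = "\<lambda>\<epsilon> t. \<integral>\<^sup>+\<sigma>. indicator {0<..} \<sigma> * ennreal (half_shifted A s (- \<epsilon> * \<sigma>) t) \<partial>lborel"
  have m: "?P \<epsilon> \<in> borel_measurable borel" for \<epsilon>
  proof -
    have "(\<lambda>z::real \<times> real. half_shifted A s (- \<epsilon> * snd z) (fst z)) \<in> borel_measurable (lborel \<Otimes>\<^sub>M lborel)"
    proof -
      have "continuous_on UNIV (\<lambda>z::real \<times> real. A (- \<epsilon> * snd z) (fst z))"
        by (rule continuous_on_compose_pair[OF A_cont]) (intro continuous_intros)+
      then have "(\<lambda>z::real \<times> real. A (- \<epsilon> * snd z) (fst z)) \<in> borel_measurable (lborel \<Otimes>\<^sub>M lborel)"
        by (simp add: lborel_prod borel_measurable_continuous_onI)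
      then show ?thesis unfolding half_shifted_def by measurable
    qed
    then have "(\<lambda>t. \<integral>\<^sup>+\<sigma>. (\<lambda>(t, \<sigma>). indicator {0<..} \<sigma> * ennreal (half_shifted A s (- \<epsilon> * \<sigma>) t)) (t, \<sigma>) \<partial>lborel) \<in> borel_measurable lborel"
      by (intro lborel.borel_measurable_nn_integral_fst) (simp add: case_prod_unfold)
    then show ?thesis by simp
  qed
  have "(\<integral>\<^sup>+t. indicator {0..<2 * pi} t * half_energy A s t \<partial>lborel)
     = (\<integral>\<^sup>+t. indicator {0..<2 * pi} t * ?P 1 t + indicator {0..<2 * pi} t * ?P (-1) t \<partial>lborel)"
    unfolding half_energy_split distrib_left ..
  also have "\<dots> = (\<integral>\<^sup>+t. indicator {0..<2 * pi} t * ?P 1 t \<partial>lborel) + (\<integral>\<^sup>+t. indicator {0..<2 * pi} t * ?P (-1) t \<partial>lborel)"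
    by (rule nn_integral_add) (use m[of 1] m[of "-1"] in measurable)
  finally have "(\<integral>\<^sup>+t. indicator {0..<2 * pi} t * half_energy A s t \<partial>lborel) < \<infinity> \<longleftrightarrow>
     (\<integral>\<^sup>+t. indicator {0..<2 * pi} t * ?P 1 t \<partial>lborel) < \<infinity> \<and> (\<integral>\<^sup>+t. indicator {0..<2 * pi} t * ?P (-1) t \<partial>lborel) < \<infinity>"
    by simp
  then show ?thesis
    unfolding finite_lattice_energy_iff_summable[symmetric] finite_energy_iff_lattice[symmetric] finite_energy_iff_half
    using plane_density_integrable_iff[of 1] plane_density_integrable_iff[of "-1"] by simp
qed

end

section \<open>Reading off the symbols\<close>

lemma closed_dist_support: "closed (dist_support u)"
  unfolding dist_support_def by (auto simp: closed_def)

text \<open>A point \<open>y\<close> lies on a line at distance \<open>|y|\<close> from the origin, the one perpendicular to \<open>y\<close>. Hence every point of \<open>S\<close> has norm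
  below \<open>pi\<close>, and the maximal norm is attained.\<close>

lemma radius_below_pi:
  fixes S :: "(real^2) set"
  assumes S: "closed S" "bounded S"
    and lines: "\<And>p \<theta>. norm \<theta> = 1 \<Longrightarrow> the_line p \<theta> \<inter> S \<noteq> {} \<Longrightarrow> \<bar>p\<bar> < pi"
  obtains R where "0 \<le> R" "R < pi" "S \<subseteq> cball 0 R"
proof -
  have n: "norm y < pi" if y: "y \<in> S" for y
  proof (cases "y = 0")
    case False
    let ?\<theta> = "(- 1 / norm y) *\<^sub>R perp y"
    have "norm ?\<theta> = 1" using False by (simp add: inner_perp)
    have "perp ?\<theta> = (1 / norm y) *\<^sub>R y" by (simp only: inner_perp) simp
    then have "norm y *\<^sub>R perp ?\<theta> + 0 *\<^sub>R ?\<theta> = y" using False by simp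
    then have "y \<in> the_line (norm y) ?\<theta>" unfolding the_line_def by (metis (mono_tags, lifting) mem_Collect_eq)
    then have "the_line (norm y) ?\<theta> \<inter> S \<noteq> {}" using y by blast
    from lines[OF \<open>norm ?\<theta> = 1\<close> this] show ?thesis by simp
  qed simp
  show thesis
  proof (cases "S = {}")
    case True then show ?thesis using that[of 0] by simp
  next
    case False
    have "compact S" using S compact_eq_bounded_closed by blast
    from continuous_attains_sup[OF this False continuous_on_norm_id]
    obtain x where x: "x \<in> S" "\<forall>y\<in>S. norm y \<le> norm x" by blast
    show ?thesis by (rule that[of "norm x"]) (use n[OF x(1)] x(2) in \<open>auto simp: dist_norm\<close>)
  qed
qed

text \<open>The phase of the amplitude is a plane wave in the direction \<open>\<theta>\<^sup>\<bottom>\<close> for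
  \<open>\<theta> = \<epsilon>\<xi>\<^sup>\<bottom>/|\<xi>|\<close>, since \<open>\<xi> = -\<epsilon>|\<xi>|\<theta>\<^sup>\<bottom>\<close>.\<close>

lemma psdo_symbol:
  assumes \<epsilon>: "\<epsilon> = 1 \<or> \<epsilon> = -1" and \<xi>: "\<xi> \<noteq> 0"
  shows "h (\<lambda>y. exp (- \<i> * of_real (y \<bullet> \<xi>)) * w y (\<epsilon> *\<^sub>R (perp \<xi> /\<^sub>R norm \<xi>)))
    = line_ft w h (- \<epsilon> * norm \<xi>) (angle (\<epsilon> *\<^sub>R (perp \<xi> /\<^sub>R norm \<xi>)))"
proof -
  let ?\<theta> = "\<epsilon> *\<^sub>R (perp \<xi> /\<^sub>R norm \<xi>)"
  have "norm ?\<theta> = 1" using \<epsilon> \<xi> by (auto simp: inner_perp)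
  note c = circ_angle[OF this]
  have "perp ?\<theta> = \<epsilon> *\<^sub>R (perp (perp \<xi>) /\<^sub>R norm \<xi>)" by (simp only: inner_perp)
  also have "\<dots> = (- \<epsilon> / norm \<xi>) *\<^sub>R \<xi>" by (simp add: inner_perp divide_inverse)
  finally have "- (- \<epsilon> * norm \<xi>) * (y \<bullet> perp ?\<theta>) = - (y \<bullet> \<xi>)" for y using \<epsilon> \<xi> by auto
  then have "char_exp (- (- \<epsilon> * norm \<xi>)) (y \<bullet> perp ?\<theta>) = exp (- \<i> * of_real (y \<bullet> \<xi>))" for y
    unfolding char_exp_def mult.assoc of_real_mult[symmetric] by simp
  then show ?thesis unfolding line_ft_def c by simp
qed

text \<open>The symbol of the operator has no meaning at the origin, where the direction of \<open>\<xi>\<close> is undefined.\<close>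

lemma inv_fourier_cong_off_origin:
  assumes [measurable]: "G \<in> borel_measurable borel" and H: "\<And>\<xi>. \<xi> \<noteq> 0 \<Longrightarrow> H \<xi> = G \<xi>" and \<phi>: "schwartz \<phi>"
  shows "inv_fourier H \<phi> = inv_fourier G \<phi>"
proof -
  have [measurable]: "ft \<phi> \<in> borel_measurable borel" by (rule ft_measurable[OF schwartz_measurable[OF \<phi>]])
  have "H = (\<lambda>\<xi>. if \<xi> = 0 then H 0 else G \<xi>)" using H by auto
  moreover have "(\<lambda>\<xi>. if \<xi> = 0 then H 0 else G \<xi>) \<in> borel_measurable borel" by measurable
  ultimately have [measurable]: "H \<in> borel_measurable borel" by simp
  have "(LINT \<xi>|lborel. H \<xi> * ft \<phi> \<xi>) = (LINT \<xi>|lborel. G \<xi> * ft \<phi> \<xi>)"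
  proof (rule integral_cong_AE)
    show "AE \<xi> in lborel. H \<xi> * ft \<phi> \<xi> = G \<xi> * ft \<phi> \<xi>"
      using AE_lborel_singleton[of 0] by eventually_elim (simp add: H)
  qed measurable
  then show ?thesis unfolding inv_fourier_ft by simp
qed

theorem proposition6p1:
  fixes w1 w2 :: "real^2 \<Rightarrow> real^2 \<Rightarrow> complex"
    and g1 g2 :: "(real^2 \<Rightarrow> complex) \<Rightarrow> complex"
    and s :: real
  assumes "smooth_weight w1" and "smooth_weight w2"
    and "compact_distribution g1" and "compact_distribution g2"
    and "dist_support g1 \<union> dist_support g2 \<subseteq> {x. \<forall>i. - pi < x $ i \<and> x $ i < pi}"
    and "\<And>p \<theta>. norm \<theta> = 1 \<Longrightarrow> the_line p \<theta> \<inter> (dist_support g1 \<union> dist_support g2) \<noteq> {}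
           \<Longrightarrow> \<bar>p\<bar> < pi"
  shows "sobolev_Z s (\<lambda>\<psi>. xray w1 g1 \<psi> + xray w2 g2 \<psi>) \<longleftrightarrow>
         sobolev (s - 1/2) (\<lambda>\<phi>. psdo 1 w1 g1 \<phi> + psdo 1 w2 g2 \<phi>) \<and>
         sobolev (s - 1/2) (\<lambda>\<phi>. psdo (-1) w1 g1 \<phi> + psdo (-1) w2 g2 \<phi>)"
proof -
  let ?S = "dist_support g1 \<union> dist_support g2"
  have "bounded {x::real^2. \<forall>i. - pi < x $ i \<and> x $ i < pi}"
    by (rule bounded_subset[OF bounded_cbox[of "vector [-pi, -pi]" "vector [pi, pi]"]])
      (auto simp: mem_box_cart forall_2 less_imp_le)
  then have "bounded ?S" using assms(5) by (rule bounded_subset)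
  moreover have "closed ?S" by (intro closed_Un closed_dist_support)
  ultimately obtain R where R: "0 \<le> R" "R < pi" "?S \<subseteq> cball 0 R"
    using radius_below_pi[of ?S] assms(6) by metis
  obtain C :: "real \<Rightarrow> int \<Rightarrow> complex" where
    C: "\<And>M. \<exists>B\<ge>0. \<forall>c\<in>{-1..1}. \<forall>n. cmod (C c n) * (1 + \<bar>of_int n\<bar>) ^ M \<le> B"
      "\<And>w g a b t. smooth_weight w \<Longrightarrow> compact_distribution g \<Longrightarrow> dist_support g \<subseteq> cball 0 R \<Longrightarrow> \<bar>a - b\<bar> \<le> 1 \<Longrightarrow>
       (\<lambda>j. C (a - b) (int_decode j) * line_ft w g (b - of_int (int_decode j)) t) sums line_ft w g a t"
    by (rule sampling_formula[OF R(1,2)]) blast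
  define A where "A \<sigma> t = line_ft w1 g1 \<sigma> t + line_ft w2 g2 \<sigma> t" for \<sigma> t
  have c1: "continuous_on UNIV (\<lambda>z. line_ft w1 g1 (fst z) (snd z))" and c2: "continuous_on UNIV (\<lambda>z. line_ft w2 g2 (fst z) (snd z))"
    using assms by (auto intro: line_ft_continuous)
  have A_cont: "continuous_on UNIV (\<lambda>z. A (fst z) (snd z))" unfolding A_def by (intro continuous_intros c1 c2)
  have A_circ: "A \<sigma> t = A \<sigma> t'" if "circ t = circ t'" for \<sigma> t t'
    unfolding A_def using line_ft_circ[OF that] by metis
  have A_sums: "(\<lambda>j. C (a - b) (int_decode j) * A (b - of_int (int_decode j)) t) sums A a t" if ab: "\<bar>a - b\<bar> \<le> 1" for a b t
    unfolding A_def distrib_left using R(3) ab assms(1-4) by (intro sums_add C(2)) auto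
  obtain D1 N1 where g1: "\<And>\<sigma> t. cmod (line_ft w1 g1 \<sigma> t) \<le> D1 * (1 + \<bar>\<sigma>\<bar>) ^ N1"
    using line_ft_growth[OF assms(1,3)] by blast
  obtain D2 N2 where g2: "\<And>\<sigma> t. cmod (line_ft w2 g2 \<sigma> t) \<le> D2 * (1 + \<bar>\<sigma>\<bar>) ^ N2"
    using line_ft_growth[OF assms(2,4)] by blast
  have A_growth: "cmod (A \<sigma> t) \<le> (\<bar>D1\<bar> + \<bar>D2\<bar>) * (1 + \<bar>\<sigma>\<bar>) ^ (N1 + N2)" for \<sigma> t
  proof -
    have le: "D * (1 + \<bar>\<sigma>\<bar>) ^ k \<le> \<bar>D\<bar> * (1 + \<bar>\<sigma>\<bar>) ^ (N1 + N2)" if "k \<le> N1 + N2" for D k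
      using that by (intro mult_mono power_increasing) auto
    show ?thesis unfolding A_def distrib_right
      by (intro order_trans[OF norm_triangle_ineq] add_mono order_trans[OF g1 le] order_trans[OF g2 le]) auto
  qed
  have v: "(\<lambda>j. let k = int_decode j in integral {0..2 * pi} (\<lambda>t. of_real (bessel_weight s k) * fourier_coeff_Z \<psi> k (circ t) * A (- of_int k) t))
      sums (xray w1 g1 (bessel_Z s \<psi>) + xray w2 g2 (bessel_Z s \<psi>))" if \<psi>: "smooth_Z \<psi>" "periodic_Z \<psi>" for \<psi>
  proof -
    have int: "(\<lambda>t. of_real (bessel_weight s k) * fourier_coeff_Z \<psi> k (circ t) * L t) integrable_on {0..2 * pi}"
      if "continuous_on {0..2 * pi} L" for L k
      using that continuous_on_subset[OF fourier_coeff_Z_continuous[OF \<psi>(1)] subset_UNIV]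
      by (intro integrable_continuous_real continuous_on_mult continuous_on_const)
    have "integral {0..2 * pi} (\<lambda>t. of_real (bessel_weight s k) * fourier_coeff_Z \<psi> k (circ t) * A (- of_int k) t)
      = integral {0..2 * pi} (\<lambda>t. of_real (bessel_weight s k) * fourier_coeff_Z \<psi> k (circ t) * line_ft w1 g1 (- of_int k) t)
      + integral {0..2 * pi} (\<lambda>t. of_real (bessel_weight s k) * fourier_coeff_Z \<psi> k (circ t) * line_ft w2 g2 (- of_int k) t)" for k
      unfolding A_def distrib_left
      by (intro Henstock_Kurzweil_Integration.integral_add int
          continuous_on_pair_sections(2)[where f="line_ft w1 g1", OF c1] continuous_on_pair_sections(2)[where f="line_ft w2 g2", OF c2])
    then show ?thesis
      using sums_add[OF xray_bessel_sums[OF assms(1,3) \<psi>, of s] xray_bessel_sums[OF assms(2,4) \<psi>, of s]] by (simp add: Let_def)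
  qed
  have 1: "sobolev_Z s (\<lambda>\<psi>. xray w1 g1 \<psi> + xray w2 g2 \<psi>) \<longleftrightarrow> summable (\<lambda>j. mode_norm A s (int_decode j))"
    using sobolev_Z_imp_summable[of A s "\<lambda>\<psi>. xray w1 g1 \<psi> + xray w2 g2 \<psi>", OF A_cont A_circ v]
      summable_imp_sobolev_Z[of A s "\<lambda>\<psi>. xray w1 g1 \<psi> + xray w2 g2 \<psi>", OF A_cont A_circ v] by blast
  have 2: "summable (\<lambda>j. mode_norm A s (int_decode j)) \<longleftrightarrow> integrable lborel (plane_density A s 1) \<and> integrable lborel (plane_density A s (-1))"
    by (rule summable_mode_norm_iff_plane_densities[OF A_cont C(1) A_sums A_circ A_growth])
  have 3: "sobolev (s - 1/2) (\<lambda>\<phi>. psdo \<epsilon> w1 g1 \<phi> + psdo \<epsilon> w2 g2 \<phi>) \<longleftrightarrow> integrable lborel (plane_density A s \<epsilon>)"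
    if \<epsilon>: "\<epsilon> = 1 \<or> \<epsilon> = -1" for \<epsilon>
  proof -
    define T where "T w g \<xi> = line_ft w g (- \<epsilon> * norm \<xi>) (angle (\<epsilon> *\<^sub>R (perp \<xi> /\<^sub>R norm \<xi>)))" for w g \<xi>
    have m1: "T w1 g1 \<in> borel_measurable borel" and m2: "T w2 g2 \<in> borel_measurable borel"
      unfolding T_def[abs_def]
      by (rule plane_symbol_measurable[where A="line_ft w1 g1", OF c1], rule plane_symbol_measurable[where A="line_ft w2 g2", OF c2])
    have ne: "\<bar>- \<epsilon> * norm \<xi>\<bar> = norm \<xi>" for \<xi> :: "real^2" using \<epsilon> by auto
    have b1: "cmod (T w1 g1 \<xi>) \<le> D1 * (1 + norm \<xi>) ^ N1" and b2: "cmod (T w2 g2 \<xi>) \<le> D2 * (1 + norm \<xi>) ^ N2" for \<xi>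
      using g1[of "- \<epsilon> * norm \<xi>"] g2[of "- \<epsilon> * norm \<xi>"] unfolding T_def ne by auto
    have bA: "cmod (T w1 g1 \<xi> + T w2 g2 \<xi>) \<le> (\<bar>D1\<bar> + \<bar>D2\<bar>) * (1 + norm \<xi>) ^ (N1 + N2)" for \<xi>
      using A_growth[of "- \<epsilon> * norm \<xi>"] unfolding T_def ne A_def by auto
    have "psdo \<epsilon> w1 g1 \<phi> + psdo \<epsilon> w2 g2 \<phi> = inv_fourier (\<lambda>\<xi>. T w1 g1 \<xi> + T w2 g2 \<xi>) \<phi>" if \<phi>: "schwartz \<phi>" for \<phi>
    proof -
      have "psdo \<epsilon> w g \<phi> = inv_fourier (T w g) \<phi>" if "T w g \<in> borel_measurable borel" for w g
        unfolding psdo_def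
        by (rule inv_fourier_cong_off_origin[OF that _ \<phi>]) (unfold T_def, rule psdo_symbol[OF \<epsilon>])
      note this[OF m1] this[OF m2]
      with inv_fourier_add[OF m1 m2 b1 b2 \<phi>] show ?thesis by simp
    qed
    from sobolev_inv_fourier_iff[OF borel_measurable_add[OF m1 m2] bA this, of "s - 1/2"]
    show ?thesis by (simp only: plane_density_def[abs_def] T_def A_def)
  qed
  show ?thesis unfolding 1 2 using 3[of 1] 3[of "-1"] by simp
qed

end
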